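(* Let $u\in\mathfrak{S}_k(M)$ and suppose that $0\in\Sigma_\kappa(u)$ with $\kappa=2m<k$, $m\in\mathbb{N}$. For any $p_\kappa\in\mathfrak{P}_\kappa$ there exist $r_M>0$ and $C_M\ge0$ (depending on $M$) such that $$M_\kappa(r,u,p_\kappa)=\frac{1}{r^{n-1+2\kappa}}\int_{\partial B_r}(u-p_\kappa)^2$$ satisfies $$\frac{d}{dr}M_\kappa(r,u,p_\kappa)\ge -C_M\big(1+\|p_\kappa\|_{L^2(B_1)}\big)\qquad\text{for }0<r<r_M.$$
   Context: Notation: $n\ge 2$, $k\in\mathbb{N}=\{1,2,\dots\}$, $M>0$, $x=(x',x_n)\in\mathbb{R}^{n-1}\times\mathbb{R}$; $B_r$ is the open ball of radius $r$ about $0$ in $\mathbb{R}^n$; $B_1^+=B_1\cap\{x_n>0\}$; $B_r'=B_r\cap(\mathbb{R}^{n-1}\times\{0\})$. On $\{x_n=0\}$, $\partial_{x_n}u$ denotes the limit from inside $\{x_n>0\}$. Class $\mathfrak{S}_k(M)$: functions $u\in C^{1,\alpha}(B_1^+\cup B_1')$, for some $\alpha\in(0,1)$, such that $|\Delta u|\le M|x'|^{k-1}$ in $B_1^+$ (weak sense); $u\ge0$, $-\partial_{x_n}u\ge0$, $u\,\partial_{x_n}u=0$ on $B_1'$; $0\in\Gamma(u)$, the boundary of $\Lambda(u)=\{u(\cdot,0)=0\}$ in the relative topology of $B_1'$; and $\|u\|_{C^1}\le M$. Every such $u$ is extended to $B_1$ by $u(x',-x_n)=u(x',x_n)$. Frequency: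 with $H(r)=\int_{\partial B_r}u^2$, let $\Phi_k(r,u)=(r+Cr^2)\frac{d}{dr}\log\max\{H(r),r^{n-1+2k}\}$, where $C>0$ is a constant depending on $M$ chosen so that $\Phi_k(\cdot,u)$ is nondecreasing (up to a null set) for small $r$; such $C$ exists, and $\Phi_k(0+,u)=\lim_{r\to0+}\Phi_k(r,u)$ does not depend on its choice. For $\kappa<k$, $0\in\Sigma_\kappa(u)$ means $\Phi_k(0+,u)=n-1+2\kappa$ and $\mathcal{H}^{n-1}(\Lambda(u)\cap B_r')/\mathcal{H}^{n-1}(B_r')\to0$ as $r\to0+$. For $\kappa=2m$, $\mathfrak{P}_\kappa$ is the class of homogeneous polynomials $p$ of degree $\kappa$ on $\mathbb{R}^n$ with $\Delta p=0$, $p(x',0)\ge0$ for all $x'$, and $p(x',-x_n)=p(x',x_n)$. *)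

theory Defs
  imports "HOL-Analysis.Analysis"
begin

section \<open>Hausdorff measure\<close>

text \<open>The library function \<open>diameter\<close> is only meaningful on bounded sets, hence the boundedness
  requirement on the covering sets. Empty covering sets carry no weight. The normalisation makes the
  \<open>s\<close>-dimensional measure agree with Lebesgue measure on \<open>s\<close>-dimensional Euclidean space.\<close>

definition hausdorff_weight :: "nat \<Rightarrow> 'b::metric_space set \<Rightarrow> ennreal" where
  "hausdorff_weight s S =
     (if S = {} then 0 else ennreal (unit_ball_vol (real s) * (diameter S / 2) ^ s))"

definition hausdorff_pre :: "nat \<Rightarrow> real \<Rightarrow> 'b::metric_space set \<Rightarrow> ennreal" where
  "hausdorff_pre s \<delta> A =
     (INF C \<in> {C :: nat \<Rightarrow> 'b set. A \<subseteq> (\<Union>i. C i) \<and> (\<forall>i. bounded (C i) \<and> diameter (C i) \<le> \<delta>)}.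
        \<Sum>i. hausdorff_weight s (C i))"

definition hausdorff_outer :: "nat \<Rightarrow> 'b::metric_space set \<Rightarrow> ennreal" where
  "hausdorff_outer s A = (SUP \<delta>\<in>{0<..}. hausdorff_pre s \<delta> A)"

definition hausdorff_measure :: "nat \<Rightarrow> 'b::metric_space measure" where
  "hausdorff_measure s = measure_of UNIV (sets borel) (hausdorff_outer s)"

text \<open>Since \<open>measure_of\<close> falls back to the null measure for set functions that are not measures, we
  check that \<open>hausdorff_outer\<close> is countably additive on the Borel sets (Caratheodory's criterion).\<close>

lemma hausdorff_pre_le:
  assumes "A \<subseteq> (\<Union>i. C i)" "\<And>i. bounded (C i)" "\<And>i. diameter (C i) \<le> \<delta>"
  shows "hausdorff_pre s \<delta> A \<le> (\<Sum>i. hausdorff_weight s (C i))"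
  unfolding hausdorff_pre_def by (rule INF_lower) (use assms in auto)

lemma hausdorff_pre_mono: "A \<subseteq> B \<Longrightarrow> hausdorff_pre s \<delta> A \<le> hausdorff_pre s \<delta> B"
  unfolding hausdorff_pre_def by (rule INF_superset_mono) auto

lemma hausdorff_pre_antimono: "\<delta> \<le> \<epsilon> \<Longrightarrow> hausdorff_pre s \<epsilon> A \<le> hausdorff_pre s \<delta> A"
  unfolding hausdorff_pre_def by (rule INF_superset_mono) (auto intro: order_trans)

lemma hausdorff_pre_le_outer: "0 < \<delta> \<Longrightarrow> hausdorff_pre s \<delta> A \<le> hausdorff_outer s A"
  unfolding hausdorff_outer_def by (rule SUP_upper) auto

lemma hausdorff_outer_mono: "A \<subseteq> B \<Longrightarrow> hausdorff_outer s A \<le> hausdorff_outer s B"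
  unfolding hausdorff_outer_def by (rule SUP_mono) (auto intro: hausdorff_pre_mono)

lemma hausdorff_outer_empty [simp]: "hausdorff_outer s {} = 0"
proof -
  have "hausdorff_pre s \<delta> {} \<le> 0" if "0 < \<delta>" for \<delta>
    using hausdorff_pre_le[of "{}" "\<lambda>_. {}" \<delta> s] that by (simp add: hausdorff_weight_def)
  then show ?thesis
    unfolding hausdorff_outer_def by (intro antisym SUP_least) auto
qed

lemma hausdorff_pre_countably_subadditive:
  "hausdorff_pre s \<delta> (\<Union>n. A n) \<le> (\<Sum>n. hausdorff_pre s \<delta> (A n))"
proof (rule ennreal_le_epsilon)
  fix e :: real
  assume fin: "(\<Sum>n. hausdorff_pre s \<delta> (A n)) < top" and e: "0 < e"
  have "\<exists>C. A n \<subseteq> (\<Union>i. C i) \<and> (\<forall>i. bounded (C i) \<and> diameter (C i) \<le> \<delta>) \<and>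
      (\<Sum>i. hausdorff_weight s (C i)) < hausdorff_pre s \<delta> (A n) + ennreal (e * (1/2) ^ Suc n)" for n
  proof -
    have "hausdorff_pre s \<delta> (A n) < top"
      using fin ennreal_suminf_lessD by blast
    then have "hausdorff_pre s \<delta> (A n) < hausdorff_pre s \<delta> (A n) + ennreal (e * (1/2) ^ Suc n)"
      using e by (simp add: ennreal_zero_less_mult_iff ennreal_add_left_cancel_less)
    then show ?thesis
      unfolding hausdorff_pre_def[of s \<delta> "A n"] INF_less_iff by auto
  qed
  then obtain C where C: "\<And>n. A n \<subseteq> (\<Union>i. C n i)" "\<And>n i. bounded (C n i)" "\<And>n i. diameter (C n i) \<le> \<delta>"
    and lt: "\<And>n. (\<Sum>i. hausdorff_weight s (C n i)) < hausdorff_pre s \<delta> (A n) + ennreal (e * (1/2) ^ Suc n)"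
    by metis
  let ?D = "\<lambda>k. case prod_decode k of (n, i) \<Rightarrow> C n i"
  have "(\<Union>n. A n) \<subseteq> (\<Union>k. ?D k)"
  proof
    fix x assume "x \<in> (\<Union>n. A n)"
    then obtain n i where "x \<in> C n i" using C(1) by blast
    then have "x \<in> ?D (prod_encode (n, i))" by simp
    then show "x \<in> (\<Union>k. ?D k)" by (rule UN_I[OF UNIV_I])
  qed
  then have "hausdorff_pre s \<delta> (\<Union>n. A n) \<le> (\<Sum>k. hausdorff_weight s (?D k))"
    by (rule hausdorff_pre_le) (auto split: prod.split intro: C)
  also have "\<dots> = (\<Sum>k. case prod_decode k of (n, i) \<Rightarrow> hausdorff_weight s (C n i))"
    by (rule arg_cong[where f=suminf]) (auto split: prod.split)
  also have "\<dots> = (\<Sum>n. \<Sum>i. hausdorff_weight s (C n i))"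
    using suminf_ennreal_2dimen[of "\<lambda>n. \<Sum>i. hausdorff_weight s (C n i)"
        "\<lambda>(n, i). hausdorff_weight s (C n i)"]
    by (simp add: comp_def)
  also have "\<dots> \<le> (\<Sum>n. hausdorff_pre s \<delta> (A n) + ennreal (e * (1/2) ^ Suc n))"
    by (intro suminf_le less_imp_le lt) auto
  also have "\<dots> = (\<Sum>n. hausdorff_pre s \<delta> (A n)) + (\<Sum>n. ennreal (e * (1/2) ^ Suc n))"
    by (rule suminf_add[symmetric]) auto
  also have "(\<Sum>n. ennreal (e * (1/2) ^ Suc n)) = ennreal e"
  proof -
    have "(\<lambda>n. e * (1/2) ^ Suc n) sums (e * 1)"
      by (intro sums_mult power_half_series)
    then show ?thesis
      using e by (subst suminf_ennreal2) (auto simp: sums_iff simp del: power_Suc)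
  qed
  finally show "hausdorff_pre s \<delta> (\<Union>n. A n) \<le> (\<Sum>n. hausdorff_pre s \<delta> (A n)) + ennreal e" .
qed

lemma hausdorff_outer_countably_subadditive:
  "hausdorff_outer s (\<Union>n. A n) \<le> (\<Sum>n. hausdorff_outer s (A n))"
  unfolding hausdorff_outer_def[of s "\<Union>n. A n"]
proof (rule SUP_least)
  fix \<delta> :: real assume "\<delta> \<in> {0<..}"
  then have "(\<Sum>n. hausdorff_pre s \<delta> (A n)) \<le> (\<Sum>n. hausdorff_outer s (A n))"
    by (intro suminf_le) (auto intro: hausdorff_pre_le_outer)
  then show "hausdorff_pre s \<delta> (\<Union>n. A n) \<le> (\<Sum>n. hausdorff_outer s (A n))"
    by (rule order_trans[OF hausdorff_pre_countably_subadditive])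
qed

lemma hausdorff_outer_Un: "hausdorff_outer s (A \<union> B) \<le> hausdorff_outer s A + hausdorff_outer s B"
proof -
  have "hausdorff_outer s (A \<union> B) \<le> (\<Sum>n. hausdorff_outer s (binaryset A B n))"
    using hausdorff_outer_countably_subadditive[of s "binaryset A B"] by (simp add: UN_binaryset_eq)
  also have "\<dots> = hausdorff_outer s A + hausdorff_outer s B"
    by (intro suminf_binaryset_eq) auto
  finally show ?thesis .
qed

lemma hausdorff_pre_separated:
  assumes sep: "\<And>x y. x \<in> A \<Longrightarrow> y \<in> B \<Longrightarrow> \<delta> < dist x y" and "0 < \<delta>"
  shows "hausdorff_pre s \<delta> A + hausdorff_pre s \<delta> B \<le> hausdorff_pre s \<delta> (A \<union> B)"
  unfolding hausdorff_pre_def[of s \<delta> "A \<union> B"]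
proof (rule INF_greatest)
  fix C assume "C \<in> {C :: nat \<Rightarrow> 'a set. A \<union> B \<subseteq> (\<Union>i. C i) \<and>
      (\<forall>i. bounded (C i) \<and> diameter (C i) \<le> \<delta>)}"
  then have C: "A \<union> B \<subseteq> (\<Union>i. C i)" "\<And>i. bounded (C i)" "\<And>i. diameter (C i) \<le> \<delta>" by auto
  define D where "D i = (if C i \<inter> A = {} then {} else C i)" for i
  define E where "E i = (if C i \<inter> A = {} then C i else {})" for i
  have disj: "C i \<inter> B = {}" if "C i \<inter> A \<noteq> {}" for i
  proof (rule ccontr)
    assume "C i \<inter> B \<noteq> {}"
    with that obtain x y where xy: "x \<in> C i" "x \<in> A" "y \<in> C i" "y \<in> B" by blast
    then have "dist x y \<le> diameter (C i)" using C(2) by (intro diameter_bounded_bound) auto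
    then show False using sep[OF xy(2,4)] C(3)[of i] by linarith
  qed
  have "A \<subseteq> (\<Union>i. D i)"
  proof
    fix x assume x: "x \<in> A"
    then obtain i where "x \<in> C i" using C(1) by blast
    then have "x \<in> D i" using x by (auto simp: D_def)
    then show "x \<in> (\<Union>i. D i)" by blast
  qed
  then have A: "hausdorff_pre s \<delta> A \<le> (\<Sum>i. hausdorff_weight s (D i))"
    by (rule hausdorff_pre_le) (use C \<open>0 < \<delta>\<close> in \<open>auto simp: D_def\<close>)
  have "B \<subseteq> (\<Union>i. E i)"
  proof
    fix x assume x: "x \<in> B"
    then obtain i where "x \<in> C i" using C(1) by blast
    then have "x \<in> E i" using x disj[of i] by (auto simp: E_def)
    then show "x \<in> (\<Union>i. E i)" by blast
  qed
  then have B: "hausdorff_pre s \<delta> B \<le> (\<Sum>i. hausdorff_weight s (E i))"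
    by (rule hausdorff_pre_le) (use C \<open>0 < \<delta>\<close> in \<open>auto simp: E_def\<close>)
  have "hausdorff_pre s \<delta> A + hausdorff_pre s \<delta> B \<le>
      (\<Sum>i. hausdorff_weight s (D i)) + (\<Sum>i. hausdorff_weight s (E i))"
    by (intro add_mono A B)
  also have "\<dots> = (\<Sum>i. hausdorff_weight s (D i) + hausdorff_weight s (E i))"
    by (rule suminf_add) auto
  also have "\<dots> = (\<Sum>i. hausdorff_weight s (C i))"
    by (rule arg_cong[where f=suminf]) (auto simp: D_def E_def hausdorff_weight_def)
  finally show "hausdorff_pre s \<delta> A + hausdorff_pre s \<delta> B \<le> (\<Sum>i. hausdorff_weight s (C i))" .
qed

lemma hausdorff_outer_separated:
  assumes sep: "\<And>x y. x \<in> A \<Longrightarrow> y \<in> B \<Longrightarrow> \<eta> \<le> dist x y" and "0 < \<eta>"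
  shows "hausdorff_outer s A + hausdorff_outer s B \<le> hausdorff_outer s (A \<union> B)"
proof -
  have "hausdorff_pre s \<delta> A + hausdorff_pre s \<epsilon> B \<le> hausdorff_outer s (A \<union> B)"
    if "0 < \<delta>" "0 < \<epsilon>" for \<delta> \<epsilon>
  proof -
    define \<rho> where "\<rho> = min (min \<delta> \<epsilon>) (\<eta> / 2)"
    have \<rho>: "0 < \<rho>" "\<rho> \<le> \<delta>" "\<rho> \<le> \<epsilon>" "\<rho> < \<eta>" using that \<open>0 < \<eta>\<close> by (auto simp: \<rho>_def)
    have "hausdorff_pre s \<delta> A + hausdorff_pre s \<epsilon> B \<le> hausdorff_pre s \<rho> A + hausdorff_pre s \<rho> B"
      by (intro add_mono hausdorff_pre_antimono \<rho>)
    also have "\<dots> \<le> hausdorff_pre s \<rho> (A \<union> B)"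
      by (rule hausdorff_pre_separated) (use sep \<rho> in \<open>force+\<close>)
    also have "\<dots> \<le> hausdorff_outer s (A \<union> B)" by (rule hausdorff_pre_le_outer[OF \<rho>(1)])
    finally show ?thesis .
  qed
  then have "(SUP \<epsilon>\<in>{0<..}. hausdorff_pre s \<delta> A + hausdorff_pre s \<epsilon> B) \<le> hausdorff_outer s (A \<union> B)"
    if "0 < \<delta>" for \<delta>
    using that by (intro SUP_least) auto
  then have *: "hausdorff_pre s \<delta> A + hausdorff_outer s B \<le> hausdorff_outer s (A \<union> B)" if "0 < \<delta>" for \<delta>
    using that unfolding hausdorff_outer_def[of s B] by (simp add: ennreal_SUP_add_right)
  have "(SUP \<delta>\<in>{0<..}. hausdorff_pre s \<delta> A + hausdorff_outer s B) \<le> hausdorff_outer s (A \<union> B)"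
    by (intro SUP_least *) auto
  then show ?thesis
    unfolding hausdorff_outer_def[of s A] by (simp add: ennreal_SUP_add_left[symmetric])
qed

lemma hausdorff_outer_infdist_chain:
  fixes F A :: "'b::metric_space set"
  assumes "F \<noteq> {}"
  defines "D \<equiv> \<lambda>j. {x \<in> A. 1 / real (j + 2) \<le> infdist x F \<and> infdist x F < 1 / real (j + 1)}"
  shows "(\<Sum>j<N. hausdorff_outer s (D (2 * j + c))) \<le> hausdorff_outer s (\<Union>j<N. D (2 * j + c))"
proof (induction N)
  case (Suc N)
  have "(\<Sum>j<Suc N. hausdorff_outer s (D (2 * j + c))) \<le>
      hausdorff_outer s (\<Union>j<N. D (2 * j + c)) + hausdorff_outer s (D (2 * N + c))"
    using Suc by (simp add: add_right_mono)
  also have "\<dots> \<le> hausdorff_outer s ((\<Union>j<N. D (2 * j + c)) \<union> D (2 * N + c))"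
  proof (cases "N = 0")
    case False
    show ?thesis
    proof (rule hausdorff_outer_separated)
      show "0 < 1 / real (2 * N + c) - 1 / real (2 * N + c + 1)"
        using False by (simp add: frac_less2)
    next
      fix x y assume x: "x \<in> (\<Union>j<N. D (2 * j + c))" and y: "y \<in> D (2 * N + c)"
      from x obtain j where j: "j < N" "1 / real (2 * j + c + 2) \<le> infdist x F" by (auto simp: D_def)
      have "1 / real (2 * N + c) \<le> 1 / real (2 * j + c + 2)" using j by (intro divide_left_mono) auto
      then have 1: "1 / real (2 * N + c) \<le> infdist x F" using j by linarith
      have 2: "infdist y F < 1 / real (2 * N + c + 1)" using y by (auto simp: D_def)
      have "infdist x F \<le> infdist y F + dist x y" by (rule infdist_triangle)
      then show "1 / real (2 * N + c) - 1 / real (2 * N + c + 1) \<le> dist x y" using 1 2 by linarith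
    qed
  qed auto
  also have "(\<Union>j<N. D (2 * j + c)) \<union> D (2 * N + c) = (\<Union>j<Suc N. D (2 * j + c))"
    by (auto simp: lessThan_Suc)
  finally show ?case .
qed auto

lemma hausdorff_outer_closed:
  fixes F A :: "'b::metric_space set"
  assumes F: "closed F"
  shows "hausdorff_outer s (A \<inter> F) + hausdorff_outer s (A - F) \<le> hausdorff_outer s A"
proof (cases "F = {} \<or> hausdorff_outer s A = top")
  case True
  then show ?thesis by auto
next
  case False
  then have ne: "F \<noteq> {}" and fin: "hausdorff_outer s A < top" by (auto simp: less_top)
  define D where "D = (\<lambda>j. {x \<in> A. 1 / real (j + 2) \<le> infdist x F \<and> infdist x F < 1 / real (j + 1)})"
  define E where "E n = {x \<in> A. 1 / real (n + 1) \<le> infdist x F}" for n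
  define d where "d j = hausdorff_outer s (D j)" for j
  have half: "(\<Sum>j. d (2 * j + c)) \<le> hausdorff_outer s A" for c
  proof (rule suminf_le_const)
    fix N
    have "(\<Sum>j<N. d (2 * j + c)) \<le> hausdorff_outer s (\<Union>j<N. D (2 * j + c))"
      unfolding d_def D_def by (rule hausdorff_outer_infdist_chain[OF ne])
    also have "\<dots> \<le> hausdorff_outer s A" by (rule hausdorff_outer_mono) (auto simp: D_def)
    finally show "(\<Sum>j<N. d (2 * j + c)) \<le> hausdorff_outer s A" .
  qed auto
  have "(\<Sum>j<N. d j) \<le> hausdorff_outer s A + hausdorff_outer s A" for N
  proof -
    have "(\<Sum>j<N. d j) \<le> (\<Sum>j<2 * N. d j)" by (rule sum_mono2) auto
    also have "\<dots> = (\<Sum>j<N. d (2 * j + 0)) + (\<Sum>j<N. d (2 * j + 1))"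
      by (induction N) (auto simp: ac_simps)
    also have "\<dots> \<le> (\<Sum>j. d (2 * j + 0)) + (\<Sum>j. d (2 * j + 1))"
      by (intro add_mono sum_le_suminf) auto
    also have "\<dots> \<le> hausdorff_outer s A + hausdorff_outer s A" by (intro add_mono half)
    finally show ?thesis .
  qed
  then have "suminf d \<le> hausdorff_outer s A + hausdorff_outer s A" by (intro suminf_le_const) auto
  also have "\<dots> < top" using fin by simp
  finally have sfin: "suminf d < top" .
  have tail: "(\<lambda>n. \<Sum>j. d (j + n)) \<longlonglongrightarrow> 0"
  proof -
    have dfin: "d j < top" for j using sfin by (rule ennreal_suminf_lessD)
    define e where "e j = enn2real (d j)" for j
    have de: "d j = ennreal (e j)" for j using dfin by (simp add: e_def)
    have e0: "0 \<le> e j" for j by (simp add: e_def)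
    have sm: "summable e"
      using sfin e0 by (intro summable_suminf_not_top) (auto simp: de[abs_def])
    have "(\<lambda>n. \<Sum>j. e (j + n)) \<longlonglongrightarrow> 0" by (rule suminf_exist_split2[OF sm])
    then have "(\<lambda>n. ennreal (\<Sum>j. e (j + n))) \<longlonglongrightarrow> ennreal 0" by (rule tendsto_ennrealI)
    moreover have "(\<Sum>j. d (j + n)) = ennreal (\<Sum>j. e (j + n))" for n
      unfolding de using sm e0 by (intro suminf_ennreal2) (auto simp: summable_iff_shift)
    ultimately show ?thesis by simp
  qed
  have bd: "hausdorff_outer s (A \<inter> F) + hausdorff_outer s (A - F) \<le>
      hausdorff_outer s A + (\<Sum>j. d (j + n))" for n
  proof -
    have "A - F \<subseteq> E n \<union> (\<Union>j. D (j + n))"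
    proof
      fix x assume x: "x \<in> A - F"
      then have pos: "0 < infdist x F"
        using in_closed_iff_infdist_zero[OF F ne] infdist_nonneg[of x F] by force
      show "x \<in> E n \<union> (\<Union>j. D (j + n))"
      proof (cases "1 / real (n + 1) \<le> infdist x F")
        case True
        then show ?thesis using x by (auto simp: E_def)
      next
        case False
        let ?P = "\<lambda>j. 1 / real (j + 1) \<le> infdist x F"
        obtain m where m: "inverse (real (Suc m)) < infdist x F" using reals_Archimedean[OF pos] by auto
        have Pm: "?P m" using m by (simp add: inverse_eq_divide)
        define l where "l = (LEAST j. ?P j)"
        have l: "?P l" unfolding l_def by (rule LeastI[of ?P, OF Pm])
        have nl: "n < l"
        proof (rule ccontr)
          assume "\<not> n < l"
          then have "1 / real (n + 1) \<le> 1 / real (l + 1)" by (intro divide_left_mono) auto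
          then show False using l False by linarith
        qed
        have "\<not> ?P (l - 1)" unfolding l_def
          by (rule not_less_Least) (use nl l_def in auto)
        moreover have "l - 1 = (l - 1 - n) + n" "l = (l - 1 - n) + n + 1" using nl by auto
        ultimately have "x \<in> D ((l - 1 - n) + n)"
          using l x nl by (auto simp: D_def not_le Suc_diff_Suc algebra_simps)
        then show ?thesis by blast
      qed
    qed
    then have "hausdorff_outer s (A - F) \<le> hausdorff_outer s (E n \<union> (\<Union>j. D (j + n)))"
      by (rule hausdorff_outer_mono)
    also have "\<dots> \<le> hausdorff_outer s (E n) + hausdorff_outer s (\<Union>j. D (j + n))"
      by (rule hausdorff_outer_Un)
    also have "\<dots> \<le> hausdorff_outer s (E n) + (\<Sum>j. d (j + n))"
      unfolding d_def by (intro add_left_mono hausdorff_outer_countably_subadditive)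
    finally have "hausdorff_outer s (A \<inter> F) + hausdorff_outer s (A - F) \<le>
        (hausdorff_outer s (A \<inter> F) + hausdorff_outer s (E n)) + (\<Sum>j. d (j + n))"
      by (simp add: add_left_mono add.assoc)
    also have "hausdorff_outer s (A \<inter> F) + hausdorff_outer s (E n) \<le> hausdorff_outer s (A \<inter> F \<union> E n)"
    proof (rule hausdorff_outer_separated)
      fix x y assume "x \<in> A \<inter> F" "y \<in> E n"
      then show "1 / real (n + 1) \<le> dist x y"
        using infdist_le[of x F y] by (auto simp: E_def dist_commute)
    qed simp
    also have "\<dots> \<le> hausdorff_outer s A" by (rule hausdorff_outer_mono) (auto simp: E_def)
    finally show ?thesis by (simp add: add_right_mono)
  qed
  have "(\<lambda>n. hausdorff_outer s A + (\<Sum>j. d (j + n))) \<longlonglongrightarrow> hausdorff_outer s A + 0"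
    by (intro tendsto_add tendsto_const tail)
  then have "(\<lambda>n. hausdorff_outer s A + (\<Sum>j. d (j + n))) \<longlonglongrightarrow> hausdorff_outer s A" by simp
  then show ?thesis by (rule LIMSEQ_le_const) (use bd in blast)
qed

lemma measure_space_hausdorff:
  "measure_space (UNIV :: 'b::metric_space set) (sets borel) (hausdorff_outer s)"
proof -
  let ?L = "lambda_system (UNIV :: 'b set) (Pow UNIV) (hausdorff_outer s)"
  have "outer_measure_space (Pow (UNIV :: 'b set)) (hausdorff_outer s)"
    unfolding outer_measure_space_def positive_def increasing_def countably_subadditive_def
    using hausdorff_outer_mono hausdorff_outer_countably_subadditive by auto
  then have L: "measure_space UNIV ?L (hausdorff_outer s)"
    by (rule sigma_algebra.caratheodory_lemma[OF sigma_algebra_Pow])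
  then interpret L: sigma_algebra UNIV ?L by (simp add: measure_space_def)
  have "F \<in> ?L" if "closed F" for F :: "'b set"
    unfolding lambda_system_def
  proof (intro CollectI conjI ballI)
    fix A :: "'b set"
    have "F \<inter> A \<union> (UNIV - F) \<inter> A = A" by auto
    then have "hausdorff_outer s A \<le> hausdorff_outer s (F \<inter> A) + hausdorff_outer s ((UNIV - F) \<inter> A)"
      using hausdorff_outer_Un[of s "F \<inter> A" "(UNIV - F) \<inter> A"] by simp
    moreover have "A \<inter> F = F \<inter> A" "A - F = (UNIV - F) \<inter> A" by auto
    ultimately show "hausdorff_outer s (F \<inter> A) + hausdorff_outer s ((UNIV - F) \<inter> A) = hausdorff_outer s A"
      using hausdorff_outer_closed[OF that, of s A] by (metis antisym)
  qed simp
  then have "Collect closed \<subseteq> ?L" by auto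
  then have "sigma_sets UNIV (Collect closed) \<subseteq> ?L" by (rule L.sigma_sets_subset)
  then have "sets (borel :: 'b measure) \<subseteq> ?L"
    unfolding borel_eq_closed by simp
  then show ?thesis
    by (intro measure_down[OF L]) (use sets.sigma_algebra_axioms[of borel] in auto)
qed

lemma space_hausdorff_measure [simp]: "space (hausdorff_measure s) = UNIV"
  and sets_hausdorff_measure [simp, measurable_cong]: "sets (hausdorff_measure s) = sets borel"
  by (simp_all add: hausdorff_measure_def sets.sigma_sets_eq[of borel, simplified])

lemma emeasure_hausdorff_measure:
  "A \<in> sets borel \<Longrightarrow> emeasure (hausdorff_measure s) A = hausdorff_outer s A"
  unfolding hausdorff_measure_def using measure_space_hausdorff[of s]
  by (intro emeasure_measure_of_sigma) (auto simp: measure_space_def)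


section \<open>Differential operators\<close>

definition grad :: "('b::euclidean_space \<Rightarrow> real) \<Rightarrow> 'b \<Rightarrow> 'b" where
  "grad f x = (\<Sum>b\<in>Basis. frechet_derivative f (at x) b *\<^sub>R b)"

definition laplacian :: "('b::euclidean_space \<Rightarrow> real) \<Rightarrow> 'b \<Rightarrow> real" where
  "laplacian f x = (\<Sum>b\<in>Basis. (deriv ^^ 2) (\<lambda>t. f (x + t *\<^sub>R b)) 0)"


section \<open>The thin obstacle problem in the unit half ball\<close>

text \<open>Points of \<open>\<real>\<^sup>n\<close> are pairs \<open>(x', x\<^sub>n)\<close> in \<open>'a \<times> real\<close>, where \<open>'a\<close> is a Euclidean space of
  arbitrary dimension \<open>DIM('a) = n - 1 \<ge> 1\<close>; the product norm is the Euclidean one.\<close>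

definition half_ball :: "real \<Rightarrow> ('a::euclidean_space \<times> real) set" where
  "half_ball r = ball 0 r \<inter> {x. 0 < snd x}"

definition thin_ball :: "real \<Rightarrow> ('a::euclidean_space \<times> real) set" where
  "thin_ball r = ball 0 r \<inter> {x. snd x = 0}"

text \<open>Local \<open>C\<^bsup>1,\<alpha>\<^esup>\<close> regularity on \<open>half_ball 1 \<union> thin_ball 1\<close>: the gradient extends to the flat
  part of the boundary, and the extension is Hoelder continuous on compact subsets.\<close>

definition C1_holder :: "real \<Rightarrow> ('a::euclidean_space \<times> real \<Rightarrow> real) \<Rightarrow> bool" where
  "C1_holder \<alpha> u \<longleftrightarrow>
     continuous_on (half_ball 1 \<union> thin_ball 1) u \<and>
     (\<forall>x\<in>half_ball 1. u differentiable (at x)) \<and>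
     (\<exists>G. (\<forall>x\<in>half_ball 1. G x = grad u x) \<and>
          (\<forall>K. compact K \<and> K \<subseteq> half_ball 1 \<union> thin_ball 1 \<longrightarrow>
             (\<exists>c. \<forall>x\<in>K. \<forall>y\<in>K. norm (G x - G y) \<le> c * dist x y powr \<alpha>)))"

definition C1_norm :: "('a::euclidean_space \<times> real \<Rightarrow> real) \<Rightarrow> ennreal" where
  "C1_norm u = (SUP x\<in>half_ball 1. ennreal \<bar>u x\<bar>) + (SUP x\<in>half_ball 1. ennreal (norm (grad u x)))"

definition dnormal :: "('a::euclidean_space \<times> real \<Rightarrow> real) \<Rightarrow> 'a \<times> real \<Rightarrow> real" where
  "dnormal u x = Lim (at x within {y. 0 < snd y}) (\<lambda>y. grad u y \<bullet> (0, 1))"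

text \<open>Test functions are of class \<open>C\<^sup>1\<close> with compact support, as is customary for weak solutions
  with locally integrable gradient.\<close>

definition test_function :: "'b::euclidean_space set \<Rightarrow> ('b \<Rightarrow> real) \<Rightarrow> bool" where
  "test_function \<Omega> \<phi> \<longleftrightarrow>
     (\<forall>x. \<phi> differentiable (at x)) \<and> continuous_on UNIV (grad \<phi>) \<and>
     compact (closure {x. \<phi> x \<noteq> 0}) \<and> closure {x. \<phi> x \<noteq> 0} \<subseteq> \<Omega>"

definition weak_laplacian ::
  "'b::euclidean_space set \<Rightarrow> ('b \<Rightarrow> real) \<Rightarrow> ('b \<Rightarrow> real) \<Rightarrow> bool" where
  "weak_laplacian \<Omega> u f \<longleftrightarrow>
     (\<forall>\<phi>. test_function \<Omega> \<phi> \<longrightarrow>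
        - (LINT x:\<Omega>|lborel. grad u x \<bullet> grad \<phi> x) = (LINT x:\<Omega>|lborel. f x * \<phi> x))"

definition contact_set :: "('a::euclidean_space \<times> real \<Rightarrow> real) \<Rightarrow> ('a \<times> real) set" where
  "contact_set u = {x \<in> thin_ball 1. u x = 0}"

definition free_boundary :: "('a::euclidean_space \<times> real \<Rightarrow> real) \<Rightarrow> ('a \<times> real) set" where
  "free_boundary u = top_of_set (thin_ball 1) frontier_of contact_set u"

text \<open>Only the values on \<open>ball 0 1\<close> matter. The last condition is the even extension to the lower
  half ball.\<close>

definition obstacle_class :: "nat \<Rightarrow> real \<Rightarrow> ('a::euclidean_space \<times> real \<Rightarrow> real) set" where
  "obstacle_class k M = {u.
     (\<exists>\<alpha>\<in>{0<..<1}. C1_holder \<alpha> u) \<and>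
     (\<exists>f\<in>borel_measurable borel. weak_laplacian (half_ball 1) u f \<and>
        (AE x in lborel. x \<in> half_ball 1 \<longrightarrow> \<bar>f x\<bar> \<le> M * norm (fst x) ^ (k - 1))) \<and>
     (\<forall>x\<in>thin_ball 1. 0 \<le> u x \<and> 0 \<le> - dnormal u x \<and> u x * dnormal u x = 0) \<and>
     0 \<in> free_boundary u \<and>
     C1_norm u \<le> ennreal M \<and>
     (\<forall>x' t. (x', t) \<in> ball 0 1 \<longrightarrow> u (x', - t) = u (x', t))}"


section \<open>Truncated frequency and singular points\<close>

definition sphere_integral :: "real \<Rightarrow> ('a::euclidean_space \<times> real \<Rightarrow> real) \<Rightarrow> real" where
  "sphere_integral r g = (LINT x:sphere 0 r|hausdorff_measure DIM('a). g x)"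

definition height :: "('a::euclidean_space \<times> real \<Rightarrow> real) \<Rightarrow> real \<Rightarrow> real" where
  "height u r = sphere_integral r (\<lambda>x. (u x)\<^sup>2)"

definition log_trunc_height :: "nat \<Rightarrow> ('a::euclidean_space \<times> real \<Rightarrow> real) \<Rightarrow> real \<Rightarrow> real" where
  "log_trunc_height k u r = ln (max (height u r) (r ^ (DIM('a) + 2 * k)))"

definition frequency :: "nat \<Rightarrow> real \<Rightarrow> ('a::euclidean_space \<times> real \<Rightarrow> real) \<Rightarrow> real \<Rightarrow> real" where
  "frequency k C u r = (r + C * r\<^sup>2) * deriv (log_trunc_height k u) r"

text \<open>The value at \<open>0+\<close> of the frequency equals \<open>L\<close>. The constant \<open>C\<close> has to make the frequency
  nondecreasing near \<open>0\<close>, off a null set \<open>N\<close> that also contains the points where the truncated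
  logarithm is not differentiable; the limit does not depend on the choice of such a \<open>C\<close>.\<close>

definition frequency_limit :: "nat \<Rightarrow> ('a::euclidean_space \<times> real \<Rightarrow> real) \<Rightarrow> real \<Rightarrow> bool" where
  "frequency_limit k u L \<longleftrightarrow>
     (\<exists>C>0. \<exists>r\<^sub>0>0. \<exists>N\<in>null_sets lborel.
        (\<forall>r\<in>{0<..<r\<^sub>0} - N. log_trunc_height k u differentiable (at r)) \<and>
        mono_on ({0<..<r\<^sub>0} - N) (frequency k C u) \<and>
        (frequency k C u \<longlongrightarrow> L) (at 0 within ({0<..<r\<^sub>0} - N)))"

definition singular_origin :: "nat \<Rightarrow> nat \<Rightarrow> ('a::euclidean_space \<times> real \<Rightarrow> real) \<Rightarrow> bool" where
  "singular_origin k \<kappa> u \<longleftrightarrow>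
     frequency_limit k u (real (DIM('a) + 2 * \<kappa>)) \<and>
     ((\<lambda>r. measure (hausdorff_measure DIM('a)) (contact_set u \<inter> thin_ball r) /
            measure (hausdorff_measure DIM('a)) (thin_ball r :: ('a \<times> real) set)) \<longlongrightarrow> 0) (at_right 0)"


section \<open>Blowup polynomials and the Monneau functional\<close>

definition blowup_polys :: "nat \<Rightarrow> ('a::euclidean_space \<times> real \<Rightarrow> real) set" where
  "blowup_polys \<kappa> = {p. real_polynomial_function p \<and>
     (\<forall>c x. p (c *\<^sub>R x) = c ^ \<kappa> * p x) \<and>
     (\<forall>x. laplacian p x = 0) \<and>
     (\<forall>x'. 0 \<le> p (x', 0)) \<and>
     (\<forall>x' t. p (x', - t) = p (x', t))}"

definition monneau ::
  "nat \<Rightarrow> ('a::euclidean_space \<times> real \<Rightarrow> real) \<Rightarrow> ('a \<times> real \<Rightarrow> real) \<Rightarrow> real \<Rightarrow> real" where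
  "monneau \<kappa> u p r =
     1 / r ^ (DIM('a) + 2 * \<kappa>) * sphere_integral r (\<lambda>x. (u x - p x)\<^sup>2)"

definition L2_norm_ball :: "('b::euclidean_space \<Rightarrow> real) \<Rightarrow> real" where
  "L2_norm_ball p = sqrt (LINT x:ball 0 1|lborel. (p x)\<^sup>2)"

end

theory Submission
  imports Defs
begin

text \<open>Let \<open>h\<close> be the normalised height and \<open>D\<close> the normalised flux \<open>\<integral> u (x \<bullet> \<nabla> u)\<close> on the sphere of
  radius \<open>r\<close>. Differentiating the Monneau functional gives, up to a factor, \<open>r ^ (- 2 * \<kappa> - 1)\<close> times
  \<open>(D - \<kappa> h) - (\<integral> p (x \<bullet> \<nabla> u) - \<kappa> \<integral> p u)\<close>. The second bracket is bounded from above by Green's formula: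
  \<open>p\<close> is harmonic, nonnegative on the thin ball and has no normal derivative there, so only the right
  hand side of the equation for \<open>u\<close> contributes, and this part is linear in \<open>p\<close>.

  Up to such errors the first bracket is a Weiss energy, and it needs a lower bound that depends only on \<open>M\<close>.
  Comparing \<open>u\<close> with the \<open>\<kappa>\<close>-homogeneous extension of its values on the sphere yields a differential
  inequality for it, whose error terms involve \<open>h\<close>. The frequency limit enters twice, each time only
  qualitatively: it shows \<open>h = O(r ^ (2 * \<kappa>))\<close>, and that \<open>(D - \<kappa> h) / r ^ (2 * \<kappa>)\<close> has nonnegative lower limit at
  \<open>0\<close>. Integrating from \<open>0\<close> gives the lower bound in terms of the supremum of \<open>h / r ^ (2 * \<kappa>)\<close>, and
  inserting it into the derivative of \<open>h / r ^ (2 * \<kappa>)\<close> bounds that supremum uniformly.\<close>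

section \<open>Surface measure on spheres\<close>

text \<open>Two obstacles shape the argument. Sphere integrals are taken against a measure built
  from coverings, whereas the weak equation speaks of Lebesgue integrals over half balls. Symmetry
  alone ties the two together: reflection-invariant measures on the unit sphere are proportional,
  and the factor \<open>c\<close> is never computed. If the covering measure of the sphere were
  infinite, Bochner integrals of nonnegative continuous functions would default to 0, a case
  absorbed by \<open>c = 0\<close>. Moreover \<open>u\<close> is only continuously differentiable up
  to the thin ball. Integration by parts therefore appears as inequalities, in which the boundary
  terms on the thin ball are discarded by their sign. The powers close because \<kappa> < k: the
  right-hand side of size M |x'|^(k-1), paired with functions of size |x|^\<kappa>, contributes
  O(r^(2\<kappa>+2)) to both brackets, while the differentiation costs r^(-2\<kappa>-1). Hence the
  radius 1/2 serves for every M, and the constant is built from M, \<kappa>, the dimension and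
  \<open>c\<close>.\<close>

text \<open>Christensen's argument. The set of pairs of points of \<open>U\<close> closer than
  \<open>\<rho> k\<close> is measured in both orders of integration: one order gives the
  \<open>N\<close>-mass of small balls around points of \<open>U\<close>, the other is at most
  \<open>g k\<close> times the \<open>N\<close>-mass of \<open>U\<close>. After division by
  \<open>h k\<close> Fatou's lemma applies, because balls around a point of the open set
  \<open>U\<close> eventually lie inside it and the quotient is then 1.\<close>

lemma uniformly_distributed_le:
  fixes M N :: "'b::{metric_space, second_countable_topology} measure"
  assumes sM [measurable_cong]: "sets M = sets borel" and sN [measurable_cong]: "sets N = sets borel"
    and sfM: "sigma_finite_measure M" and sfN: "sigma_finite_measure N"
    and aeM: "AE x in M. x \<in> S" and aeN: "AE x in N. x \<in> S"
    and g: "\<And>x k. x \<in> S \<Longrightarrow> emeasure M (ball x (\<rho> k)) = g k"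
    and h: "\<And>x k. x \<in> S \<Longrightarrow> emeasure N (ball x (\<rho> k)) = h k"
    and h0: "\<And>k. 0 < h k" "\<And>k. h k < \<infinity>"
    and \<rho>: "\<rho> \<longlonglongrightarrow> 0"
    and lim: "(\<lambda>k. g k / h k) \<longlonglongrightarrow> a"
    and U: "open U" and NU: "emeasure N U < \<infinity>"
  shows "emeasure M U \<le> a * emeasure N U"
proof -
  interpret M: sigma_finite_measure M by fact
  interpret N: sigma_finite_measure N by fact
  interpret MN: pair_sigma_finite M N ..
  have [measurable]: "U \<in> sets borel" using U by auto
  define F where "F k = (\<lambda>(x, y). indicator U x * indicator U y * indicator {z. dist (fst z) (snd z) < \<rho> k} (x, y) :: ennreal)" for k
  have [measurable]: "{z :: 'b \<times> 'b. dist (fst z) (snd z) < \<rho> k} \<in> sets (borel \<Otimes>\<^sub>M borel)" for k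
  proof -
    have "open {z :: 'b \<times> 'b. dist (fst z) (snd z) < \<rho> k}"
      by (intro open_Collect_less continuous_intros)
    then show ?thesis by (subst borel_prod) (rule borel_open)
  qed
  have Fm [measurable]: "F k \<in> borel_measurable (M \<Otimes>\<^sub>M N)" for k
    unfolding F_def by measurable
  have inner: "(\<integral>\<^sup>+y. F k (x, y) \<partial>N) = indicator U x * emeasure N (U \<inter> ball x (\<rho> k))" for x k
  proof -
    have "(\<integral>\<^sup>+y. F k (x, y) \<partial>N) = (\<integral>\<^sup>+y. indicator U x * indicator (U \<inter> ball x (\<rho> k)) y \<partial>N)"
      by (intro nn_integral_cong) (auto simp: F_def split: split_indicator)
    also have "\<dots> = indicator U x * emeasure N (U \<inter> ball x (\<rho> k))"
      by (subst nn_integral_cmult) (auto intro!: borel_measurable_indicator simp: sN)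
    finally show ?thesis .
  qed
  have inner': "(\<integral>\<^sup>+x. F k (x, y) \<partial>M) = indicator U y * emeasure M (U \<inter> ball y (\<rho> k))" for y k
  proof -
    have "(\<integral>\<^sup>+x. F k (x, y) \<partial>M) = (\<integral>\<^sup>+x. indicator U y * indicator (U \<inter> ball y (\<rho> k)) x \<partial>M)"
      by (intro nn_integral_cong) (auto simp: F_def dist_commute split: split_indicator)
    also have "\<dots> = indicator U y * emeasure M (U \<inter> ball y (\<rho> k))"
      by (subst nn_integral_cmult) (auto intro!: borel_measurable_indicator simp: sM)
    finally show ?thesis .
  qed
  have m1: "(\<lambda>x. indicator U x * emeasure N (U \<inter> ball x (\<rho> k))) \<in> borel_measurable M" for k
    unfolding inner[symmetric] by measurable
  have le: "(\<integral>\<^sup>+x. indicator U x * emeasure N (U \<inter> ball x (\<rho> k)) / h k \<partial>M) \<le> g k / h k * emeasure N U" for k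
  proof -
    have "(\<integral>\<^sup>+x. indicator U x * emeasure N (U \<inter> ball x (\<rho> k)) / h k \<partial>M)
        = (\<integral>\<^sup>+x. (\<integral>\<^sup>+y. F k (x, y) \<partial>N) \<partial>M) / h k"
      unfolding inner by (rule nn_integral_divide[OF m1])
    also have "(\<integral>\<^sup>+x. (\<integral>\<^sup>+y. F k (x, y) \<partial>N) \<partial>M) = (\<integral>\<^sup>+y. (\<integral>\<^sup>+x. F k (x, y) \<partial>M) \<partial>N)"
      by (rule MN.Fubini[symmetric]) measurable
    also have "\<dots> \<le> (\<integral>\<^sup>+y. g k * indicator U y \<partial>N)"
      unfolding inner'
    proof (rule nn_integral_mono_AE, use aeN in eventually_elim)
      case (elim y)
      have "emeasure M (U \<inter> ball y (\<rho> k)) \<le> emeasure M (ball y (\<rho> k))"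
        by (intro emeasure_mono) (auto simp: sM)
      then show ?case using g[OF elim] by (auto split: split_indicator)
    qed
    also have "\<dots> = g k * emeasure N U" by (rule nn_integral_cmult_indicator) (simp add: sN)
    finally show ?thesis
      by (simp add: divide_ennreal_def mult_ac mult_right_mono)
  qed
  have "emeasure M U = (\<integral>\<^sup>+x. indicator U x \<partial>M)" by (simp add: sM)
  also have "\<dots> \<le> (\<integral>\<^sup>+x. liminf (\<lambda>k. indicator U x * emeasure N (U \<inter> ball x (\<rho> k)) / h k) \<partial>M)"
  proof (rule nn_integral_mono_AE, use aeM in eventually_elim)
    case (elim x)
    show ?case
    proof (cases "x \<in> U")
      case True
      obtain e where e: "0 < e" "ball x e \<subseteq> U" using U True open_contains_ball by blast
      have "\<forall>\<^sub>F k in sequentially. \<rho> k < e" using order_tendstoD(2)[OF \<rho> e(1)] .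
      then have "\<forall>\<^sub>F k in sequentially. indicator U x * emeasure N (U \<inter> ball x (\<rho> k)) / h k = (1::ennreal)"
      proof eventually_elim
        case (elim k)
        have "U \<inter> ball x (\<rho> k) = ball x (\<rho> k)" using e elim by auto
        then have "emeasure N (U \<inter> ball x (\<rho> k)) = h k" using h[OF \<open>x \<in> S\<close>] by simp
        moreover have "h k / h k = 1" using h0[of k] by (intro ennreal_divide_self) auto
        ultimately show ?case using True by simp
      qed
      then have "liminf (\<lambda>k. indicator U x * emeasure N (U \<inter> ball x (\<rho> k)) / h k) = 1"
        by (subst Liminf_eq[of _ "\<lambda>_. 1"]) (auto simp: Liminf_const)
      then show ?thesis by (simp split: split_indicator)
    qed simp
  qed
  also have "\<dots> \<le> liminf (\<lambda>k. \<integral>\<^sup>+x. indicator U x * emeasure N (U \<inter> ball x (\<rho> k)) / h k \<partial>M)"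
    using m1 by (intro nn_integral_liminf) (auto intro!: borel_measurable_divide_ennreal)
  also have "\<dots> \<le> liminf (\<lambda>k. g k / h k * emeasure N U)"
    by (intro Liminf_mono always_eventually allI le)
  also have "\<dots> = a * emeasure N U"
  \<comment> \<open>Multiplication on \<open>ennreal\<close> is discontinuous at
    (\<open>top\<close>, 0) and \<open>a\<close> may be \<open>top\<close>, so null sets
    \<open>U\<close> are handled apart.\<close>
  proof (cases "emeasure N U = 0")
    case False
    then have "((\<lambda>k. g k / h k * emeasure N U) \<longlongrightarrow> a * emeasure N U) sequentially"
      using NU by (intro tendsto_mult_ennreal lim tendsto_const) auto
    then show ?thesis by (intro lim_imp_Liminf) auto
  qed (simp add: Liminf_const)
  finally show ?thesis .
qed


section \<open>Reflections and the uniqueness of reflection-invariant measures on the sphere\<close>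

text \<open>Mirror image in the hyperplane orthogonal to \<open>w\<close>, which need not be a unit
  vector; for \<open>w = 0\<close> it is the identity. Two points of equal norm are exchanged by a
  single reflection, the one with \<open>w = x - y\<close>, so reflections stand in for the whole
  orthogonal group.\<close>

definition reflection :: "'b::real_inner \<Rightarrow> 'b \<Rightarrow> 'b" where
  "reflection w z = z - (2 * (z \<bullet> w) / (w \<bullet> w)) *\<^sub>R w"

lemma inner_reflection_self: "reflection w z \<bullet> w = - (z \<bullet> w)"
  by (cases "w = 0") (simp_all add: reflection_def inner_diff_left)

lemma reflection_reflection [simp]: "reflection w (reflection w z) = z"
  using inner_reflection_self[of w z] by (subst reflection_def) (simp add: reflection_def)

lemma reflection_diff: "reflection w (x - y) = reflection w x - reflection w y"
  by (simp add: reflection_def inner_diff_left algebra_simps diff_divide_distrib)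

lemma reflection_scaleR: "reflection w (c *\<^sub>R x) = c *\<^sub>R reflection w x"
  by (simp add: reflection_def algebra_simps)

lemma norm_reflection [simp]: "norm (reflection w z) = norm z"
proof -
  have "reflection w z \<bullet> reflection w z = reflection w z \<bullet> z + (2 * (z \<bullet> w) / (w \<bullet> w)) * (z \<bullet> w)"
    by (subst (2) reflection_def) (simp add: inner_diff_right inner_reflection_self)
  also have "\<dots> = z \<bullet> z"
    by (simp add: reflection_def inner_diff_left inner_diff_right inner_commute)
  finally show ?thesis by (simp add: norm_eq_sqrt_inner)
qed

lemma dist_reflection [simp]: "dist (reflection w x) (reflection w y) = dist x y"
  by (metis dist_norm norm_reflection reflection_diff)

lemma reflection_swaps:
  assumes "norm x = norm y"
  shows "reflection (x - y) x = y"
proof (cases "x = y")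
  case False
  have "x \<bullet> x = y \<bullet> y" using assms by (simp add: norm_eq_sqrt_inner)
  then have "2 * (x \<bullet> (x - y)) = (x - y) \<bullet> (x - y)"
    by (simp add: inner_diff_left inner_diff_right inner_commute)
  then show ?thesis using False by (simp add: reflection_def)
qed (simp add: reflection_def)

lemma continuous_on_reflection [continuous_intros]: "continuous_on A (reflection w)"
  by (auto simp: continuous_on_iff)

lemma reflection_measurable [measurable]:
  "reflection (w :: 'b::euclidean_space) \<in> borel_measurable borel"
  by (intro borel_measurable_continuous_onI continuous_intros)

lemma vimage_reflection_ball: "reflection w -` ball x r = ball (reflection w x) r"
  by (auto simp: mem_ball) (metis dist_reflection reflection_reflection)+

text \<open>A reflection maps balls to balls of the same radius, so the image measure and
  \<open>lborel\<close> agree on all balls. The comparison of uniformly distributed measures with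
  ratio 1, used in both directions, extends this to boxes.\<close>

lemma lborel_distr_reflection: "distr lborel borel (reflection w) = (lborel :: 'b::euclidean_space measure)"
proof -
  let ?D = "distr lborel borel (reflection w) :: 'b measure"
  have sfD: "sigma_finite_measure ?D"
  proof
    let ?A = "range (\<lambda>n::nat. ball (0::'b) n)"
    have "emeasure ?D a \<noteq> \<infinity>" if "a \<in> ?A" for a
      using that emeasure_lborel_ball_finite[where 'a='b]
      by (auto simp: emeasure_distr vimage_reflection_ball less_top)
    moreover have "\<Union>?A = UNIV"
      using reals_Archimedean2 by (auto simp: dist_norm) 
    ultimately show "\<exists>A. countable A \<and> A \<subseteq> sets ?D \<and> \<Union>A = space ?D \<and> (\<forall>a\<in>A. emeasure ?D a \<noteq> \<infinity>)"
      by (intro exI[of _ ?A]) auto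
  qed
  let ?\<rho> = "\<lambda>k. inverse (real (Suc k))"
  define g where "g = (\<lambda>k. ennreal (unit_ball_vol DIM('b) * ?\<rho> k ^ DIM('b)))"
  have g: "emeasure lborel (ball x (?\<rho> k)) = g k" for x :: 'b and k
    unfolding g_def by (subst emeasure_ball) auto
  have g': "emeasure ?D (ball x (?\<rho> k)) = g k" for x :: 'b and k
    by (subst emeasure_distr) (auto simp: vimage_reflection_ball g simp del: of_nat_Suc)
  have "0 < unit_ball_vol DIM('b) * ?\<rho> k ^ DIM('b)" for k
    by (intro mult_pos_pos unit_ball_vol_pos zero_less_power) auto
  then have g0: "0 < g k" "g k < \<infinity>" for k
    unfolding g_def by (simp_all only: ennreal_less_zero_iff ennreal_less_top infinity_ennreal_def)
  have "g k / g k = 1" for k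
    using g0[of k] by (intro ennreal_divide_self) auto
  then have lim: "(\<lambda>k. g k / g k) \<longlonglongrightarrow> 1" by simp
  have eq: "emeasure ?D (box l u) = emeasure lborel (box l u)" for l u
  proof (rule antisym)
    have fin: "emeasure lborel (box l u) < \<infinity>" by (rule emeasure_lborel_box_finite)
    have "emeasure ?D (box l u) \<le> 1 * emeasure lborel (box l u)"
      by (rule uniformly_distributed_le[where S=UNIV and \<rho>="?\<rho>" and g=g and h=g])
        (use sfD g g' g0 lim fin lborel.sigma_finite_measure_axioms LIMSEQ_inverse_real_of_nat in auto)
    then show le: "emeasure ?D (box l u) \<le> emeasure lborel (box l u)" by simp
    have "emeasure lborel (box l u) \<le> 1 * emeasure ?D (box l u)"
      by (rule uniformly_distributed_le[where S=UNIV and \<rho>="?\<rho>" and g=g and h=g])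
        (use sfD g g' g0 lim le fin lborel.sigma_finite_measure_axioms LIMSEQ_inverse_real_of_nat in auto)
    then show "emeasure lborel (box l u) \<le> emeasure ?D (box l u)" by simp
  qed
  have "lborel = ?D"
    by (rule lborel_eqI) (auto simp: eq)
  then show ?thesis by simp
qed

definition reflection_invariant :: "'b::euclidean_space measure \<Rightarrow> bool" where
  "reflection_invariant M \<longleftrightarrow> sets M = sets borel \<and>
     (\<forall>w. \<forall>A\<in>sets borel. emeasure M (reflection w -` A) = emeasure M A)"

lemma reflection_invariant_ball:
  assumes "reflection_invariant M" "norm x = norm y"
  shows "emeasure M (ball x r) = emeasure M (ball y r)"
proof -
  have "emeasure M (ball y r) = emeasure M (reflection (x - y) -` ball y r)"
    using assms(1) unfolding reflection_invariant_def by auto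
  also have "reflection (x - y) -` ball y r = ball x r"
    using reflection_swaps[OF assms(2)] by (metis reflection_reflection vimage_reflection_ball)
  finally show ?thesis by simp
qed

text \<open>By compactness finitely many balls of radius \<open>r\<close> cover the sphere, and by
  invariance all of them have the same mass. So positive mass of the sphere forces positive mass of
  every small ball, and infinite mass forces infinite mass.\<close>

lemma reflection_invariant_sphere_le:
  assumes inv: "reflection_invariant M" and "0 < r"
  shows "\<exists>m::nat. \<forall>x\<in>sphere 0 1. emeasure M (sphere 0 1) \<le> of_nat m * emeasure M (ball x r)"
proof -
  have sM: "sets M = sets borel" using inv by (simp add: reflection_invariant_def)
  have "compact (sphere (0::'a) 1)" by simp
  then obtain C where C: "C \<subseteq> sphere 0 1" "finite C" "sphere (0::'a) 1 \<subseteq> (\<Union>c\<in>C. ball c r)"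
    by (rule compactE_image[of _ "sphere 0 1" "\<lambda>c. ball c r"]) (use \<open>0 < r\<close> in \<open>auto intro!: bexI\<close>)
  have "emeasure M (sphere 0 1) \<le> of_nat (card C) * emeasure M (ball x r)" if "x \<in> sphere 0 1" for x
  proof -
    have "emeasure M (sphere 0 1) \<le> emeasure M (\<Union>c\<in>C. ball c r)"
      by (rule emeasure_mono) (use C sM in auto)
    also have "\<dots> \<le> (\<Sum>c\<in>C. emeasure M (ball c r))"
      by (rule emeasure_subadditive_finite) (use C sM in auto)
    also have "\<dots> = (\<Sum>c\<in>C. emeasure M (ball x r))"
      using C that by (intro sum.cong reflection_invariant_ball[OF inv]) auto
    finally show ?thesis by simp
  qed
  then show ?thesis by blast
qed

lemma finite_measure_eqI_open:
  fixes M N :: "'b::topological_space measure"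
  assumes s: "sets M = sets borel" "sets N = sets borel"
    and fin: "emeasure M UNIV \<noteq> \<infinity>"
    and eq: "\<And>U. open U \<Longrightarrow> emeasure M U = emeasure N U"
  shows "M = N"
proof (rule measure_eqI_generator_eq[where E="Collect open" and \<Omega>=UNIV and A="\<lambda>_. UNIV"])
  show "Int_stable (Collect (open :: 'b set \<Rightarrow> bool))" by (auto simp: Int_stable_def)
qed (use s fin eq in \<open>auto simp: borel_def sets_measure_of\<close>)

text \<open>For both measures the mass of a ball centred on the sphere depends on its radius only. A
  cluster value \<open>a\<close> of the ratio of these masses, as the radius tends to 0, gives the
  bound of \<open>M\<close> by \<open>a\<close> times \<open>N\<close> and of \<open>N\<close> by
  \<open>inverse a\<close> times \<open>M\<close> on open sets, hence equality there.\<close>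

lemma reflection_invariant_proportional:
  fixes M N :: "'b::euclidean_space measure"
  assumes invM: "reflection_invariant M" and invN: "reflection_invariant N"
    and aeM: "AE x in M. x \<in> sphere 0 1" and aeN: "AE x in N. x \<in> sphere 0 1"
    and finM: "emeasure M UNIV < \<infinity>" and finN: "emeasure N UNIV < \<infinity>"
    and posM: "emeasure M UNIV \<noteq> 0"
  shows "\<exists>c. c < \<infinity> \<and> N = scale_measure c M"
proof -
  have sM: "sets M = sets borel" "space M = UNIV" and sN: "sets N = sets borel" "space N = UNIV"
    using invM invN sets_eq_imp_space_eq[of M borel] sets_eq_imp_space_eq[of N borel]
    by (simp_all add: reflection_invariant_def)
  have full: "emeasure M (sphere 0 1) = emeasure M UNIV" "emeasure N (sphere 0 1) = emeasure N UNIV"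
    using aeM aeN sM sN by (auto intro!: emeasure_eq_AE)
  show ?thesis
  proof (cases "emeasure N UNIV = 0")
    case True
    have "N = scale_measure 0 M"
      by (rule measure_eqI)
        (use True sM sN in \<open>auto intro: antisym[OF order_trans[OF emeasure_space]]\<close>)
    then show ?thesis by (intro exI[of _ 0]) auto
  next
    case posN: False
    obtain x0 :: 'b where x0: "x0 \<in> sphere 0 1" using vector_choose_size[of 1] by auto
    let ?\<rho> = "\<lambda>k. inverse (real (Suc k))"
    have ball_pos: "0 < emeasure L (ball x0 (?\<rho> k))"
      if L: "reflection_invariant L" "emeasure L (sphere 0 1) \<noteq> 0" for L k
    proof -
      obtain m :: nat where m: "emeasure L (sphere 0 1) \<le> of_nat m * emeasure L (ball x0 (?\<rho> k))"
        using reflection_invariant_sphere_le[OF L(1), of "?\<rho> k"] x0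
        by (metis inverse_positive_iff_positive of_nat_0_less_iff zero_less_Suc)
      show ?thesis
      proof (rule ccontr)
        assume "\<not> 0 < emeasure L (ball x0 (?\<rho> k))"
        then have "emeasure L (ball x0 (?\<rho> k)) = 0" by (simp add: not_less)
        then show False using m L(2) by simp
      qed
    qed
    have ball_fin: "emeasure L (ball x0 (?\<rho> k)) < \<infinity>"
      if "emeasure L UNIV < \<infinity>" "sets L = sets borel" for L k
      using emeasure_mono[of "ball x0 (?\<rho> k)" UNIV L] that sets_eq_imp_space_eq[of L borel] by (auto simp: less_top[symmetric] top_unique)
    let ?q = "\<lambda>k. emeasure M (ball x0 (?\<rho> k)) / emeasure N (ball x0 (?\<rho> k))"
    \<comment> \<open>Compactness of \<open>ennreal\<close> provides a cluster value between 0 and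
      \<open>top\<close>; the two endpoints are excluded afterwards by testing the inequalities with
      the whole space.\<close>
    obtain a s where s: "strict_mono (s :: nat \<Rightarrow> nat)" and a: "(?q \<circ> s) \<longlonglongrightarrow> a"
      using compact_imp_seq_compact[OF compact_UNIV] unfolding seq_compact_def by blast
    have rho: "(\<lambda>k. ?\<rho> (s k)) \<longlonglongrightarrow> 0"
      using LIMSEQ_subseq_LIMSEQ[OF LIMSEQ_inverse_real_of_nat s] by (simp add: comp_def)
    note ballM = reflection_invariant_ball[OF invM] and ballN = reflection_invariant_ball[OF invN]
    have gM: "emeasure M (ball x (?\<rho> (s k))) = emeasure M (ball x0 (?\<rho> (s k)))" if "x \<in> sphere 0 1" for x k
      using that x0 by (intro ballM) auto
    have gN: "emeasure N (ball x (?\<rho> (s k))) = emeasure N (ball x0 (?\<rho> (s k)))" if "x \<in> sphere 0 1" for x k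
      using that x0 by (intro ballN) auto
    have finU: "emeasure M U < \<infinity>" "emeasure N U < \<infinity>" for U
      using emeasure_space[of M U] emeasure_space[of N U] finM finN sM sN
      by (auto simp: less_top[symmetric] top_unique)
    have sf: "sigma_finite_measure M" "sigma_finite_measure N"
      using finM finN sM sN by (auto intro!: finite_measure.axioms(1) finite_measureI)
    have posM': "0 < emeasure M (ball x0 (?\<rho> k))" and posN': "0 < emeasure N (ball x0 (?\<rho> k))" for k
      using ball_pos[OF invM] ball_pos[OF invN] full posM posN by auto
    have le1: "emeasure M U \<le> a * emeasure N U" if "open U" for U
      by (rule uniformly_distributed_le[where \<rho>="\<lambda>k. ?\<rho> (s k)" and S="sphere 0 1"
            and g="\<lambda>k. emeasure M (ball x0 (?\<rho> (s k)))" and h="\<lambda>k. emeasure N (ball x0 (?\<rho> (s k)))"])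
        (use sM sN sf aeM aeN gM gN posN' finU rho a that in \<open>auto simp: comp_def\<close>)
    have inv_q: "inverse (?q k) = emeasure N (ball x0 (?\<rho> k)) / emeasure M (ball x0 (?\<rho> k))" for k
    proof -
      obtain p where p: "emeasure M (ball x0 (?\<rho> k)) = ennreal p" "0 < p"
        using posM'[of k] finU[of "ball x0 (?\<rho> k)"] by (cases "emeasure M (ball x0 (?\<rho> k))") auto
      obtain r where r: "emeasure N (ball x0 (?\<rho> k)) = ennreal r" "0 < r"
        using posN'[of k] finU[of "ball x0 (?\<rho> k)"] by (cases "emeasure N (ball x0 (?\<rho> k))") auto
      show ?thesis unfolding p r using p r
        by (simp add: divide_ennreal inverse_ennreal)
    qed
    have b: "(\<lambda>k. emeasure N (ball x0 (?\<rho> (s k))) / emeasure M (ball x0 (?\<rho> (s k)))) \<longlonglongrightarrow> inverse a"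
      
    proof -
      have "continuous_on UNIV (inverse :: ennreal \<Rightarrow> ennreal)"
        using continuous_on_inverse_ennreal[OF continuous_on_id] by simp
      then have "isCont (inverse :: ennreal \<Rightarrow> ennreal) a"
        by (simp add: continuous_on_eq_continuous_at)
      from isCont_tendsto_compose[OF this a] show ?thesis
        unfolding inv_q[symmetric] by (simp add: comp_def)
    qed
    have le2: "emeasure N U \<le> inverse a * emeasure M U" if "open U" for U
      by (rule uniformly_distributed_le[where \<rho>="\<lambda>k. ?\<rho> (s k)" and S="sphere 0 1"
            and g="\<lambda>k. emeasure N (ball x0 (?\<rho> (s k)))" and h="\<lambda>k. emeasure M (ball x0 (?\<rho> (s k)))"])
        (use sM sN sf aeM aeN gM gN posM' finU rho b that in \<open>auto\<close>)
    have a0: "a \<noteq> 0" using le1[of UNIV] posM by auto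
    have a1: "a \<noteq> top" using le2[of UNIV] posN by auto
    have "N = scale_measure (inverse a) M"
    proof (rule finite_measure_eqI_open)
      fix U :: "'b set" assume "open U"
      have "inverse a * emeasure M U \<le> inverse a * (a * emeasure N U)"
        by (intro mult_left_mono le1 \<open>open U\<close>) simp
      also have "\<dots> = emeasure N U"
        using a0 a1 by (simp add: mult.assoc[symmetric] mult.commute[of "inverse a"] less_top ennreal_divide_self flip: divide_ennreal_def)
      finally show "emeasure N U = emeasure (scale_measure (inverse a) M) U"
        using le2[OF \<open>open U\<close>] by simp
    qed (use sM sN finN in auto)
    moreover have "inverse a < \<infinity>" using a0 by (simp add: less_top[symmetric])
    ultimately show ?thesis by blast
  qed
qed


text \<open>\<open>N\<close> is first restricted to the sphere, where its mass may be infinite. In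
  that case every ball around a point of the sphere has infinite mass, so a continuous
  \<open>g\<close> that is positive somewhere is not integrable; its Bochner integral is 0 by
  convention, and \<open>c = 0\<close> works. Otherwise the restriction is a finite multiple of
  \<open>M\<close>.\<close>

lemma continuous_sphere_integral_proportional:
  fixes M N :: "'b::euclidean_space measure"
  assumes invM: "reflection_invariant M" and invN: "reflection_invariant N"
    and aeM: "AE x in M. x \<in> sphere 0 1"
    and finM: "emeasure M UNIV < \<infinity>" and posM: "emeasure M UNIV \<noteq> 0"
  shows "\<exists>c\<ge>0. \<forall>g. continuous_on (sphere 0 1) g \<longrightarrow> (\<forall>x\<in>sphere 0 1. 0 \<le> g x) \<longrightarrow>
    (LINT x:sphere 0 1|N. g x) = c * (LINT x:sphere 0 1|M. g x :: real)"
proof -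
  have sM: "sets M = sets borel" "space M = UNIV" and sN: "sets N = sets borel" "space N = UNIV"
    using invM invN sets_eq_imp_space_eq[of M borel] sets_eq_imp_space_eq[of N borel]
    by (simp_all add: reflection_invariant_def)
  note [measurable_cong] = sM(1) sN(1)
  define N' where "N' = density N (indicator (sphere 0 1))"
  have sN': "sets N' = sets borel" "space N' = UNIV" by (simp_all add: N'_def sN)
  have N': "emeasure N' A = emeasure N (sphere 0 1 \<inter> A)" if "A \<in> sets borel" for A
    unfolding N'_def using that by (subst emeasure_density) (auto intro!: borel_measurable_indicator simp: sN nn_integral_indicator[symmetric] indicator_inter_arith simp del: nn_integral_indicator)
  have vr: "reflection w -` A \<in> sets borel" if "A \<in> sets borel" for w and A :: "'b set"
    using measurable_sets[OF reflection_measurable that, of w] by simp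
  have inv': "reflection_invariant N'"
    unfolding reflection_invariant_def
  proof (intro conjI allI ballI)
    fix w and A :: "'b set" assume A: "A \<in> sets borel"
    have "emeasure N (reflection w -` (sphere 0 1 \<inter> A)) = emeasure N (sphere 0 1 \<inter> A)"
      using invN A unfolding reflection_invariant_def by (simp del: vimage_Int)
    moreover have "reflection w -` (sphere 0 1 \<inter> A) = sphere 0 1 \<inter> reflection w -` A" by auto
    ultimately show "emeasure N' (reflection w -` A) = emeasure N' A"
      using A vr[OF A] by (simp add: N')
  qed (simp add: sN')
  have ae': "AE x in N'. x \<in> sphere 0 1"
    unfolding N'_def by (subst AE_density) (auto intro!: borel_measurable_indicator simp: sN split: split_indicator)
  have int_N': "(LINT x:sphere 0 1|N. g x) = (LINT x|N'. indicator (sphere 0 1) x *\<^sub>R g x)"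
    and meas: "(\<lambda>x. indicator (sphere 0 1) x *\<^sub>R g x) \<in> borel_measurable borel"
    if g: "continuous_on (sphere 0 1) g" for g :: "'b \<Rightarrow> real"
  proof -
    let ?h = "\<lambda>y. indicator (sphere 0 1) y *\<^sub>R g y"
    show h: "?h \<in> borel_measurable borel"
      by (intro borel_measurable_continuous_on_indicator g) auto
    have "(LINT x|N'. ?h x) = (LINT x|density N (\<lambda>x. ennreal (indicator (sphere 0 1) x)). ?h x)"
      by (simp add: N'_def ennreal_indicator)
    also have "\<dots> = (LINT x|N. indicator (sphere 0 1) x *\<^sub>R ?h x)"
      using h by (intro integral_density) (auto intro!: borel_measurable_indicator simp: sN measurable_cong_sets[OF sN(1) refl])
    also have "\<dots> = (LINT x:sphere 0 1|N. g x)"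
      unfolding set_lebesgue_integral_def by (intro Bochner_Integration.integral_cong) (auto split: split_indicator)
    finally show "(LINT x:sphere 0 1|N. g x) = (LINT x|N'. ?h x)" by simp
  qed
  show ?thesis
  proof (cases "emeasure N' (sphere 0 1) = \<infinity>")
    case True
    have inf: "emeasure N' (ball x r) = \<infinity>" if "x \<in> sphere 0 1" "0 < r" for x r
    proof -
      have "\<exists>m::nat. emeasure N' (sphere 0 1) \<le> of_nat m * emeasure N' (ball x r)"
        using reflection_invariant_sphere_le[OF inv' \<open>0 < r\<close>] \<open>x \<in> sphere 0 1\<close> by blast
      then obtain m :: nat where "of_nat m * emeasure N' (ball x r) = top"
        using True by (auto simp: top_unique)
      then show ?thesis by (simp add: ennreal_mult_eq_top_iff)
    qed
    have "(LINT x:sphere 0 1|N. g x) = 0"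
      if g: "continuous_on (sphere 0 1) g" "\<forall>x\<in>sphere 0 1. 0 \<le> g x" for g :: "'b \<Rightarrow> real"
    proof (cases "\<forall>x\<in>sphere 0 1. g x = 0")
      case True
      then show ?thesis
        unfolding set_lebesgue_integral_def by (intro integral_eq_zero_AE AE_I2) (auto split: split_indicator)
    next
      case False
      then obtain x where x: "x \<in> sphere 0 1" "0 < g x" using g by force
      then obtain \<delta> where \<delta>: "0 < \<delta>" "\<And>y. y \<in> sphere 0 1 \<Longrightarrow> dist y x < \<delta> \<Longrightarrow> dist (g y) (g x) < g x / 2"
        using g(1)[unfolded continuous_on_iff] by (metis half_gt_zero)
      let ?h = "\<lambda>y. indicator (sphere 0 1) y *\<^sub>R g y"
      have "\<not> integrable N' ?h"
      proof
        assume int: "integrable N' ?h"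
        have "emeasure N' (ball x \<delta>) = emeasure N' (sphere 0 1 \<inter> ball x \<delta>)" by (simp add: N')
        also have "\<dots> \<le> emeasure N' {y \<in> space N'. g x / 2 \<le> ?h y}"
        proof (rule emeasure_mono)
          show "sphere 0 1 \<inter> ball x \<delta> \<subseteq> {y \<in> space N'. g x / 2 \<le> ?h y}"
          proof safe
            fix y assume y: "y \<in> ball x \<delta>" "y \<in> sphere 0 1"
            then have "dist (g y) (g x) < g x / 2" using \<delta>(2)[of y] by (simp add: dist_commute)
            then show "g x / 2 \<le> ?h y" using y by (simp add: dist_real_def abs_if split: if_splits)
          qed (simp add: sN')
          show "{y \<in> space N'. g x / 2 \<le> ?h y} \<in> sets N'"
            using int by measurable
        qed
        also have "\<dots> \<le> ennreal (1 / (g x / 2) * (LINT y|N'. ?h y))"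
          by (rule integral_Markov_inequality[OF int]) (use g x in \<open>auto split: split_indicator\<close>)
        also have "\<dots> < \<infinity>" by simp
        finally show False using inf[OF x(1) \<delta>(1)] by simp
      qed
      then show ?thesis by (simp add: int_N'[OF g(1)] not_integrable_integral_eq)
    qed
    then show ?thesis by (intro exI[of _ 0]) auto
  next
    case fin: False
    obtain c where c: "c < \<infinity>" "N' = scale_measure c M"
      using reflection_invariant_proportional[OF invM inv' aeM ae' finM _ posM] fin
      by (auto simp: less_top N')
    have "N' = density M (\<lambda>_. ennreal (enn2real c))"
      by (rule measure_eqI) (use c in \<open>auto simp: emeasure_density_const sM\<close>)
    note N'M = this
    have "(LINT x:sphere 0 1|N. g x) = enn2real c * (LINT x:sphere 0 1|M. g x)"
      if g: "continuous_on (sphere 0 1) g" for g :: "'b \<Rightarrow> real"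
      unfolding int_N'[OF g] N'M unfolding set_lebesgue_integral_def
      by (subst integral_density) (use meas[OF g] in \<open>auto simp: measurable_cong_sets[OF sM(1) refl]\<close>)
    then show ?thesis by (intro exI[of _ "enn2real c"]) auto
  qed
qed

section \<open>Hausdorff measure under similarities\<close>

text \<open>Coverings are transported by \<open>f\<close> with all diameters multiplied by
  \<open>c\<close>. The scale \<open>\<delta>\<close> for \<open>A\<close> thus corresponds to
  \<open>c * \<delta>\<close> for the image, a shift that the supremum over all scales
  absorbs.\<close>

lemma hausdorff_outer_similarity_le:
  fixes f :: "'b::metric_space \<Rightarrow> 'c::metric_space"
  assumes "0 < c" and dist_f: "\<And>x y. dist (f x) (f y) = c * dist x y"
  shows "hausdorff_outer s (f ` A) \<le> ennreal (c ^ s) * hausdorff_outer s A"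
proof -
  have bd: "bounded (f ` S)" and diam: "diameter (f ` S) \<le> c * diameter S"
    and w: "hausdorff_weight s (f ` S) \<le> ennreal (c ^ s) * hausdorff_weight s S"
    if S: "bounded S" for S
  proof -
    show bd: "bounded (f ` S)"
    proof -
      obtain x e where "\<forall>y\<in>S. dist x y \<le> e" using S unfolding bounded_def by auto
      then have "\<forall>y\<in>S. dist (f x) (f y) \<le> c * e" using \<open>0 < c\<close> by (simp add: dist_f)
      then show ?thesis unfolding bounded_def by auto
    qed
    show diam: "diameter (f ` S) \<le> c * diameter S"
      unfolding diameter_def[of "f ` S"]
      using \<open>0 < c\<close> diameter_bounded_bound[OF S] diameter_ge_0[OF S]
      by (auto simp: dist_f intro!: cSUP_least)
    have "(diameter (f ` S) / 2) ^ s \<le> (c * (diameter S / 2)) ^ s"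
      using diam diameter_ge_0[OF bd] by (intro power_mono) auto
    then have "unit_ball_vol s * (diameter (f ` S) / 2) ^ s \<le> unit_ball_vol s * (c * (diameter S / 2)) ^ s"
      by (intro mult_left_mono) auto
    also have "\<dots> = c ^ s * (unit_ball_vol s * (diameter S / 2) ^ s)"
      by (simp add: power_mult_distrib power_divide)
    finally show "hausdorff_weight s (f ` S) \<le> ennreal (c ^ s) * hausdorff_weight s S"
      using \<open>0 < c\<close> by (simp add: hausdorff_weight_def ennreal_mult'[symmetric] ennreal_leI)
  qed
  have pre: "hausdorff_pre s (c * \<delta>) (f ` A) \<le> ennreal (c ^ s) * hausdorff_pre s \<delta> A" for \<delta>
  proof -
    have "hausdorff_pre s (c * \<delta>) (f ` A) / ennreal (c ^ s) \<le> hausdorff_pre s \<delta> A"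
      unfolding hausdorff_pre_def[of s \<delta> A]
    proof (rule INF_greatest)
      fix C assume "C \<in> {C :: nat \<Rightarrow> 'b set. A \<subseteq> (\<Union>i. C i) \<and> (\<forall>i. bounded (C i) \<and> diameter (C i) \<le> \<delta>)}"
      then have C: "A \<subseteq> (\<Union>i. C i)" "\<And>i. bounded (C i)" "\<And>i. diameter (C i) \<le> \<delta>" by auto
      have "f ` A \<subseteq> (\<Union>i. f ` C i)" using C(1) by blast
      then have "hausdorff_pre s (c * \<delta>) (f ` A) \<le> (\<Sum>i. hausdorff_weight s (f ` C i))"
        by (rule hausdorff_pre_le) (use C \<open>0 < c\<close> in \<open>auto intro: bd order_trans[OF diam]\<close>)
      also have "\<dots> \<le> (\<Sum>i. ennreal (c ^ s) * hausdorff_weight s (C i))"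
        by (intro suminf_le w C) auto
      finally show "hausdorff_pre s (c * \<delta>) (f ` A) / ennreal (c ^ s) \<le> (\<Sum>i. hausdorff_weight s (C i))"
        using \<open>0 < c\<close>
        by (subst divide_le_posI_ennreal) (auto simp: mult.commute zero_less_power)
    qed
    then have "ennreal (c ^ s) * (hausdorff_pre s (c * \<delta>) (f ` A) / ennreal (c ^ s)) \<le> ennreal (c ^ s) * hausdorff_pre s \<delta> A"
      by (rule mult_left_mono) simp
    then show ?thesis
      using \<open>0 < c\<close> by (simp add: ennreal_times_divide mult.commute[of "ennreal (c ^ s)"] mult_divide_eq_ennreal)
  qed
  show ?thesis
    unfolding hausdorff_outer_def[of s "f ` A"]
  proof (rule SUP_least)
    fix \<delta> :: real assume "\<delta> \<in> {0<..}"
    then have "0 < \<delta> / c" using \<open>0 < c\<close> by simp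
    have "hausdorff_pre s \<delta> (f ` A) \<le> ennreal (c ^ s) * hausdorff_pre s (\<delta> / c) A"
      using pre[of "\<delta> / c"] \<open>0 < c\<close> by simp
    also have "\<dots> \<le> ennreal (c ^ s) * hausdorff_outer s A"
      by (intro mult_left_mono hausdorff_pre_le_outer \<open>0 < \<delta> / c\<close>) simp
    finally show "hausdorff_pre s \<delta> (f ` A) \<le> ennreal (c ^ s) * hausdorff_outer s A" .
  qed
qed

lemma hausdorff_outer_similarity:
  fixes f :: "'b::metric_space \<Rightarrow> 'c::metric_space"
  assumes c: "0 < c" and dist_f: "\<And>x y. dist (f x) (f y) = c * dist x y" and "surj f"
  shows "hausdorff_outer s (f ` A) = ennreal (c ^ s) * hausdorff_outer s A"
proof (rule antisym)
  show "hausdorff_outer s (f ` A) \<le> ennreal (c ^ s) * hausdorff_outer s A"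
    by (rule hausdorff_outer_similarity_le[OF c dist_f])
  have inj: "inj f"
    using c by (intro injI) (metis dist_eq_0_iff dist_f less_irrefl mult_eq_0_iff)
  have "dist (inv f x) (inv f y) = inverse c * dist x y" for x y
    using dist_f[of "inv f x" "inv f y"] c \<open>surj f\<close> by (simp add: surj_f_inv_f field_simps)
  then have "hausdorff_outer s (inv f ` (f ` A)) \<le> ennreal (inverse c ^ s) * hausdorff_outer s (f ` A)"
    using c by (intro hausdorff_outer_similarity_le) auto
  then have "ennreal (c ^ s) * hausdorff_outer s A \<le> ennreal (c ^ s) * (ennreal (inverse c ^ s) * hausdorff_outer s (f ` A))"
    using inj by (intro mult_left_mono) (auto simp: image_image)
  also have "\<dots> = hausdorff_outer s (f ` A)"
    using c by (simp add: mult.assoc[symmetric] ennreal_mult[symmetric] power_mult_distrib[symmetric])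
  finally show "ennreal (c ^ s) * hausdorff_outer s A \<le> hausdorff_outer s (f ` A)" .
qed

lemma reflection_invariant_hausdorff: "reflection_invariant (hausdorff_measure s)"
  unfolding reflection_invariant_def
proof (intro conjI allI ballI)
  fix w and A :: "'a set" assume A: "A \<in> sets borel"
  have eq: "reflection w -` A = reflection w ` A"
    by (auto simp: image_iff) (metis reflection_reflection)
  have "reflection w -` A \<in> sets borel"
    using measurable_sets[OF reflection_measurable A, of w] by simp
  moreover have "surj (reflection w)" by (metis reflection_reflection surjI)
  then have "hausdorff_outer s (reflection w ` A) = ennreal (1 ^ s) * hausdorff_outer s A"
    by (intro hausdorff_outer_similarity) auto
  ultimately show "emeasure (hausdorff_measure s) (reflection w -` A) = emeasure (hausdorff_measure s) A"
    using A by (simp add: emeasure_hausdorff_measure eq)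
qed simp

lemma distr_hausdorff_scaleR:
  assumes "0 < r"
  shows "distr (hausdorff_measure s) borel (\<lambda>x :: 'b::euclidean_space. r *\<^sub>R x) =
    density (hausdorff_measure s) (\<lambda>_. ennreal (inverse r ^ s))"
proof (rule measure_eqI)
  fix A assume "A \<in> sets (distr (hausdorff_measure s) borel (\<lambda>x :: 'b. r *\<^sub>R x))"
  then have A: "A \<in> sets borel" by simp
  have m: "(\<lambda>x :: 'b. r *\<^sub>R x) -` A \<in> sets borel"
    by (rule measurable_sets_borel[OF _ A]) measurable
  have "hausdorff_outer s ((\<lambda>x. inverse r *\<^sub>R x) ` A) = ennreal (inverse r ^ s) * hausdorff_outer s A"
  proof (rule hausdorff_outer_similarity)
    show "surj (\<lambda>x::'b. inverse r *\<^sub>R x)"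
      using assms by (intro surjI[of _ "\<lambda>x. r *\<^sub>R x"]) simp
  qed (use assms in \<open>auto simp: dist_norm simp flip: scaleR_diff_right\<close>)
  moreover have "(\<lambda>x. inverse r *\<^sub>R x) ` A = (\<lambda>x. r *\<^sub>R x) -` A"
    using assms by (force simp: image_iff)
  ultimately show "emeasure (distr (hausdorff_measure s) borel (\<lambda>x :: 'b. r *\<^sub>R x)) A =
      emeasure (density (hausdorff_measure s) (\<lambda>_. ennreal (inverse r ^ s))) A"
    using A m by (simp add: emeasure_distr emeasure_density_const emeasure_hausdorff_measure)
qed simp

section \<open>Polar coordinates in the half ball\<close>

text \<open>For \<open>\<Omega>\<close> the unit ball this is the surface measure of the unit sphere
  divided by the dimension. The origin is sent to 0, off the sphere, but carries no volume.\<close>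

definition cone_measure :: "'b::euclidean_space set \<Rightarrow> 'b measure" where
  "cone_measure \<Omega> = distr (restrict_space lborel \<Omega>) borel (\<lambda>x. x /\<^sub>R norm x)"

lemma normalize_measurable [measurable]:
  "(\<lambda>x :: 'b::euclidean_space. x /\<^sub>R norm x) \<in> borel_measurable borel"
  by measurable

lemma sets_cone_measure [simp, measurable_cong]: "sets (cone_measure \<Omega>) = sets borel"
  and space_cone_measure [simp]: "space (cone_measure \<Omega>) = UNIV"
  by (simp_all add: cone_measure_def)

lemma emeasure_cone_measure:
  assumes "\<Omega> \<in> sets borel" "A \<in> sets borel"
  shows "emeasure (cone_measure \<Omega>) A = emeasure lborel {x \<in> \<Omega>. x /\<^sub>R norm x \<in> A}"
proof -
  have m: "(\<lambda>x. x /\<^sub>R norm x) \<in> measurable (restrict_space lborel \<Omega>) borel"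
    by (rule measurable_restrict_space1) simp
  have "emeasure (cone_measure \<Omega>) A = emeasure (restrict_space lborel \<Omega>) ((\<lambda>x. x /\<^sub>R norm x) -` A \<inter> \<Omega>)"
    unfolding cone_measure_def using assms by (subst emeasure_distr[OF m]) (auto simp: space_restrict_space)
  also have "\<dots> = emeasure lborel ((\<lambda>x. x /\<^sub>R norm x) -` A \<inter> \<Omega>)"
    using assms by (intro emeasure_restrict_space) auto
  finally show ?thesis by (simp add: Collect_conj_eq vimage_def Int_commute)
qed

lemma integral_cone_measure:
  fixes g :: "'b::euclidean_space \<Rightarrow> real"
  assumes "\<Omega> \<in> sets borel" "g \<in> borel_measurable borel"
  shows "integral\<^sup>L (cone_measure \<Omega>) g = (LINT x:\<Omega>|lborel. g (x /\<^sub>R norm x))"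
  unfolding cone_measure_def set_lebesgue_integral_def
  using assms by (subst integral_distr) (auto simp: integral_restrict_space intro!: measurable_restrict_space1)

lemma finite_measure_cone_measure:
  assumes "\<Omega> \<in> sets borel" "bounded \<Omega>"
  shows "finite_measure (cone_measure \<Omega>)"
proof
  have "emeasure lborel \<Omega> < \<infinity>" using assms(2) by (rule emeasure_bounded_finite)
  then show "emeasure (cone_measure \<Omega>) (space (cone_measure \<Omega>)) \<noteq> \<infinity>"
    using assms by (simp add: emeasure_cone_measure)
qed

lemma AE_cone_measure:
  assumes "\<Omega> \<in> sets borel" and "{x. P x} \<in> sets borel" and "AE x in lborel. x \<in> \<Omega> \<longrightarrow> P (x /\<^sub>R norm x)"
  shows "AE x in cone_measure \<Omega>. P x"
  unfolding cone_measure_def using assms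
  by (subst AE_distr_iff) (auto simp: AE_restrict_space_iff intro!: measurable_restrict_space1)

lemma reflection_invariant_cone_measure_ball:
  "reflection_invariant (cone_measure (ball (0 :: 'b::euclidean_space) 1))"
  unfolding reflection_invariant_def
proof (intro conjI allI ballI)
  fix w and A :: "'b set" assume A: "A \<in> sets borel"
  let ?B = "{x \<in> ball 0 1. x /\<^sub>R norm x \<in> A}"
  have [measurable]: "reflection w -` A \<in> sets borel"
    by (rule measurable_sets_borel[OF reflection_measurable A])
  have B_eq: "?B = ball 0 1 \<inter> (\<lambda>x. x /\<^sub>R norm x) -` A" by auto
  have Bm: "?B \<in> sets borel"
    unfolding B_eq by (intro sets.Int measurable_sets_borel[OF normalize_measurable A]) auto
  have "emeasure lborel ?B = emeasure (distr lborel borel (reflection w)) ?B"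
    by (simp add: lborel_distr_reflection)
  also have "\<dots> = emeasure lborel (reflection w -` ?B)"
    using emeasure_distr[of "reflection w" lborel borel ?B] Bm by simp
  also have "reflection w -` ?B = {x \<in> ball 0 1. x /\<^sub>R norm x \<in> reflection w -` A}"
    by (auto simp: reflection_scaleR)
  finally show "emeasure (cone_measure (ball 0 1)) (reflection w -` A) = emeasure (cone_measure (ball 0 1)) A"
    using A by (simp add: emeasure_cone_measure)
qed simp

lemma half_ball_open: "open (half_ball r :: ('a::euclidean_space \<times> real) set)"
  unfolding half_ball_def by (intro open_Int open_ball open_Collect_less continuous_intros)

lemma half_ball_borel [measurable]: "half_ball r \<in> sets borel"
  by (intro borel_open half_ball_open)

definition hemi_measure :: "('a::euclidean_space \<times> real) measure" where
  "hemi_measure = cone_measure (half_ball 1)"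

lemma sets_hemi_measure [simp, measurable_cong]: "sets hemi_measure = sets borel"
  and space_hemi_measure [simp]: "space hemi_measure = UNIV"
  by (simp_all add: hemi_measure_def)

text \<open>The equator is included to make the set compact; \<open>hemi_measure\<close> gives it no
  mass.\<close>

definition hemi :: "('a::euclidean_space \<times> real) set" where
  "hemi = {x. norm x = 1 \<and> 0 \<le> snd x}"

text \<open>The distribution of the norm of a uniformly distributed point of the unit ball in
  dimension \<open>n\<close>. The factor \<open>n\<close> compensates the division by the dimension
  that is hidden in a cone measure.\<close>

definition radial_measure :: "nat \<Rightarrow> real measure" where
  "radial_measure n = density lborel (\<lambda>\<rho>. ennreal (real n * \<rho> ^ (n - 1)) * indicator {0<..<1} \<rho>)"

lemma sets_radial_measure [simp, measurable_cong]: "sets (radial_measure n) = sets borel"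
  by (simp add: radial_measure_def)

lemma emeasure_radial_measure:
  assumes "0 < n"
  shows "emeasure (radial_measure n) {..<a} = ennreal (max 0 (min 1 a) ^ n)"
proof -
  define b where "b = max 0 (min 1 a)"
  have b: "0 \<le> b" by (simp add: b_def)
  have ae: "AE \<rho> in lborel. (ennreal (real n * \<rho> ^ (n - 1)) * indicator {0<..<1} \<rho>) * indicator {..<a} \<rho>
      = ennreal (real n * \<rho> ^ (n - 1)) * indicator {0..b} \<rho>"
    using AE_lborel_singleton[of b] AE_lborel_singleton[of 0]
    by eventually_elim (auto simp: b_def max_def min_def split: split_indicator if_splits)
  have "emeasure (radial_measure n) {..<a} =
      (\<integral>\<^sup>+\<rho>. (ennreal (real n * \<rho> ^ (n - 1)) * indicator {0<..<1} \<rho>) * indicator {..<a} \<rho> \<partial>lborel)"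
    unfolding radial_measure_def by (rule emeasure_density) auto
  also have "\<dots> = (\<integral>\<^sup>+\<rho>. ennreal (real n * \<rho> ^ (n - 1)) * indicator {0..b} \<rho> \<partial>lborel)"
    by (rule nn_integral_cong_AE[OF ae])
  also have "\<dots> = ennreal (b ^ n - 0 ^ n)"
    using b by (intro nn_integral_FTC_Icc) (auto intro!: derivative_eq_intros)
  finally show ?thesis using assms by (simp add: b_def)
qed

lemma finite_measure_radial_measure: "0 < n \<Longrightarrow> finite_measure (radial_measure n)"
proof
  assume n: "0 < n"
  have "AE x in radial_measure n. x < 1"
    unfolding radial_measure_def by (subst AE_density) (auto split: split_indicator)
  then have "emeasure (radial_measure n) UNIV = emeasure (radial_measure n) {..<1}"
    by (intro emeasure_eq_AE) auto
  then show "emeasure (radial_measure n) (space (radial_measure n)) \<noteq> \<infinity>"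
    using emeasure_radial_measure[OF n, of 1] by (simp add: radial_measure_def)
qed

lemma emeasure_truncated_cone:
  assumes B: "B \<in> sets borel"
  shows "emeasure lborel {x \<in> half_ball 1 :: ('a::euclidean_space \<times> real) set. norm x < a \<and> x /\<^sub>R norm x \<in> B}
    = ennreal (max 0 (min 1 a) ^ (DIM('a) + 1)) * emeasure hemi_measure B"
proof (cases "0 < a")
  case False
  then have "{x \<in> half_ball 1 :: ('a \<times> real) set. norm x < a \<and> x /\<^sub>R norm x \<in> B} = {}"
    using norm_ge_zero less_le_trans by (fastforce simp: not_less)
  then show ?thesis using False by (simp only:) (simp add: max_def)
next
  case True
  define b where "b = min 1 a"
  have b: "0 < b" "b \<le> 1" using True by (auto simp: b_def)
  let ?C = "{x \<in> half_ball 1 :: ('a \<times> real) set. norm x < a \<and> x /\<^sub>R norm x \<in> B}"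
  have [measurable]: "?C \<in> sets borel" using B by measurable
  have pre: "(\<lambda>x. 0 + b *\<^sub>R x) -` ?C = {x \<in> half_ball 1. x /\<^sub>R norm x \<in> B}"
  proof -
    have "b * t < a \<and> b * t < 1 \<longleftrightarrow> t < 1" if "0 \<le> t" for t
      using b True that unfolding b_def min_def by (auto simp: field_simps split: if_splits) (smt (verit) mult_less_cancel_left2 mult_less_cancel_right2 mult_le_cancel_right1)+
    from this[OF norm_ge_zero]
    have "b *\<^sub>R x \<in> half_ball 1 \<and> norm (b *\<^sub>R x) < a \<longleftrightarrow> x \<in> half_ball 1" for x :: "'a \<times> real"
      using b by (simp add: half_ball_def zero_less_mult_iff) blast
    moreover have "b *\<^sub>R x /\<^sub>R norm (b *\<^sub>R x) = x /\<^sub>R norm x" for x :: "'a \<times> real"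
      using b by simp
    ultimately show ?thesis by (intro set_eqI) (simp only: vimage_eq mem_Collect_eq add_0, blast)
  qed
  have "emeasure lborel ?C = emeasure (density (distr lborel borel (\<lambda>x. 0 + b *\<^sub>R x)) (\<lambda>_. ennreal (\<bar>b\<bar> ^ DIM('a \<times> real)))) ?C"
    using lborel_affine[of b "0 :: 'a \<times> real"] b by simp
  also have "\<dots> = ennreal (b ^ (DIM('a) + 1)) * emeasure lborel ((\<lambda>x. 0 + b *\<^sub>R x) -` ?C)"
    using b by (subst emeasure_density_const, simp, subst emeasure_distr) auto
  also have "\<dots> = ennreal (b ^ (DIM('a) + 1)) * emeasure hemi_measure B"
    unfolding pre hemi_measure_def by (simp add: emeasure_cone_measure B)
  finally show ?thesis using b True by (simp add: b_def max_def)
qed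

lemma half_ball_bounded: "bounded (half_ball r)"
  unfolding half_ball_def by (intro bounded_Int) auto

lemma finite_measure_hemi_measure: "finite_measure hemi_measure"
  unfolding hemi_measure_def
  by (rule finite_measure_cone_measure) (auto simp: half_ball_bounded)

text \<open>Rectangles determine the product. For fixed \<open>B\<close> both sides are measures in
  \<open>A\<close>, and it is enough to compare them on the half-lines \<open>{..<a}\<close>, where
  the scaling of Lebesgue measure produces the power of the radius.\<close>

lemma polar_distr:
  "distr (restrict_space lborel (half_ball 1 :: ('a::euclidean_space \<times> real) set)) (borel \<Otimes>\<^sub>M borel) (\<lambda>x. (norm x, x /\<^sub>R norm x))
    = radial_measure (DIM('a) + 1) \<Otimes>\<^sub>M hemi_measure" (is "?D = ?K \<Otimes>\<^sub>M _")
proof (rule sym, rule pair_measure_eqI)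
  interpret K: finite_measure ?K by (rule finite_measure_radial_measure) simp
  interpret H: finite_measure "hemi_measure :: ('a \<times> real) measure" by (rule finite_measure_hemi_measure)
  show "sigma_finite_measure ?K" "sigma_finite_measure (hemi_measure :: ('a \<times> real) measure)" ..
  show "sets (?K \<Otimes>\<^sub>M hemi_measure) = sets ?D"
    by (simp cong: sets_pair_measure_cong)
  fix A and B :: "('a \<times> real) set" assume "A \<in> sets ?K" "B \<in> sets hemi_measure"
  then have A: "A \<in> sets borel" and B: "B \<in> sets borel" by auto
  have D: "emeasure ?D (A \<times> B) = emeasure lborel {x \<in> half_ball 1. norm x \<in> A \<and> x /\<^sub>R norm x \<in> B}"
    if "A \<in> sets borel" for A
  proof -
    have "emeasure ?D (A \<times> B) = emeasure (restrict_space lborel (half_ball 1)) {x \<in> half_ball 1. norm x \<in> A \<and> x /\<^sub>R norm x \<in> B}"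
      using that B by (subst emeasure_distr)
        (auto simp: space_restrict_space intro!: measurable_restrict_space1 arg_cong[where f="emeasure _"])
    then show ?thesis by (subst (asm) emeasure_restrict_space) auto
  qed
  let ?M = "density ?K (\<lambda>_. emeasure hemi_measure B)"
  let ?N = "distr (restrict_space lborel {x \<in> half_ball 1 :: ('a \<times> real) set. x /\<^sub>R norm x \<in> B}) borel norm"
  have Bm: "{x \<in> half_ball 1 :: ('a \<times> real) set. x /\<^sub>R norm x \<in> B} \<in> sets borel" using B by measurable
  have N: "emeasure ?N A = emeasure lborel {x \<in> half_ball 1. norm x \<in> A \<and> x /\<^sub>R norm x \<in> B}"
    if "A \<in> sets borel" for A
  proof -
    have "emeasure ?N A = emeasure (restrict_space lborel {x \<in> half_ball 1 :: ('a \<times> real) set. x /\<^sub>R norm x \<in> B}) {x \<in> half_ball 1. norm x \<in> A \<and> x /\<^sub>R norm x \<in> B}"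
      using that Bm by (subst emeasure_distr)
        (auto simp: space_restrict_space intro!: measurable_restrict_space1 arg_cong[where f="emeasure _"])
    then show ?thesis using Bm by (subst (asm) emeasure_restrict_space) auto
  qed
  have M: "emeasure ?M A = emeasure hemi_measure B * emeasure ?K A" if "A \<in> sets borel" for A
    using that by (subst emeasure_density_const) auto
  have "?M = ?N"
  proof (rule measure_eqI_generator_eq[where E="range lessThan" and \<Omega>=UNIV and A="\<lambda>i. {..<real i}"])
    have "{..<a} \<inter> {..<b} = {..<min a b}" for a b :: real by auto
    then show "Int_stable (range (lessThan :: real \<Rightarrow> _))"
      unfolding Int_stable_def by blast
    show "emeasure ?M X = emeasure ?N X" if X: "X \<in> range lessThan" for X
    proof -
      obtain a where X: "X = {..<a}" using X by auto
      have "emeasure ?M {..<a} = emeasure hemi_measure B * emeasure ?K {..<a}"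
        by (rule M) simp
      also have "\<dots> = ennreal (max 0 (min 1 a) ^ (DIM('a) + 1)) * emeasure hemi_measure B"
        by (subst emeasure_radial_measure) (auto simp: mult.commute)
      also have "\<dots> = emeasure ?N {..<a}"
        using N[of "{..<a}"] emeasure_truncated_cone[OF B, of a] by simp
      finally show ?thesis unfolding X .
    qed
    show "emeasure ?M {..<real i} \<noteq> \<infinity>" for i
      using K.emeasure_finite[of "{..<real i}"] H.emeasure_finite[of B]
      by (subst M) (auto simp: ennreal_mult_eq_top_iff)
  qed (use reals_Archimedean2 in \<open>auto simp: borel_Iio\<close>)
  then have "emeasure ?M A = emeasure ?N A" by simp
  then show "emeasure ?K A * emeasure hemi_measure B = emeasure ?D (A \<times> B)"
    using M[OF A] N[OF A] D[OF A] by (metis mult.commute)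
qed

section \<open>Integrals over the upper half sphere as functions of the radius\<close>

definition upper_ball :: "('a::euclidean_space \<times> real) set" where
  "upper_ball = half_ball 1 \<union> thin_ball 1"

lemma mem_upper_ball: "x \<in> upper_ball \<longleftrightarrow> norm x < 1 \<and> 0 \<le> snd x"
  by (auto simp: upper_ball_def half_ball_def thin_ball_def)

lemma half_ball_subset_upper_ball: "R \<le> 1 \<Longrightarrow> half_ball R \<subseteq> upper_ball"
  by (auto simp: mem_upper_ball half_ball_def)

lemma compact_hemi: "compact (hemi :: ('a::euclidean_space \<times> real) set)"
proof -
  have "hemi = sphere (0 :: 'a \<times> real) 1 \<inter> {x. 0 \<le> snd x}" by (auto simp: hemi_def)
  moreover have "closed {x :: 'a \<times> real. 0 \<le> snd x}" by (intro closed_Collect_le continuous_intros)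
  ultimately show ?thesis using compact_Int_closed[OF compact_sphere] by metis
qed

lemma hemi_borel [measurable]: "hemi \<in> sets borel"
  by (intro borel_closed compact_imp_closed compact_hemi)

lemma scaleR_hemi_upper_ball: "\<theta> \<in> hemi \<Longrightarrow> 0 \<le> \<rho> \<Longrightarrow> \<rho> < 1 \<Longrightarrow> \<rho> *\<^sub>R \<theta> \<in> upper_ball"
  by (auto simp: mem_upper_ball hemi_def)

lemma set_integrable_hemi:
  fixes h :: "'a::euclidean_space \<times> real \<Rightarrow> real"
  assumes h: "continuous_on hemi h"
  shows "set_integrable hemi_measure hemi h"
proof -
  interpret finite_measure "hemi_measure :: ('a \<times> real) measure" by (rule finite_measure_hemi_measure)
  have "compact (h ` hemi)" by (rule compact_continuous_image[OF h compact_hemi])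
  then obtain B where B: "\<And>x. x \<in> hemi \<Longrightarrow> norm (h x) \<le> B"
    using compact_imp_bounded bounded_iff by (metis image_eqI)
  have "(\<lambda>x. indicator hemi x *\<^sub>R h x) \<in> borel_measurable hemi_measure"
    using borel_measurable_continuous_on_indicator[OF hemi_borel h] by simp
  then show ?thesis
    unfolding set_integrable_def
    by (intro integrable_const_bound[where B="max B 0"] AE_I2)
      (auto simp: indicator_def max_def dest!: B split: if_splits)
qed

lemma set_integral_hemi_diff_le:
  fixes h k :: "'a::euclidean_space \<times> real \<Rightarrow> real"
  assumes h: "continuous_on hemi h" and k: "continuous_on hemi k"
    and le: "\<And>\<theta>. \<theta> \<in> hemi \<Longrightarrow> \<bar>h \<theta> - k \<theta>\<bar> \<le> e"
  shows "\<bar>(LINT \<theta>:hemi|hemi_measure. h \<theta>) - (LINT \<theta>:hemi|hemi_measure. k \<theta>)\<bar>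
    \<le> e * measure (hemi_measure :: ('a \<times> real) measure) hemi"
proof -
  interpret finite_measure "hemi_measure :: ('a \<times> real) measure" by (rule finite_measure_hemi_measure)
  note ih = set_integrable_hemi[OF h] and ik = set_integrable_hemi[OF k]
  have ic: "set_integrable hemi_measure (hemi :: ('a \<times> real) set) (\<lambda>_. e)" by (intro set_integrable_hemi continuous_intros)
  have "\<bar>(LINT \<theta>:hemi|hemi_measure. h \<theta>) - (LINT \<theta>:hemi|hemi_measure. k \<theta>)\<bar> = \<bar>LINT \<theta>:hemi|hemi_measure. h \<theta> - k \<theta>\<bar>"
    by (subst set_integral_diff(2)[OF ih ik]) simp
  also have "\<dots> \<le> (LINT \<theta>:hemi|hemi_measure. \<bar>h \<theta> - k \<theta>\<bar>)"
    using set_integral_norm_bound[OF set_integral_diff(1)[OF ih ik]] by simp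
  also have "\<dots> \<le> (LINT \<theta>:(hemi :: ('a \<times> real) set)|hemi_measure. e)"
    using set_integrable_abs[OF set_integral_diff(1)[OF ih ik]] ic le by (rule set_integral_mono)
  also have "\<dots> = e * measure (hemi_measure :: ('a \<times> real) measure) hemi"
    by (subst set_integral_const) (auto simp: mult.commute)
  finally show ?thesis .
qed

text \<open>The mean value theorem turns a difference quotient into \<open>f'\<close> at an
  intermediate time, and \<open>f'\<close> is uniformly continuous on a compact time interval times
  \<open>hemi\<close>. So the quotients converge uniformly on \<open>hemi\<close>.\<close>

lemma has_real_derivative_hemi_integral:
  fixes f f' :: "real \<Rightarrow> 'a::euclidean_space \<times> real \<Rightarrow> real"
  assumes t: "t \<in> {a<..<b}"
    and der: "\<And>t \<theta>. t \<in> {a<..<b} \<Longrightarrow> \<theta> \<in> hemi \<Longrightarrow> ((\<lambda>t. f t \<theta>) has_real_derivative f' t \<theta>) (at t)"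
    and cf: "\<And>t. t \<in> {a<..<b} \<Longrightarrow> continuous_on hemi (f t)"
    and cf': "continuous_on ({a<..<b} \<times> hemi) (\<lambda>(t, \<theta>). f' t \<theta>)"
  shows "((\<lambda>t. LINT \<theta>:hemi|hemi_measure. f t \<theta>) has_real_derivative
    (LINT \<theta>:hemi|hemi_measure. f' t \<theta>)) (at t)"
proof -
  let ?I = "\<lambda>h :: 'a \<times> real \<Rightarrow> real. LINT \<theta>:hemi|hemi_measure. h \<theta>"
  let ?m = "measure (hemi_measure :: ('a \<times> real) measure) hemi"
  obtain \<eta> where \<eta>: "0 < \<eta>" "cball t \<eta> \<subseteq> {a<..<b}"
    using t open_contains_cball[of "{a<..<b}"] open_greaterThanLessThan by metis
  have "compact (cball t \<eta> \<times> (hemi :: ('a \<times> real) set))" by (intro compact_Times compact_hemi) auto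
  then have uc: "uniformly_continuous_on (cball t \<eta> \<times> hemi) (\<lambda>(t, \<theta>). f' t \<theta>)"
    by (rule compact_uniformly_continuous[rotated]) (rule continuous_on_subset[OF cf'], use \<eta> in auto)
  have cf't: "continuous_on hemi (f' t)"
  proof -
    have "continuous_on hemi (\<lambda>\<theta> :: 'a \<times> real. (t, \<theta>))"
      by (intro continuous_on_Pair continuous_on_const continuous_on_id)
    moreover have "(\<lambda>\<theta>. (t, \<theta>)) ` hemi \<subseteq> {a<..<b} \<times> (hemi :: ('a \<times> real) set)"
      using t by (intro image_subsetI) simp
    ultimately have "continuous_on hemi (\<lambda>\<theta>. case (t, \<theta>) of (t, \<theta>) \<Rightarrow> f' t \<theta>)"
      by (rule continuous_on_compose2[OF cf'])
    then show ?thesis by simp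
  qed
  show ?thesis
    unfolding has_field_derivative_iff LIM_eq
  proof (intro allI impI)
    fix e :: real assume "0 < e"
    define e' where "e' = e / (?m + 1)"
    have "0 < e'" using \<open>0 < e\<close> by (simp add: e'_def add_nonneg_pos)
    obtain \<delta> where \<delta>: "0 < \<delta>" "\<And>x y. x \<in> cball t \<eta> \<times> hemi \<Longrightarrow> y \<in> cball t \<eta> \<times> hemi \<Longrightarrow>
        dist y x < \<delta> \<Longrightarrow> dist (case y of (t, \<theta>) \<Rightarrow> f' t \<theta>) (case x of (t, \<theta>) \<Rightarrow> f' t \<theta>) < e'"
      using uc \<open>0 < e'\<close> unfolding uniformly_continuous_on_def by metis
    have "norm ((?I (f s) - ?I (f t)) / (s - t) - ?I (f' t)) < e" if s: "s \<noteq> t" "norm (s - t) < min \<delta> \<eta>" for s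
    proof -
      have sI: "s \<in> {a<..<b}" using s \<eta>(2) by (auto simp: dist_real_def subset_iff abs_minus_commute)
      have q: "\<bar>(f s \<theta> - f t \<theta>) / (s - t) - f' t \<theta>\<bar> \<le> e'" if \<theta>: "\<theta> \<in> hemi" for \<theta>
      proof -
        have seg: "\<And>x. min s t \<le> x \<Longrightarrow> x \<le> max s t \<Longrightarrow> x \<in> {a<..<b}" using sI t by auto
        have "\<exists>\<xi>. min s t < \<xi> \<and> \<xi> < max s t \<and>
            f (max s t) \<theta> - f (min s t) \<theta> = (max s t - min s t) * f' \<xi> \<theta>"
          using s(1) by (intro MVT2 der[OF seg \<theta>]) auto
        then obtain \<xi> where \<xi>: "min s t < \<xi>" "\<xi> < max s t"
          and eq: "f (max s t) \<theta> - f (min s t) \<theta> = (max s t - min s t) * f' \<xi> \<theta>" by auto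
        have "(f s \<theta> - f t \<theta>) / (s - t) = f' \<xi> \<theta>"
          using eq s(1) by (auto simp: max_def min_def field_simps split: if_splits)
        moreover have "dist (f' \<xi> \<theta>) (f' t \<theta>) < e'"
          using \<delta>(2)[of "(t, \<theta>)" "(\<xi>, \<theta>)"] \<xi> s \<theta> \<eta>(1) by (auto simp: dist_real_def dist_Pair_Pair max_def min_def split: if_splits)
        ultimately show ?thesis by (simp add: dist_real_def)
      qed
      have "(?I (f s) - ?I (f t)) / (s - t) = ?I (\<lambda>\<theta>. (f s \<theta> - f t \<theta>) / (s - t))"
        using set_integrable_hemi[OF cf[OF sI]] set_integrable_hemi[OF cf[OF t]]
        by (simp add: set_integral_diff)
      also have "\<bar>\<dots> - ?I (f' t)\<bar> \<le> e' * ?m"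
        using s(1) by (intro set_integral_hemi_diff_le cf't q continuous_intros cf sI t) auto
      also have "\<dots> < e"
        using \<open>0 < e\<close> unfolding e'_def by (simp add: pos_divide_less_eq add_nonneg_pos)
      finally show ?thesis by simp
    qed
    then show "\<exists>\<delta>>0. \<forall>s. s \<noteq> t \<and> norm (s - t) < \<delta> \<longrightarrow> norm ((?I (f s) - ?I (f t)) / (s - t) - ?I (f' t)) < e"
      using \<delta>(1) \<eta>(1) by (intro exI[of _ "min \<delta> \<eta>"]) auto
  qed
qed

text \<open>The factor makes \<open>\<rho> ^ DIM('a) * hemi_int g \<rho>\<close> the integral of \<open>g\<close> over the upper half of the
  sphere of radius \<open>\<rho>\<close> with respect to the surface measure (see \<open>polar_half_ball\<close>).\<close>

definition hemi_int :: "('a::euclidean_space \<times> real \<Rightarrow> real) \<Rightarrow> real \<Rightarrow> real" where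
  "hemi_int g \<rho> = real (DIM('a) + 1) * (LINT \<theta>:hemi|hemi_measure. g (\<rho> *\<^sub>R \<theta>))"

lemma continuous_on_scaled_hemi:
  assumes "continuous_on upper_ball g" "0 \<le> \<rho>" "\<rho> < 1"
  shows "continuous_on hemi (\<lambda>\<theta>. g (\<rho> *\<^sub>R \<theta>) :: real)"
  by (rule continuous_on_compose2[OF assms(1)])
    (intro continuous_intros, intro image_subsetI scaleR_hemi_upper_ball assms)

lemma hemi_int_add:
  assumes "continuous_on upper_ball g" "continuous_on upper_ball h" "0 \<le> \<rho>" "\<rho> < 1"
  shows "hemi_int (\<lambda>x. g x + h x) \<rho> = hemi_int g \<rho> + hemi_int h \<rho>"
  unfolding hemi_int_def using assms
  by (subst set_integral_add) (auto intro!: set_integrable_hemi continuous_on_scaled_hemi simp: algebra_simps)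

lemma hemi_int_diff:
  assumes "continuous_on upper_ball g" "continuous_on upper_ball h" "0 \<le> \<rho>" "\<rho> < 1"
  shows "hemi_int (\<lambda>x. g x - h x) \<rho> = hemi_int g \<rho> - hemi_int h \<rho>"
  unfolding hemi_int_def using assms
  by (subst set_integral_diff) (auto intro!: set_integrable_hemi continuous_on_scaled_hemi simp: algebra_simps)

lemma hemi_int_cmult: "hemi_int (\<lambda>x. c * g x) \<rho> = c * hemi_int g \<rho>"
  unfolding hemi_int_def by simp

lemma hemi_int_mono:
  assumes "continuous_on upper_ball g" "continuous_on upper_ball h" "0 \<le> \<rho>" "\<rho> < 1"
    and "\<And>x. x \<in> upper_ball \<Longrightarrow> norm x = \<rho> \<Longrightarrow> g x \<le> h x"
  shows "hemi_int g \<rho> \<le> hemi_int h \<rho>"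
  unfolding hemi_int_def using assms(3,4)
  by (intro mult_left_mono set_integral_mono set_integrable_hemi continuous_on_scaled_hemi assms scaleR_hemi_upper_ball)
    (auto simp: hemi_def)

lemma hemi_int_nonneg:
  assumes "\<And>x. x \<in> upper_ball \<Longrightarrow> norm x = \<rho> \<Longrightarrow> 0 \<le> g x" "0 \<le> \<rho>" "\<rho> < 1"
  shows "0 \<le> hemi_int g \<rho>"
  unfolding hemi_int_def set_lebesgue_integral_def using assms
  by (intro mult_nonneg_nonneg integral_nonneg) (auto simp: hemi_def mem_upper_ball split: split_indicator)

lemma hemi_int_cong:
  assumes "\<And>x. x \<in> upper_ball \<Longrightarrow> norm x = \<rho> \<Longrightarrow> g x = h x" "0 \<le> \<rho>" "\<rho> < 1"
  shows "hemi_int g \<rho> = hemi_int h \<rho>"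
  unfolding hemi_int_def set_lebesgue_integral_def using assms
  by (intro arg_cong2[where f="(*)"] Bochner_Integration.integral_cong) (auto simp: hemi_def mem_upper_ball split: split_indicator)

lemma continuous_on_hemi_int:
  fixes g :: "'a::euclidean_space \<times> real \<Rightarrow> real"
  assumes g: "continuous_on upper_ball g" and "R < 1"
  shows "continuous_on {0..R} (hemi_int g)"
proof -
  let ?m = "measure (hemi_measure :: ('a \<times> real) measure) hemi"
  have "compact ({0..R} \<times> (hemi :: ('a \<times> real) set))" by (intro compact_Times compact_hemi) auto
  moreover have "continuous_on ({0..R} \<times> hemi) (\<lambda>(\<rho>, \<theta>). g (\<rho> *\<^sub>R \<theta>))"
    unfolding case_prod_beta
    by (rule continuous_on_compose2[OF g])
      (intro continuous_intros, intro image_subsetI scaleR_hemi_upper_ball, use \<open>R < 1\<close> in auto)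
  ultimately have uc: "uniformly_continuous_on ({0..R} \<times> hemi) (\<lambda>(\<rho>, \<theta>). g (\<rho> *\<^sub>R \<theta>))"
    by (rule compact_uniformly_continuous[rotated])
  have "continuous_on {0..R} (\<lambda>\<rho>. LINT \<theta>:hemi|hemi_measure. g (\<rho> *\<^sub>R \<theta>))"
    unfolding continuous_on_iff
  proof (intro ballI allI impI)
    fix t e :: real assume t: "t \<in> {0..R}" and "0 < e"
    define e' where "e' = e / (?m + 1)"
    have "0 < e'" using \<open>0 < e\<close> by (simp add: e'_def add_nonneg_pos)
    obtain \<delta> where \<delta>: "0 < \<delta>" "\<And>x y. x \<in> {0..R} \<times> hemi \<Longrightarrow> y \<in> {0..R} \<times> hemi \<Longrightarrow>
        dist y x < \<delta> \<Longrightarrow> dist (case y of (\<rho>, \<theta>) \<Rightarrow> g (\<rho> *\<^sub>R \<theta>)) (case x of (\<rho>, \<theta>) \<Rightarrow> g (\<rho> *\<^sub>R \<theta>)) < e'"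
      using uc \<open>0 < e'\<close> unfolding uniformly_continuous_on_def by metis
    have "dist (LINT \<theta>:hemi|hemi_measure. g (s *\<^sub>R \<theta>)) (LINT \<theta>:hemi|hemi_measure. g (t *\<^sub>R \<theta>)) < e"
      if s: "s \<in> {0..R}" "dist s t < \<delta>" for s
    proof -
      have "\<bar>g (s *\<^sub>R \<theta>) - g (t *\<^sub>R \<theta>)\<bar> \<le> e'" if "\<theta> \<in> hemi" for \<theta>
        using \<delta>(2)[of "(t, \<theta>)" "(s, \<theta>)"] s t that by (simp add: dist_Pair_Pair dist_real_def)
      then have "\<bar>(LINT \<theta>:hemi|hemi_measure. g (s *\<^sub>R \<theta>)) - (LINT \<theta>:hemi|hemi_measure. g (t *\<^sub>R \<theta>))\<bar> \<le> e' * ?m"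
        using s t \<open>R < 1\<close> by (intro set_integral_hemi_diff_le continuous_on_scaled_hemi[OF g]) auto
      also have "\<dots> < e"
        using \<open>0 < e\<close> unfolding e'_def by (simp add: pos_divide_less_eq add_nonneg_pos)
      finally show ?thesis by (simp add: dist_real_def)
    qed
    then show "\<exists>d>0. \<forall>s\<in>{0..R}. dist s t < d \<longrightarrow>
        dist (LINT \<theta>:hemi|hemi_measure. g (s *\<^sub>R \<theta>)) (LINT \<theta>:hemi|hemi_measure. g (t *\<^sub>R \<theta>)) < e"
      using \<delta>(1) by blast
  qed
  then show ?thesis unfolding hemi_int_def[abs_def] by (intro continuous_intros)
qed

text \<open>\<open>g'\<close> plays the role of \<open>x \<bullet> \<nabla> g\<close>, the radial
  derivative multiplied by the radius, which stays continuous up to the origin. Hence the divisions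
  by \<open>t\<close> and \<open>r\<close>.\<close>

lemma has_real_derivative_hemi_int:
  assumes r: "0 < r" "r < 1" and g: "continuous_on upper_ball g" and g': "continuous_on upper_ball g'"
    and der: "\<And>t x. x \<in> hemi \<Longrightarrow> 0 < t \<Longrightarrow> t < 1 \<Longrightarrow>
      ((\<lambda>t. g (t *\<^sub>R x)) has_real_derivative g' (t *\<^sub>R x) / t) (at t)"
  shows "(hemi_int g has_real_derivative hemi_int g' r / r) (at r)"
proof -
  have "((\<lambda>t. LINT \<theta>:hemi|hemi_measure. g (t *\<^sub>R \<theta>)) has_real_derivative
      (LINT \<theta>:hemi|hemi_measure. g' (r *\<^sub>R \<theta>) / r)) (at r)"
  proof (rule has_real_derivative_hemi_integral[where a=0 and b=1])
    show "continuous_on ({0<..<1} \<times> hemi) (\<lambda>(t, \<theta>). g' (t *\<^sub>R \<theta>) / t)"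
      unfolding case_prod_beta
      by (intro continuous_on_divide continuous_on_compose2[OF g'] continuous_intros image_subsetI scaleR_hemi_upper_ball) auto
  qed (use r der in \<open>auto intro!: continuous_on_scaled_hemi g\<close>)
  from DERIV_cmult[OF this, of "real (DIM('a) + 1)"] show ?thesis
    unfolding hemi_int_def[abs_def] by simp
qed


lemma AE_hemi_measure: "AE \<theta> in hemi_measure. norm \<theta> = 1 \<and> 0 < snd (\<theta> :: 'a::euclidean_space \<times> real)"
  unfolding hemi_measure_def
proof (rule AE_cone_measure)
  show "{\<theta> :: 'a \<times> real. norm \<theta> = 1 \<and> 0 < snd \<theta>} \<in> sets borel"
  proof -
    have "{\<theta> :: 'a \<times> real. norm \<theta> = 1 \<and> 0 < snd \<theta>} = sphere 0 1 \<inter> {\<theta>. 0 < snd \<theta>}" by auto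
    moreover have "open {\<theta> :: 'a \<times> real. 0 < snd \<theta>}" by (intro open_Collect_less continuous_intros)
    ultimately show ?thesis by (metis borel_closed borel_open closed_sphere sets.Int)
  qed
  have "norm (x /\<^sub>R norm x) = 1 \<and> 0 < snd (x /\<^sub>R norm x)" if "x \<in> half_ball 1" for x :: "'a \<times> real"
  proof -
    have "x \<noteq> 0" using that by (auto simp: half_ball_def)
    then show ?thesis using that by (simp add: half_ball_def)
  qed
  then show "AE x in lborel. x \<in> half_ball 1 \<longrightarrow> norm (x /\<^sub>R norm x) = 1 \<and> 0 < snd (x /\<^sub>R norm x :: 'a \<times> real)"
    by (intro AE_I2) blast
qed simp

lemma compact_truncated_upper_ball: "compact {x :: 'a::euclidean_space \<times> real. norm x \<le> R \<and> 0 \<le> snd x}"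
proof -
  have "{x :: 'a \<times> real. norm x \<le> R \<and> 0 \<le> snd x} = cball 0 R \<inter> {x. 0 \<le> snd x}" by auto
  moreover have "closed {x :: 'a \<times> real. 0 \<le> snd x}" by (intro closed_Collect_le continuous_intros)
  ultimately show ?thesis using compact_Int_closed[OF compact_cball] by metis
qed

lemma continuous_on_upper_ball_bounded:
  assumes g: "continuous_on upper_ball (g :: 'a::euclidean_space \<times> real \<Rightarrow> 'b::real_normed_vector)" and "R < 1"
  obtains B where "0 \<le> B" "\<And>x. norm x \<le> R \<Longrightarrow> 0 \<le> snd x \<Longrightarrow> norm (g x) \<le> B"
proof -
  let ?K = "{x :: 'a \<times> real. norm x \<le> R \<and> 0 \<le> snd x}"
  have "continuous_on ?K g"
    by (rule continuous_on_subset[OF g]) (use \<open>R < 1\<close> in \<open>auto simp: mem_upper_ball\<close>)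
  then have "bounded (g ` ?K)"
    using compact_truncated_upper_ball by (intro compact_imp_bounded compact_continuous_image)
  then obtain B where "\<And>x. x \<in> ?K \<Longrightarrow> norm (g x) \<le> B" unfolding bounded_iff by blast
  then show thesis by (intro that[of "max B 0"]) (auto simp: le_max_iff_disj)
qed

lemma borel_measurable_half_ball_indicator:
  fixes g :: "'a::euclidean_space \<times> real \<Rightarrow> real"
  assumes g: "continuous_on upper_ball g" and "R \<le> 1"
  shows "(\<lambda>x. indicator (half_ball R) x *\<^sub>R g x) \<in> borel_measurable borel"
  by (intro borel_measurable_continuous_on_indicator continuous_on_subset[OF g] half_ball_subset_upper_ball \<open>R \<le> 1\<close>) simp

lemma set_integrable_half_ball:
  fixes g :: "'a::euclidean_space \<times> real \<Rightarrow> real"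
  assumes g: "continuous_on upper_ball g" and "R < 1"
  shows "set_integrable lborel (half_ball R) g"
proof -
  obtain B where B: "0 \<le> B" "\<And>x. norm x \<le> R \<Longrightarrow> 0 \<le> snd x \<Longrightarrow> norm (g x) \<le> B"
    using continuous_on_upper_ball_bounded[OF g \<open>R < 1\<close>] by blast
  have "emeasure lborel (half_ball R :: ('a \<times> real) set) < \<infinity>"
    by (rule emeasure_bounded_finite[OF half_ball_bounded])
  then have "set_integrable lborel (half_ball R :: ('a \<times> real) set) (\<lambda>_. B)"
    unfolding set_integrable_def by (intro integrable_scaleR_left integrable_real_indicator) auto
  then show ?thesis
  proof (rule set_integrable_bound)
    show "set_borel_measurable lborel (half_ball R) g"
      using borel_measurable_half_ball_indicator[OF g, of R] \<open>R < 1\<close> by (simp add: set_borel_measurable_def)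
    show "AE x in lborel. x \<in> half_ball R \<longrightarrow> norm (g x) \<le> norm B"
      using B by (intro AE_I2) (auto simp: half_ball_def)
  qed
qed

lemma polar_half_ball:
  fixes g :: "'a::euclidean_space \<times> real \<Rightarrow> real"
  assumes g: "continuous_on upper_ball g" and R: "0 < R" "R < 1"
  shows "(LINT x:half_ball R|lborel. g x) = integral {0..R} (\<lambda>\<rho>. \<rho> ^ DIM('a) * hemi_int g \<rho>)"
proof -
  let ?K = "radial_measure (DIM('a) + 1)"
  let ?M = "hemi_measure :: ('a \<times> real) measure"
  interpret K: finite_measure ?K by (rule finite_measure_radial_measure) simp
  interpret H: finite_measure ?M by (rule finite_measure_hemi_measure)
  interpret P: pair_sigma_finite ?K ?M ..
  interpret PF: finite_measure "?K \<Otimes>\<^sub>M ?M"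
    by (intro finite_measure_pair_measure K.finite_measure_axioms H.finite_measure_axioms)
  define h where "h x = indicator (half_ball R) x *\<^sub>R g x" for x
  have hm [measurable]: "h \<in> borel_measurable borel"
    unfolding h_def[abs_def] using R by (intro borel_measurable_half_ball_indicator g) auto
  obtain B where B: "0 \<le> B" "\<And>x. norm x \<le> R \<Longrightarrow> 0 \<le> snd x \<Longrightarrow> norm (g x) \<le> B"
    using continuous_on_upper_ball_bounded[OF g \<open>R < 1\<close>] by blast
  have hB: "norm (h x) \<le> B" for x
    using B by (auto simp: h_def half_ball_def split: split_indicator)
  have pm: "(\<lambda>x :: 'a \<times> real. (norm x, x /\<^sub>R norm x)) \<in> measurable (restrict_space lborel (half_ball 1)) (borel \<Otimes>\<^sub>M borel)"
    by (rule measurable_restrict_space1) measurable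
  have "(LINT x:half_ball R|lborel. g x) = (LINT x|lborel. indicator (half_ball 1) x *\<^sub>R h x)"
    unfolding set_lebesgue_integral_def h_def using R
    by (intro Bochner_Integration.integral_cong) (auto simp: half_ball_def split: split_indicator)
  also have "\<dots> = (LINT x|restrict_space lborel (half_ball 1). h x)"
    by (rule integral_restrict_space[symmetric]) auto
  also have "\<dots> = (LINT x|restrict_space lborel (half_ball 1). (\<lambda>(\<rho>, \<theta>). h (\<rho> *\<^sub>R \<theta>)) (norm x, x /\<^sub>R norm x))"
  proof -
    have "norm x *\<^sub>R (x /\<^sub>R norm x) = x" for x :: "'a \<times> real" by (cases "x = 0") simp_all
    then show ?thesis by (simp only: prod.case)
  qed
  also have "\<dots> = (LINT z|distr (restrict_space lborel (half_ball 1)) (borel \<Otimes>\<^sub>M borel) (\<lambda>x. (norm x, x /\<^sub>R norm x)). (\<lambda>(\<rho>, \<theta>). h (\<rho> *\<^sub>R \<theta>)) z)"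
    by (rule integral_distr[OF pm, symmetric]) measurable
  also have "\<dots> = (LINT z|(?K \<Otimes>\<^sub>M ?M). (\<lambda>(\<rho>, \<theta>). h (\<rho> *\<^sub>R \<theta>)) z)"
    by (simp only: polar_distr)
  also have "\<dots> = (LINT \<rho>|?K. LINT \<theta>|?M. h (\<rho> *\<^sub>R \<theta>))"
  proof -
    have "integrable (?K \<Otimes>\<^sub>M ?M) (\<lambda>(\<rho>, \<theta>). h (\<rho> *\<^sub>R \<theta>))"
      using hB by (intro PF.integrable_const_bound[where B=B] AE_I2) (auto simp: case_prod_beta)
    from P.integral_fst'[OF this] show ?thesis by simp
  qed
  also have "\<dots> = (LINT \<rho>|lborel. (real (DIM('a) + 1) * \<rho> ^ DIM('a) * indicator {0<..<1} \<rho>) *\<^sub>R (LINT \<theta>|?M. h (\<rho> *\<^sub>R \<theta>)))"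
  proof -
    have "?K = density lborel (\<lambda>\<rho>. ennreal (real (DIM('a) + 1) * \<rho> ^ DIM('a) * indicator {0<..<1} \<rho>))"
      unfolding radial_measure_def by (intro density_cong) (auto split: split_indicator)
    then show ?thesis
      by (simp only:) (rule integral_density, auto split: split_indicator)
  qed
  also have "\<dots> = (LINT \<rho>:{0..R}|lborel. \<rho> ^ DIM('a) * hemi_int g \<rho>)"
    unfolding set_lebesgue_integral_def
  proof (rule integral_cong_AE)
    have inner: "(LINT \<theta>|?M. h (\<rho> *\<^sub>R \<theta>)) = (LINT \<theta>:hemi|?M. g (\<rho> *\<^sub>R \<theta>))" if "0 < \<rho>" "\<rho> < R" for \<rho>
      unfolding set_lebesgue_integral_def
    proof (rule integral_cong_AE)
      show "(\<lambda>\<theta>. indicator hemi \<theta> *\<^sub>R g (\<rho> *\<^sub>R \<theta>)) \<in> borel_measurable ?M"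
        using borel_measurable_continuous_on_indicator[OF hemi_borel continuous_on_scaled_hemi[OF g, of \<rho>]] that R by simp
      show "AE \<theta> in ?M. h (\<rho> *\<^sub>R \<theta>) = indicator hemi \<theta> *\<^sub>R g (\<rho> *\<^sub>R \<theta>)"
        using AE_hemi_measure by eventually_elim (use that in \<open>auto simp: h_def half_ball_def hemi_def\<close>)
    qed measurable
    have zero: "(LINT \<theta>|?M. h (\<rho> *\<^sub>R \<theta>)) = 0" if "R < \<rho>" for \<rho>
    proof (rule integral_eq_zero_AE)
      show "AE \<theta> in ?M. h (\<rho> *\<^sub>R \<theta>) = 0"
        using AE_hemi_measure by eventually_elim (use that R in \<open>auto simp: h_def half_ball_def\<close>)
    qed
    show "AE \<rho> in lborel. (real (DIM('a) + 1) * \<rho> ^ DIM('a) * indicator {0<..<1} \<rho>) *\<^sub>R (LINT \<theta>|?M. h (\<rho> *\<^sub>R \<theta>))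
        = indicator {0..R} \<rho> *\<^sub>R (\<rho> ^ DIM('a) * hemi_int g \<rho>)"
      using AE_lborel_singleton[of R] AE_lborel_singleton[of "0::real"]
    proof eventually_elim
      case (elim \<rho>)
      then consider "\<rho> < 0" | "0 < \<rho>" "\<rho> < R" | "R < \<rho>" by linarith
      then show ?case
      proof cases
        case 2
        then show ?thesis using inner[OF 2] R by (simp add: hemi_int_def)
      qed (use R zero in auto)
    qed
    show "(\<lambda>\<rho>. indicator {0..R} \<rho> *\<^sub>R (\<rho> ^ DIM('a) * hemi_int g \<rho>)) \<in> borel_measurable lborel"
    proof -
      have "continuous_on {0..R} (\<lambda>\<rho>. \<rho> ^ DIM('a) * hemi_int g \<rho>)"
        by (intro continuous_intros continuous_on_hemi_int[OF g R(2)])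
      from borel_measurable_continuous_on_indicator[OF _ this] show ?thesis by simp
    qed
  qed measurable
  also have "\<dots> = integral {0..R} (\<lambda>\<rho>. \<rho> ^ DIM('a) * hemi_int g \<rho>)"
    using continuous_on_hemi_int[OF g R(2)]
    by (intro set_borel_integral_eq_integral(2) borel_integrable_atLeastAtMost' continuous_intros)
  finally show ?thesis .
qed

section \<open>From full spheres with Hausdorff measure to half spheres\<close>

definition even_in :: "('a::euclidean_space \<times> real \<Rightarrow> real) \<Rightarrow> bool" where
  "even_in g \<longleftrightarrow> (\<forall>x' t. (x', t) \<in> ball 0 1 \<longrightarrow> g (x', - t) = g (x', t))"

definition fold_up :: "'a::euclidean_space \<times> real \<Rightarrow> 'a \<times> real" where
  "fold_up x = (fst x, \<bar>snd x\<bar>)"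

lemma norm_fold_up [simp]: "norm (fold_up x) = norm x"
  by (simp add: fold_up_def norm_prod_def)

lemma even_in_fold_up: "even_in g \<Longrightarrow> norm x < 1 \<Longrightarrow> g (fold_up x) = g x"
  by (cases x) (auto simp: even_in_def fold_up_def abs_if)

lemma reflection_vertical: "reflection (0, 1) (x', t :: real) = (x', - t)"
  by (simp add: reflection_def inner_Pair)

lemma continuous_on_fold_up: "continuous_on A fold_up"
  unfolding fold_up_def[abs_def] by (intro continuous_intros)

text \<open>The vertical reflection exchanges the two half balls and preserves both Lebesgue measure
  and \<open>g\<close>; the hyperplane between them is null.\<close>

lemma integral_cone_measure_ball_even:
  fixes g :: "'a::euclidean_space \<times> real \<Rightarrow> real"
  assumes g: "continuous_on (sphere 0 1) g" and ev: "\<And>x' t. norm (x', t) = 1 \<Longrightarrow> g (x', - t) = g (x', t)"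
  shows "(LINT x:sphere 0 1|cone_measure (ball 0 1). g x) = 2 * (LINT x:hemi|hemi_measure. g x)"
proof -
  define h where "h x = indicator (sphere 0 1) x *\<^sub>R g x" for x
  have hm [measurable]: "h \<in> borel_measurable borel"
    unfolding h_def[abs_def] by (intro borel_measurable_continuous_on_indicator g) auto
  have "compact (g ` sphere 0 1)" by (intro compact_continuous_image g) simp
  then obtain B where B: "\<And>x. x \<in> sphere 0 1 \<Longrightarrow> norm (g x) \<le> B"
    using compact_imp_bounded bounded_iff by (metis image_eqI)
  define k where "k x = h (x /\<^sub>R norm x)" for x
  have km [measurable]: "k \<in> borel_measurable borel" unfolding k_def[abs_def] by measurable
  have kB: "norm (k x) \<le> max B 0" for x
    using B by (auto simp: k_def h_def le_max_iff_disj split: split_indicator)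
  have mk: "(\<lambda>x. indicator \<Omega> x *\<^sub>R k x) \<in> borel_measurable lborel" if "\<Omega> \<in> sets borel" for \<Omega>
    using that by (intro borel_measurable_scaleR borel_measurable_indicator) simp_all
  have int: "set_integrable lborel \<Omega> k" if "\<Omega> \<in> sets borel" "bounded \<Omega>" for \<Omega>
  proof (rule set_integrable_bound)
    have "emeasure lborel \<Omega> < \<infinity>" using that(2) by (rule emeasure_bounded_finite)
    then show "set_integrable lborel \<Omega> (\<lambda>_. max B 0)"
      unfolding set_integrable_def using that by (intro integrable_scaleR_left integrable_real_indicator) auto
    show "set_borel_measurable lborel \<Omega> k"
      unfolding set_borel_measurable_def by (rule mk[OF that(1)])
  qed (use kB in auto)
  define L where "L = reflection (0, 1) -` half_ball 1 \<inter> (UNIV :: ('a \<times> real) set)"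
  have Lb [measurable]: "L \<in> sets borel"
    unfolding L_def using measurable_sets_borel[OF reflection_measurable half_ball_borel] by simp
  have L: "L = {x. norm x < 1 \<and> snd x < 0}"
    unfolding L_def by (auto simp: half_ball_def reflection_vertical norm_prod_def)
  have hr: "h (reflection (0, 1) y) = h y" for y
  proof -
    obtain x' t where y: "y = (x', t)" by (cases y)
    have "norm (x', - t) = norm (x', t)" by (simp add: norm_prod_def)
    then show ?thesis using ev[of x' t] by (auto simp: y h_def reflection_vertical indicator_def simp del: norm_Pair)
  qed
  have kr: "k (reflection (0, 1) x) = k x" for x
    using hr[of "x /\<^sub>R norm x"] by (simp add: k_def reflection_scaleR)
  have low: "(LINT x:L|lborel. k x) = (LINT x:half_ball 1|lborel. k x)"
  proof -
    have "(LINT x:half_ball 1|lborel. k x) = (LINT x|distr lborel borel (reflection (0, 1)). indicator (half_ball 1) x *\<^sub>R k x)"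
      by (simp add: lborel_distr_reflection set_lebesgue_integral_def)
    also have "\<dots> = (LINT x|lborel. indicator (half_ball 1) (reflection (0, 1) x) *\<^sub>R k (reflection (0, 1) x))"
      by (rule integral_distr) measurable
    also have "\<dots> = (LINT x:L|lborel. k x)"
      unfolding set_lebesgue_integral_def L_def
      by (intro Bochner_Integration.integral_cong) (auto simp: kr split: split_indicator)
    finally show ?thesis by simp
  qed
  have "(LINT x:sphere 0 1|cone_measure (ball 0 1). g x) = (LINT x:ball 0 1|lborel. k x)"
  proof -
    have "(LINT x:sphere 0 1|cone_measure (ball 0 1). g x) = integral\<^sup>L (cone_measure (ball 0 1)) h"
      unfolding set_lebesgue_integral_def h_def[abs_def] ..
    also have "\<dots> = (LINT x:ball 0 1|lborel. k x)"
      unfolding k_def by (rule integral_cone_measure) auto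
    finally show ?thesis .
  qed
  also have "\<dots> = (LINT x:half_ball 1 \<union> L|lborel. k x)"
  proof -
    have null: "AE x in lborel. snd (x :: 'a \<times> real) \<noteq> 0"
    proof -
      have "negligible {x :: 'a \<times> real. (0, 1) \<bullet> x = 0}" by (rule negligible_hyperplane) (simp add: zero_prod_def)
      then have "{x :: 'a \<times> real. (0, 1) \<bullet> x = 0} \<in> null_sets lebesgue" by (simp add: negligible_iff_null_sets)
      moreover have "{x :: 'a \<times> real. (0, 1) \<bullet> x = 0} \<in> sets borel" by (intro borel_closed closed_hyperplane)
      ultimately have "{x :: 'a \<times> real. (0, 1) \<bullet> x = 0} \<in> null_sets lborel" by (auto simp: null_sets_def)
      from AE_not_in[OF this] show ?thesis by (auto simp: inner_prod_def)
    qed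
    show ?thesis
      unfolding set_lebesgue_integral_def
    proof (rule integral_cong_AE)
      show "AE x in lborel. indicator (ball 0 1) x *\<^sub>R k x = indicator (half_ball 1 \<union> L) x *\<^sub>R k x"
        using null by eventually_elim (auto simp: L half_ball_def split: split_indicator)
    qed (rule mk, use Lb in simp)+
  qed
  also have "\<dots> = (LINT x:half_ball 1|lborel. k x) + (LINT x:L|lborel. k x)"
  proof (rule set_integral_Un)
    show "half_ball 1 \<inter> L = {}" by (auto simp: L half_ball_def)
    show "set_integrable lborel (half_ball 1) k" by (rule int[OF half_ball_borel half_ball_bounded])
    have "bounded L" by (rule bounded_subset[OF bounded_ball[of 0 1]]) (auto simp: L)
    then show "set_integrable lborel L k" by (rule int[OF Lb])
  qed
  also have "\<dots> = 2 * (LINT x:half_ball 1|lborel. h (x /\<^sub>R norm x))" unfolding low unfolding k_def by simp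
  also have "(LINT x:half_ball 1|lborel. h (x /\<^sub>R norm x)) = (LINT x|hemi_measure. h x)"
    unfolding hemi_measure_def by (rule integral_cone_measure[OF half_ball_borel hm, symmetric])
  also have "\<dots> = (LINT x:hemi|hemi_measure. g x)"
    unfolding set_lebesgue_integral_def
  proof (rule integral_cong_AE)
    show "(\<lambda>x. indicator hemi x *\<^sub>R g x) \<in> borel_measurable hemi_measure"
    proof -
      have "hemi \<subseteq> sphere (0 :: 'a \<times> real) 1" by (auto simp: hemi_def)
      from borel_measurable_continuous_on_indicator[OF hemi_borel continuous_on_subset[OF g this]]
      show ?thesis by simp
    qed
    show "AE x in hemi_measure. h x = indicator hemi x *\<^sub>R g x"
      using AE_hemi_measure by eventually_elim (simp add: h_def hemi_def)
  qed (use hm in simp)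
  finally show ?thesis .
qed

lemma sphere_integral_scale:
  fixes F :: "'a::euclidean_space \<times> real \<Rightarrow> real"
  assumes r: "0 < r" and F: "continuous_on (sphere 0 r) F"
  shows "sphere_integral r F = r ^ DIM('a) * (LINT \<theta>:sphere 0 1|hausdorff_measure DIM('a). F (r *\<^sub>R \<theta>))"
proof -
  let ?H = "hausdorff_measure DIM('a) :: ('a \<times> real) measure"
  define h where "h x = indicator (sphere 0 r) x *\<^sub>R F x" for x
  have hm [measurable]: "h \<in> borel_measurable borel"
    unfolding h_def[abs_def] by (intro borel_measurable_continuous_on_indicator F) auto
  have m: "(\<lambda>x :: 'a \<times> real. r *\<^sub>R x) \<in> measurable ?H borel" by measurable
  have "inverse r ^ DIM('a) * sphere_integral r F = (LINT x|density ?H (\<lambda>_. ennreal (inverse r ^ DIM('a))). h x)"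
    using r by (subst integral_density) (auto simp: sphere_integral_def set_lebesgue_integral_def h_def)
  also have "\<dots> = (LINT x|distr ?H borel (\<lambda>x. r *\<^sub>R x). h x)"
    using r by (simp add: distr_hausdorff_scaleR)
  also have "\<dots> = (LINT x|?H. h (r *\<^sub>R x))"
    by (rule integral_distr[OF m]) measurable
  also have "\<dots> = (LINT \<theta>:sphere 0 1|?H. F (r *\<^sub>R \<theta>))"
    unfolding set_lebesgue_integral_def h_def using r
    by (intro Bochner_Integration.integral_cong) (auto split: split_indicator)
  finally show ?thesis using r by (simp add: power_inverse field_simps)
qed

text \<open>One \<open>c\<close> serves all \<open>F\<close> and all radii: it combines the
  proportionality factor between Hausdorff and cone measure, the factor 2 for the two hemispheres
  and the normalisation of \<open>hemi_int\<close>. It is only known to be nonnegative, since 0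
  covers the case of infinite surface measure.\<close>

lemma sphere_integral_hemi_int:
  "\<exists>c\<ge>0. \<forall>F r. continuous_on upper_ball F \<longrightarrow> even_in F \<longrightarrow> (\<forall>x\<in>upper_ball. 0 \<le> F x) \<longrightarrow> 0 < r \<longrightarrow> r < 1 \<longrightarrow>
    sphere_integral r F = c * r ^ DIM('a) * hemi_int (F :: 'a::euclidean_space \<times> real \<Rightarrow> real) r"
proof -
  let ?M = "cone_measure (ball 0 1) :: ('a \<times> real) measure"
  interpret M: finite_measure ?M by (rule finite_measure_cone_measure) auto
  have ae: "AE x in ?M. x \<in> sphere 0 1"
  proof (rule AE_cone_measure)
    show "AE x in lborel. x \<in> ball 0 1 \<longrightarrow> x /\<^sub>R norm x \<in> sphere (0 :: 'a \<times> real) 1"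
      using AE_lborel_singleton[of 0] by eventually_elim auto
  qed auto
  have pos: "emeasure ?M UNIV \<noteq> 0"
  proof -
    have "emeasure ?M UNIV = ennreal (unit_ball_vol DIM('a \<times> real) * 1 ^ DIM('a \<times> real))"
      using emeasure_cone_measure[of "ball (0 :: 'a \<times> real) 1" UNIV] emeasure_ball[of 1 "0 :: 'a \<times> real"]
      by (simp add: ball_def)
    moreover have "0 < unit_ball_vol (real DIM('a \<times> real))" by (rule unit_ball_vol_pos) simp
    ultimately show ?thesis by (metis ennreal_eq_0_iff mult_1_right not_le power_one)
  qed
  have fin: "emeasure ?M UNIV < \<infinity>" using M.emeasure_finite[of UNIV] by (simp only: less_top infinity_ennreal_def)
  obtain c where c: "0 \<le> c" and int': "\<forall>g. continuous_on (sphere 0 1) g \<longrightarrow> (\<forall>x\<in>sphere 0 1. 0 \<le> g x) \<longrightarrow>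
      (LINT x:sphere 0 1|hausdorff_measure DIM('a). g x) = c * (LINT x:sphere 0 1|?M. g x :: real)"
    using continuous_sphere_integral_proportional[OF reflection_invariant_cone_measure_ball reflection_invariant_hausdorff[of "DIM('a)"] ae fin pos]
    by (elim exE conjE) (rule that)
  have int: "(LINT x:sphere 0 1|hausdorff_measure DIM('a). g x) = c * (LINT x:sphere 0 1|?M. g x)"
    if "continuous_on (sphere 0 1) g" "\<forall>x\<in>sphere 0 1. 0 \<le> g x" for g :: "'a \<times> real \<Rightarrow> real"
    using int' that by simp
  have "sphere_integral r F = (2 * c / real (DIM('a) + 1)) * r ^ DIM('a) * hemi_int F r"
    if F: "continuous_on upper_ball F" "even_in F" "\<forall>x\<in>upper_ball. 0 \<le> F x" and r: "0 < r" "r < 1"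
    for F :: "'a \<times> real \<Rightarrow> real" and r
  proof -
    have Fc: "continuous_on (sphere 0 r) F"
    proof -
      have "continuous_on (sphere 0 r) (\<lambda>x. F (fold_up x))"
        by (rule continuous_on_compose2[OF F(1) continuous_on_fold_up])
          (use r in \<open>auto simp: mem_upper_ball fold_up_def norm_prod_def\<close>)
      then show ?thesis
        by (rule continuous_on_eq) (use r even_in_fold_up[OF F(2)] in auto)
    qed
    have Fr: "continuous_on (sphere 0 1) (\<lambda>\<theta>. F (r *\<^sub>R \<theta>))"
      by (rule continuous_on_compose2[OF Fc])
        (intro continuous_intros, intro image_subsetI, use r in \<open>simp del: scaleR_Pair\<close>)
    have F0: "0 \<le> F (r *\<^sub>R \<theta>)" if "\<theta> \<in> sphere 0 1" for \<theta>
    proof -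
      have "fold_up (r *\<^sub>R \<theta>) \<in> upper_ball" using that r by (simp add: mem_upper_ball) (simp add: fold_up_def)
      then have "0 \<le> F (fold_up (r *\<^sub>R \<theta>))" using F(3) by blast
      then show ?thesis using even_in_fold_up[OF F(2), of "r *\<^sub>R \<theta>"] that r by simp
    qed
    have ev: "F (r *\<^sub>R (x', - t)) = F (r *\<^sub>R (x', t))" if "norm (x', t) = 1" for x' t
    proof -
      have "norm (r *\<^sub>R (x', t)) < 1" using that r by (simp del: scaleR_Pair)
      then show ?thesis using F(2) unfolding even_in_def by simp
    qed
    have "sphere_integral r F = r ^ DIM('a) * (c * (LINT \<theta>:sphere 0 1|?M. F (r *\<^sub>R \<theta>)))"
      using sphere_integral_scale[OF r(1) Fc] int[OF Fr] F0 by simp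
    also have "(LINT \<theta>:sphere 0 1|?M. F (r *\<^sub>R \<theta>)) = 2 * (LINT \<theta>:hemi|hemi_measure. F (r *\<^sub>R \<theta>))"
      by (rule integral_cone_measure_ball_even[OF Fr ev])
    finally show ?thesis by (simp add: hemi_int_def)
  qed
  then show ?thesis using c by (intro exI[of _ "2 * c / real (DIM('a) + 1)"]) simp
qed

section \<open>Functions that are continuously differentiable up to the thin ball\<close>

text \<open>Building block of the cutoffs: squaring makes the positive part continuously
  differentiable, which is the regularity that \<open>test_function\<close> asks for.\<close>

definition possq :: "real \<Rightarrow> real" where "possq t = (max 0 t)\<^sup>2"

lemma possq_DERIV: "(possq has_real_derivative 2 * max 0 t) (at t)"
proof -
  consider "t < 0" | "t = 0" | "0 < t" by linarith
  then show ?thesis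
  proof cases
    case 1
    have "((\<lambda>_. 0) has_real_derivative 0) (at t)" by simp
    then have "(possq has_real_derivative 0) (at t)"
      by (rule has_field_derivative_transform_within_open[of _ _ _ "{..<0}"]) (use 1 in \<open>auto simp: possq_def\<close>)
    then show ?thesis using 1 by simp
  next
    case 2
    have "((\<lambda>h. (possq (0 + h) - possq 0) / h) \<longlongrightarrow> 0) (at 0)"
    proof (rule Lim_null_comparison)
      show "\<forall>\<^sub>F h in at 0. norm ((possq (0 + h) - possq 0) / h) \<le> \<bar>h\<bar>"
        by (intro always_eventually) (auto simp: possq_def max_def power2_eq_square)
    qed (auto intro!: tendsto_eq_intros)
    then show ?thesis using 2 by (simp add: DERIV_def)
  next
    case 3
    have "((\<lambda>t. t\<^sup>2) has_real_derivative 2 * t) (at t)" by (auto intro!: derivative_eq_intros)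
    then have "(possq has_real_derivative 2 * t) (at t)"
      by (rule has_field_derivative_transform_within_open[of _ _ _ "{0<..}"]) (use 3 in \<open>auto simp: possq_def\<close>)
    then show ?thesis using 3 by simp
  qed
qed

text \<open>A \<open>C\<^sup>1\<close> transition from \<open>0\<close> on \<open>t \<le> 1\<close> to \<open>1\<close> on \<open>t \<ge> 2\<close>.\<close>

definition step :: "real \<Rightarrow> real" where "step t = 1 - possq (1 - possq (t - 1))"

definition step' :: "real \<Rightarrow> real" where
  "step' t = 2 * max 0 (1 - possq (t - 1)) * (2 * max 0 (t - 1))"

lemma step_DERIV: "(step has_real_derivative step' t) (at t)"
  unfolding step_def[abs_def] step'_def
  by (rule derivative_eq_intros DERIV_chain2[OF possq_DERIV] refl)+ (simp add: max_def)

lemma continuous_on_step: "continuous_on A step"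
  using step_DERIV by (meson DERIV_isCont continuous_at_imp_continuous_on)

lemma continuous_on_step': "continuous_on A step'"
  unfolding step'_def[abs_def] possq_def by (intro continuous_intros)

lemma step_le_1: "t \<le> 1 \<Longrightarrow> step t = 0" "t \<le> 1 \<Longrightarrow> step' t = 0"
  by (simp_all add: step_def step'_def possq_def)

lemma possq_ge_1: "2 \<le> t \<Longrightarrow> 1 \<le> possq (t - 1)"
  by (simp add: possq_def max_def)

lemma step_ge_2: "2 \<le> t \<Longrightarrow> step t = 1" "2 \<le> t \<Longrightarrow> step' t = 0"
  using possq_ge_1[of t] by (simp_all add: step_def step'_def possq_def[of "1 - possq (t - 1)"])

lemma step_bounds: "0 \<le> step t" "step t \<le> 1"
proof -
  have "0 \<le> max 0 (1 - possq (t - 1))" "max 0 (1 - possq (t - 1)) \<le> 1" by (auto simp: possq_def)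
  then show "0 \<le> step t" "step t \<le> 1"
    unfolding step_def possq_def[of "1 - _"] by (auto simp: power_le_one)
qed

lemma step'_bounds: "0 \<le> step' t" "step' t \<le> 4"
proof -
  show "0 \<le> step' t" by (simp add: step'_def)
  show "step' t \<le> 4"
  proof (cases "t \<le> 2")
    case True
    have "max 0 (1 - possq (t - 1)) * max 0 (t - 1) \<le> 1 * 1"
      using True by (intro mult_mono) (auto simp: possq_def)
    then show ?thesis by (simp add: step'_def)
  qed (simp add: step_ge_2)
qed

text \<open>\<open>G\<close> is the gradient in the open half ball together with its continuous
  extension to the thin ball, where the two-sided \<open>grad g\<close> may fail to exist.\<close>

definition C1_upper :: "('a::euclidean_space \<times> real \<Rightarrow> real) \<Rightarrow> ('a \<times> real \<Rightarrow> 'a \<times> real) \<Rightarrow> bool" where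
  "C1_upper g G \<longleftrightarrow> continuous_on upper_ball g \<and> continuous_on upper_ball G \<and>
     (\<forall>x\<in>half_ball 1. (g has_derivative (\<lambda>h. G x \<bullet> h)) (at x))"

lemma C1_upperD:
  assumes "C1_upper g G"
  shows "continuous_on upper_ball g" "continuous_on upper_ball G"
    "x \<in> half_ball 1 \<Longrightarrow> (g has_derivative (\<lambda>h. G x \<bullet> h)) (at x)"
  using assms by (auto simp: C1_upper_def)

lemma C1_upper_mult:
  assumes "C1_upper g G" "C1_upper h H"
  shows "C1_upper (\<lambda>x. g x * h x) (\<lambda>x. g x *\<^sub>R H x + h x *\<^sub>R G x)"
  unfolding C1_upper_def
  by (auto intro!: continuous_intros C1_upperD[OF assms(1)] C1_upperD[OF assms(2)]
      derivative_eq_intros simp: inner_add_left algebra_simps)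

lemma C1_upper_diff:
  assumes "C1_upper g G" "C1_upper h H"
  shows "C1_upper (\<lambda>x. g x - h x) (\<lambda>x. G x - H x)"
  unfolding C1_upper_def
  by (auto intro!: continuous_intros C1_upperD[OF assms(1)] C1_upperD[OF assms(2)]
      derivative_eq_intros simp: inner_diff_left)

lemma C1_upper_uminus:
  assumes "C1_upper g G"
  shows "C1_upper (\<lambda>x. - g x) (\<lambda>x. - G x)"
  unfolding C1_upper_def
  by (auto intro!: continuous_intros C1_upperD[OF assms(1)] derivative_eq_intros)

lemma C1_upperI:
  assumes "\<And>x. (g has_derivative (\<lambda>h. G x \<bullet> h)) (at x)" "continuous_on UNIV G"
  shows "C1_upper g G"
  unfolding C1_upper_def
proof (intro conjI ballI)
  show "continuous_on upper_ball g"
    using assms(1) by (meson continuous_at_imp_continuous_on has_derivative_continuous)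
qed (use assms continuous_on_subset[OF assms(2)] in auto)

lemma grad_eqI:
  assumes "(g has_derivative (\<lambda>h. v \<bullet> h)) (at x)"
  shows "grad g x = v"
proof -
  have "frechet_derivative g (at x) = (\<lambda>h. v \<bullet> h)" using frechet_derivative_at[OF assms] by simp
  then show ?thesis by (simp add: grad_def euclidean_representation)
qed

lemma has_derivative_grad:
  assumes "g differentiable (at x)"
  shows "(g has_derivative (\<lambda>h. grad g x \<bullet> h)) (at x)"
proof -
  let ?D = "frechet_derivative g (at x)"
  have D: "(g has_derivative ?D) (at x)" using assms by (simp add: frechet_derivative_works)
  then have lin: "linear ?D" by (rule has_derivative_linear)
  have "?D h = grad g x \<bullet> h" for h
  proof -
    have "?D h = ?D (\<Sum>b\<in>Basis. (h \<bullet> b) *\<^sub>R b)" by (simp add: euclidean_representation)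
    also have "\<dots> = (\<Sum>b\<in>Basis. (h \<bullet> b) * ?D b)"
      using lin by (simp add: linear_sum linear_scale)
    finally show ?thesis by (simp add: grad_def inner_sum_left inner_sum_right inner_commute[of _ h] mult.commute)
  qed
  then have "?D = (\<lambda>h. grad g x \<bullet> h)" by auto
  then show ?thesis using D by simp
qed

text \<open>On the convex part of the open half ball near \<open>x\<close>, the mean value
  inequality for \<open>g\<close> minus the linear map \<open>G x\<close> gives the estimate. Points
  of the thin ball are reached by lifting both points by \<open>(0, t)\<close>, which keeps their
  difference, and letting \<open>t\<close> tend to 0.\<close>

lemma C1_upper_has_derivative_within:
  assumes "C1_upper g G" and x: "x \<in> upper_ball"
  shows "(g has_derivative (\<lambda>h. G x \<bullet> h)) (at x within upper_ball)"
  unfolding has_derivative_within_alt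
proof (intro conjI allI impI)
  note g = C1_upperD[OF assms(1)]
  show "bounded_linear (\<lambda>h. G x \<bullet> h)" by (rule bounded_linear_inner_right)
  fix e :: real assume "0 < e"
  obtain d where d: "0 < d" "\<And>y. y \<in> upper_ball \<Longrightarrow> dist y x < d \<Longrightarrow> dist (G y) (G x) < e"
    using g(2) x \<open>0 < e\<close> unfolding continuous_on_iff by metis
  have "norm (g y - g x - G x \<bullet> (y - x)) \<le> e * norm (y - x)" if y: "y \<in> upper_ball" "norm (y - x) < d" for y
  proof -
    let ?S = "half_ball 1 \<inter> ball x d"
    have "{x :: 'a \<times> real. 0 < snd x} = {x. (0, 1) \<bullet> x > 0}" by (auto simp: inner_prod_def)
    then have "convex {x :: 'a \<times> real. 0 < snd x}" by (simp only: convex_halfspace_gt)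
    then have conv: "convex ?S"
      unfolding half_ball_def by (intro convex_Int convex_ball)
    have bd: "\<bar>(g z - G x \<bullet> z) - (g w - G x \<bullet> w)\<bar> \<le> e * norm (z - w)" if "z \<in> ?S" "w \<in> ?S" for z w
    proof -
      have "norm ((g z - G x \<bullet> z) - (g w - G x \<bullet> w)) \<le> e * norm (z - w)"
      proof (rule differentiable_bound[OF conv])
        fix y assume y: "y \<in> ?S"
        show "((\<lambda>y. g y - G x \<bullet> y) has_derivative (\<lambda>h. (G y - G x) \<bullet> h)) (at y within ?S)"
          using y by (auto intro!: derivative_eq_intros has_derivative_at_withinI[OF g(3)] simp: inner_diff_left)
        have "norm (G y - G x) \<le> e"
          using d(2)[of y] y half_ball_subset_upper_ball[of 1] by (auto simp: dist_norm norm_minus_commute)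
        then show "onorm (\<lambda>h. (G y - G x) \<bullet> h) \<le> e"
          using \<open>0 < e\<close> by (intro onorm_le) (metis Cauchy_Schwarz_ineq2 mult_right_mono norm_ge_zero order_trans real_norm_def)
      qed (use that in auto)
      then show ?thesis by simp
    qed
    define sh where "sh t z = z + (0, t :: real)" for t and z :: "'a \<times> real"
    have lim: "((\<lambda>t. g (sh t z)) \<longlongrightarrow> g z) (at_right 0)" and ev: "\<forall>\<^sub>F t in at_right 0. sh t z \<in> ?S"
      if z: "z \<in> upper_ball" "norm (z - x) < d" for z
    proof -
      have sh: "((\<lambda>t. sh t z) \<longlongrightarrow> z) (at_right 0)"
        unfolding sh_def by (auto intro!: tendsto_eq_intros simp: zero_prod_def[symmetric])
      have "z \<in> ball 0 1 \<inter> ball x d" using z by (auto simp: mem_upper_ball dist_norm norm_minus_commute)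
      then have "\<forall>\<^sub>F t in at_right 0. sh t z \<in> ball 0 1 \<inter> ball x d"
        using topological_tendstoD[OF sh] by (metis open_Int open_ball)
      moreover have "\<forall>\<^sub>F t in at_right (0::real). 0 < t" by (rule eventually_at_right_less)
      ultimately show ev: "\<forall>\<^sub>F t in at_right 0. sh t z \<in> ?S"
        by eventually_elim (use z in \<open>auto simp: half_ball_def mem_upper_ball sh_def\<close>)
      show "((\<lambda>t. g (sh t z)) \<longlongrightarrow> g z) (at_right 0)"
      proof (rule continuous_on_tendsto_compose[OF g(1) sh z(1)])
        show "\<forall>\<^sub>F t in at_right 0. sh t z \<in> upper_ball"
          using ev by eventually_elim (use half_ball_subset_upper_ball[of 1] in auto)
      qed
    qed
    have xd: "norm (x - x) < d" using d(1) by simp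
    have "((\<lambda>t. \<bar>g (sh t y) - g (sh t x) - G x \<bullet> (y - x)\<bar>) \<longlongrightarrow> \<bar>g y - g x - G x \<bullet> (y - x)\<bar>) (at_right 0)"
      by (intro tendsto_intros lim y x xd)
    moreover have "\<forall>\<^sub>F t in at_right 0. \<bar>g (sh t y) - g (sh t x) - G x \<bullet> (y - x)\<bar> \<le> e * norm (y - x)"
      using ev[OF y] ev[OF x xd]
    proof eventually_elim
      case (elim t)
      have sh: "sh t y - sh t x = y - x" by (simp add: sh_def)
      have "g (sh t y) - g (sh t x) - G x \<bullet> (sh t y - sh t x)
          = (g (sh t y) - G x \<bullet> sh t y) - (g (sh t x) - G x \<bullet> sh t x)"
        by (simp only: inner_diff_right)
      then show ?case using bd[OF elim] by (simp only: sh)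
    qed
    ultimately have "\<bar>g y - g x - G x \<bullet> (y - x)\<bar> \<le> e * norm (y - x)"
      by (rule tendsto_upperbound) simp
    then show ?thesis by simp
  qed
  then show "\<exists>d>0. \<forall>y\<in>upper_ball. norm (y - x) < d \<longrightarrow> norm (g y - g x - G x \<bullet> (y - x)) \<le> e * norm (y - x)"
    using d(1) by blast
qed

text \<open>For \<open>x\<close> on the equator the whole ray lies in the thin ball, so the chain
  rule has to run through the derivative within \<open>upper_ball\<close>.\<close>

lemma C1_upper_radial_derivative:
  assumes "C1_upper g G" and x: "x \<in> hemi" and t: "0 < t" "t < 1"
  shows "((\<lambda>t. g (t *\<^sub>R x)) has_real_derivative (G (t *\<^sub>R x) \<bullet> (t *\<^sub>R x)) / t) (at t)"
proof -
  have mem: "s *\<^sub>R x \<in> upper_ball" if "s \<in> {0<..<1}" for s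
    using that x by (intro scaleR_hemi_upper_ball) auto
  have d: "(g has_derivative (\<lambda>h. G (t *\<^sub>R x) \<bullet> h)) (at (t *\<^sub>R x) within (\<lambda>s. s *\<^sub>R x) ` {0<..<1})"
    by (rule has_derivative_subset[OF C1_upper_has_derivative_within[OF assms(1)]]) (use mem t in auto)
  have "((\<lambda>s. g (s *\<^sub>R x)) has_derivative (\<lambda>h. G (t *\<^sub>R x) \<bullet> (h *\<^sub>R x))) (at t within {0<..<1})"
    by (rule has_derivative_in_compose[OF _ d]) (auto intro!: derivative_eq_intros)
  moreover have "at t within {0<..<1} = at t" using t by (intro at_within_open) auto
  moreover have "(\<lambda>h. G (t *\<^sub>R x) \<bullet> (h *\<^sub>R x)) = (*) ((G (t *\<^sub>R x) \<bullet> (t *\<^sub>R x)) / t)"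
  proof
    fix h
    show "G (t *\<^sub>R x) \<bullet> (h *\<^sub>R x) = (G (t *\<^sub>R x) \<bullet> (t *\<^sub>R x)) / t * h"
      using t by (simp only: inner_scaleR_right) simp
  qed
  ultimately show ?thesis unfolding has_field_derivative_def by (simp only:)
qed

section \<open>The weak equation up to the thin ball\<close>

lemma integrable_half_ball_vanishing:
  fixes g :: "'a::euclidean_space \<times> real \<Rightarrow> real"
  assumes g: "continuous_on upper_ball g" and R: "R < 1"
    and zero: "\<And>x. x \<in> upper_ball \<Longrightarrow> R \<le> norm x \<Longrightarrow> g x = 0"
  shows "set_integrable lborel (half_ball 1) g"
    and "\<exists>B\<ge>0. \<forall>x\<in>upper_ball. \<bar>g x\<bar> \<le> B"
proof -
  obtain B where B: "0 \<le> B" "\<And>x. norm x \<le> R \<Longrightarrow> 0 \<le> snd x \<Longrightarrow> norm (g x) \<le> B"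
    using continuous_on_upper_ball_bounded[OF g R] by blast
  have gB: "\<bar>g x\<bar> \<le> B" if "x \<in> upper_ball" for x
    using B zero[OF that] that by (cases "norm x \<le> R") (auto simp: mem_upper_ball)
  then show "\<exists>B\<ge>0. \<forall>x\<in>upper_ball. \<bar>g x\<bar> \<le> B" using B(1) by blast
  have "emeasure lborel (half_ball 1 :: ('a \<times> real) set) < \<infinity>"
    by (rule emeasure_bounded_finite[OF half_ball_bounded])
  then have "set_integrable lborel (half_ball 1 :: ('a \<times> real) set) (\<lambda>_. B)"
    unfolding set_integrable_def by (intro integrable_scaleR_left integrable_real_indicator) auto
  then show "set_integrable lborel (half_ball 1) g"
  proof (rule set_integrable_bound)
    show "set_borel_measurable lborel (half_ball 1) g"
      using borel_measurable_half_ball_indicator[OF g, of 1] by (simp add: set_borel_measurable_def)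
    show "AE x in lborel. x \<in> half_ball 1 \<longrightarrow> norm (g x) \<le> norm B"
    proof (intro AE_I2 impI)
      fix x :: "'a \<times> real" assume "x \<in> half_ball 1"
      then have "x \<in> upper_ball" using half_ball_subset_upper_ball[of 1] by auto
      then show "norm (g x) \<le> norm B" using gB B(1) by simp
    qed
  qed
qed

text \<open>\<open>step\<close> kills the layer \<open>snd x \<le> \<delta>\<close> and
  \<open>\<phi>\<close> vanishes from radius \<open>R\<close> on, so the support lies in a compact
  subset \<open>K\<close> of the open half ball. The open sets \<open>half_ball 1\<close> and
  \<open>- K\<close> cover the space; on the first, \<open>\<tau>\<close> is a product of
  differentiable functions, on the second it is 0.\<close>

lemma cutoff_test_function:
  fixes \<phi> :: "'a::euclidean_space \<times> real \<Rightarrow> real"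
  assumes \<phi>: "C1_upper \<phi> \<Phi>" and R: "0 \<le> R" "R < 1" and \<delta>: "0 < \<delta>"
    and zero: "\<And>x. x \<in> upper_ball \<Longrightarrow> R \<le> norm x \<Longrightarrow> \<phi> x = 0 \<and> \<Phi> x = 0"
  defines "\<tau> \<equiv> \<lambda>x. if x \<in> half_ball 1 then step (snd x / \<delta>) * \<phi> x else 0"
  shows "test_function (half_ball 1) \<tau>"
    and "\<And>x. x \<in> half_ball 1 \<Longrightarrow>
      grad \<tau> x = step (snd x / \<delta>) *\<^sub>R \<Phi> x + (step' (snd x / \<delta>) / \<delta> * \<phi> x) *\<^sub>R (0, 1)"
proof -
  define \<Psi> where "\<Psi> x = (if x \<in> half_ball 1 then
      step (snd x / \<delta>) *\<^sub>R \<Phi> x + (step' (snd x / \<delta>) / \<delta> * \<phi> x) *\<^sub>R (0, 1) else 0)" for x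
  define K where "K = {x :: 'a \<times> real. norm x \<le> R \<and> 0 \<le> snd x} \<inter> {x. \<delta> \<le> snd x}"
  have K: "compact K"
    unfolding K_def by (intro compact_Int_closed compact_truncated_upper_ball closed_Collect_le continuous_intros)
  have Ksub: "K \<subseteq> half_ball 1" using R \<delta> by (auto simp: K_def half_ball_def)
  have off: "\<tau> x = 0 \<and> \<Psi> x = 0" if "x \<notin> K" for x
  proof (cases "x \<in> half_ball 1")
    case True
    then have xu: "x \<in> upper_ball" using half_ball_subset_upper_ball[of 1] by auto
    have "0 < snd x" using True by (simp add: half_ball_def)
    then have "R \<le> norm x \<or> snd x \<le> \<delta>" using that by (auto simp: K_def)
    then show ?thesis
    proof
      assume "snd x \<le> \<delta>"
      then have "snd x / \<delta> \<le> 1" using \<delta> by simp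
      then show ?thesis by (simp add: \<tau>_def \<Psi>_def step_le_1 zero_prod_def)
    qed (use zero[OF xu] in \<open>simp add: \<tau>_def \<Psi>_def zero_prod_def\<close>)
  qed (simp add: \<tau>_def \<Psi>_def)
  have cover: "half_ball 1 \<union> - K = UNIV" using Ksub by auto
  have oK: "open (- K)" using K by (simp add: compact_imp_closed open_Compl)
  have der: "(\<tau> has_derivative (\<lambda>h. \<Psi> x \<bullet> h)) (at x)" for x
  proof (cases "x \<in> half_ball 1")
    case True
    have "((\<lambda>x. step (snd x / \<delta>)) has_derivative (\<lambda>h. step' (snd x / \<delta>) * (snd h / \<delta>))) (at x)"
      using \<delta> by (intro DERIV_compose_FDERIV[OF step_DERIV, THEN has_derivative_eq_rhs])
        (auto intro!: derivative_eq_intros)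
    then have "((\<lambda>x. step (snd x / \<delta>) * \<phi> x) has_derivative (\<lambda>h. \<Psi> x \<bullet> h)) (at x)"
      using True by (auto intro!: derivative_eq_intros C1_upperD(3)[OF \<phi>]
          simp: \<Psi>_def inner_add_left inner_prod_def algebra_simps)
    then show ?thesis
      by (rule has_derivative_transform_within_open[OF _ half_ball_open True]) (simp add: \<tau>_def)
  next
    case False
    then have "x \<in> - K" using Ksub by auto
    have "((\<lambda>_. 0 :: real) has_derivative (\<lambda>h. \<Psi> x \<bullet> h)) (at x)"
      using off[of x] \<open>x \<in> - K\<close> by simp
    then show ?thesis
      by (rule has_derivative_transform_within_open[OF _ oK \<open>x \<in> - K\<close>]) (use off in auto)
  qed
  have grad: "grad \<tau> = \<Psi>" using grad_eqI[OF der] by auto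
  have "continuous_on (half_ball 1 \<union> - K) \<Psi>"
  proof (rule continuous_on_open_Un[OF half_ball_open oK])
    have "continuous_on (half_ball 1) (\<lambda>x. step (snd x / \<delta>) *\<^sub>R \<Phi> x + (step' (snd x / \<delta>) / \<delta> * \<phi> x) *\<^sub>R (0, 1))"
      using \<delta> half_ball_subset_upper_ball[of 1]
      by (intro continuous_intros continuous_on_compose2[OF continuous_on_step[of UNIV]]
          continuous_on_compose2[OF continuous_on_step'[of UNIV]] continuous_on_subset[OF C1_upperD(1)[OF \<phi>]]
          continuous_on_subset[OF C1_upperD(2)[OF \<phi>]]) auto
    then show "continuous_on (half_ball 1) \<Psi>"
      by (rule continuous_on_eq) (simp add: \<Psi>_def)
    have "continuous_on (- K) (\<lambda>_. 0 :: 'a \<times> real)" by simp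
    then show "continuous_on (- K) \<Psi>" by (rule continuous_on_eq) (use off in auto)
  qed
  then have cont: "continuous_on UNIV (grad \<tau>)" by (simp only: cover grad)
  have cl: "closure {x. \<tau> x \<noteq> 0} \<subseteq> K"
    by (rule closure_minimal) (use off K in \<open>auto simp: compact_imp_closed\<close>)
  then have "compact (closure {x. \<tau> x \<noteq> 0})"
    using K by (metis closed_closure compact_Int_closed inf.absorb_iff2)
  moreover have "\<forall>x. \<tau> differentiable (at x)" using der unfolding differentiable_def by blast
  ultimately show "test_function (half_ball 1) \<tau>"
    unfolding test_function_def using cont cl Ksub by blast
  show "grad \<tau> x = step (snd x / \<delta>) *\<^sub>R \<Phi> x + (step' (snd x / \<delta>) / \<delta> * \<phi> x) *\<^sub>R (0, 1)"
    if "x \<in> half_ball 1" for x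
    using that by (simp add: grad \<Psi>_def)
qed

text \<open>The weak equation tested against functions that need not vanish on the thin ball: cutting off
  at height \<open>\<delta>\<close> produces the boundary term \<open>V \<bullet> (0, 1) * \<phi>\<close> as \<open>\<delta> \<rightarrow> 0\<close>.\<close>

lemma weak_laplacian_upto_thin_ball:
  fixes v :: "'a::euclidean_space \<times> real \<Rightarrow> real"
  assumes v: "C1_upper v V" and weak: "weak_laplacian (half_ball 1) v f"
    and fm: "f \<in> borel_measurable borel" and fK: "AE x in lborel. x \<in> half_ball 1 \<longrightarrow> \<bar>f x\<bar> \<le> F"
    and \<phi>: "C1_upper \<phi> \<Phi>" and R: "0 \<le> R" "R < 1"
    and zero: "\<And>x. x \<in> upper_ball \<Longrightarrow> R \<le> norm x \<Longrightarrow> \<phi> x = 0 \<and> \<Phi> x = 0"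
    and sign: "\<And>x. x \<in> thin_ball 1 \<Longrightarrow> (V x \<bullet> (0, 1)) * \<phi> x \<le> 0"
  shows "set_integrable lborel (half_ball 1) (\<lambda>x. f x * \<phi> x)"
    and "0 \<le> (LINT x:half_ball 1|lborel. V x \<bullet> \<Phi> x + f x * \<phi> x)"
proof -
  note vc = C1_upperD(1,2)[OF v] and \<phi>c = C1_upperD(1,2)[OF \<phi>]
  let ?H = "half_ball 1 :: ('a \<times> real) set"
  define k where "k x = (V x \<bullet> (0, 1)) * \<phi> x" for x
  have kc: "continuous_on upper_ball k" unfolding k_def[abs_def] by (intro continuous_intros vc \<phi>c)
  have kz: "k x = 0" if "x \<in> upper_ball" "R \<le> norm x" for x using zero[OF that] by (simp add: k_def)
  have Vc: "continuous_on upper_ball (\<lambda>x. V x \<bullet> \<Phi> x)" by (intro continuous_intros vc \<phi>c)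
  have iV: "set_integrable lborel ?H (\<lambda>x. V x \<bullet> \<Phi> x)"
    by (rule integrable_half_ball_vanishing(1)[OF Vc R(2)]) (use zero in auto)
  have i\<phi>: "set_integrable lborel ?H \<phi>"
    by (rule integrable_half_ball_vanishing(1)[OF \<phi>c(1) R(2)]) (use zero in auto)
  have ik: "set_integrable lborel ?H k"
    by (rule integrable_half_ball_vanishing(1)[OF kc R(2)]) (use kz in auto)
  have bounded_mult: "set_integrable lborel ?H (\<lambda>x. c x * h x)"
    if "set_integrable lborel ?H h" "c \<in> borel_measurable borel" "AE x in lborel. x \<in> ?H \<longrightarrow> \<bar>c x\<bar> \<le> B" for c h :: "'a \<times> real \<Rightarrow> real" and B
  proof (rule set_integrable_bound[where f="\<lambda>x. B * h x"])
    show "set_integrable lborel ?H (\<lambda>x. B * h x)" using that(1) by simp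
    have "(\<lambda>x. c x * (indicator ?H x *\<^sub>R h x)) \<in> borel_measurable lborel"
      using that unfolding set_integrable_def by (intro borel_measurable_times) auto
    then show "set_borel_measurable lborel ?H (\<lambda>x. c x * h x)"
      by (simp add: set_borel_measurable_def mult_ac)
    show "AE x in lborel. x \<in> ?H \<longrightarrow> norm (c x * h x) \<le> norm (B * h x)"
      using that(3) by eventually_elim (auto simp: abs_mult intro!: mult_right_mono)
  qed
  show if\<phi>: "set_integrable lborel ?H (\<lambda>x. f x * \<phi> x)"
    by (rule bounded_mult[OF i\<phi> fm fK])
  let ?T = "\<lambda>x. V x \<bullet> \<Phi> x + f x * \<phi> x"
  have iT: "set_integrable lborel ?H ?T" by (intro set_integral_add iV if\<phi>)
  have stm: "(\<lambda>x :: 'a \<times> real. step (snd x / \<delta>)) \<in> borel_measurable borel" if "0 < \<delta>" for \<delta>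
    using that by (intro borel_measurable_continuous_onI continuous_on_compose2[OF continuous_on_step[of UNIV]] continuous_intros) auto
  have st'm: "(\<lambda>x :: 'a \<times> real. step' (snd x / \<delta>) / \<delta>) \<in> borel_measurable borel" if "0 < \<delta>" for \<delta>
    using that by (intro borel_measurable_continuous_onI continuous_intros continuous_on_compose2[OF continuous_on_step'[of UNIV]]) auto
  have iA: "set_integrable lborel ?H (\<lambda>x. step (snd x / \<delta>) * ?T x)" if "0 < \<delta>" for \<delta>
    by (rule bounded_mult[OF iT stm[OF that], of 1]) (auto simp: step_bounds)
  have iB: "set_integrable lborel ?H (\<lambda>x. step' (snd x / \<delta>) / \<delta> * k x)" if "0 < \<delta>" for \<delta>
    by (rule bounded_mult[OF ik st'm[OF that], of "4 / \<delta>"])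
      (use that in \<open>auto simp: step'_bounds divide_right_mono\<close>)
  \<comment> \<open>The gradient of the test function has a part with the cutoff itself and a part
    with its derivative. \<open>A\<close> collects the former together with the right-hand side,
    \<open>B\<close> the latter, which lives where
    \<open>\<delta> \<le> snd x \<le> 2 * \<delta>\<close>. The weak equation says that they
    cancel.\<close>
  define A where "A \<delta> = (LINT x:?H|lborel. step (snd x / \<delta>) * ?T x)" for \<delta>
  define B where "B \<delta> = (LINT x:?H|lborel. step' (snd x / \<delta>) / \<delta> * k x)" for \<delta>
  have AB: "A \<delta> = - B \<delta>" if \<delta>: "0 < \<delta>" for \<delta>
  proof -
    let ?\<tau> = "\<lambda>x. if x \<in> half_ball 1 then step (snd x / \<delta>) * \<phi> x else 0"
    have \<tau>1: "test_function (half_ball 1) ?\<tau>"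
      by (rule cutoff_test_function(1)[OF \<phi> R \<delta>]) (rule zero)
    have \<tau>2: "grad ?\<tau> x = step (snd x / \<delta>) *\<^sub>R \<Phi> x + (step' (snd x / \<delta>) / \<delta> * \<phi> x) *\<^sub>R (0, 1)"
      if "x \<in> ?H" for x
      by (rule cutoff_test_function(2)[OF \<phi> R \<delta> _ that]) (rule zero)
    have e1: "(LINT x:?H|lborel. grad v x \<bullet> grad ?\<tau> x)
        = (LINT x:?H|lborel. step (snd x / \<delta>) * (V x \<bullet> \<Phi> x) + step' (snd x / \<delta>) / \<delta> * k x)"
    proof (intro set_lebesgue_integral_cong allI impI)
      fix x assume x: "x \<in> ?H"
      have gv: "grad v x = V x" by (rule grad_eqI[OF C1_upperD(3)[OF v x]])
      show "grad v x \<bullet> grad ?\<tau> x = step (snd x / \<delta>) * (V x \<bullet> \<Phi> x) + step' (snd x / \<delta>) / \<delta> * k x"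
        unfolding gv \<tau>2[OF x] by (simp only: inner_add_right inner_scaleR_right k_def mult_ac)
    qed simp
    have e2: "(LINT x:?H|lborel. f x * ?\<tau> x) = (LINT x:?H|lborel. step (snd x / \<delta>) * (f x * \<phi> x))"
      by (intro set_lebesgue_integral_cong) auto
    have i1: "set_integrable lborel ?H (\<lambda>x. step (snd x / \<delta>) * (V x \<bullet> \<Phi> x))"
      by (rule bounded_mult[OF iV stm[OF \<delta>], of 1]) (auto simp: step_bounds)
    have i2: "set_integrable lborel ?H (\<lambda>x. step (snd x / \<delta>) * (f x * \<phi> x))"
      by (rule bounded_mult[OF if\<phi> stm[OF \<delta>], of 1]) (auto simp: step_bounds)
    have "- (LINT x:?H|lborel. grad v x \<bullet> grad ?\<tau> x) = (LINT x:?H|lborel. f x * ?\<tau> x)"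
      using weak \<tau>1 unfolding weak_laplacian_def by blast
    then show ?thesis
      unfolding e1 e2 A_def B_def distrib_left
      using set_integral_add(2)[OF i1 iB[OF \<delta>]] set_integral_add(2)[OF i1 i2] by linarith
  qed
  define c where "c = measure lborel (cball 0 1 :: 'a set)"
  have c: "0 \<le> c" by (simp add: c_def)
  \<comment> \<open>The layer sits in a cylinder of volume \<open>c * \<delta>\<close>, the
    derivative of the cutoff is at most \<open>4 / \<delta>\<close>, and near the thin ball
    \<open>k \<le> e\<close> by uniform continuity and the sign condition.\<close>
  have Bsmall: "\<exists>\<eta>>0. \<forall>\<delta>. 0 < \<delta> \<longrightarrow> \<delta> < \<eta> \<longrightarrow> B \<delta> \<le> 4 * e * c" if e: "0 < e" for e
  proof -
    let ?K = "{x :: 'a \<times> real. norm x \<le> R \<and> 0 \<le> snd x}"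
    have "continuous_on ?K k"
      by (rule continuous_on_subset[OF kc]) (use R in \<open>auto simp: mem_upper_ball\<close>)
    then have uc: "uniformly_continuous_on ?K k"
      using compact_truncated_upper_ball by (rule compact_uniformly_continuous)
    obtain d where d: "0 < d" "\<And>x y. x \<in> ?K \<Longrightarrow> y \<in> ?K \<Longrightarrow> dist y x < d \<Longrightarrow> dist (k y) (k x) < e"
      by (rule uniformly_continuous_onE[OF uc e]) (rule that)
    have ke: "k x \<le> e" if x: "x \<in> upper_ball" "snd x < d" for x
    proof (cases "norm x \<le> R")
      case True
      let ?y = "(fst x, 0 :: real)"
      have ny: "norm ?y \<le> norm x" by (simp add: norm_prod_def)
      have "dist x ?y = \<bar>snd x\<bar>" by (simp add: dist_prod_def dist_real_def)
      then have "dist (k x) (k ?y) < e"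
        using x True ny by (intro d(2)) (auto simp: mem_upper_ball)
      moreover have "k ?y \<le> 0"
        using sign[of ?y] x ny by (simp add: k_def thin_ball_def mem_upper_ball)
      ultimately show ?thesis by (simp add: dist_real_def)
    qed (use kz[OF x(1)] e in auto)
    have "B \<delta> \<le> 4 * e * c" if \<delta>: "0 < \<delta>" "\<delta> < d / 2" for \<delta>
    proof -
      let ?S = "cball (0 :: 'a) 1 \<times> {\<delta>..2 * \<delta>}"
      have Sm: "?S \<in> sets borel" by (intro borel_closed closed_Times closed_cball closed_atLeastAtMost)
      have Sbd: "bounded ?S" by (intro bounded_Times) auto
      have mS: "measure lborel ?S = c * \<delta>"
      proof -
        have "emeasure lborel ?S = emeasure (lborel \<Otimes>\<^sub>M lborel) ?S" by (simp add: lborel_prod)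
        also have "\<dots> = emeasure lborel (cball (0 :: 'a) 1) * emeasure lborel {\<delta>..2 * \<delta>}"
          by (rule lborel.emeasure_pair_measure_Times) auto
        finally show ?thesis using \<delta> by (simp add: measure_def enn2real_mult c_def)
      qed
      have iS: "integrable lborel (\<lambda>x. indicator ?S x * (4 * e / \<delta>))"
        by (intro integrable_mult_left integrable_real_indicator)
          (use Sm emeasure_bounded_finite[OF Sbd] in auto)
      have "B \<delta> \<le> (LINT x|lborel. indicator ?S x * (4 * e / \<delta>))"
        unfolding B_def set_lebesgue_integral_def
      proof (rule integral_mono[OF iB[OF \<delta>(1), unfolded set_integrable_def] iS])
        fix x :: "'a \<times> real"
        show "indicator ?H x *\<^sub>R (step' (snd x / \<delta>) / \<delta> * k x) \<le> indicator ?S x * (4 * e / \<delta>)"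
        proof (cases "x \<in> ?H")
          case True
          then have xu: "x \<in> upper_ball" using half_ball_subset_upper_ball[of 1] by auto
          have "norm (fst x) \<le> norm x" by (simp add: norm_prod_def)
          then have n: "norm (fst x) \<le> 1" using xu by (simp add: mem_upper_ball)
          show ?thesis
          proof (cases "x \<in> ?S")
            case S: True
            then have "snd x < d" using \<delta> by (cases x) auto
            then have "step' (snd x / \<delta>) * k x \<le> 4 * e"
              using step'_bounds[of "snd x / \<delta>"] ke[OF xu] e
              by (meson mult_left_mono mult_right_mono less_imp_le order_trans)
            then show ?thesis using S True \<delta> by (simp add: divide_right_mono)
          next
            case False
            then have "snd x / \<delta> \<le> 1 \<or> 2 \<le> snd x / \<delta>"
              using n \<delta> by (cases x) (auto simp: field_simps)
            then have "step' (snd x / \<delta>) = 0" using step_le_1 step_ge_2 by blast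
            then show ?thesis using False by simp
          qed
        qed (use \<delta> e in simp)
      qed
      also have "\<dots> = measure lborel ?S * (4 * e / \<delta>)"
        using Sm by simp
      also have "\<dots> = 4 * e * c" using \<delta> by (simp add: mS)
      finally show ?thesis .
    qed
    then show ?thesis using d(1) by (intro exI[of _ "d / 2"]) auto
  qed
  let ?\<delta> = "\<lambda>n. inverse (real (Suc n))"
  have lim: "(\<lambda>n. A (?\<delta> n)) \<longlonglongrightarrow> (LINT x:?H|lborel. ?T x)"
    unfolding A_def set_lebesgue_integral_def
  proof (rule integral_dominated_convergence[where w="\<lambda>x. \<bar>indicator ?H x *\<^sub>R ?T x\<bar>"])
    show "integrable lborel (\<lambda>x. \<bar>indicator ?H x *\<^sub>R ?T x\<bar>)"
      using iT unfolding set_integrable_def by (rule integrable_abs)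
    show "(\<lambda>x. indicator ?H x *\<^sub>R ?T x) \<in> borel_measurable lborel"
      using iT unfolding set_integrable_def by (rule borel_measurable_integrable)
    show "(\<lambda>x. indicator ?H x *\<^sub>R (step (snd x / ?\<delta> n) * ?T x)) \<in> borel_measurable lborel" for n
      using iA[of "?\<delta> n"] unfolding set_integrable_def by (intro borel_measurable_integrable) simp
    show "AE x in lborel. norm (indicator ?H x *\<^sub>R (step (snd x / ?\<delta> n) * ?T x)) \<le> \<bar>indicator ?H x *\<^sub>R ?T x\<bar>" for n
      using step_bounds by (intro AE_I2) (auto simp: abs_mult mult_left_le_one_le split: split_indicator)
    show "AE x in lborel. (\<lambda>n. indicator ?H x *\<^sub>R (step (snd x / ?\<delta> n) * ?T x)) \<longlonglongrightarrow> indicator ?H x *\<^sub>R ?T x"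
    proof (rule AE_I2)
      fix x :: "'a \<times> real"
      show "(\<lambda>n. indicator ?H x *\<^sub>R (step (snd x / ?\<delta> n) * ?T x)) \<longlonglongrightarrow> indicator ?H x *\<^sub>R ?T x"
      proof (cases "x \<in> ?H")
        case True
        then have "0 < snd x / 2" by (simp add: half_ball_def)
        then have "\<forall>\<^sub>F n in sequentially. ?\<delta> n < snd x / 2"
          using order_tendstoD(2)[OF LIMSEQ_inverse_real_of_nat] by blast
        then have "\<forall>\<^sub>F n in sequentially. step (snd x / ?\<delta> n) = 1"
        proof eventually_elim
          case (elim n)
          then have "2 \<le> snd x / ?\<delta> n" by (subst pos_le_divide_eq) auto
          then show ?case by (rule step_ge_2)
        qed
        then have "\<forall>\<^sub>F n in sequentially. indicator ?H x *\<^sub>R (step (snd x / ?\<delta> n) * ?T x) = indicator ?H x *\<^sub>R ?T x"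
          by eventually_elim simp
        then show ?thesis by (rule tendsto_eventually)
      qed simp
    qed
  qed
  have lower: "- (4 * e * c) \<le> (LINT x:?H|lborel. ?T x)" if e: "0 < e" for e
  proof -
    obtain \<eta> where \<eta>: "0 < \<eta>" "\<And>\<delta>. 0 < \<delta> \<Longrightarrow> \<delta> < \<eta> \<Longrightarrow> B \<delta> \<le> 4 * e * c" using Bsmall[OF e] by blast
    have "\<forall>\<^sub>F n in sequentially. ?\<delta> n < \<eta>"
      using order_tendstoD(2)[OF LIMSEQ_inverse_real_of_nat \<eta>(1)] .
    then have "\<forall>\<^sub>F n in sequentially. - (4 * e * c) \<le> A (?\<delta> n)"
    proof eventually_elim
      case (elim n)
      have "0 < ?\<delta> n" by simp
      then show ?case using AB[of "?\<delta> n"] \<eta>(2)[of "?\<delta> n"] elim by linarith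
    qed
    then show ?thesis by (rule tendsto_lowerbound[OF lim]) simp
  qed
  have ge: "- e \<le> (LINT x:?H|lborel. ?T x)" if "0 < e" for e
  proof -
    have "- (4 * (e / (4 * (c + 1))) * c) \<le> (LINT x:?H|lborel. ?T x)"
      using that c by (intro lower) simp
    moreover have "4 * (e / (4 * (c + 1))) * c \<le> e"
      using that c by (simp add: field_simps)
    ultimately show ?thesis by linarith
  qed
  show "0 \<le> (LINT x:?H|lborel. ?T x)"
    by (rule field_le_epsilon) (use ge in force)
qed

text \<open>Trading the merely measurable \<open>f\<close> for its bound \<open>w\<close> makes
  every integrand continuous up to the thin ball, so that polar coordinates apply.\<close>

lemma weak_laplacian_upto_thin_ball_abs:
  fixes v :: "'a::euclidean_space \<times> real \<Rightarrow> real"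
  assumes v: "C1_upper v V" and weak: "weak_laplacian (half_ball 1) v f"
    and fm: "f \<in> borel_measurable borel" and fw: "AE x in lborel. x \<in> half_ball 1 \<longrightarrow> \<bar>f x\<bar> \<le> w x"
    and w: "continuous_on upper_ball w" "\<And>x. x \<in> upper_ball \<Longrightarrow> w x \<le> F"
    and \<phi>: "C1_upper \<phi> \<Phi>" and R: "0 \<le> R" "R < 1"
    and zero: "\<And>x. x \<in> upper_ball \<Longrightarrow> R \<le> norm x \<Longrightarrow> \<phi> x = 0 \<and> \<Phi> x = 0"
    and sign: "\<And>x. x \<in> thin_ball 1 \<Longrightarrow> (V x \<bullet> (0, 1)) * \<phi> x \<le> 0"
  shows "0 \<le> (LINT x:half_ball 1|lborel. V x \<bullet> \<Phi> x + w x * \<bar>\<phi> x\<bar>)"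
proof -
  have fK: "AE x in lborel. x \<in> half_ball 1 \<longrightarrow> \<bar>f x\<bar> \<le> F"
    using fw by eventually_elim (use w(2) half_ball_subset_upper_ball[of 1] in force)
  note * = weak_laplacian_upto_thin_ball[OF v weak fm fK \<phi> R zero sign]
  note c = C1_upperD(1,2)[OF v] C1_upperD(1,2)[OF \<phi>]
  have iV: "set_integrable lborel (half_ball 1) (\<lambda>x. V x \<bullet> \<Phi> x)"
    by (rule integrable_half_ball_vanishing(1)[OF _ R(2)]) (use zero in \<open>auto intro!: continuous_intros c\<close>)
  have "continuous_on upper_ball (\<lambda>x. V x \<bullet> \<Phi> x + w x * \<bar>\<phi> x\<bar>)"
    by (intro continuous_intros c w)
  then have iW: "set_integrable lborel (half_ball 1) (\<lambda>x. V x \<bullet> \<Phi> x + w x * \<bar>\<phi> x\<bar>)"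
    by (rule integrable_half_ball_vanishing(1)[OF _ R(2)]) (use zero in auto)
  have "0 \<le> (LINT x:half_ball 1|lborel. V x \<bullet> \<Phi> x + f x * \<phi> x)" using * by blast
  also have "\<dots> \<le> (LINT x:half_ball 1|lborel. V x \<bullet> \<Phi> x + w x * \<bar>\<phi> x\<bar>)"
  proof (rule set_integral_mono_AE[OF set_integral_add(1)[OF iV] iW])
    show "set_integrable lborel (half_ball 1) (\<lambda>x. f x * \<phi> x)" using * by blast
    show "AE x\<in>half_ball 1 in lborel. V x \<bullet> \<Phi> x + f x * \<phi> x \<le> V x \<bullet> \<Phi> x + w x * \<bar>\<phi> x\<bar>"
      using fw
    proof (eventually_elim, intro impI)
      fix x assume "x \<in> half_ball 1 \<longrightarrow> \<bar>f x\<bar> \<le> w x" "x \<in> half_ball 1"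
      then have "\<bar>f x\<bar> * \<bar>\<phi> x\<bar> \<le> w x * \<bar>\<phi> x\<bar>" by (intro mult_right_mono) auto
      moreover have "f x * \<phi> x \<le> \<bar>f x\<bar> * \<bar>\<phi> x\<bar>" by (metis abs_ge_self abs_mult)
      ultimately show "V x \<bullet> \<Phi> x + f x * \<phi> x \<le> V x \<bullet> \<Phi> x + w x * \<bar>\<phi> x\<bar>" by linarith
    qed
  qed
  finally show ?thesis .
qed

section \<open>Green's formula on half balls, by shrinking radial cutoffs\<close>

text \<open>The factor of \<open>P\<close> is 1 up to radius \<open>r\<close> and 0 at
  \<open>R\<close>; the factor of \<open>S\<close> is minus its derivative and has integral 1 over
  the shell between them. As \<open>R\<close> decreases to \<open>r\<close>, the hypothesis
  therefore concentrates to the claim.\<close>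

lemma radial_localization:
  fixes P S :: "real \<Rightarrow> real"
  assumes r: "0 < r" "r < R\<^sub>0" and P: "continuous_on {0..R\<^sub>0} P" and S: "continuous_on {0..R\<^sub>0} S"
    and H: "\<And>R. r < R \<Longrightarrow> R < R\<^sub>0 \<Longrightarrow>
      0 \<le> integral {0..R} (\<lambda>\<rho>. (1 - step (1 + (\<rho>\<^sup>2 - r\<^sup>2) / (R\<^sup>2 - r\<^sup>2))) * P \<rho>
        - (2 * \<rho> / (R\<^sup>2 - r\<^sup>2) * step' (1 + (\<rho>\<^sup>2 - r\<^sup>2) / (R\<^sup>2 - r\<^sup>2))) * S \<rho>)"
  shows "S r \<le> integral {0..r} P"
proof (rule field_le_epsilon)
  fix e :: real assume e: "0 < e"
  have "compact (P ` {0..R\<^sub>0})" by (intro compact_continuous_image P) simp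
  then obtain C where C: "\<And>\<rho>. \<rho> \<in> {0..R\<^sub>0} \<Longrightarrow> norm (P \<rho>) \<le> C"
    using compact_imp_bounded bounded_iff by (metis image_eqI)
  have C0: "0 \<le> C" using C[of 0] r by (auto intro: order_trans[OF norm_ge_zero])
  obtain d where d: "0 < d" "\<And>\<rho>. \<rho> \<in> {0..R\<^sub>0} \<Longrightarrow> dist \<rho> r < d \<Longrightarrow> dist (S \<rho>) (S r) < e / 2"
    using S r e unfolding continuous_on_iff by (metis atLeastAtMost_iff half_gt_zero less_imp_le)
  \<comment> \<open>Three demands on the width of the shell: \<open>S\<close> varies there by less
    than \<open>e / 2\<close>, the shell stays below \<open>R\<^sub>0\<close>, and \<open>P\<close>,
    bounded by \<open>C\<close>, contributes at most \<open>e / 2\<close>.\<close>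
  define \<mu> where "\<mu> = min (min (d / 2) ((R\<^sub>0 - r) / 2)) (e / (2 * (C + 1)))"
  have "0 < \<mu>" using r d(1) e C0 by (simp add: \<mu>_def)
  moreover have "\<mu> \<le> d / 2" "\<mu> \<le> (R\<^sub>0 - r) / 2" "\<mu> \<le> e / (2 * (C + 1))"
    by (simp_all only: \<mu>_def min_le_iff_disj order_refl simp_thms)
  ultimately have \<mu>: "0 < \<mu>" "\<mu> \<le> d / 2" "\<mu> \<le> (R\<^sub>0 - r) / 2" "\<mu> \<le> e / (2 * (C + 1))" .
  define R where "R = r + \<mu>"
  have R: "r < R" "R < R\<^sub>0" "R - r < d" using \<mu> r d by (auto simp: R_def)
  have RC: "(R - r) * C \<le> e / 2"
  proof -
    have "R - r \<le> e / (2 * (C + 1))" using \<mu>(4) by (simp add: R_def)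
    then have "(R - r) * C \<le> e / (2 * (C + 1)) * C" using C0 by (rule mult_right_mono)
    also have "\<dots> \<le> e / 2" using C0 e by (simp add: field_simps)
    finally show ?thesis .
  qed
  define \<epsilon> where "\<epsilon> = R\<^sup>2 - r\<^sup>2"
  have \<epsilon>: "0 < \<epsilon>" using R r by (simp add: \<epsilon>_def power_strict_mono)
  define a where "a \<rho> = step (1 + (\<rho>\<^sup>2 - r\<^sup>2) / \<epsilon>)" for \<rho>
  define b where "b \<rho> = 2 * \<rho> / \<epsilon> * step' (1 + (\<rho>\<^sup>2 - r\<^sup>2) / \<epsilon>)" for \<rho>
  have ac: "continuous_on X a" for X
    unfolding a_def[abs_def] using \<epsilon> by (intro continuous_on_compose2[OF continuous_on_step[of UNIV]] continuous_intros) auto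
  have bc: "continuous_on X b" for X
    unfolding b_def[abs_def] using \<epsilon> by (intro continuous_intros continuous_on_compose2[OF continuous_on_step'[of UNIV]]) auto
  have ab: "(a has_real_derivative b \<rho>) (at \<rho>)" for \<rho>
  proof -
    have "((\<lambda>\<rho>. 1 + (\<rho>\<^sup>2 - r\<^sup>2) / \<epsilon>) has_real_derivative 2 * \<rho> / \<epsilon>) (at \<rho>)"
      using \<epsilon> by (auto intro!: derivative_eq_intros)
    from DERIV_chain2[OF step_DERIV this] show ?thesis
      by (simp add: a_def[abs_def] b_def mult.commute)
  qed
  have low: "a \<rho> = 0" "b \<rho> = 0" if "0 \<le> \<rho>" "\<rho> \<le> r" for \<rho>
  proof -
    have "\<rho>\<^sup>2 \<le> r\<^sup>2" using that by (simp add: power_mono)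
    then have "1 + (\<rho>\<^sup>2 - r\<^sup>2) / \<epsilon> \<le> 1" using \<epsilon> by (simp add: divide_nonpos_pos)
    then show "a \<rho> = 0" "b \<rho> = 0" by (simp_all add: a_def b_def step_le_1)
  qed
  have b0: "0 \<le> b \<rho>" if "0 \<le> \<rho>" for \<rho>
    using that \<epsilon> step'_bounds by (simp add: b_def)
  have a01: "0 \<le> a \<rho>" "a \<rho> \<le> 1" for \<rho> by (simp_all add: a_def step_bounds)
  let ?f = "\<lambda>\<rho>. (1 - a \<rho>) * P \<rho> - b \<rho> * S \<rho>"
  have fc: "continuous_on {0..R} ?f"
    using R by (intro continuous_intros ac bc continuous_on_subset[OF P] continuous_on_subset[OF S]) auto
  have intf: "?f integrable_on {0..R}" by (rule integrable_continuous_real[OF fc])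
  have "0 \<le> integral {0..R} ?f" using H[OF R(1,2)] by (simp add: a_def b_def \<epsilon>_def)
  also have "\<dots> = integral {0..r} ?f + integral {r..R} ?f"
    using R r intf by (intro Henstock_Kurzweil_Integration.integral_combine[symmetric]) auto
  also have "integral {0..r} ?f = integral {0..r} P"
    by (rule Henstock_Kurzweil_Integration.integral_cong) (simp add: low)
  also have "integral {r..R} ?f \<le> integral {r..R} (\<lambda>\<rho>. C + b \<rho> * (e / 2 - S r))"
  proof (rule integral_le)
    show "?f integrable_on {r..R}" using r by (intro integrable_continuous_real continuous_on_subset[OF fc]) auto
    show "(\<lambda>\<rho>. C + b \<rho> * (e / 2 - S r)) integrable_on {r..R}"
      by (intro integrable_continuous_real continuous_intros bc)
    fix \<rho> assume \<rho>: "\<rho> \<in> {r..R}"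
    have "(1 - a \<rho>) * P \<rho> \<le> \<bar>(1 - a \<rho>) * P \<rho>\<bar>" by simp
    also have "\<dots> \<le> 1 * C"
      unfolding abs_mult using a01[of \<rho>] C[of \<rho>] \<rho> R r by (intro mult_mono) auto
    finally have 1: "(1 - a \<rho>) * P \<rho> \<le> C" by simp
    have "dist (S \<rho>) (S r) < e / 2" using \<rho> R r by (intro d(2)) (auto simp: dist_real_def)
    then have "S r - e / 2 \<le> S \<rho>" unfolding dist_real_def by linarith
    then have "b \<rho> * (S r - e / 2) \<le> b \<rho> * S \<rho>" using b0[of \<rho>] \<rho> r by (intro mult_left_mono) auto
    then show "?f \<rho> \<le> C + b \<rho> * (e / 2 - S r)" using 1 by (simp add: algebra_simps)
  qed
  also have "\<dots> = (R - r) * C + (e / 2 - S r)"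
  proof -
    have "(b has_integral (a R - a r)) {r..R}"
      using R ab by (intro fundamental_theorem_of_calculus) (auto simp: has_real_derivative_iff_has_vector_derivative[symmetric] intro: has_field_derivative_at_within)
    moreover have "a R = 1" using \<epsilon> by (simp add: a_def \<epsilon>_def step_ge_2)
    moreover have "a r = 0" using r by (intro low) auto
    ultimately have "(b has_integral 1) {r..R}" by simp
    then have "((\<lambda>\<rho>. C + b \<rho> * (e / 2 - S r)) has_integral ((R - r) *\<^sub>R C + 1 * (e / 2 - S r))) {r..R}"
      using R has_integral_const_real[of C r R] by (intro has_integral_add has_integral_mult_left) auto
    then show ?thesis by (simp add: integral_unique)
  qed
  finally show "S r \<le> integral {0..r} P + e" using RC by simp
qed

text \<open>The squared norm keeps the cutoff differentiable at the origin. Its gradient is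
  \<open>- radial_cutoff' r \<epsilon> x *\<^sub>R x\<close>, with the vector \<open>x\<close> in
  place of the unit normal. The transition takes place where the squared norm lies between
  \<open>r\<^sup>2\<close> and \<open>r\<^sup>2 + \<epsilon>\<close>.\<close>

definition radial_cutoff :: "real \<Rightarrow> real \<Rightarrow> 'b::euclidean_space \<Rightarrow> real" where
  "radial_cutoff r \<epsilon> x = 1 - step (1 + ((norm x)\<^sup>2 - r\<^sup>2) / \<epsilon>)"

definition radial_cutoff' :: "real \<Rightarrow> real \<Rightarrow> 'b::euclidean_space \<Rightarrow> real" where
  "radial_cutoff' r \<epsilon> x = 2 / \<epsilon> * step' (1 + ((norm x)\<^sup>2 - r\<^sup>2) / \<epsilon>)"

lemma continuous_on_radial_cutoff:
  assumes "0 < \<epsilon>"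
  shows "continuous_on A (radial_cutoff r \<epsilon>)" "continuous_on A (radial_cutoff' r \<epsilon>)"
  unfolding radial_cutoff_def[abs_def] radial_cutoff'_def[abs_def] using assms
  by (intro continuous_intros continuous_on_compose2[OF continuous_on_step[of UNIV]]
      continuous_on_compose2[OF continuous_on_step'[of UNIV]]; simp)+

lemma C1_upper_radial_cutoff:
  assumes "0 < \<epsilon>"
  shows "C1_upper (radial_cutoff r \<epsilon>) (\<lambda>x. - radial_cutoff' r \<epsilon> x *\<^sub>R x)"
proof (rule C1_upperI)
  fix x :: "'a \<times> real"
  have "((\<lambda>x :: 'a \<times> real. step (1 + (x \<bullet> x - r\<^sup>2) / \<epsilon>)) has_derivative
      (\<lambda>h. step' (1 + (x \<bullet> x - r\<^sup>2) / \<epsilon>) * (2 * (x \<bullet> h) / \<epsilon>))) (at x)"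
    using assms by (intro DERIV_compose_FDERIV[OF step_DERIV, THEN has_derivative_eq_rhs])
      (auto intro!: derivative_eq_intros simp: inner_commute)
  then show "(radial_cutoff r \<epsilon> has_derivative (\<lambda>h. (- radial_cutoff' r \<epsilon> x *\<^sub>R x) \<bullet> h)) (at x)"
    unfolding radial_cutoff_def[abs_def] radial_cutoff'_def power2_norm_eq_inner
    by (auto intro!: derivative_eq_intros simp: mult_ac)
qed (use assms in \<open>intro continuous_intros continuous_on_radial_cutoff; simp\<close>)

lemma radial_cutoff_zero:
  assumes "0 < \<epsilon>" "r\<^sup>2 + \<epsilon> \<le> (norm x)\<^sup>2"
  shows "radial_cutoff r \<epsilon> x = 0" "radial_cutoff' r \<epsilon> x = 0"
proof -
  have "2 \<le> 1 + ((norm x)\<^sup>2 - r\<^sup>2) / \<epsilon>" using assms by (simp add: field_simps)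
  then show "radial_cutoff r \<epsilon> x = 0" "radial_cutoff' r \<epsilon> x = 0"
    by (simp_all add: radial_cutoff_def radial_cutoff'_def step_ge_2)
qed

lemma radial_cutoff_nonneg: "0 \<le> radial_cutoff r \<epsilon> x"
  by (simp add: radial_cutoff_def step_bounds)

text \<open>The exponent \<open>DIM('a) - 1\<close> is one less than that of the Jacobian because
  the radial derivative of the cutoff is, up to sign, \<open>\<rho>\<close> times
  \<open>radial_cutoff'\<close>: one factor \<open>\<rho>\<close> is spent on forming this
  derivative.\<close>

lemma half_ball_localization:
  fixes w s :: "'a::euclidean_space \<times> real \<Rightarrow> real"
  assumes w: "continuous_on upper_ball w" and s: "continuous_on upper_ball s" and r: "0 < r" "r < 1"
    and H: "\<And>\<epsilon>. 0 < \<epsilon> \<Longrightarrow> r\<^sup>2 + \<epsilon> < 1 \<Longrightarrow>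
      0 \<le> (LINT x:half_ball 1|lborel. radial_cutoff r \<epsilon> x * w x - radial_cutoff' r \<epsilon> x * s x)"
  shows "r ^ (DIM('a) - 1) * hemi_int s r \<le> (LINT x:half_ball r|lborel. w x)"
proof -
  let ?d = "DIM('a)"
  define P where "P \<rho> = \<rho> ^ ?d * hemi_int w \<rho>" for \<rho>
  define S where "S \<rho> = \<rho> ^ (?d - 1) * hemi_int s \<rho>" for \<rho>
  define R\<^sub>0 where "R\<^sub>0 = (r + 1) / 2"
  have R0: "r < R\<^sub>0" "R\<^sub>0 < 1" using r by (auto simp: R\<^sub>0_def)
  have Pc: "continuous_on {0..R\<^sub>0} P" and Sc: "continuous_on {0..R\<^sub>0} S"
    unfolding P_def[abs_def] S_def[abs_def]
    by (intro continuous_intros continuous_on_hemi_int w s R0)+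
  have "S r \<le> integral {0..r} P"
  proof (rule radial_localization[OF r(1) R0(1) Pc Sc])
    fix R assume R: "r < R" "R < R\<^sub>0"
    let ?\<epsilon> = "R\<^sup>2 - r\<^sup>2"
    have \<epsilon>: "0 < ?\<epsilon>" using R r by (simp add: power_strict_mono)
    have R1: "R\<^sup>2 < 1" using R R0 r by (simp add: power_less_one_iff abs_square_less_1)
    let ?g = "\<lambda>x :: 'a \<times> real. radial_cutoff r ?\<epsilon> x * w x - radial_cutoff' r ?\<epsilon> x * s x"
    have gc: "continuous_on upper_ball ?g"
      by (intro continuous_intros continuous_on_radial_cutoff \<epsilon> w s)
    have "0 \<le> (LINT x:half_ball 1|lborel. ?g x)" using H[OF \<epsilon>] R1 by simp
    also have "\<dots> = (LINT x:half_ball R|lborel. ?g x)"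
      unfolding set_lebesgue_integral_def
    proof (intro Bochner_Integration.integral_cong refl)
      fix x :: "'a \<times> real"
      have "?g x = 0" if "R \<le> norm x"
      proof -
        have "R\<^sup>2 \<le> (norm x)\<^sup>2" using that R r by (intro power_mono) auto
        then show ?thesis using radial_cutoff_zero[OF \<epsilon>, of r x] by simp
      qed
      then show "indicator (half_ball 1) x *\<^sub>R ?g x = indicator (half_ball R) x *\<^sub>R ?g x"
        using R R0 by (cases "R \<le> norm x") (auto simp: half_ball_def split: split_indicator)
    qed
    also have "\<dots> = integral {0..R} (\<lambda>\<rho>. \<rho> ^ ?d * hemi_int ?g \<rho>)"
      by (rule polar_half_ball[OF gc]) (use R R0 r in auto)
    also have "\<dots> = integral {0..R} (\<lambda>\<rho>. (1 - step (1 + (\<rho>\<^sup>2 - r\<^sup>2) / ?\<epsilon>)) * P \<rho>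
        - (2 * \<rho> / ?\<epsilon> * step' (1 + (\<rho>\<^sup>2 - r\<^sup>2) / ?\<epsilon>)) * S \<rho>)"
    proof (rule Henstock_Kurzweil_Integration.integral_cong)
      fix \<rho> assume "\<rho> \<in> {0..R}"
      then have \<rho>: "0 \<le> \<rho>" "\<rho> < 1" using R R0 by auto
      let ?a = "1 - step (1 + (\<rho>\<^sup>2 - r\<^sup>2) / ?\<epsilon>)" and ?b = "2 / ?\<epsilon> * step' (1 + (\<rho>\<^sup>2 - r\<^sup>2) / ?\<epsilon>)"
      have lin: "hemi_int (\<lambda>x. a * w x - b * s x) \<rho> = a * hemi_int w \<rho> - b * hemi_int s \<rho>" for a b
        using \<rho> by (subst hemi_int_diff) (auto intro!: continuous_intros w s simp: hemi_int_cmult)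
      have "hemi_int ?g \<rho> = hemi_int (\<lambda>x. ?a * w x - ?b * s x) \<rho>"
        by (rule hemi_int_cong) (use \<rho> in \<open>auto simp: radial_cutoff_def radial_cutoff'_def\<close>)
      also have "\<dots> = ?a * hemi_int w \<rho> - ?b * hemi_int s \<rho>"
        by (rule lin)
      finally have eq: "hemi_int ?g \<rho> = ?a * hemi_int w \<rho> - ?b * hemi_int s \<rho>" .
      have "\<rho> ^ ?d = \<rho> * \<rho> ^ (?d - 1)" by (metis DIM_positive power_minus_mult mult.commute)
      then show "\<rho> ^ ?d * hemi_int ?g \<rho> = ?a * P \<rho> - (2 * \<rho> / ?\<epsilon> * step' (1 + (\<rho>\<^sup>2 - r\<^sup>2) / ?\<epsilon>)) * S \<rho>"
        unfolding eq P_def S_def by (simp add: algebra_simps)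
    qed
    finally show "0 \<le> integral {0..R} (\<lambda>\<rho>. (1 - step (1 + (\<rho>\<^sup>2 - r\<^sup>2) / ?\<epsilon>)) * P \<rho>
        - (2 * \<rho> / ?\<epsilon> * step' (1 + (\<rho>\<^sup>2 - r\<^sup>2) / ?\<epsilon>)) * S \<rho>)" .
  qed
  then show ?thesis
    unfolding polar_half_ball[OF w r] S_def P_def .
qed

text \<open>One-sided Green formula. On the sphere \<open>V x \<bullet> x\<close> is
  \<open>r\<close> times the outward normal derivative of \<open>v\<close>, so the left-hand side is
  the integral of \<open>\<phi>\<close> times that derivative over the curved part of the boundary;
  the flat part is dropped by its sign. Where the sign expression vanishes, \<open>\<phi>\<close>
  and its negative together give both directions.\<close>

lemma flux_le:
  fixes v :: "'a::euclidean_space \<times> real \<Rightarrow> real"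
  assumes v: "C1_upper v V" and weak: "weak_laplacian (half_ball 1) v f"
    and fm: "f \<in> borel_measurable borel" and fw: "AE x in lborel. x \<in> half_ball 1 \<longrightarrow> \<bar>f x\<bar> \<le> w x"
    and w: "continuous_on upper_ball w" "\<And>x. x \<in> upper_ball \<Longrightarrow> w x \<le> F"
    and \<phi>: "C1_upper \<phi> \<Phi>" and r: "0 < r" "r < 1"
    and sign: "\<And>x. x \<in> thin_ball 1 \<Longrightarrow> (V x \<bullet> (0, 1)) * \<phi> x \<le> 0"
  shows "r ^ (DIM('a) - 1) * hemi_int (\<lambda>x. \<phi> x * (V x \<bullet> x)) r
    \<le> (LINT x:half_ball r|lborel. V x \<bullet> \<Phi> x + w x * \<bar>\<phi> x\<bar>)"
proof (rule half_ball_localization[OF _ _ r])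
  note c = C1_upperD(1,2)[OF v] C1_upperD(1,2)[OF \<phi>]
  show "continuous_on upper_ball (\<lambda>x. V x \<bullet> \<Phi> x + w x * \<bar>\<phi> x\<bar>)" "continuous_on upper_ball (\<lambda>x. \<phi> x * (V x \<bullet> x))"
    by (intro continuous_intros c w)+
  fix \<epsilon> :: real assume \<epsilon>: "0 < \<epsilon>" "r\<^sup>2 + \<epsilon> < 1"
  let ?\<omega> = "radial_cutoff r \<epsilon> :: 'a \<times> real \<Rightarrow> real" and ?b = "radial_cutoff' r \<epsilon> :: 'a \<times> real \<Rightarrow> real"
  have C: "C1_upper (\<lambda>x. ?\<omega> x * \<phi> x) (\<lambda>x. ?\<omega> x *\<^sub>R \<Phi> x + \<phi> x *\<^sub>R (- ?b x *\<^sub>R x))"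
    by (rule C1_upper_mult[OF C1_upper_radial_cutoff[OF \<epsilon>(1)] \<phi>])
  have "0 \<le> (LINT x:half_ball 1|lborel. V x \<bullet> (?\<omega> x *\<^sub>R \<Phi> x + \<phi> x *\<^sub>R (- ?b x *\<^sub>R x)) + w x * \<bar>?\<omega> x * \<phi> x\<bar>)"
  proof (rule weak_laplacian_upto_thin_ball_abs[OF v weak fm fw w C])
    show "0 \<le> sqrt (r\<^sup>2 + \<epsilon>)" "sqrt (r\<^sup>2 + \<epsilon>) < 1" using \<epsilon> by auto
    show "?\<omega> x * \<phi> x = 0 \<and> ?\<omega> x *\<^sub>R \<Phi> x + \<phi> x *\<^sub>R (- ?b x *\<^sub>R x) = 0" if "sqrt (r\<^sup>2 + \<epsilon>) \<le> norm x" for x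
      using radial_cutoff_zero[OF \<epsilon>(1), of r x] sqrt_le_D[OF that] by simp
    show "(V x \<bullet> (0, 1)) * (?\<omega> x * \<phi> x) \<le> 0" if "x \<in> thin_ball 1" for x
      using mult_left_mono[OF sign[OF that] radial_cutoff_nonneg[of r \<epsilon> x]] by (simp add: mult_ac)
  qed
  also have "\<dots> = (LINT x:half_ball 1|lborel. ?\<omega> x * (V x \<bullet> \<Phi> x + w x * \<bar>\<phi> x\<bar>) - ?b x * (\<phi> x * (V x \<bullet> x)))"
  proof (rule set_lebesgue_integral_cong, simp, intro allI impI)
    fix x :: "'a \<times> real"
    have "\<bar>?\<omega> x * \<phi> x\<bar> = ?\<omega> x * \<bar>\<phi> x\<bar>" using radial_cutoff_nonneg[of r \<epsilon> x] by (simp add: abs_mult)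
    then show "V x \<bullet> (?\<omega> x *\<^sub>R \<Phi> x + \<phi> x *\<^sub>R (- ?b x *\<^sub>R x)) + w x * \<bar>?\<omega> x * \<phi> x\<bar>
        = ?\<omega> x * (V x \<bullet> \<Phi> x + w x * \<bar>\<phi> x\<bar>) - ?b x * (\<phi> x * (V x \<bullet> x))"
      by (simp add: inner_add_right algebra_simps)
  qed
  finally show "0 \<le> (LINT x:half_ball 1|lborel. ?\<omega> x * (V x \<bullet> \<Phi> x + w x * \<bar>\<phi> x\<bar>) - ?b x * (\<phi> x * (V x \<bullet> x)))" .
qed

section \<open>Homogeneous extensions\<close>

text \<open>At the origin \<open>r / norm x\<close> is 0 by convention, but for positive
  \<open>\<kappa>\<close> the first factor vanishes there, so the value is the 0 that homogeneity
  requires.\<close>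

definition homog_ext :: "nat \<Rightarrow> real \<Rightarrow> ('b::euclidean_space \<Rightarrow> real) \<Rightarrow> 'b \<Rightarrow> real" where
  "homog_ext \<kappa> r u x = (norm x / r) ^ \<kappa> * u ((r / norm x) *\<^sub>R x)"

text \<open>The radial component is dictated by homogeneity; the tangential one is the tangential
  part of \<open>U\<close> at the projected point \<open>y\<close>, rescaled.\<close>

definition homog_ext_grad :: "nat \<Rightarrow> real \<Rightarrow> ('b::euclidean_space \<Rightarrow> real) \<Rightarrow> ('b \<Rightarrow> 'b) \<Rightarrow> 'b \<Rightarrow> 'b" where
  "homog_ext_grad \<kappa> r u U x = (let y = (r / norm x) *\<^sub>R x in (norm x / r) ^ \<kappa> *\<^sub>R
     ((real \<kappa> * u y / (norm x)\<^sup>2) *\<^sub>R x + (r / norm x) *\<^sub>R (U y - ((U y \<bullet> x) / (norm x)\<^sup>2) *\<^sub>R x)))"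

lemma has_derivative_homog_ext:
  fixes u :: "'b::euclidean_space \<Rightarrow> real"
  assumes x: "x \<noteq> 0" and r: "0 < r" and \<kappa>: "1 \<le> \<kappa>"
    and u: "(u has_derivative (\<lambda>h. U ((r / norm x) *\<^sub>R x) \<bullet> h)) (at ((r / norm x) *\<^sub>R x))"
  shows "(homog_ext \<kappa> r u has_derivative (\<lambda>h. homog_ext_grad \<kappa> r u U x \<bullet> h)) (at x)"
proof -
  let ?n = "norm x" and ?y = "\<lambda>x. (r / norm x) *\<^sub>R x"
  have n: "0 < ?n" using x by simp
  have dN: "(norm has_derivative (\<lambda>h. (x \<bullet> h) / ?n)) (at x)"
    using has_derivative_norm[OF x] by (simp add: sgn_div_norm inner_commute divide_inverse mult.commute)
  have dinv: "((\<lambda>x. r / norm x) has_derivative (\<lambda>h. - (r * ((x \<bullet> h) / ?n) / (?n * ?n)))) (at x)"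
    using n by (auto intro!: derivative_eq_intros dN)
  have dy: "(?y has_derivative (\<lambda>h. (r / ?n) *\<^sub>R h + (- (r * ((x \<bullet> h) / ?n) / (?n * ?n))) *\<^sub>R x)) (at x)"
    by (rule has_derivative_scaleR[OF dinv has_derivative_ident])
  have duy: "((\<lambda>x. u (?y x)) has_derivative (\<lambda>h. U (?y x) \<bullet> ((r / ?n) *\<^sub>R h + (- (r * ((x \<bullet> h) / ?n) / (?n * ?n))) *\<^sub>R x))) (at x)"
    by (rule has_derivative_compose[OF dy u])
  have dp: "((\<lambda>x. (norm x / r) ^ \<kappa>) has_derivative (\<lambda>h. real \<kappa> * ((x \<bullet> h) / ?n / r) * (?n / r) ^ (\<kappa> - 1))) (at x)"
    using r by (auto intro!: derivative_eq_intros dN)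
  have pk: "(?n / r) ^ \<kappa> = ?n / r * (?n / r) ^ (\<kappa> - 1)"
    using \<kappa> by (cases \<kappa>) auto
  have "(homog_ext \<kappa> r u has_derivative (\<lambda>h. (?n / r) ^ \<kappa> * (U (?y x) \<bullet> ((r / ?n) *\<^sub>R h + (- (r * ((x \<bullet> h) / ?n) / (?n * ?n))) *\<^sub>R x))
      + real \<kappa> * ((x \<bullet> h) / ?n / r) * (?n / r) ^ (\<kappa> - 1) * u (?y x))) (at x)"
    unfolding homog_ext_def[abs_def] by (rule has_derivative_mult[OF dp duy])
  moreover have "(?n / r) ^ \<kappa> * (U (?y x) \<bullet> ((r / ?n) *\<^sub>R h + (- (r * ((x \<bullet> h) / ?n) / (?n * ?n))) *\<^sub>R x))
      + real \<kappa> * ((x \<bullet> h) / ?n / r) * (?n / r) ^ (\<kappa> - 1) * u (?y x) = homog_ext_grad \<kappa> r u U x \<bullet> h" for h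
  proof -
    define p where "p = (?n / r) ^ (\<kappa> - 1)"
    define Y where "Y = U (?y x)"
    define v where "v = u (?y x)"
    show ?thesis
      unfolding homog_ext_grad_def Let_def pk p_def[symmetric] Y_def[symmetric] v_def[symmetric]
      using n r
      by (simp add: inner_add_left inner_add_right inner_diff_left inner_diff_right power2_eq_square field_simps)
  qed
  ultimately show ?thesis by (simp only:)
qed

text \<open>Radial and tangential components are orthogonal. The squared radial derivative
  \<open>(U y \<bullet> y)\<^sup>2 / r\<^sup>2\<close> of \<open>u\<close> is replaced by the one of
  a homogeneous function with the same value; this is the source of \<open>radial_mean\<close> and
  \<open>height_mean\<close> in the energy comparison.\<close>

lemma inner_homog_ext_grad:
  fixes u :: "'b::euclidean_space \<Rightarrow> real"
  assumes x: "x \<noteq> 0" and r: "0 < r" and \<kappa>: "1 \<le> \<kappa>" and y: "y = (r / norm x) *\<^sub>R x"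
  shows "homog_ext_grad \<kappa> r u U x \<bullet> homog_ext_grad \<kappa> r u U x
    = (norm x / r) ^ (2 * \<kappa> - 2) * (U y \<bullet> U y - (U y \<bullet> y)\<^sup>2 / r\<^sup>2 + (real \<kappa>)\<^sup>2 * (u y)\<^sup>2 / r\<^sup>2)"
proof -
  let ?n = "norm x"
  have n: "0 < ?n" using x by simp
  define Y where "Y = U y"
  define v where "v = u y"
  define t where "t = Y \<bullet> x"
  have xx: "x \<bullet> x = ?n\<^sup>2" by (simp add: power2_norm_eq_inner)
  have Yy: "U y \<bullet> y = r / ?n * t" by (simp add: y Y_def[symmetric] t_def) (simp add: y Y_def t_def)
  have Z: "homog_ext_grad \<kappa> r u U x = (?n / r) ^ \<kappa> *\<^sub>R
     ((real \<kappa> * v / ?n\<^sup>2) *\<^sub>R x + (r / ?n) *\<^sub>R (Y - (t / ?n\<^sup>2) *\<^sub>R x))"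
    by (simp add: homog_ext_grad_def Let_def y Y_def v_def t_def)
  have expand: "(\<alpha> *\<^sub>R x + \<beta> *\<^sub>R (Y - \<gamma> *\<^sub>R x)) \<bullet> (\<alpha> *\<^sub>R x + \<beta> *\<^sub>R (Y - \<gamma> *\<^sub>R x))
      = \<alpha>\<^sup>2 * ?n\<^sup>2 + 2 * \<alpha> * \<beta> * (t - \<gamma> * ?n\<^sup>2) + \<beta>\<^sup>2 * (Y \<bullet> Y - 2 * \<gamma> * t + \<gamma>\<^sup>2 * ?n\<^sup>2)" for \<alpha> \<beta> \<gamma>
    unfolding xx[symmetric] t_def
    by (simp add: inner_add_left inner_add_right inner_diff_left inner_diff_right inner_commute[of x Y]
        power2_eq_square algebra_simps)
  have "(2 * \<kappa> - 2) + 2 = 2 * \<kappa>" using \<kappa> by simp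
  then have pw: "(?n / r) ^ \<kappa> * (?n / r) ^ \<kappa> = (?n / r) ^ (2 * \<kappa> - 2) * (?n / r)\<^sup>2"
    by (metis mult_2 power_add)
  have "homog_ext_grad \<kappa> r u U x \<bullet> homog_ext_grad \<kappa> r u U x = (?n / r) ^ \<kappa> * (?n / r) ^ \<kappa> *
      ((real \<kappa> * v / ?n\<^sup>2)\<^sup>2 * ?n\<^sup>2 + 2 * (real \<kappa> * v / ?n\<^sup>2) * (r / ?n) * (t - t / ?n\<^sup>2 * ?n\<^sup>2)
        + (r / ?n)\<^sup>2 * (Y \<bullet> Y - 2 * (t / ?n\<^sup>2) * t + (t / ?n\<^sup>2)\<^sup>2 * ?n\<^sup>2))"
    unfolding Z by (simp only: inner_scaleR_left inner_scaleR_right expand mult.assoc)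
  also have "\<dots> = (?n / r) ^ (2 * \<kappa> - 2) * ((?n / r)\<^sup>2 *
      ((real \<kappa> * v)\<^sup>2 / ?n\<^sup>2 + (r / ?n)\<^sup>2 * (Y \<bullet> Y - t\<^sup>2 / ?n\<^sup>2)))"
    unfolding pw using n by (simp add: power2_eq_square field_simps)
  also have "(?n / r)\<^sup>2 * ((real \<kappa> * v)\<^sup>2 / ?n\<^sup>2 + (r / ?n)\<^sup>2 * (Y \<bullet> Y - t\<^sup>2 / ?n\<^sup>2))
      = Y \<bullet> Y - (r / ?n * t)\<^sup>2 / r\<^sup>2 + (real \<kappa>)\<^sup>2 * v\<^sup>2 / r\<^sup>2"
    using n r by (simp add: power2_eq_square field_simps)
  finally show ?thesis by (simp only: Yy Y_def v_def)
qed

lemma norm_homog_ext_grad_le: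
  fixes u :: "'b::euclidean_space \<Rightarrow> real"
  assumes x: "x \<noteq> 0" and r: "0 < r" and \<kappa>: "2 \<le> \<kappa>" and y: "y = (r / norm x) *\<^sub>R x"
    and B: "\<bar>u y\<bar> \<le> B" "norm (U y) \<le> B"
  shows "norm (homog_ext_grad \<kappa> r u U x) \<le> norm x ^ (\<kappa> - 1) * ((B + (real \<kappa>) * B / r) / r ^ (\<kappa> - 1))"
proof -
  let ?Z = "homog_ext_grad \<kappa> r u U x"
  have B0: "0 \<le> B" using B(1) by linarith
  have "(norm ?Z)\<^sup>2 = ?Z \<bullet> ?Z" by (simp add: power2_norm_eq_inner)
  also have "\<dots> = (norm x / r) ^ (2 * \<kappa> - 2) * (U y \<bullet> U y - (U y \<bullet> y)\<^sup>2 / r\<^sup>2 + (real \<kappa>)\<^sup>2 * (u y)\<^sup>2 / r\<^sup>2)"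
    using \<kappa> by (intro inner_homog_ext_grad x r y) auto
  also have "\<dots> \<le> (norm x / r) ^ (2 * \<kappa> - 2) * (B\<^sup>2 + (real \<kappa>)\<^sup>2 * B\<^sup>2 / r\<^sup>2)"
  proof (intro mult_left_mono)
    have "U y \<bullet> U y \<le> B\<^sup>2"
      using power_mono[OF B(2) norm_ge_zero, of 2] by (simp add: power2_norm_eq_inner)
    moreover have "(u y)\<^sup>2 \<le> B\<^sup>2" using B(1) B0 by (metis abs_le_square_iff abs_of_nonneg)
    then have "(real \<kappa>)\<^sup>2 * (u y)\<^sup>2 / r\<^sup>2 \<le> (real \<kappa>)\<^sup>2 * B\<^sup>2 / r\<^sup>2"
      by (intro divide_right_mono mult_left_mono) auto
    moreover have "0 \<le> (U y \<bullet> y)\<^sup>2 / r\<^sup>2" by simp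
    ultimately show "U y \<bullet> U y - (U y \<bullet> y)\<^sup>2 / r\<^sup>2 + (real \<kappa>)\<^sup>2 * (u y)\<^sup>2 / r\<^sup>2 \<le> B\<^sup>2 + (real \<kappa>)\<^sup>2 * B\<^sup>2 / r\<^sup>2"
      by linarith
  qed (use r in simp)
  also have "\<dots> \<le> ((norm x / r) ^ (\<kappa> - 1) * (B + real \<kappa> * B / r))\<^sup>2"
  proof -
    have "2 * \<kappa> - 2 = (\<kappa> - 1) * 2" by simp
    then have "(norm x / r) ^ (2 * \<kappa> - 2) = ((norm x / r) ^ (\<kappa> - 1))\<^sup>2" by (simp only: power_mult)
    moreover have "B\<^sup>2 + (real \<kappa>)\<^sup>2 * B\<^sup>2 / r\<^sup>2 \<le> (B + real \<kappa> * B / r)\<^sup>2"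
      using B0 r by (simp add: power2_sum power_divide power_mult_distrib)
    ultimately show ?thesis by (simp only: power_mult_distrib) (intro mult_left_mono, auto)
  qed
  finally have "norm ?Z \<le> (norm x / r) ^ (\<kappa> - 1) * (B + real \<kappa> * B / r)"
    by (rule power2_le_imp_le) (use B0 r in simp)
  then show ?thesis by (simp add: power_divide)
qed

lemma continuous_on_puncture:
  fixes g :: "'b::real_normed_vector \<Rightarrow> 'c::real_normed_vector"
  assumes "continuous_on (X - {0}) g" "g 0 = 0" and "0 \<in> X"
    and b: "\<And>x. x \<in> X \<Longrightarrow> x \<noteq> 0 \<Longrightarrow> norm (g x) \<le> C * norm x"
  shows "continuous_on X g"
  unfolding continuous_on_eq_continuous_within
proof
  fix x assume x: "x \<in> X"
  show "continuous (at x within X) g"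
  proof (cases "x = 0")
    case True
    have "(g \<longlongrightarrow> 0) (at 0 within X)"
    proof (rule Lim_null_comparison)
      show "\<forall>\<^sub>F x in at 0 within X. norm (g x) \<le> C * norm x"
        using b by (auto simp: eventually_at_filter)
      show "((\<lambda>x. C * norm x) \<longlongrightarrow> 0) (at 0 within X)" by (auto intro!: tendsto_eq_intros)
    qed
    then show ?thesis using True assms(2) by (simp add: continuous_within)
  next
    case False
    have "continuous (at x within X - {0}) g"
      using assms(1) x False by (simp add: continuous_on_eq_continuous_within)
    moreover have "at x within X - {0} = at x within X"
      by (rule at_within_nhd[of _ "- {0}"]) (use False in auto)
    ultimately show ?thesis by simp
  qed
qed

text \<open>The origin, which lies on the thin ball, is the only delicate point. The gradient is
  there of size \<open>norm x ^ (\<kappa> - 1)\<close>, so \<open>2 \<le> \<kappa>\<close> makes it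
  continuous with value 0.\<close>

lemma C1_upper_homog_ext:
  fixes u :: "'a::euclidean_space \<times> real \<Rightarrow> real"
  assumes u: "C1_upper u U" and r: "0 < r" "r < 1" and \<kappa>: "2 \<le> \<kappa>"
  shows "C1_upper (homog_ext \<kappa> r u) (homog_ext_grad \<kappa> r u U)"
proof -
  obtain B\<^sub>1 where B1: "0 \<le> B\<^sub>1" "\<And>x. norm x \<le> r \<Longrightarrow> 0 \<le> snd x \<Longrightarrow> norm (u x) \<le> B\<^sub>1"
    using continuous_on_upper_ball_bounded[OF C1_upperD(1)[OF u] r(2)] by blast
  obtain B\<^sub>2 where B2: "0 \<le> B\<^sub>2" "\<And>x. norm x \<le> r \<Longrightarrow> 0 \<le> snd x \<Longrightarrow> norm (U x) \<le> B\<^sub>2"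
    using continuous_on_upper_ball_bounded[OF C1_upperD(2)[OF u] r(2)] by blast
  define B where "B = max B\<^sub>1 B\<^sub>2"
  have B: "\<bar>u y\<bar> \<le> B" "norm (U y) \<le> B" "0 \<le> B" if "norm y = r" "0 \<le> snd y" for y
    using B1 B2 that unfolding B_def by (auto simp: le_max_iff_disj)
  let ?y = "\<lambda>x. (r / norm x) *\<^sub>R x"
  have y: "norm (?y x) = r" "0 \<le> snd (?y x)" "?y x \<in> upper_ball" if "x \<in> upper_ball" "x \<noteq> 0" for x :: "'a \<times> real"
    using that r by (auto simp: mem_upper_ball simp del: scaleR_Pair)
  have yc: "continuous_on (upper_ball - {0}) ?y" by (intro continuous_intros) auto
  have uy: "continuous_on (upper_ball - {0}) (\<lambda>x. u (?y x))"
    by (rule continuous_on_compose2[OF C1_upperD(1)[OF u] yc]) (intro image_subsetI y(3), auto)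
  have Uy: "continuous_on (upper_ball - {0}) (\<lambda>x. U (?y x))"
    by (rule continuous_on_compose2[OF C1_upperD(2)[OF u] yc]) (intro image_subsetI y(3), auto)
  have 0: "(0 :: 'a \<times> real) \<in> upper_ball" by (simp add: mem_upper_ball)
  have small: "norm x ^ j \<le> norm x" if "x \<in> upper_ball" "1 \<le> j" for x :: "'a \<times> real" and j
    using that power_decreasing[of 1 j "norm x"] by (simp add: mem_upper_ball)
  show ?thesis
    unfolding C1_upper_def
  proof (intro conjI ballI)
    show "continuous_on upper_ball (homog_ext \<kappa> r u)"
    proof (rule continuous_on_puncture[OF _ _ 0, where C="B / r ^ \<kappa>"])
      show "continuous_on (upper_ball - {0}) (homog_ext \<kappa> r u)"
        unfolding homog_ext_def[abs_def] using r by (intro continuous_intros uy) auto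
      show "homog_ext \<kappa> r u 0 = 0" using \<kappa> by (simp add: homog_ext_def power_0_left)
      fix x :: "'a \<times> real" assume x: "x \<in> upper_ball" "x \<noteq> 0"
      have "norm (homog_ext \<kappa> r u x) = norm x ^ \<kappa> / r ^ \<kappa> * \<bar>u (?y x)\<bar>"
        using r by (simp add: homog_ext_def abs_mult power_abs power_divide)
      also have "\<dots> \<le> norm x / r ^ \<kappa> * B"
        using small[OF x(1), of \<kappa>] \<kappa> r B(1)[OF y(1,2)[OF x]]
        by (intro mult_mono divide_right_mono) auto
      finally show "norm (homog_ext \<kappa> r u x) \<le> B / r ^ \<kappa> * norm x" by (simp add: mult.commute)
    qed
    show "continuous_on upper_ball (homog_ext_grad \<kappa> r u U)"
    proof (rule continuous_on_puncture[OF _ _ 0, where C="(B + (real \<kappa>) * B / r) / r ^ (\<kappa> - 1)"])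
      show "continuous_on (upper_ball - {0}) (homog_ext_grad \<kappa> r u U)"
        unfolding homog_ext_grad_def[abs_def] Let_def using r
        by (intro continuous_intros uy Uy) auto
      show "homog_ext_grad \<kappa> r u U 0 = 0" using \<kappa> by (simp add: homog_ext_grad_def power_0_left)
      fix x :: "'a \<times> real" assume x: "x \<in> upper_ball" "x \<noteq> 0"
      have "norm (homog_ext_grad \<kappa> r u U x) \<le> norm x ^ (\<kappa> - 1) * ((B + (real \<kappa>) * B / r) / r ^ (\<kappa> - 1))"
        by (rule norm_homog_ext_grad_le[where y="?y x" and u=u and U=U, OF x(2) r(1) \<kappa> refl B(1,2)[OF y(1,2)[OF x] ]])
      also have "\<dots> \<le> norm x * ((B + (real \<kappa>) * B / r) / r ^ (\<kappa> - 1))"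
        using small[OF x(1), of "\<kappa> - 1"] \<kappa> r B(3)[OF y(1,2)[OF x]] by (intro mult_right_mono) auto
      finally show "norm (homog_ext_grad \<kappa> r u U x) \<le> (B + (real \<kappa>) * B / r) / r ^ (\<kappa> - 1) * norm x"
        by (simp add: mult.commute)
    qed
    fix x :: "'a \<times> real" assume x: "x \<in> half_ball 1"
    then have x0: "x \<noteq> 0" and xu: "x \<in> upper_ball"
      using half_ball_subset_upper_ball[of 1] by (auto simp: half_ball_def)
    have "?y x \<in> half_ball 1"
      using y(1)[OF xu x0] x r x0 by (simp add: half_ball_def)
    then show "(homog_ext \<kappa> r u has_derivative (\<lambda>h. homog_ext_grad \<kappa> r u U x \<bullet> h)) (at x)"
      using \<kappa> by (intro has_derivative_homog_ext x0 r C1_upperD(3)[OF u]) auto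
  qed
qed

section \<open>Harmonic polynomials\<close>

lemma real_polynomial_function_gradient:
  assumes "real_polynomial_function (p :: 'b::euclidean_space \<Rightarrow> real)"
  shows "\<exists>q. (\<forall>h. real_polynomial_function (\<lambda>x. q x h)) \<and> (\<forall>x. (p has_derivative q x) (at x))"
  using assms
proof induction
  case (linear f)
  then show ?case
    by (intro exI[of _ "\<lambda>x h. f h"]) (auto intro: real_polynomial_function.intros(2) bounded_linear_imp_has_derivative)
next
  case (const c)
  show ?case
    by (intro exI[of _ "\<lambda>x h. 0"]) (auto intro: real_polynomial_function.intros(2))
next
  case (add f g)
  then obtain qf qg where "\<And>h. real_polynomial_function (\<lambda>x. qf x h)" "\<And>x. (f has_derivative qf x) (at x)"
    "\<And>h. real_polynomial_function (\<lambda>x. qg x h)" "\<And>x. (g has_derivative qg x) (at x)" by blast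
  then show ?case
    by (intro exI[of _ "\<lambda>x h. qf x h + qg x h"]) (auto intro: real_polynomial_function.intros(3) has_derivative_add)
next
  case (mult f g)
  then obtain qf qg where "\<And>h. real_polynomial_function (\<lambda>x. qf x h)" "\<And>x. (f has_derivative qf x) (at x)"
    "\<And>h. real_polynomial_function (\<lambda>x. qg x h)" "\<And>x. (g has_derivative qg x) (at x)" by blast
  then show ?case using mult(1,2)
    by (intro exI[of _ "\<lambda>x h. f x * qg x h + qf x h * g x"])
      (auto intro!: real_polynomial_function.intros(3) real_polynomial_function.intros(4) has_derivative_mult)
qed

section \<open>Harmonic polynomials satisfy the weak equation\<close>

lemma integrable_continuous_compact_support:
  fixes g :: "'b::euclidean_space \<Rightarrow> real"
  assumes K: "compact K" and g: "continuous_on UNIV g" and zero: "\<And>x. x \<notin> K \<Longrightarrow> g x = 0"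
  shows "integrable lborel g"
proof -
  have "integrable lborel (\<lambda>x. indicator K x *\<^sub>R g x)"
    by (rule borel_integrable_compact[OF K continuous_on_subset[OF g]]) simp
  moreover have "(\<lambda>x. indicator K x *\<^sub>R g x) = g" using zero by (auto split: split_indicator)
  ultimately show ?thesis by (simp only:)
qed

text \<open>Difference quotients of \<open>F\<close> in direction \<open>b\<close> have integral 0
  by translation invariance. They are bounded through the Lipschitz constant of \<open>F\<close>
  and, for increments at most 1, supported in one fixed ball, so dominated convergence passes to the
  derivative.\<close>

lemma integral_directional_derivative_eq_0:
  fixes F :: "'b::euclidean_space \<Rightarrow> real"
  assumes F: "\<And>x. (F has_derivative (\<lambda>h. G x \<bullet> h)) (at x)" and Gc: "continuous_on UNIV G"
    and K: "compact K" and zero: "\<And>x. x \<notin> K \<Longrightarrow> F x = 0" "\<And>x. x \<notin> K \<Longrightarrow> G x = 0"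
  shows "(LINT x|lborel. G x \<bullet> b) = 0"
proof -
  have Fc: "continuous_on A F" for A
    using F by (meson continuous_at_imp_continuous_on has_derivative_continuous)
  have Fm [measurable]: "F \<in> borel_measurable borel" by (intro borel_measurable_continuous_onI Fc)
  have Gm: "(\<lambda>x. G x \<bullet> b) \<in> borel_measurable borel"
    by (intro borel_measurable_continuous_onI continuous_intros Gc)
  have "bounded (G ` K)" by (intro compact_imp_bounded compact_continuous_image K continuous_on_subset[OF Gc]) auto
  then obtain C\<^sub>0 where C0: "\<And>x. x \<in> K \<Longrightarrow> norm (G x) \<le> C\<^sub>0" unfolding bounded_iff by blast
  define C where "C = max C\<^sub>0 0"
  have C: "norm (G x) \<le> C" for x
    using C0[of x] zero(2)[of x] by (cases "x \<in> K") (auto simp: C_def)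
  have C_nonneg: "0 \<le> C" by (simp add: C_def)
  obtain R where R: "\<And>x. x \<in> K \<Longrightarrow> norm x \<le> R" using compact_imp_bounded[OF K] unfolding bounded_iff by blast
  have iF: "integrable lborel F"
    by (rule integrable_continuous_compact_support[OF K Fc zero(1)])
  have shift: "integrable lborel (\<lambda>x. F (c + x))" "(LINT x|lborel. F (c + x)) = (LINT x|lborel. F x)" for c
  proof -
    have "integrable (distr lborel borel ((+) c)) F" using iF by (simp add: lborel_distr_plus)
    then show "integrable lborel (\<lambda>x. F (c + x))" by (subst (asm) integrable_distr_eq) auto
    have "(LINT x|lborel. F x) = (LINT x|distr lborel borel ((+) c). F x)" by (simp add: lborel_distr_plus)
    also have "\<dots> = (LINT x|lborel. F (c + x))" by (rule integral_distr) auto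
    finally show "(LINT x|lborel. F (c + x)) = (LINT x|lborel. F x)" by simp
  qed
  let ?t = "\<lambda>n. inverse (real (Suc n))"
  define k where "k n x = (F (?t n *\<^sub>R b + x) - F x) / ?t n" for n x
  have t01: "0 < ?t n" "?t n \<le> 1" for n by (auto simp: inverse_eq_divide divide_le_eq)
  have k0: "(LINT x|lborel. k n x) = 0" for n
    unfolding k_def using shift iF by (simp add: Bochner_Integration.integral_diff)
  have lip: "\<bar>F x - F y\<bar> \<le> C * norm (x - y)" for x y
  proof -
    have "norm (F x - F y) \<le> C * norm (x - y)"
    proof (rule differentiable_bound[OF convex_UNIV])
      show "(F has_derivative (\<lambda>h. G z \<bullet> h)) (at z within UNIV)" for z using F by simp
      show "onorm (\<lambda>h. G z \<bullet> h) \<le> C" for z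
        by (rule onorm_le) (metis C Cauchy_Schwarz_ineq2 mult_right_mono norm_ge_zero order_trans real_norm_def)
    qed auto
    then show ?thesis by simp
  qed
  have kb: "\<bar>k n x\<bar> \<le> indicator (cball 0 (R + norm b)) x * (C * norm b)" for n x
  proof (cases "norm x \<le> R + norm b")
    case True
    have "\<bar>F (?t n *\<^sub>R b + x) - F x\<bar> \<le> C * norm (?t n *\<^sub>R b)" using lip[of "?t n *\<^sub>R b + x" x] by simp
    also have "\<dots> = ?t n * (C * norm b)" by simp
    finally have "\<bar>k n x\<bar> \<le> C * norm b"
      using t01(1)[of n] by (simp add: k_def abs_divide pos_divide_le_eq mult.commute)
    then show ?thesis using True by simp
  next
    case False
    have "norm (?t n *\<^sub>R b) \<le> norm b"
      using t01[of n] by (simp add: mult_left_le_one_le del: of_nat_Suc)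
    moreover have "norm x \<le> norm (?t n *\<^sub>R b + x) + norm (?t n *\<^sub>R b)"
      using norm_triangle_ineq4[of "?t n *\<^sub>R b + x" "?t n *\<^sub>R b"] by simp
    ultimately have "R < norm (?t n *\<^sub>R b + x)" using False by linarith
    then have "?t n *\<^sub>R b + x \<notin> K" "x \<notin> K" using R False by (force, smt (verit) R norm_ge_zero)
    then show ?thesis using False zero(1) by (simp add: k_def)
  qed
  have "(\<lambda>n. LINT x|lborel. k n x) \<longlonglongrightarrow> (LINT x|lborel. G x \<bullet> b)"
  proof (rule integral_dominated_convergence[where w="\<lambda>x. indicator (cball 0 (R + norm b)) x * (C * norm b)"])
    show "integrable lborel (\<lambda>x. indicator (cball 0 (R + norm b)) x * (C * norm b))"
      by (intro integrable_mult_left integrable_real_indicator emeasure_lborel_cball_finite) simp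
    show "AE x in lborel. (\<lambda>n. k n x) \<longlonglongrightarrow> G x \<bullet> b"
    proof (rule AE_I2)
      fix x
      have "((\<lambda>t. F (t *\<^sub>R b + x)) has_derivative (\<lambda>h. G (0 *\<^sub>R b + x) \<bullet> (h *\<^sub>R b))) (at 0)"
        by (rule has_derivative_compose[of _ _ _ _ F]) (auto intro!: derivative_eq_intros F)
      then have "((\<lambda>t. F (t *\<^sub>R b + x)) has_real_derivative (G x \<bullet> b)) (at 0)"
        unfolding has_field_derivative_def by (rule has_derivative_eq_rhs) (simp add: fun_eq_iff mult.commute)
      then have lim: "((\<lambda>t. (F (t *\<^sub>R b + x) - F x) / t) \<longlongrightarrow> G x \<bullet> b) (at 0)"
        by (simp add: has_field_derivative_iff)
      have "filterlim ?t (at 0) sequentially"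
        using t01(1) by (auto simp: filterlim_at LIMSEQ_inverse_real_of_nat simp del: of_nat_Suc)
      from filterlim_compose[OF lim this] show "(\<lambda>n. k n x) \<longlonglongrightarrow> G x \<bullet> b" by (simp add: k_def)
    qed
    show "AE x in lborel. norm (k n x) \<le> indicator (cball 0 (R + norm b)) x * (C * norm b)" for n
      using kb by (intro AE_I2) simp
    show "k n \<in> borel_measurable lborel" for n unfolding k_def[abs_def] by measurable
  qed (use Gm in simp)
  then show ?thesis using k0 by (simp add: LIMSEQ_const_iff)
qed

text \<open>Integration by parts, one coordinate at a time, for the product of a partial derivative
  of \<open>p\<close> with the test function. \<open>P\<close> is handed out as well because Green's
  formula and Euler's identity refer to the gradient as a continuous field.\<close>

lemma weak_laplacian_harmonic_polynomial:
  fixes p :: "'b::euclidean_space \<Rightarrow> real"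
  assumes p: "real_polynomial_function p" and harm: "\<And>x. laplacian p x = 0" and \<Omega>: "\<Omega> \<in> sets borel"
  obtains P where "\<And>x. (p has_derivative (\<lambda>h. P x \<bullet> h)) (at x)" "continuous_on UNIV P"
    "weak_laplacian \<Omega> p (\<lambda>_. 0)"
proof -
  obtain q where q: "\<And>h. real_polynomial_function (\<lambda>x. q x h)" "\<And>x. (p has_derivative q x) (at x)"
    using real_polynomial_function_gradient[OF p] by blast
  have "\<exists>qq. (\<forall>h. real_polynomial_function (\<lambda>x. qq x h)) \<and> (\<forall>x. ((\<lambda>x. q x b) has_derivative qq x) (at x))" for b
    using real_polynomial_function_gradient[OF q(1)] by blast
  then obtain qq where qq: "\<And>b h. real_polynomial_function (\<lambda>x. qq b x h)"
    "\<And>b x. ((\<lambda>x. q x b) has_derivative qq b x) (at x)" by metis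
  define P where "P x = (\<Sum>b\<in>Basis. q x b *\<^sub>R b)" for x
  have qP: "q x h = P x \<bullet> h" for x h
    using has_derivative_grad[of p x] q(2)[of x] by (metis P_def differentiableI euclidean_representation frechet_derivative_at grad_def)
  have der: "(p has_derivative (\<lambda>h. P x \<bullet> h)) (at x)" for x
  proof -
    have "q x = (\<lambda>h. P x \<bullet> h)" using qP by auto
    then show ?thesis using q(2)[of x] by (simp only:)
  qed
  have qc: "continuous_on A (\<lambda>x. q x h)" "continuous_on A (\<lambda>x. qq b x h)" for A h b
    using q(1) qq(1) by (auto intro!: continuous_at_imp_continuous_on continuous_real_polymonial_function)
  have Pc: "continuous_on UNIV P" unfolding P_def[abs_def] by (intro continuous_intros qc)
  \<comment> \<open>\<open>laplacian\<close> is defined through iterated one-dimensional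
    derivatives, which are identified here with the diagonal second derivatives
    \<open>qq b x b\<close>.\<close>
  have second: "(\<Sum>b\<in>Basis. qq b x b) = 0" for x
  proof -
    have "(deriv ^^ 2) (\<lambda>t. p (x + t *\<^sub>R b)) 0 = qq b x b" for b
    proof -
      have "((\<lambda>t. p (x + t *\<^sub>R b)) has_derivative (\<lambda>h. q (x + t *\<^sub>R b) (h *\<^sub>R b))) (at t)" for t
        by (rule has_derivative_compose[of _ _ _ _ p]) (auto intro!: derivative_eq_intros q(2))
      then have "((\<lambda>t. p (x + t *\<^sub>R b)) has_real_derivative q (x + t *\<^sub>R b) b) (at t)" for t
        unfolding has_field_derivative_def by (rule has_derivative_eq_rhs) (simp add: fun_eq_iff qP mult.commute)
      then have d1: "deriv (\<lambda>t. p (x + t *\<^sub>R b)) = (\<lambda>t. q (x + t *\<^sub>R b) b)"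
        by (intro ext DERIV_imp_deriv)
      have lin: "qq b x (h *\<^sub>R b) = qq b x b * h" for h
        using has_derivative_linear[OF qq(2)[of b x]] by (simp add: linear_scale)
      have "((\<lambda>t. q (x + t *\<^sub>R b) b) has_derivative (\<lambda>h. qq b (x + 0 *\<^sub>R b) (h *\<^sub>R b))) (at 0)"
        by (rule has_derivative_compose[of _ _ _ _ "\<lambda>x. q x b"]) (auto intro!: derivative_eq_intros qq(2))
      then have "((\<lambda>t. q (x + t *\<^sub>R b) b) has_real_derivative qq b x b) (at 0)"
        unfolding has_field_derivative_def by (rule has_derivative_eq_rhs) (simp add: fun_eq_iff lin)
      then show ?thesis by (simp add: numeral_2_eq_2 d1 DERIV_imp_deriv)
    qed
    then show ?thesis using harm[of x] by (simp add: laplacian_def)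
  qed
  have gradp: "grad p x = P x" for x by (rule grad_eqI[OF der])
  have "weak_laplacian \<Omega> p (\<lambda>_. 0)"
    unfolding weak_laplacian_def
  proof (intro allI impI)
    fix \<phi> assume "test_function \<Omega> \<phi>"
    then have \<phi>d: "\<And>x. \<phi> differentiable (at x)" and gc: "continuous_on UNIV (grad \<phi>)"
      and K0: "compact (closure {x. \<phi> x \<noteq> 0})" "closure {x. \<phi> x \<noteq> 0} \<subseteq> \<Omega>"
      by (auto simp: test_function_def)
    obtain L where L: "L = closure {x. \<phi> x \<noteq> 0}" by blast
    have K: "compact L" and K\<Omega>: "L \<subseteq> \<Omega>" using K0 by (simp_all add: L)
    have \<phi>z: "\<phi> x = 0" if "x \<in> - L" for x
      using that closure_subset[of "{x. \<phi> x \<noteq> 0}"] unfolding L by auto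
    note d\<phi> = has_derivative_grad[OF \<phi>d]
    have z: "\<phi> x = 0" "grad \<phi> x = 0" if "x \<notin> L" for x
    proof -
      show "\<phi> x = 0" using that by (intro \<phi>z) simp
      have "((\<lambda>_. 0) has_derivative (\<lambda>h. 0 \<bullet> h)) (at x)" by simp
      then have "(\<phi> has_derivative (\<lambda>h. 0 \<bullet> h)) (at x)"
        by (rule has_derivative_transform_within_open[OF _ open_Compl[OF compact_imp_closed[OF K]]])
          (use that in \<open>simp_all add: \<phi>z\<close>)
      then show "grad \<phi> x = 0" by (rule grad_eqI)
    qed
    have \<phi>c: "continuous_on UNIV \<phi>"
      using d\<phi> by (meson continuous_at_imp_continuous_on has_derivative_continuous)
    have int: "integrable lborel g" if "continuous_on UNIV g" "\<And>x. x \<notin> L \<Longrightarrow> g x = 0" for g :: "'b \<Rightarrow> real"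
      by (rule integrable_continuous_compact_support[OF K that])
    have part: "(LINT x|lborel. q x b * (grad \<phi> x \<bullet> b)) = - (LINT x|lborel. qq b x b * \<phi> x)" if "b \<in> Basis" for b
    proof -
      have Q: "qq b x h = (\<Sum>c\<in>Basis. qq b x c *\<^sub>R c) \<bullet> h" for x h
        using has_derivative_grad[of "\<lambda>x. q x b" x] qq(2)[of b x]
        by (metis differentiableI frechet_derivative_at grad_def)
      let ?G = "\<lambda>x. q x b *\<^sub>R grad \<phi> x + \<phi> x *\<^sub>R (\<Sum>c\<in>Basis. qq b x c *\<^sub>R c)"
      have "(LINT x|lborel. ?G x \<bullet> b) = 0"
      proof (rule integral_directional_derivative_eq_0[where F="\<lambda>x. q x b * \<phi> x" and K="L"])
        show "((\<lambda>x. q x b * \<phi> x) has_derivative (\<lambda>h. ?G x \<bullet> h)) (at x)" for x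
        proof (rule has_derivative_eq_rhs[OF has_derivative_mult[OF qq(2) d\<phi>]], rule ext)
          show "q x b * (grad \<phi> x \<bullet> h) + qq b x h * \<phi> x = ?G x \<bullet> h" for h
            by (simp only: inner_add_left inner_scaleR_left Q[symmetric] mult.commute[of "\<phi> x"])
        qed
        show "continuous_on UNIV ?G" by (intro continuous_intros qc gc \<phi>c)
      qed (use K z in auto)
      moreover have "?G x \<bullet> b = q x b * (grad \<phi> x \<bullet> b) + qq b x b * \<phi> x" for x
        by (simp only: inner_add_left inner_scaleR_left Q[symmetric] mult.commute[of "\<phi> x"])
      ultimately have "(LINT x|lborel. q x b * (grad \<phi> x \<bullet> b) + qq b x b * \<phi> x) = 0" by simp
      moreover have "(LINT x|lborel. q x b * (grad \<phi> x \<bullet> b) + qq b x b * \<phi> x)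
          = (LINT x|lborel. q x b * (grad \<phi> x \<bullet> b)) + (LINT x|lborel. qq b x b * \<phi> x)"
        by (intro Bochner_Integration.integral_add int continuous_intros qc gc \<phi>c) (use z in auto)
      ultimately show ?thesis by simp
    qed
    have "(LINT x:\<Omega>|lborel. grad p x \<bullet> grad \<phi> x) = (LINT x|lborel. grad p x \<bullet> grad \<phi> x)"
      unfolding set_lebesgue_integral_def
    proof (rule Bochner_Integration.integral_cong[OF refl])
      show "indicator \<Omega> x *\<^sub>R (grad p x \<bullet> grad \<phi> x) = grad p x \<bullet> grad \<phi> x" for x
        using z(2)[of x] K\<Omega> by (cases "x \<in> L") auto
    qed
    also have "\<dots> = (LINT x|lborel. (\<Sum>b\<in>Basis. q x b * (grad \<phi> x \<bullet> b)))"
      by (rule Bochner_Integration.integral_cong[OF refl]) (simp add: gradp P_def inner_sum_left inner_sum_right inner_commute)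
    also have "\<dots> = (\<Sum>b\<in>Basis. (LINT x|lborel. q x b * (grad \<phi> x \<bullet> b)))"
      by (intro Bochner_Integration.integral_sum int continuous_intros qc gc) (use z in auto)
    also have "\<dots> = - (\<Sum>b\<in>Basis. (LINT x|lborel. qq b x b * \<phi> x))"
      using part by (simp add: sum_negf)
    also have "(\<Sum>b\<in>Basis. (LINT x|lborel. qq b x b * \<phi> x)) = (LINT x|lborel. (\<Sum>b\<in>Basis. qq b x b * \<phi> x))"
      by (intro Bochner_Integration.integral_sum[symmetric] int continuous_intros qc \<phi>c) (use z in auto)
    also have "\<dots> = 0" by (simp add: sum_distrib_right[symmetric] second)
    finally show "- (LINT x:\<Omega>|lborel. grad p x \<bullet> grad \<phi> x) = (LINT x:\<Omega>|lborel. 0 * \<phi> x)"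
      by (simp add: set_lebesgue_integral_def)
  qed
  then show thesis using that der Pc by blast
qed

section \<open>Energy and flux of a solution\<close>

lemma integral_power_0:
  assumes "0 \<le> (r :: real)"
  shows "integral {0..r} (\<lambda>\<rho>. \<rho> ^ n) = r ^ Suc n / Suc n"
proof -
  have "((\<lambda>\<rho>. \<rho> ^ n) has_integral (r ^ Suc n / Suc n - 0 ^ Suc n / Suc n)) {0..r}"
    using assms by (intro fundamental_theorem_of_calculus)
      (auto intro!: derivative_eq_intros simp: has_real_derivative_iff_has_vector_derivative[symmetric] simp del: power_Suc of_nat_Suc)
  then show ?thesis by (simp add: integral_unique)
qed

lemma set_integral_half_ball_le:
  fixes g :: "'a::euclidean_space \<times> real \<Rightarrow> real"
  assumes "continuous_on upper_ball g" "continuous_on upper_ball h" "r < 1"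
    and "\<And>x. x \<in> half_ball r \<Longrightarrow> g x \<le> h x"
  shows "(LINT x:half_ball r|lborel. g x) \<le> (LINT x:half_ball r|lborel. h x)"
  by (intro set_integral_mono set_integrable_half_ball assms)

text \<open>\<open>U\<close> is the gradient extended continuously to the thin ball, so that the
  one-sided normal derivative reads \<open>U x \<bullet> (0, 1)\<close>. The constants introduced in
  this locale are built from \<open>M\<close>, \<open>\<kappa>\<close> and the dimension only and
  are thus common to all solutions.\<close>

locale thin_solution =
  fixes u :: "'a::euclidean_space \<times> real \<Rightarrow> real" and U :: "'a \<times> real \<Rightarrow> 'a \<times> real"
    and f :: "'a \<times> real \<Rightarrow> real" and M :: real and k :: nat
  assumes C1: "C1_upper u U"
    and weak: "weak_laplacian (half_ball 1) u f" and f_meas: "f \<in> borel_measurable borel"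
    and f_bound: "AE x in lborel. x \<in> half_ball 1 \<longrightarrow> \<bar>f x\<bar> \<le> M * norm (fst x) ^ (k - 1)"
    and M_pos: "0 < M"
    and u_bound: "x \<in> upper_ball \<Longrightarrow> \<bar>u x\<bar> \<le> M" and U_bound: "x \<in> upper_ball \<Longrightarrow> norm (U x) \<le> M"
    and thin_nonneg: "x \<in> thin_ball 1 \<Longrightarrow> 0 \<le> u x"
    and thin_normal: "x \<in> thin_ball 1 \<Longrightarrow> U x \<bullet> (0, 1) \<le> 0"
    and thin_compl: "x \<in> thin_ball 1 \<Longrightarrow> u x * (U x \<bullet> (0, 1)) = 0"
begin

abbreviation "weight \<equiv> (\<lambda>x :: 'a \<times> real. M * norm (fst x) ^ (k - 1))"

text \<open>The means are integrals over the half sphere without the Jacobian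
  \<open>r ^ DIM('a)\<close>. In \<open>flux_mean\<close> and \<open>radial_mean\<close> the
  expression \<open>U x \<bullet> x\<close> is \<open>r\<close> times the normal derivative.
  \<open>energy\<close> and \<open>mass\<close> belong to half balls and are written in polar form,
  so that \<open>energy\<close> can be differentiated in \<open>r\<close>.\<close>

definition "height_mean = hemi_int (\<lambda>x. (u x)\<^sup>2)"
definition "flux_mean = hemi_int (\<lambda>x. u x * (U x \<bullet> x))"
definition "radial_mean = hemi_int (\<lambda>x. (U x \<bullet> x)\<^sup>2)"
definition "energy_mean = hemi_int (\<lambda>x. U x \<bullet> U x)"
definition "abs_mean = hemi_int (\<lambda>x. \<bar>u x\<bar>)"
definition "energy r = integral {0..r} (\<lambda>\<rho>. \<rho> ^ DIM('a) * energy_mean \<rho>)"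
definition "mass r = integral {0..r} (\<lambda>\<rho>. \<rho> ^ DIM('a) * abs_mean \<rho>)"

lemmas uc = C1_upperD(1)[OF C1] and Uc = C1_upperD(2)[OF C1]

lemma weight_continuous: "continuous_on upper_ball weight"
  by (intro continuous_intros)

lemma weight_le: "norm x \<le> r \<Longrightarrow> weight x \<le> M * r ^ (k - 1)"
proof -
  assume "norm x \<le> r"
  moreover have "norm (fst x) \<le> norm x" by (simp add: norm_prod_def)
  ultimately show ?thesis using M_pos by (intro mult_left_mono power_mono) auto
qed

lemma weight_le_M: "x \<in> upper_ball \<Longrightarrow> weight x \<le> M"
  using weight_le[of x 1] by (simp add: mem_upper_ball)

lemma energy_eq: "0 < r \<Longrightarrow> r < 1 \<Longrightarrow> energy r = (LINT x:half_ball r|lborel. U x \<bullet> U x)"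
  unfolding energy_def energy_mean_def by (subst polar_half_ball) (auto intro!: continuous_intros Uc)

lemma mass_eq: "0 < r \<Longrightarrow> r < 1 \<Longrightarrow> mass r = (LINT x:half_ball r|lborel. \<bar>u x\<bar>)"
  unfolding mass_def abs_mean_def by (subst polar_half_ball) (auto intro!: continuous_intros uc)

lemma weighted_abs_le:
  assumes "continuous_on upper_ball g" "continuous_on upper_ball \<phi>" "0 < r" "r < 1"
  shows "(LINT x:half_ball r|lborel. g x + weight x * \<bar>\<phi> x\<bar>)
    \<le> (LINT x:half_ball r|lborel. g x) + M * r ^ (k - 1) * (LINT x:half_ball r|lborel. \<bar>\<phi> x\<bar>)"
proof -
  have c: "continuous_on upper_ball (\<lambda>x. M * r ^ (k - 1) * \<bar>\<phi> x\<bar>)" by (intro continuous_intros assms)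
  have "(LINT x:half_ball r|lborel. g x + weight x * \<bar>\<phi> x\<bar>)
      \<le> (LINT x:half_ball r|lborel. g x + M * r ^ (k - 1) * \<bar>\<phi> x\<bar>)"
    using assms by (intro set_integral_half_ball_le continuous_intros add_left_mono mult_right_mono weight_le)
      (auto simp: half_ball_def)
  also have "\<dots> = (LINT x:half_ball r|lborel. g x) + (LINT x:half_ball r|lborel. M * r ^ (k - 1) * \<bar>\<phi> x\<bar>)"
    using assms c by (intro set_integral_add(2) set_integrable_half_ball)
  finally show ?thesis by simp
qed

lemma thin_compl': "x \<in> thin_ball 1 \<Longrightarrow> (U x \<bullet> (0, 1)) * u x = 0"
  using thin_compl by (simp only: mult.commute)

lemmas solution_flux = flux_le[OF C1 weak f_meas f_bound weight_continuous weight_le_M]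

text \<open>The equation is tested with \<open>u\<close> and with \<open>- u\<close>: by
  complementarity the term on the thin ball vanishes for both, so Green's formula holds in both
  directions up to the right-hand side.\<close>

lemma flux_energy:
  assumes r: "0 < r" "r < 1"
  shows "\<bar>r ^ (DIM('a) - 1) * flux_mean r - energy r\<bar> \<le> M * r ^ (k - 1) * mass r"
proof -
  have UU: "continuous_on upper_ball (\<lambda>x. U x \<bullet> U x)" by (intro continuous_intros Uc)
  have "r ^ (DIM('a) - 1) * hemi_int (\<lambda>x. u x * (U x \<bullet> x)) r
      \<le> (LINT x:half_ball r|lborel. U x \<bullet> U x + weight x * \<bar>u x\<bar>)"
    by (rule solution_flux[OF _ C1 r]) (simp_all only: thin_compl' order_refl)
  also have "\<dots> \<le> energy r + M * r ^ (k - 1) * mass r"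
    unfolding energy_eq[OF r] mass_eq[OF r] by (rule weighted_abs_le[OF UU uc r])
  finally have 1: "r ^ (DIM('a) - 1) * flux_mean r \<le> energy r + M * r ^ (k - 1) * mass r"
    by (simp add: flux_mean_def)
  have "r ^ (DIM('a) - 1) * hemi_int (\<lambda>x. - u x * (U x \<bullet> x)) r
      \<le> (LINT x:half_ball r|lborel. U x \<bullet> (- U x) + weight x * \<bar>- u x\<bar>)"
    by (rule solution_flux[OF _ C1_upper_uminus[OF C1] r])
      (simp_all only: mult_minus_right thin_compl' order_refl minus_zero)
  also have "\<dots> = (LINT x:half_ball r|lborel. - (U x \<bullet> U x) + weight x * \<bar>u x\<bar>)" by simp
  also have "\<dots> \<le> (LINT x:half_ball r|lborel. - (U x \<bullet> U x)) + M * r ^ (k - 1) * (LINT x:half_ball r|lborel. \<bar>u x\<bar>)"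
    by (rule weighted_abs_le[OF _ uc r]) (intro continuous_intros Uc)
  also have "(LINT x:half_ball r|lborel. - (U x \<bullet> U x)) = - energy r"
    unfolding energy_eq[OF r] by (simp add: set_lebesgue_integral_def)
  also have "hemi_int (\<lambda>x. - u x * (U x \<bullet> x)) r = - flux_mean r"
    using hemi_int_cmult[of "-1" "\<lambda>x. u x * (U x \<bullet> x)" r] by (simp add: flux_mean_def)
  finally have 2: "- (r ^ (DIM('a) - 1) * flux_mean r) \<le> - energy r + M * r ^ (k - 1) * mass r"
    unfolding mass_eq[OF r] by simp
  show ?thesis using 1 2 by linarith
qed

text \<open>Comparison with the \<open>\<kappa>\<close>-homogeneous extension of the values on the sphere of radius \<open>r\<close>. It is
  admissible for the obstacle problem, so it replaces the Rellich identity, which would need second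
  derivatives of \<open>u\<close>.\<close>

lemma energy_comparison:
  assumes r: "0 < r" "r < 1" and \<kappa>: "2 \<le> \<kappa>"
  shows "energy r \<le> r ^ (DIM('a) + 1) / (real (DIM('a) + 2 * \<kappa>) - 1) *
      (energy_mean r - radial_mean r / r\<^sup>2 + (real \<kappa>)\<^sup>2 * height_mean r / r\<^sup>2)
    + 2 * M * r ^ (k - 1) * (mass r + abs_mean r * r ^ (DIM('a) + 1))"
proof -
  let ?d = "DIM('a)"
  let ?z = "homog_ext \<kappa> r u" and ?Z = "homog_ext_grad \<kappa> r u U"
  have Cz: "C1_upper ?z ?Z" by (rule C1_upper_homog_ext[OF C1 r \<kappa>])
  note zc = C1_upperD(1)[OF Cz] and Zc = C1_upperD(2)[OF Cz]
  define E where "E = energy_mean r - radial_mean r / r\<^sup>2 + (real \<kappa>)\<^sup>2 * height_mean r / r\<^sup>2"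
  \<comment> \<open>The extension agrees with \<open>u\<close> on the sphere, so the flux term of
    Green's formula for the difference drops out.\<close>
  have sph: "?z x = u x" if "norm x = r" for x using that r by (simp add: homog_ext_def)
  have "r ^ (?d - 1) * hemi_int (\<lambda>x. (?z x - u x) * (U x \<bullet> x)) r
      \<le> (LINT x:half_ball r|lborel. U x \<bullet> (?Z x - U x) + weight x * \<bar>?z x - u x\<bar>)"
  proof (rule solution_flux[OF _ C1_upper_diff[OF Cz C1] r])
    fix x :: "'a \<times> real" assume x: "x \<in> thin_ball 1"
    have "0 \<le> ?z x"
    proof (cases "x = 0")
      case False
      then have "(r / norm x) *\<^sub>R x \<in> thin_ball 1" using x r by (auto simp: thin_ball_def)
      then show ?thesis using thin_nonneg r by (simp add: homog_ext_def)
    qed (use \<kappa> in \<open>simp add: homog_ext_def power_0_left\<close>)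
    then have "(U x \<bullet> (0, 1)) * ?z x \<le> 0" using thin_normal[OF x] by (simp add: mult_nonpos_nonneg)
    then show "(U x \<bullet> (0, 1)) * (?z x - u x) \<le> 0"
      by (simp only: right_diff_distrib thin_compl'[OF x] diff_zero)
  qed
  moreover have "hemi_int (\<lambda>x. (?z x - u x) * (U x \<bullet> x)) r = hemi_int (\<lambda>x :: 'a \<times> real. 0) r"
    using r by (intro hemi_int_cong) (auto simp: sph)
  moreover have "hemi_int (\<lambda>x :: 'a \<times> real. 0) r = 0" by (simp add: hemi_int_def)
  ultimately have "0 \<le> (LINT x:half_ball r|lborel. U x \<bullet> (?Z x - U x) + weight x * \<bar>?z x - u x\<bar>)" by simp
  also have "\<dots> \<le> (LINT x:half_ball r|lborel. U x \<bullet> (?Z x - U x)) + M * r ^ (k - 1) * (LINT x:half_ball r|lborel. \<bar>?z x - u x\<bar>)"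
    by (intro weighted_abs_le r continuous_intros uc Uc zc Zc)
  \<comment> \<open>Convexity of the square turns the weak inequality into a comparison of two
    energies.\<close>
  also have "(LINT x:half_ball r|lborel. U x \<bullet> (?Z x - U x)) \<le> (LINT x:half_ball r|lborel. (1/2) * (?Z x \<bullet> ?Z x) + (-1/2) * (U x \<bullet> U x))"
  proof (rule set_integral_half_ball_le)
    fix x :: "'a \<times> real"
    have "0 \<le> (?Z x - U x) \<bullet> (?Z x - U x)" by simp
    then show "U x \<bullet> (?Z x - U x) \<le> (1/2) * (?Z x \<bullet> ?Z x) + (-1/2) * (U x \<bullet> U x)"
      by (simp add: inner_diff_left inner_diff_right inner_commute)
  qed (use r in \<open>auto intro!: continuous_intros Uc Zc\<close>)
  also have "\<dots> = (LINT x:half_ball r|lborel. (1/2) * (?Z x \<bullet> ?Z x)) + (LINT x:half_ball r|lborel. (-1/2) * (U x \<bullet> U x))"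
    using r by (intro set_integral_add(2) set_integrable_half_ball continuous_intros Uc Zc)
  also have "\<dots> = (1/2) * (LINT x:half_ball r|lborel. ?Z x \<bullet> ?Z x) - (1/2) * energy r"
    unfolding energy_eq[OF r] set_integral_mult_right by simp
  also have "(LINT x:half_ball r|lborel. \<bar>?z x - u x\<bar>) \<le> (LINT x:half_ball r|lborel. \<bar>?z x\<bar> + \<bar>u x\<bar>)"
    using r by (intro set_integral_half_ball_le continuous_intros uc zc) auto
  also have "\<dots> = (LINT x:half_ball r|lborel. \<bar>?z x\<bar>) + mass r"
    unfolding mass_eq[OF r] using r by (intro set_integral_add(2) set_integrable_half_ball continuous_intros uc zc)
  finally have main: "energy r \<le> (LINT x:half_ball r|lborel. ?Z x \<bullet> ?Z x)
      + 2 * (M * r ^ (k - 1)) * ((LINT x:half_ball r|lborel. \<bar>?z x\<bar>) + mass r)"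
    using M_pos r by (simp add: mult_left_mono)
  have scale: "\<rho> *\<^sub>R \<theta> = (\<rho> / r) *\<^sub>R (r *\<^sub>R \<theta>)" for \<rho> :: real and \<theta> :: "'a \<times> real" using r by simp
  have hz: "hemi_int (\<lambda>x. \<bar>?z x\<bar>) \<rho> = (\<rho> / r) ^ \<kappa> * abs_mean r" if \<rho>: "0 < \<rho>" "\<rho> \<le> r" for \<rho>
  proof -
    have "\<bar>?z (\<rho> *\<^sub>R \<theta>)\<bar> = (\<rho> / r) ^ \<kappa> * \<bar>u (r *\<^sub>R \<theta>)\<bar>" if "\<theta> \<in> hemi" for \<theta>
      using that \<rho> r by (simp add: homog_ext_def hemi_def abs_mult)
    then have "(LINT \<theta>:hemi|hemi_measure. \<bar>?z (\<rho> *\<^sub>R \<theta>)\<bar>) = (LINT \<theta>:hemi|hemi_measure. (\<rho> / r) ^ \<kappa> * \<bar>u (r *\<^sub>R \<theta>)\<bar>)"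
      by (intro set_lebesgue_integral_cong) auto
    then show ?thesis by (simp add: hemi_int_def abs_mean_def)
  qed
  have cr: "continuous_on upper_ball (\<lambda>x. (U x \<bullet> x)\<^sup>2)" "continuous_on upper_ball (\<lambda>x. (u x)\<^sup>2)" "continuous_on upper_ball (\<lambda>x. U x \<bullet> U x)"
    by (intro continuous_intros uc Uc)+
  have hE: "hemi_int (\<lambda>x. U x \<bullet> U x - (1 / r\<^sup>2) * (U x \<bullet> x)\<^sup>2 + ((real \<kappa>)\<^sup>2 / r\<^sup>2) * (u x)\<^sup>2) r = E"
    using r by (simp only: hemi_int_add hemi_int_diff hemi_int_cmult cr continuous_on_diff continuous_on_mult continuous_on_const less_imp_le)
      (simp add: E_def energy_mean_def radial_mean_def height_mean_def)
  have hZ: "hemi_int (\<lambda>x. ?Z x \<bullet> ?Z x) \<rho> = (\<rho> / r) ^ (2 * \<kappa> - 2) * E" if \<rho>: "0 < \<rho>" "\<rho> \<le> r" for \<rho>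
  proof -
    let ?e = "\<lambda>x. U x \<bullet> U x - (1 / r\<^sup>2) * (U x \<bullet> x)\<^sup>2 + ((real \<kappa>)\<^sup>2 / r\<^sup>2) * (u x)\<^sup>2"
    have "?Z (\<rho> *\<^sub>R \<theta>) \<bullet> ?Z (\<rho> *\<^sub>R \<theta>) = (\<rho> / r) ^ (2 * \<kappa> - 2) * ?e (r *\<^sub>R \<theta>)" if \<theta>: "\<theta> \<in> hemi" for \<theta>
    proof -
      have n: "norm (\<rho> *\<^sub>R \<theta>) = \<rho>" using \<theta> \<rho> by (simp add: hemi_def)
      have "\<rho> *\<^sub>R \<theta> \<noteq> 0" using n \<rho> by auto
      moreover have "r *\<^sub>R \<theta> = (r / norm (\<rho> *\<^sub>R \<theta>)) *\<^sub>R (\<rho> *\<^sub>R \<theta>)" using n \<rho> by simp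
      ultimately show ?thesis
        using \<kappa> n by (subst inner_homog_ext_grad[where y="r *\<^sub>R \<theta>", OF _ r(1)]) auto
    qed
    then have "(LINT \<theta>:hemi|hemi_measure. ?Z (\<rho> *\<^sub>R \<theta>) \<bullet> ?Z (\<rho> *\<^sub>R \<theta>))
        = (LINT \<theta>:hemi|hemi_measure. (\<rho> / r) ^ (2 * \<kappa> - 2) * ?e (r *\<^sub>R \<theta>))"
      by (intro set_lebesgue_integral_cong) auto
    then show ?thesis unfolding hE[symmetric] by (simp add: hemi_int_def)
  qed
  have int_pow: "integral {0..r} (\<lambda>\<rho>. \<rho> ^ ?d * hemi_int g \<rho>) = G * (r ^ (?d + 1) / (?d + j + 1))"
    if g: "\<And>\<rho>. 0 < \<rho> \<Longrightarrow> \<rho> \<le> r \<Longrightarrow> hemi_int g \<rho> = (\<rho> / r) ^ j * G" for g :: "'a \<times> real \<Rightarrow> real" and j G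
  proof -
    have "integral {0..r} (\<lambda>\<rho>. \<rho> ^ ?d * hemi_int g \<rho>) = integral {0..r} (\<lambda>\<rho>. (G / r ^ j) * \<rho> ^ (?d + j))"
    proof (rule Henstock_Kurzweil_Integration.integral_cong)
      fix \<rho> assume "\<rho> \<in> {0..r}"
      then consider "\<rho> = 0" | "0 < \<rho>" "\<rho> \<le> r" by fastforce
      then show "\<rho> ^ ?d * hemi_int g \<rho> = (G / r ^ j) * \<rho> ^ (?d + j)"
        by cases (auto simp: g power_0_left power_divide power_add)
    qed
    also have "\<dots> = (G / r ^ j) * (r ^ Suc (?d + j) / Suc (?d + j))"
      using r by (subst integral_mult_right) (simp add: integral_power_0 del: power_Suc of_nat_Suc)
    also have "\<dots> = G * (r ^ (?d + 1) / (?d + j + 1))"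
      using r by (simp add: power_add)
    finally show ?thesis .
  qed
  \<comment> \<open>The Jacobian power \<open>DIM('a)\<close> and the homogeneity
    \<open>2 * \<kappa> - 2\<close> of the squared gradient add up; integration in the radius then
    yields the denominator \<open>DIM('a) + 2 * \<kappa> - 1\<close>.\<close>
  have "(LINT x:half_ball r|lborel. ?Z x \<bullet> ?Z x) = E * (r ^ (?d + 1) / (?d + (2 * \<kappa> - 2) + 1))"
    by (subst polar_half_ball[OF _ r]) (intro continuous_intros Zc, rule int_pow[OF hZ])
  moreover have "real ?d + real (2 * \<kappa> - 2) + 1 = real (?d + 2 * \<kappa>) - 1" using \<kappa> by (simp add: of_nat_diff)
  moreover have "(LINT x:half_ball r|lborel. \<bar>?z x\<bar>) \<le> abs_mean r * r ^ (?d + 1)"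
  proof -
    have "(LINT x:half_ball r|lborel. \<bar>?z x\<bar>) = abs_mean r * (r ^ (?d + 1) / (?d + \<kappa> + 1))"
      by (subst polar_half_ball[OF _ r]) (intro continuous_intros zc, rule int_pow[OF hz])
    also have "\<dots> \<le> abs_mean r * r ^ (?d + 1)"
    proof (intro mult_left_mono)
      show "r ^ (?d + 1) / (?d + \<kappa> + 1) \<le> r ^ (?d + 1)"
        using r by (simp add: divide_le_eq mult_le_cancel_left1 del: power_Suc)
      show "0 \<le> abs_mean r" unfolding abs_mean_def using r by (intro hemi_int_nonneg) auto
    qed
    finally show ?thesis .
  qed
  then have "2 * (M * r ^ (k - 1)) * ((LINT x:half_ball r|lborel. \<bar>?z x\<bar>) + mass r)
      \<le> 2 * (M * r ^ (k - 1)) * (abs_mean r * r ^ (?d + 1) + mass r)"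
    using M_pos r by (intro mult_left_mono) auto
  ultimately show ?thesis using main unfolding E_def[symmetric]
    by (simp add: algebra_simps)
qed

lemma height_mean_derivative:
  assumes "0 < r" "r < 1"
  shows "(height_mean has_real_derivative 2 * flux_mean r / r) (at r)"
proof -
  have "(height_mean has_real_derivative hemi_int (\<lambda>x. 2 * (u x * (U x \<bullet> x))) r / r) (at r)"
    unfolding height_mean_def
  proof (rule has_real_derivative_hemi_int[OF assms])
    fix t x assume "x \<in> (hemi :: ('a \<times> real) set)" and t: "0 < t" "t < (1::real)"
    from C1_upper_radial_derivative[OF C1 this]
    have d: "((\<lambda>t. u (t *\<^sub>R x)) has_real_derivative (U (t *\<^sub>R x) \<bullet> (t *\<^sub>R x)) / t) (at t)" .
    show "((\<lambda>t. (u (t *\<^sub>R x))\<^sup>2) has_real_derivative 2 * (u (t *\<^sub>R x) * (U (t *\<^sub>R x) \<bullet> (t *\<^sub>R x))) / t) (at t)"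
      by (rule DERIV_cong[OF DERIV_power[OF d, of 2]]) simp
  qed (intro continuous_intros uc Uc)+
  then show ?thesis by (simp add: hemi_int_cmult flux_mean_def)
qed

lemma energy_derivative:
  assumes "0 < r" "r < 1"
  shows "(energy has_real_derivative r ^ DIM('a) * energy_mean r) (at r)"
proof -
  let ?R = "(r + 1) / 2"
  have R: "r < ?R" "?R < 1" using assms by auto
  have c: "continuous_on {0..?R} (\<lambda>\<rho>. \<rho> ^ DIM('a) * energy_mean \<rho>)"
    unfolding energy_mean_def by (intro continuous_intros continuous_on_hemi_int R Uc)
  have "(energy has_real_derivative r ^ DIM('a) * energy_mean r) (at r within {0..?R})"
    unfolding energy_def[abs_def] by (rule integral_has_real_derivative[OF c]) (use assms in auto)
  then show ?thesis using assms R by (simp add: at_within_Icc_at)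
qed

text \<open>This is the mean of the squared defect \<open>x \<bullet> \<nabla> u - c u\<close>. For
  \<open>c = \<kappa>\<close> it measures the deviation from homogeneity and is what remains in the
  derivative of the Weiss energy.\<close>

lemma means_square_nonneg:
  assumes "0 < r" "r < 1"
  shows "0 \<le> radial_mean r - 2 * c * flux_mean r + c\<^sup>2 * height_mean r"
proof -
  have c: "continuous_on upper_ball (\<lambda>x. (U x \<bullet> x)\<^sup>2)" "continuous_on upper_ball (\<lambda>x. u x * (U x \<bullet> x))"
    "continuous_on upper_ball (\<lambda>x. (u x)\<^sup>2)" by (intro continuous_intros uc Uc)+
  have "0 \<le> hemi_int (\<lambda>x. (U x \<bullet> x - c * u x)\<^sup>2) r" using assms by (intro hemi_int_nonneg) auto
  also have "\<dots> = hemi_int (\<lambda>x. (U x \<bullet> x)\<^sup>2 - (2 * c) * (u x * (U x \<bullet> x)) + c\<^sup>2 * (u x)\<^sup>2) r"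
    by (simp add: power2_eq_square algebra_simps)
  also have "\<dots> = radial_mean r - 2 * c * flux_mean r + c\<^sup>2 * height_mean r"
    using assms by (simp only: hemi_int_add hemi_int_diff hemi_int_cmult c continuous_on_diff continuous_on_mult continuous_on_const less_imp_le)
      (simp add: radial_mean_def flux_mean_def height_mean_def)
  finally show ?thesis .
qed

text \<open>Young's inequality with a free parameter: \<open>\<tau>\<close> will be the expected
  size \<open>q * \<rho> ^ \<kappa>\<close> of \<open>u\<close>, which balances the two
  terms.\<close>

lemma abs_mean_le:
  assumes "0 \<le> r" "r < 1" "0 < \<tau>"
  shows "abs_mean r \<le> (\<tau> * hemi_int (\<lambda>x :: 'a \<times> real. 1) r + height_mean r / \<tau>) / 2"
proof -
  have c: "continuous_on upper_ball (\<lambda>x :: 'a \<times> real. 1 :: real)" "continuous_on upper_ball (\<lambda>x. (u x)\<^sup>2)"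
    by (intro continuous_intros uc)+
  have "abs_mean r \<le> hemi_int (\<lambda>x. (\<tau> / 2) * 1 + (1 / (2 * \<tau>)) * (u x)\<^sup>2) r"
    unfolding abs_mean_def
  proof (rule hemi_int_mono)
    fix x
    have "0 \<le> (\<tau> - \<bar>u x\<bar>)\<^sup>2" by simp
    then have "2 * \<tau> * \<bar>u x\<bar> \<le> \<tau>\<^sup>2 + (u x)\<^sup>2" by (simp add: power2_diff)
    then show "\<bar>u x\<bar> \<le> (\<tau> / 2) * 1 + (1 / (2 * \<tau>)) * (u x)\<^sup>2"
      using assms(3) by (simp add: field_simps power2_eq_square)
  qed (use assms in \<open>auto intro!: continuous_intros uc\<close>)
  also have "\<dots> = (\<tau> / 2) * hemi_int (\<lambda>x :: 'a \<times> real. 1) r + (1 / (2 * \<tau>)) * height_mean r"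
    using assms by (simp only: hemi_int_add hemi_int_cmult c continuous_on_mult continuous_on_const) (simp add: height_mean_def)
  finally show ?thesis by (simp add: add_divide_distrib)
qed

lemma hemi_int_one: "hemi_int (\<lambda>x :: 'a \<times> real. 1) r = hemi_int (\<lambda>x :: 'a \<times> real. 1) 0"
  by (simp add: hemi_int_def)

end

section \<open>Error terms, Weiss energy and the a priori bound\<close>

context thin_solution
begin

definition "hemi_mass = hemi_int (\<lambda>x :: 'a \<times> real. 1) 0"

lemma hemi_mass_nonneg: "0 \<le> hemi_mass"
  unfolding hemi_mass_def by (intro hemi_int_nonneg) auto

text \<open>\<open>M\<close> comes from the weight, \<open>(hemi_mass + 1) / 2\<close> from Young's
  inequality for the mean of \<open>|u|\<close>.\<close>

definition "err\<^sub>0 = M * ((hemi_mass + 1) / 2)"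

lemma err0_nonneg: "0 \<le> err\<^sub>0"
  using M_pos hemi_mass_nonneg by (simp add: err\<^sub>0_def)

text \<open>In dimension \<open>n = DIM('a) + 1\<close> the energy is divided by
  \<open>r ^ (n - 2 + 2 * \<kappa>)\<close>, the usual Weiss scaling; \<open>height_mean\<close>
  lacks the Jacobian, which explains its smaller power. \<open>N\<^sub>0 \<kappa>\<close> is the
  exponent below the energy and at the same time the denominator in the energy comparison. This
  coincidence makes \<open>energy_mean\<close> cancel in the derivative.\<close>

definition "weiss \<kappa> r = energy r / r ^ (DIM('a) - 1 + 2 * \<kappa>) - real \<kappa> * (height_mean r / r ^ (2 * \<kappa>))"
definition "N\<^sub>0 \<kappa> = real (DIM('a) + 2 * \<kappa>) - 1"

context
  fixes \<kappa> :: nat and q :: real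
  assumes \<kappa>: "2 \<le> \<kappa>" "\<kappa> < k" and q: "0 < q"
    and growth: "\<And>\<rho>. 0 < \<rho> \<Longrightarrow> \<rho> \<le> 1/2 \<Longrightarrow> height_mean \<rho> \<le> q\<^sup>2 * \<rho> ^ (2 * \<kappa>)"
begin

text \<open>Only the first power of \<open>u\<close> meets the right-hand side of the equation, so
  all errors are linear in \<open>q\<close>, the square root of the height bound. This linearity
  later closes the a priori estimate.\<close>

lemma abs_mean_growth:
  assumes "0 < \<rho>" "\<rho> \<le> 1/2"
  shows "abs_mean \<rho> \<le> (hemi_mass + 1) / 2 * q * \<rho> ^ \<kappa>"
proof -
  have p: "0 < q * \<rho> ^ \<kappa>" using q assms by simp
  have "height_mean \<rho> / (q * \<rho> ^ \<kappa>) \<le> q\<^sup>2 * \<rho> ^ (2 * \<kappa>) / (q * \<rho> ^ \<kappa>)"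
    using growth[OF assms] p by (intro divide_right_mono) auto
  also have "\<dots> = q * \<rho> ^ \<kappa>"
    using q assms by (simp add: power2_eq_square mult_2 power_add)
  finally have "abs_mean \<rho> \<le> (q * \<rho> ^ \<kappa> * hemi_mass + q * \<rho> ^ \<kappa>) / 2"
    using abs_mean_le[of \<rho> "q * \<rho> ^ \<kappa>"] p assms hemi_int_one[of \<rho>] by (simp add: hemi_mass_def)
  then show ?thesis by (simp add: algebra_simps add_divide_distrib)
qed

lemma mass_growth:
  assumes r: "0 < r" "r \<le> 1/2"
  shows "mass r \<le> (hemi_mass + 1) / 2 * q * r ^ (DIM('a) + \<kappa> + 1)"
proof -
  let ?c = "(hemi_mass + 1) / 2 * q"
  have c: "0 \<le> ?c" using hemi_mass_nonneg q by simp
  have am: "continuous_on {0..r} abs_mean"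
    unfolding abs_mean_def using r by (intro continuous_on_hemi_int continuous_intros uc) auto
  have "mass r \<le> integral {0..r} (\<lambda>\<rho>. ?c * r ^ (DIM('a) + \<kappa>))"
    unfolding mass_def
  proof (rule integral_le)
    show "(\<lambda>\<rho>. \<rho> ^ DIM('a) * abs_mean \<rho>) integrable_on {0..r}"
      by (intro integrable_continuous_real continuous_intros am)
    fix \<rho> assume \<rho>: "\<rho> \<in> {0..r}"
    show "\<rho> ^ DIM('a) * abs_mean \<rho> \<le> ?c * r ^ (DIM('a) + \<kappa>)"
    proof (cases "\<rho> = 0")
      case False
      then have "\<rho> ^ DIM('a) * abs_mean \<rho> \<le> \<rho> ^ DIM('a) * (?c * \<rho> ^ \<kappa>)"
        using \<rho> r by (intro mult_left_mono abs_mean_growth) auto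
      also have "\<dots> = ?c * \<rho> ^ (DIM('a) + \<kappa>)" by (simp add: power_add)
      also have "\<dots> \<le> ?c * r ^ (DIM('a) + \<kappa>)" using \<rho> c by (intro mult_left_mono power_mono) auto
      finally show ?thesis .
    next
      case True
      have "0 \<le> ?c * r ^ (DIM('a) + \<kappa>)" using r by (intro mult_nonneg_nonneg[OF c]) auto
      then show ?thesis unfolding True by (simp only: power_0_left DIM_positive less_imp_neq[symmetric] if_False mult_zero_left)
    qed
  qed auto
  also have "\<dots> = ?c * r ^ (DIM('a) + \<kappa> + 1)" using r by simp
  finally show ?thesis .
qed

text \<open>Here \<open>\<kappa> < k\<close> pays off: \<open>k - 1 \<ge> \<kappa>\<close> lets the
  weight contribute a second factor \<open>r ^ \<kappa>\<close>.\<close>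

lemma weight_power_le:
  assumes "0 < r" "r \<le> 1/2"
  shows "M * r ^ (k - 1) * r ^ (DIM('a) + \<kappa> + 1) \<le> M * r ^ (DIM('a) + 2 * \<kappa> + 1)"
proof -
  have "r ^ (k - 1) * r ^ (DIM('a) + \<kappa> + 1) = r ^ (k - 1 + (DIM('a) + \<kappa> + 1))" by (simp only: power_add)
  also have "\<dots> \<le> r ^ (DIM('a) + 2 * \<kappa> + 1)"
    using assms \<kappa> by (intro power_decreasing) auto
  finally show ?thesis using M_pos by (simp only: mult.assoc mult_left_mono less_imp_le)
qed

lemma mass_error:
  assumes "0 < r" "r \<le> 1/2"
  shows "M * r ^ (k - 1) * mass r \<le> err\<^sub>0 * q * r ^ (DIM('a) + 2 * \<kappa> + 1)"
    "M * r ^ (k - 1) * (abs_mean r * r ^ (DIM('a) + 1)) \<le> err\<^sub>0 * q * r ^ (DIM('a) + 2 * \<kappa> + 1)"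
proof -
  let ?c = "(hemi_mass + 1) / 2 * q"
  have c: "0 \<le> ?c" using hemi_mass_nonneg q by simp
  have fin: "M * r ^ (k - 1) * (?c * r ^ (DIM('a) + \<kappa> + 1)) \<le> err\<^sub>0 * q * r ^ (DIM('a) + 2 * \<kappa> + 1)"
  proof -
    have "M * r ^ (k - 1) * (?c * r ^ (DIM('a) + \<kappa> + 1)) = ?c * (M * r ^ (k - 1) * r ^ (DIM('a) + \<kappa> + 1))"
      by (simp only: mult_ac)
    also have "\<dots> \<le> ?c * (M * r ^ (DIM('a) + 2 * \<kappa> + 1))"
      by (intro mult_left_mono weight_power_le assms c)
    finally show ?thesis by (simp only: err\<^sub>0_def mult_ac)
  qed
  have "M * r ^ (k - 1) * mass r \<le> M * r ^ (k - 1) * (?c * r ^ (DIM('a) + \<kappa> + 1))"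
    using M_pos assms by (intro mult_left_mono mass_growth) auto
  then show "M * r ^ (k - 1) * mass r \<le> err\<^sub>0 * q * r ^ (DIM('a) + 2 * \<kappa> + 1)" using fin by linarith
  have "abs_mean r * r ^ (DIM('a) + 1) \<le> (?c * r ^ \<kappa>) * r ^ (DIM('a) + 1)"
    using assms by (intro mult_right_mono abs_mean_growth) auto
  also have "\<dots> = ?c * r ^ (DIM('a) + \<kappa> + 1)" by (simp add: power_add)
  finally have "M * r ^ (k - 1) * (abs_mean r * r ^ (DIM('a) + 1)) \<le> M * r ^ (k - 1) * (?c * r ^ (DIM('a) + \<kappa> + 1))"
    using M_pos assms by (intro mult_left_mono) auto
  then show "M * r ^ (k - 1) * (abs_mean r * r ^ (DIM('a) + 1)) \<le> err\<^sub>0 * q * r ^ (DIM('a) + 2 * \<kappa> + 1)"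
    using fin by linarith
qed

text \<open>The relation between flux and energy is divided by
  \<open>r ^ (DIM('a) - 1 + 2 * \<kappa>)\<close>; the power
  \<open>DIM('a) + 2 * \<kappa> + 1\<close> of the error exceeds this one by 2.\<close>

lemma flux_weiss:
  assumes r: "0 < r" "r \<le> 1/2"
  shows "\<bar>(flux_mean r - real \<kappa> * height_mean r) / r ^ (2 * \<kappa>) - weiss \<kappa> r\<bar> \<le> err\<^sub>0 * q * r\<^sup>2"
proof -
  let ?m = "DIM('a) - 1"
  have d: "DIM('a) = Suc ?m" by (metis DIM_positive Suc_diff_1)
  have "\<bar>r ^ ?m * flux_mean r - energy r\<bar> \<le> err\<^sub>0 * q * r ^ (DIM('a) + 2 * \<kappa> + 1)"
    using flux_energy[of r] mass_error(1)[OF r] r by linarith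
  then have "\<bar>r ^ ?m * flux_mean r - energy r\<bar> / r ^ (?m + 2 * \<kappa>) \<le> err\<^sub>0 * q * r ^ (DIM('a) + 2 * \<kappa> + 1) / r ^ (?m + 2 * \<kappa>)"
    using r by (intro divide_right_mono) auto
  also have "\<dots> = err\<^sub>0 * q * r\<^sup>2"
  proof -
    have "DIM('a) + 2 * \<kappa> + 1 = 2 + (?m + 2 * \<kappa>)" using d by simp
    then have "r ^ (DIM('a) + 2 * \<kappa> + 1) = r\<^sup>2 * r ^ (?m + 2 * \<kappa>)" by (simp only: power_add)
    then show ?thesis using r by simp
  qed
  also have "\<bar>r ^ ?m * flux_mean r - energy r\<bar> / r ^ (?m + 2 * \<kappa>) = \<bar>(r ^ ?m * flux_mean r - energy r) / r ^ (?m + 2 * \<kappa>)\<bar>"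
    using r by (simp add: abs_divide)
  also have "(r ^ ?m * flux_mean r - energy r) / r ^ (?m + 2 * \<kappa>) = (flux_mean r - real \<kappa> * height_mean r) / r ^ (2 * \<kappa>) - weiss \<kappa> r"
  proof -
    have W: "weiss \<kappa> r = energy r / (r ^ ?m * r ^ (2 * \<kappa>)) - real \<kappa> * (height_mean r / r ^ (2 * \<kappa>))"
      by (simp only: weiss_def power_add)
    have "0 < r ^ ?m" "0 < r ^ (2 * \<kappa>)" using r by simp_all
    then show ?thesis unfolding W power_add using r by (simp only: diff_divide_distrib) simp
  qed
  finally show ?thesis .
qed

lemma N0_pos: "0 < N\<^sub>0 \<kappa>" using \<kappa> DIM_positive[where 'a='a] by (simp add: N\<^sub>0_def)

text \<open>The energy enters the derivative with a negative sign, so its upper bound by comparison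
  has the right direction. Once \<open>energy_mean\<close> has cancelled, the remaining means
  assemble to that of \<open>(x \<bullet> \<nabla> u - \<kappa> u)\<^sup>2\<close>, which is
  nonnegative, and only the error is left.\<close>

lemma weiss_derivative:
  assumes r: "0 < r" "r < 1/2"
  shows "\<exists>D. (weiss \<kappa> has_real_derivative D) (at r) \<and> - (4 * N\<^sub>0 \<kappa> * err\<^sub>0 * q * r) \<le> D"
proof -
  let ?m = "DIM('a) - 1"
  have d: "DIM('a) = Suc ?m" by (metis DIM_positive Suc_diff_1)
  define n where "n = ?m + 2 * \<kappa>"
  have n: "real n = N\<^sub>0 \<kappa>" "n \<noteq> 0" using d \<kappa> by (simp_all add: n_def N\<^sub>0_def)
  define e where "e = energy_mean r"
  define s where "s = height_mean r"
  define i where "i = flux_mean r"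
  define j where "j = radial_mean r"
  define E where "E = energy r"
  have pn: "r ^ n = r ^ (n - 1) * r" "r ^ (2 * \<kappa>) = r ^ (2 * \<kappa> - 1) * r"
    by (rule power_minus_mult[symmetric], use n \<kappa> in simp)+
  have dW: "(weiss \<kappa> has_real_derivative (r ^ DIM('a) * e / r ^ n - N\<^sub>0 \<kappa> * E / (r ^ n * r))
      - real \<kappa> * (2 * i / r / r ^ (2 * \<kappa>) - 2 * real \<kappa> * s / (r ^ (2 * \<kappa>) * r))) (at r)"
  proof -
    have 1: "((\<lambda>r. energy r / r ^ n) has_real_derivative (r ^ DIM('a) * e / r ^ n - N\<^sub>0 \<kappa> * E / (r ^ n * r))) (at r)"
    proof (rule DERIV_cong[OF DERIV_divide[OF energy_derivative DERIV_pow]])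
      show "(r ^ DIM('a) * energy_mean r * r ^ n - energy r * (real n * r ^ (n - Suc 0))) / (r ^ n * r ^ n)
          = r ^ DIM('a) * e / r ^ n - N\<^sub>0 \<kappa> * E / (r ^ n * r)"
      proof -
        define p where "p = r ^ (n - 1)"
        have "0 < p" using r by (simp add: p_def)
        moreover have "r ^ n = p * r" "r ^ (n - Suc 0) = p" using pn(1) by (simp_all add: p_def)
        ultimately show ?thesis using r unfolding n(1) e_def E_def by (simp add: field_simps)
      qed
    qed (use r in auto)
    have 2: "((\<lambda>r. height_mean r / r ^ (2 * \<kappa>)) has_real_derivative (2 * i / r / r ^ (2 * \<kappa>) - 2 * real \<kappa> * s / (r ^ (2 * \<kappa>) * r))) (at r)"
    proof (rule DERIV_cong[OF DERIV_divide[OF height_mean_derivative DERIV_pow]])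
      show "(2 * flux_mean r / r * r ^ (2 * \<kappa>) - height_mean r * (real (2 * \<kappa>) * r ^ (2 * \<kappa> - Suc 0))) / (r ^ (2 * \<kappa>) * r ^ (2 * \<kappa>))
          = 2 * i / r / r ^ (2 * \<kappa>) - 2 * real \<kappa> * s / (r ^ (2 * \<kappa>) * r)"
      proof -
        define p where "p = r ^ (2 * \<kappa> - 1)"
        have "0 < p" using r by (simp add: p_def)
        moreover have "r ^ (2 * \<kappa>) = p * r" "r ^ (2 * \<kappa> - Suc 0) = p" using pn(2) by (simp_all add: p_def)
        ultimately show ?thesis using r unfolding i_def s_def by (simp add: field_simps)
      qed
    qed (use r in auto)
    show ?thesis
      unfolding weiss_def[abs_def] n_def[symmetric]
      by (intro DERIV_diff DERIV_cmult 1 2)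
  qed
  have "E \<le> r ^ (DIM('a) + 1) / N\<^sub>0 \<kappa> * (e - j / r\<^sup>2 + (real \<kappa>)\<^sup>2 * s / r\<^sup>2) + 2 * (M * r ^ (k - 1) * mass r) + 2 * (M * r ^ (k - 1) * (abs_mean r * r ^ (DIM('a) + 1)))"
    using energy_comparison[of r \<kappa>] r \<kappa>(1) unfolding E_def e_def j_def s_def N\<^sub>0_def by (simp add: algebra_simps)
  then have cmp: "E \<le> r ^ (DIM('a) + 1) / N\<^sub>0 \<kappa> * (e - j / r\<^sup>2 + (real \<kappa>)\<^sup>2 * s / r\<^sup>2) + 4 * (err\<^sub>0 * q * r ^ (DIM('a) + 2 * \<kappa> + 1))"
    using mass_error[of r] r by linarith
  have j0: "0 \<le> j - 2 * real \<kappa> * i + (real \<kappa>)\<^sup>2 * s"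
    using means_square_nonneg[of r "real \<kappa>"] r by (simp add: i_def j_def s_def)
  define R where "R = r ^ ?m"
  define T where "T = r ^ (2 * \<kappa>)"
  define \<epsilon> where "\<epsilon> = err\<^sub>0 * q"
  have RT: "0 < R" "0 < T" using r by (simp_all add: R_def T_def)
  have pw: "r ^ DIM('a) = R * r" "r ^ n = R * T" "r ^ (DIM('a) + 1) = R * r\<^sup>2" "r ^ (DIM('a) + 2 * \<kappa> + 1) = R * T * r\<^sup>2"
  proof -
    show dm: "r ^ DIM('a) = R * r" unfolding R_def by (rule power_minus_mult[symmetric]) simp
    show "r ^ n = R * T" by (simp only: n_def R_def T_def power_add)
    show "r ^ (DIM('a) + 1) = R * r\<^sup>2" by (simp only: power_add dm power_one_right power2_eq_square mult.assoc)
    show "r ^ (DIM('a) + 2 * \<kappa> + 1) = R * T * r\<^sup>2"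
      by (simp only: power_add dm T_def[symmetric] power_one_right) (simp add: power2_eq_square)
  qed
  \<comment> \<open>The linear arithmetic behind the last step: \<open>y\<close> is the energy term
    with its bound \<open>a + b + c\<close>, where \<open>c\<close> is the error, \<open>z\<close>
    is the height term, and \<open>b + w = - v\<close> expresses the completed square.\<close>
  have combine: "y \<le> a + b + c \<Longrightarrow> x = a \<Longrightarrow> z = w \<Longrightarrow> 0 \<le> v \<Longrightarrow> b + w = - v \<Longrightarrow> - c \<le> (x - y) - z"
    for a b c v w x y z :: real by linarith
  have "N\<^sub>0 \<kappa> * E \<le> N\<^sub>0 \<kappa> * (R * r\<^sup>2 / N\<^sub>0 \<kappa> * (e - j / r\<^sup>2 + (real \<kappa>)\<^sup>2 * s / r\<^sup>2) + 4 * (\<epsilon> * (R * T * r\<^sup>2)))"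
    using cmp N0_pos unfolding pw \<epsilon>_def by (intro mult_left_mono) auto
  also have "\<dots> = R * (r\<^sup>2 * e - j + (real \<kappa>)\<^sup>2 * s + 4 * N\<^sub>0 \<kappa> * \<epsilon> * T * r\<^sup>2)"
    using r N0_pos by (simp add: field_simps)
  finally have "N\<^sub>0 \<kappa> * E / (R * T * r) \<le> R * (r\<^sup>2 * e - j + (real \<kappa>)\<^sup>2 * s + 4 * N\<^sub>0 \<kappa> * \<epsilon> * T * r\<^sup>2) / (R * T * r)"
    using RT r by (intro divide_right_mono) auto
  also have "\<dots> = r * e / T + ((real \<kappa>)\<^sup>2 * s - j) / (T * r) + 4 * N\<^sub>0 \<kappa> * \<epsilon> * r"
    using RT r by (simp add: field_simps power2_eq_square)
  finally have "N\<^sub>0 \<kappa> * E / (R * T * r) \<le> r * e / T + ((real \<kappa>)\<^sup>2 * s - j) / (T * r) + 4 * N\<^sub>0 \<kappa> * \<epsilon> * r" .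
  moreover have "R * r * e / (R * T) = r * e / T" using RT by simp
  moreover have "real \<kappa> * (2 * i / r / T - 2 * real \<kappa> * s / (T * r)) = (2 * real \<kappa> * i - 2 * (real \<kappa>)\<^sup>2 * s) / (T * r)"
    using RT r by (simp add: field_simps power2_eq_square)
  moreover have "0 \<le> (j - 2 * real \<kappa> * i + (real \<kappa>)\<^sup>2 * s) / (T * r)"
    using j0 RT r by simp
  moreover have "((real \<kappa>)\<^sup>2 * s - j) / (T * r) + (2 * real \<kappa> * i - 2 * (real \<kappa>)\<^sup>2 * s) / (T * r)
      = - ((j - 2 * real \<kappa> * i + (real \<kappa>)\<^sup>2 * s) / (T * r))"
    unfolding add_divide_distrib[symmetric] minus_divide_left by (rule arg_cong2[where f="(/)"]) simp_all
  ultimately have "- (4 * N\<^sub>0 \<kappa> * \<epsilon> * r) \<le> (R * r * e / (R * T) - N\<^sub>0 \<kappa> * E / (R * T * r))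
      - real \<kappa> * (2 * i / r / T - 2 * real \<kappa> * s / (T * r))"
    by (rule combine)
  then show ?thesis using dW unfolding pw T_def[symmetric] \<epsilon>_def by (auto simp: mult.assoc)
qed

text \<open>Adding a multiple of \<open>r\<^sup>2\<close> makes \<open>weiss \<kappa>\<close>
  nondecreasing, and \<open>start\<close> says that its lower limit at 0 is nonnegative. Hence the
  corrected function is nonnegative throughout, and the flux bracket follows it up to the
  error.\<close>

lemma flux_lower_bound:
  assumes start: "\<And>e. 0 < e \<Longrightarrow> \<exists>\<rho>>0. \<forall>r. 0 < r \<longrightarrow> r < \<rho> \<longrightarrow>
      - e * r ^ (2 * \<kappa>) \<le> flux_mean r - real \<kappa> * height_mean r"
    and r: "0 < r" "r < 1/2"
  shows "- ((2 * N\<^sub>0 \<kappa> + 1) * err\<^sub>0 * q * r ^ (2 * \<kappa> + 2)) \<le> flux_mean r - real \<kappa> * height_mean r"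
proof -
  define c where "c = 2 * N\<^sub>0 \<kappa> * err\<^sub>0 * q"
  have c0: "0 \<le> c" using N0_pos err0_nonneg q by (simp add: c_def)
  define G where "G r = weiss \<kappa> r + c * r\<^sup>2" for r
  have mono: "G a \<le> G b" if "0 < a" "a \<le> b" "b < 1/2" for a b
  proof (rule DERIV_nonneg_imp_nondecreasing[OF that(2)])
    fix x assume x: "a \<le> x" "x \<le> b"
    then obtain D where D: "(weiss \<kappa> has_real_derivative D) (at x)" "- (4 * N\<^sub>0 \<kappa> * err\<^sub>0 * q * x) \<le> D"
      using weiss_derivative[of x] \<open>0 < a\<close> \<open>b < 1/2\<close> by auto
    have "(G has_real_derivative (D + 2 * c * x)) (at x)"
      unfolding G_def[abs_def] by (auto intro!: derivative_eq_intros D(1))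
    then show "\<exists>y. (G has_real_derivative y) (at x) \<and> 0 \<le> y"
      using D(2) by (intro exI[of _ "D + 2 * c * x"]) (simp add: c_def)
  qed
  have "0 \<le> G r + e" if e: "0 < e" for e
  proof -
    obtain \<rho> where \<rho>: "0 < \<rho>" "\<And>r. 0 < r \<Longrightarrow> r < \<rho> \<Longrightarrow> - (e / 2) * r ^ (2 * \<kappa>) \<le> flux_mean r - real \<kappa> * height_mean r"
      using start[of "e / 2"] e by auto
    define eq where "eq = err\<^sub>0 * q"
    have eq: "0 \<le> eq" using err0_nonneg q by (simp add: eq_def)
    \<comment> \<open>A radius small enough for \<open>start\<close> and for the closeness of flux
      and Weiss energy, not beyond \<open>r\<close> so that monotonicity applies, and with
      \<open>eq * a\<^sup>2 \<le> e / 2\<close>.\<close>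
    define a where "a = min (min (\<rho> / 2) r) (min (1/2) (e / (2 * (eq + 1)))) / 1"
    have "0 < a" using \<rho> r e eq by (simp add: a_def)
    have a: "a \<le> \<rho> / 2" "a \<le> r" "a \<le> 1/2" "a \<le> e / (2 * (eq + 1))"
      unfolding a_def by (simp_all only: min_le_iff_disj order_refl simp_thms div_by_1)
    have "eq * a\<^sup>2 \<le> e / 2"
    proof -
      have "a\<^sup>2 \<le> a * 1" unfolding power2_eq_square using a \<open>0 < a\<close> by (intro mult_left_mono) auto
      then have "eq * a\<^sup>2 \<le> eq * (e / (2 * (eq + 1)))" using a eq by (intro mult_left_mono) auto
      also have "\<dots> \<le> e / 2" using eq e by (simp add: field_simps)
      finally show ?thesis .
    qed
    moreover have "\<bar>(flux_mean a - real \<kappa> * height_mean a) / a ^ (2 * \<kappa>) - weiss \<kappa> a\<bar> \<le> eq * a\<^sup>2"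
      unfolding eq_def using flux_weiss[of a] \<open>0 < a\<close> a by simp
    moreover have "- (e / 2) \<le> (flux_mean a - real \<kappa> * height_mean a) / a ^ (2 * \<kappa>)"
      using \<rho>(2)[of a] \<open>0 < a\<close> a \<rho>(1) by (subst pos_le_divide_eq) auto
    ultimately have "- e \<le> weiss \<kappa> a" unfolding abs_le_iff by argo
    also have "\<dots> \<le> G a" using c0 by (simp add: G_def)
    also have "\<dots> \<le> G r" using mono \<open>0 < a\<close> a r by auto
    finally show ?thesis by simp
  qed
  then have "0 \<le> G r" by (rule field_le_epsilon)
  then have "- (c * r\<^sup>2 + err\<^sub>0 * q * r\<^sup>2) \<le> (flux_mean r - real \<kappa> * height_mean r) / r ^ (2 * \<kappa>)"
  proof -
    have "\<bar>(flux_mean r - real \<kappa> * height_mean r) / r ^ (2 * \<kappa>) - weiss \<kappa> r\<bar> \<le> err\<^sub>0 * q * r\<^sup>2"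
      using flux_weiss[of r] r by simp
    then show ?thesis using \<open>0 \<le> G r\<close> unfolding G_def abs_le_iff by argo
  qed
  then have "- (c * r\<^sup>2 + err\<^sub>0 * q * r\<^sup>2) * r ^ (2 * \<kappa>) \<le> flux_mean r - real \<kappa> * height_mean r"
    using r by (simp add: pos_le_divide_eq)
  then show ?thesis by (simp add: c_def power_add power2_eq_square algebra_simps)
qed

end

text \<open>\<open>height_bound\<close> controls \<open>height_mean r / r ^ (2 * \<kappa>)\<close>
  at the reference radius 1/2, whence the power of 2. \<open>flux_const\<close> is the factor of
  \<open>q\<close> in the lower bound for the flux, and \<open>growth_const\<close> is this factor
  times the a priori bound for \<open>q\<close>.\<close>

definition "height_bound \<kappa> = 2 ^ (2 * \<kappa>) * (M\<^sup>2 * hemi_mass)"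
definition "flux_const \<kappa> = (2 * N\<^sub>0 \<kappa> + 1) * err\<^sub>0"
definition "growth_const \<kappa> = flux_const \<kappa> * (1 + height_bound \<kappa> + flux_const \<kappa>)"

lemma height_mean_le:
  assumes "0 \<le> r" "r < 1"
  shows "height_mean r \<le> M\<^sup>2 * hemi_mass"
proof -
  have "height_mean r \<le> hemi_int (\<lambda>x :: 'a \<times> real. M\<^sup>2 * 1) r"
    unfolding height_mean_def
  proof (rule hemi_int_mono)
    show "(u x)\<^sup>2 \<le> M\<^sup>2 * 1" if "x \<in> upper_ball" for x
      using power_mono[OF u_bound[OF that], of 2] by simp
  qed (use assms in \<open>auto intro!: continuous_intros uc\<close>)
  also have "\<dots> = M\<^sup>2 * hemi_mass"
    unfolding hemi_int_cmult hemi_mass_def hemi_int_one[of r] ..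
  finally show ?thesis .
qed

lemma flux_const_nonneg: "2 \<le> \<kappa> \<Longrightarrow> 0 \<le> flux_const \<kappa>"
  using err0_nonneg by (auto simp: flux_const_def N\<^sub>0_def intro!: mult_nonneg_nonneg)

text \<open>The a priori bound: the supremum \<open>Q\<close> of \<open>height_mean \<rho> / \<rho> ^ (2 * \<kappa>)\<close>, finite by hypothesis,
  satisfies \<open>Q \<le> c + c' * sqrt Q\<close> with constants that do not depend on \<open>u\<close>.\<close>

lemma flux_uniform_lower_bound:
  assumes \<kappa>: "2 \<le> \<kappa>" "\<kappa> < k"
    and start: "\<And>e. 0 < e \<Longrightarrow> \<exists>\<rho>>0. \<forall>r. 0 < r \<longrightarrow> r < \<rho> \<longrightarrow>
      - e * r ^ (2 * \<kappa>) \<le> flux_mean r - real \<kappa> * height_mean r"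
    and growth: "\<exists>C \<rho>. 0 < \<rho> \<and> (\<forall>r. 0 < r \<longrightarrow> r < \<rho> \<longrightarrow> height_mean r \<le> C * r ^ (2 * \<kappa>))"
    and r: "0 < r" "r < 1/2"
  shows "- (growth_const \<kappa> * r ^ (2 * \<kappa> + 2)) \<le> flux_mean r - real \<kappa> * height_mean r"
proof -
  define h where "h \<rho> = height_mean \<rho> / \<rho> ^ (2 * \<kappa>)" for \<rho>
  obtain C \<rho>\<^sub>0 where C: "0 < \<rho>\<^sub>0" "\<And>r. 0 < r \<Longrightarrow> r < \<rho>\<^sub>0 \<Longrightarrow> height_mean r \<le> C * r ^ (2 * \<kappa>)"
    using growth by blast
  have hm0: "0 \<le> M\<^sup>2 * hemi_mass" using hemi_mass_nonneg by simp
  \<comment> \<open>The growth hypothesis serves to make the supremum finite: \<open>C\<close> and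
    \<open>\<rho>\<^sub>0\<close> depend on the solution and disappear from the final
    constants.\<close>
  have hb: "h \<rho> \<le> max C (M\<^sup>2 * hemi_mass / \<rho>\<^sub>0 ^ (2 * \<kappa>))" if \<rho>: "0 < \<rho>" "\<rho> \<le> 1/2" for \<rho>
  proof (cases "\<rho> < \<rho>\<^sub>0")
    case True
    then have "h \<rho> \<le> C" using C(2)[OF \<rho>(1)] \<rho> by (simp add: h_def pos_divide_le_eq)
    then show ?thesis by simp
  next
    case False
    have "h \<rho> \<le> M\<^sup>2 * hemi_mass / \<rho>\<^sub>0 ^ (2 * \<kappa>)"
      unfolding h_def using False C(1) \<rho> hm0 height_mean_le[of \<rho>]
      by (intro frac_le power_mono zero_less_power) auto
    then show ?thesis by simp
  qed
  let ?X = "h ` {0<..1/2}"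
  have bdd: "bdd_above ?X" using hb by (intro bdd_aboveI[of _ "max C (M\<^sup>2 * hemi_mass / \<rho>\<^sub>0 ^ (2 * \<kappa>))"]) auto
  have ne: "?X \<noteq> {}" by auto
  \<comment> \<open>The lower bound 1 makes \<open>q\<close> positive and allows the constant term
    \<open>1 + height_bound \<kappa>\<close> to be absorbed into a multiple of \<open>q\<close>
    below.\<close>
  define q where "q = sqrt (max 1 (Sup ?X))"
  have q2: "q\<^sup>2 = max 1 (Sup ?X)" by (simp add: q_def)
  have q1: "1 \<le> q" by (simp add: q_def)
  have gr: "height_mean \<rho> \<le> q\<^sup>2 * \<rho> ^ (2 * \<kappa>)" if "0 < \<rho>" "\<rho> \<le> 1/2" for \<rho>
  proof -
    have "h \<rho> \<le> Sup ?X" using that by (intro cSup_upper bdd) auto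
    then have "h \<rho> \<le> q\<^sup>2" unfolding q2 by simp
    then show ?thesis using that by (simp add: h_def pos_divide_le_eq)
  qed
  have q0: "0 < q" using q1 by simp
  have fl: "- (flux_const \<kappa> * q * \<rho> ^ (2 * \<kappa> + 2)) \<le> flux_mean \<rho> - real \<kappa> * height_mean \<rho>"
    if "0 < \<rho>" "\<rho> < 1/2" for \<rho>
    unfolding flux_const_def using flux_lower_bound[OF \<kappa> q0 gr start that] by simp
  \<comment> \<open>Corrected by this multiple of \<open>\<rho>\<^sup>2\<close> the normalised
    height is nondecreasing, so its value at radius 1/2 controls all smaller radii.\<close>
  define H where "H \<rho> = h \<rho> + flux_const \<kappa> * q * \<rho>\<^sup>2" for \<rho>
  have fc: "0 \<le> flux_const \<kappa> * q" using flux_const_nonneg \<kappa> q0 by simp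
  have dh: "(h has_real_derivative 2 * (flux_mean x - real \<kappa> * height_mean x) / (x ^ (2 * \<kappa>) * x)) (at x)" if x: "0 < x" "x < 1" for x
  proof -
    have px: "x ^ (2 * \<kappa>) = x ^ (2 * \<kappa> - 1) * x" by (rule power_minus_mult[symmetric]) (use \<kappa> in simp)
    show ?thesis
      unfolding h_def[abs_def]
    proof (rule DERIV_cong[OF DERIV_divide[OF height_mean_derivative DERIV_pow]])
      show "(2 * flux_mean x / x * x ^ (2 * \<kappa>) - height_mean x * (real (2 * \<kappa>) * x ^ (2 * \<kappa> - Suc 0))) / (x ^ (2 * \<kappa>) * x ^ (2 * \<kappa>))
          = 2 * (flux_mean x - real \<kappa> * height_mean x) / (x ^ (2 * \<kappa>) * x)"
      proof -
        define p where "p = x ^ (2 * \<kappa> - 1)"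
        have "0 < p" using x by (simp add: p_def)
        moreover have "x ^ (2 * \<kappa>) = p * x" "x ^ (2 * \<kappa> - Suc 0) = p" using px by (simp_all add: p_def)
        ultimately show ?thesis using x by (simp add: field_simps)
      qed
    qed (use x in auto)
  qed
  have Hmono: "H \<rho> \<le> H (1/2)" if \<rho>: "0 < \<rho>" "\<rho> \<le> 1/2" for \<rho>
  proof (rule DERIV_nonneg_imp_increasing_open[OF \<rho>(2)])
    fix x assume x: "\<rho> < x" "x < 1/2"
    have dH: "(H has_real_derivative (2 * (flux_mean x - real \<kappa> * height_mean x) / (x ^ (2 * \<kappa>) * x) + flux_const \<kappa> * q * (2 * x))) (at x)"
      unfolding H_def[abs_def] using x \<rho> by (auto intro!: derivative_eq_intros dh)
    have "2 * - (flux_const \<kappa> * q * x ^ (2 * \<kappa> + 2)) / (x ^ (2 * \<kappa>) * x) \<le> 2 * (flux_mean x - real \<kappa> * height_mean x) / (x ^ (2 * \<kappa>) * x)"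
      using fl[of x] x \<rho> by (intro divide_right_mono mult_left_mono) auto
    also have "2 * - (flux_const \<kappa> * q * x ^ (2 * \<kappa> + 2)) / (x ^ (2 * \<kappa>) * x) = - (flux_const \<kappa> * q * (2 * x))"
      using x \<rho> by (simp add: power_add)
    finally show "\<exists>y. (H has_real_derivative y) (at x) \<and> 0 \<le> y" using dH by force
  next
    have "isCont H x" if "x \<in> {\<rho>..1/2}" for x
      unfolding H_def[abs_def] using that \<rho> by (intro continuous_intros DERIV_isCont[OF dh]) auto
    then show "continuous_on {\<rho>..1/2} H" by (simp add: continuous_at_imp_continuous_on)
  qed
  have H2: "h (1/2) \<le> height_bound \<kappa>"
    using height_mean_le[of "1/2"] by (simp add: h_def height_bound_def power_divide mult.commute)
  have "h \<rho> \<le> height_bound \<kappa> + flux_const \<kappa> * q" if \<rho>: "0 < \<rho>" "\<rho> \<le> 1/2" for \<rho>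
  proof -
    have "h \<rho> \<le> H \<rho>" using fc by (simp add: H_def)
    also have "\<dots> \<le> H (1/2)" by (rule Hmono[OF \<rho>])
    also have "\<dots> \<le> height_bound \<kappa> + flux_const \<kappa> * q" using H2 fc by (simp add: H_def power2_eq_square)
    finally show ?thesis .
  qed
  then have "Sup ?X \<le> height_bound \<kappa> + flux_const \<kappa> * q" by (intro cSup_least ne) auto
  moreover have hb0: "0 \<le> height_bound \<kappa>" using hm0 by (simp add: height_bound_def)
  ultimately have "q * q \<le> 1 + height_bound \<kappa> + flux_const \<kappa> * q"
    using q2 fc by (simp add: power2_eq_square max_def split: if_splits)
  also have "\<dots> \<le> (1 + height_bound \<kappa> + flux_const \<kappa>) * q"
    using mult_left_mono[OF q1, of "1 + height_bound \<kappa>"] hb0 by (simp add: algebra_simps)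
  finally have "q \<le> 1 + height_bound \<kappa> + flux_const \<kappa>" using q0 by simp
  then have "flux_const \<kappa> * q \<le> growth_const \<kappa>"
    unfolding growth_const_def using flux_const_nonneg \<kappa> by (intro mult_left_mono) auto
  then have "flux_const \<kappa> * q * r ^ (2 * \<kappa> + 2) \<le> growth_const \<kappa> * r ^ (2 * \<kappa> + 2)"
    using r by (intro mult_right_mono) auto
  then show ?thesis using fl[OF r] by linarith
qed

end

section \<open>The frequency limit\<close>

lemma null_set_avoid:
  assumes "N \<in> null_sets lborel" "a < (b :: real)"
  obtains x where "a < x" "x < b" "x \<notin> N"
proof -
  have "\<not> {a<..<b} \<subseteq> N"
  proof
    assume "{a<..<b} \<subseteq> N"
    then have "emeasure lborel {a<..<b} \<le> emeasure lborel N" using assms(1) by (intro emeasure_mono) auto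
    also have "\<dots> = 0" using assms(1) by auto
    finally show False using assms(2) by simp
  qed
  then obtain x where "x \<in> {a<..<b}" "x \<notin> N" by blast
  then show thesis using that[of x] by simp
qed

text \<open>The complement of a null set is dense, so a continuous function that is negative at one
  point would be negative at an admissible point nearby. In this way inequalities for the frequency
  lose the exceptional set.\<close>

lemma nonneg_off_null_set:
  fixes g :: "real \<Rightarrow> real"
  assumes g: "continuous_on {a<..<b} g" and N: "N \<in> null_sets lborel"
    and nn: "\<And>r. r \<in> {a<..<b} - N \<Longrightarrow> 0 \<le> g r" and r: "r \<in> {a<..<b}"
  shows "0 \<le> g r"
proof (rule ccontr)
  assume neg: "\<not> 0 \<le> g r"
  have "isCont g r" using g r by (simp add: continuous_on_eq_continuous_at)
  then have "\<forall>\<^sub>F x in at r. g x < 0" using neg by (intro order_tendstoD(2)[of _ "g r"]) (auto simp: isCont_def)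
  then obtain d where d: "0 < d" "\<And>x. x \<noteq> r \<Longrightarrow> dist x r < d \<Longrightarrow> g x < 0"
    unfolding eventually_at by auto
  obtain x where x: "r < x" "x < min b (r + d)" "x \<notin> N"
    by (rule null_set_avoid[OF N, of r "min b (r + d)"]) (use r d in auto)
  then have "g x < 0" by (intro d(2)) (auto simp: dist_real_def)
  moreover have "0 \<le> g x" using x r by (intro nn) auto
  ultimately show False by simp
qed

context thin_solution
begin

lemma continuous_on_means:
  assumes "b < 1"
  shows "continuous_on {0<..<b} height_mean" "continuous_on {0<..<b} flux_mean"
  unfolding height_mean_def flux_mean_def
  by (rule continuous_on_subset[OF continuous_on_hemi_int[OF _ assms]]; auto intro!: continuous_intros uc Uc)+

text \<open>By monotonicity the limit at 0 is a lower bound for the frequency. Since it is smaller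
  than the frequency of the power \<open>r ^ (DIM('a) + 2 * k)\<close>, it also forces the height to
  exceed this power near 0. So the truncation is inactive there and the frequency equals
  \<open>(1 + C * r) * (DIM('a) + 2 * flux_mean r / height_mean r)\<close> off the null set.\<close>

lemma frequency_lower_bound:
  assumes c: "0 < c" and H: "\<And>r. 0 < r \<Longrightarrow> r < 1 \<Longrightarrow> height u r = c * r ^ DIM('a) * height_mean r"
    and freq: "frequency_limit k u (real (DIM('a) + 2 * \<kappa>))" and \<kappa>: "\<kappa> < k"
  shows "\<exists>K \<rho>. 0 \<le> K \<and> 0 < \<rho> \<and> \<rho> < 1 \<and> (\<forall>r. 0 < r \<longrightarrow> r < \<rho> \<longrightarrow>
    0 < height_mean r \<and> real \<kappa> * height_mean r - K * r * height_mean r \<le> flux_mean r)"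
proof -
  let ?d = "DIM('a)"
  define n where "n = ?d + 2 * k"
  define \<Lambda> where "\<Lambda> = real (?d + 2 * \<kappa>)"
  \<comment> \<open>\<open>\<kappa> < k\<close> separates the two exponents by at least 2, which
    leaves room for the tolerance 1 used from here on.\<close>
  have n\<Lambda>: "\<Lambda> + 1 < real n" using \<kappa> by (simp add: n_def \<Lambda>_def)
  let ?L = "log_trunc_height k u" and ?H = "height u"
  obtain C r\<^sub>0 N where C: "0 < C" and r0: "0 < r\<^sub>0" and N: "N \<in> null_sets lborel"
    and mono: "mono_on ({0<..<r\<^sub>0} - N) (frequency k C u)"
    and lim: "(frequency k C u \<longlongrightarrow> \<Lambda>) (at 0 within ({0<..<r\<^sub>0} - N))"
    using freq unfolding frequency_limit_def \<Lambda>_def by blast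
  define r\<^sub>1 where "r\<^sub>1 = min r\<^sub>0 (1/2)"
  have r1: "0 < r\<^sub>1" "r\<^sub>1 \<le> r\<^sub>0" "r\<^sub>1 < 1" using r0 by (auto simp: r\<^sub>1_def)
  let ?F = "frequency k C u" and ?X = "{0<..<r\<^sub>0} - N"
  have low: "\<Lambda> \<le> ?F r" if r: "r \<in> ?X" for r
  proof (rule tendsto_upperbound[OF lim])
    show "\<forall>\<^sub>F s in at 0 within ?X. ?F s \<le> ?F r"
      unfolding eventually_at using r mono_onD[OF mono _ r] by (intro exI[of _ r]) (auto simp: dist_real_def)
    have "\<exists>y\<in>?X. y \<noteq> 0 \<and> dist y 0 < e" if e: "0 < e" for e
    proof -
      obtain x where "0 < x" "x < min e r\<^sub>0" "x \<notin> N" by (rule null_set_avoid[OF N, of 0 "min e r\<^sub>0"]) (use e r0 in auto)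
      then show ?thesis by (intro bexI[of _ x]) auto
    qed
    then have "0 islimpt ?X" unfolding islimpt_approachable by blast
    then show "at 0 within ?X \<noteq> bot" by (simp add: trivial_limit_within)
  qed
  have "\<forall>\<^sub>F s in at 0 within ?X. ?F s < \<Lambda> + 1" by (rule order_tendstoD(2)[OF lim]) simp
  then obtain \<delta>\<^sub>0 where \<delta>0: "0 < \<delta>\<^sub>0" "\<And>r. r \<in> ?X \<Longrightarrow> r < \<delta>\<^sub>0 \<Longrightarrow> ?F r < \<Lambda> + 1"
    unfolding eventually_at by (auto simp: dist_real_def)
  define \<delta> where "\<delta> = min \<delta>\<^sub>0 r\<^sub>1"
  have \<delta>: "0 < \<delta>" "\<delta> < 1" "\<delta> \<le> r\<^sub>0" "\<delta> \<le> \<delta>\<^sub>0" using \<delta>0 r1 by (auto simp: \<delta>_def)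
  have up: "?F r < \<Lambda> + 1" if "r \<in> {0<..<\<delta>} - N" for r using that \<delta> by (intro \<delta>0(2)) auto
  have low': "\<Lambda> \<le> ?F r" if "r \<in> {0<..<\<delta>} - N" for r using that \<delta> by (intro low) auto
  define H' where "H' r = c * (r ^ ?d * (2 * flux_mean r / r) + real ?d * r ^ (?d - 1) * height_mean r)" for r
  have DH: "(?H has_real_derivative H' r) (at r)" if r: "0 < r" "r < 1" for r
  proof (rule has_field_derivative_transform_within_open[of _ _ _ "{0<..<1}"])
    show "((\<lambda>r. c * r ^ ?d * height_mean r) has_real_derivative H' r) (at r)"
      unfolding H'_def
      by (rule derivative_eq_intros height_mean_derivative[OF r] refl)+ (simp add: algebra_simps)
  qed (use r H in auto)
  have posH: "0 < ?H x" if "x ^ n < ?H x" "0 < x" for x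
    using that by (meson less_trans zero_less_power)
  have Hcont: "isCont ?H r" if "0 < r" "r < 1" for r by (rule DERIV_isCont[OF DH[OF that]])
  have pw: "r ^ ?d = r ^ (?d - 1) * r" for r :: real by (rule power_minus_mult[symmetric]) simp
  have Hrat: "(r + C * r\<^sup>2) * (H' r / ?H r) = (1 + C * r) * (real ?d + 2 * flux_mean r / height_mean r)"
    if r: "0 < r" "r < 1" "0 < ?H r" for r
  proof -
    define p where "p = r ^ (?d - 1)"
    have p: "0 < p" using r by (simp add: p_def)
    have h: "height_mean r \<noteq> 0" using r H by auto
    have "H' r = c * p * (2 * flux_mean r + real ?d * height_mean r)"
      unfolding H'_def pw p_def using r by (simp add: algebra_simps)
    moreover have "?H r = c * p * r * height_mean r" using H r pw[of r] by (simp add: p_def)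
    ultimately have "H' r / ?H r = (2 * flux_mean r + real ?d * height_mean r) / (r * height_mean r)"
      using c p by simp
    then show ?thesis using r h by (simp add: field_simps power2_eq_square)
  qed
  have Fbig: "?F r = (r + C * r\<^sup>2) * (H' r / ?H r)" if r: "0 < r" "r < 1" "r ^ n < ?H r" for r
  proof -
    have "\<forall>\<^sub>F x in nhds r. x ^ n < ?H x"
    proof -
      have "((\<lambda>x. ?H x - x ^ n) \<longlongrightarrow> ?H r - r ^ n) (nhds r)"
        using Hcont[OF r(1,2)] by (intro tendsto_intros) (auto simp: continuous_within tendsto_at_iff_tendsto_nhds intro: filterlim_ident)
      from order_tendstoD(1)[OF this, of 0] have "\<forall>\<^sub>F x in nhds r. 0 < ?H x - x ^ n" using r by simp
      then show ?thesis by eventually_elim simp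
    qed
    then have ev: "\<forall>\<^sub>F x in nhds r. ln (?H x) = ?L x"
      by eventually_elim (simp add: log_trunc_height_def n_def)
    have pos: "0 < ?H r" using r by (meson less_trans zero_less_power)
    have "((\<lambda>x. ln (?H x)) has_real_derivative H' r / ?H r) (at r)"
      by (rule DERIV_cong[OF DERIV_chain2[OF DERIV_ln[OF pos] DH[OF r(1,2)]]]) (simp add: divide_inverse)
    then have "(?L has_real_derivative H' r / ?H r) (at r)"
      by (rule DERIV_cong_ev[OF refl ev refl, THEN iffD1])
    then show ?thesis by (simp add: frequency_def DERIV_imp_deriv)
  qed
  \<comment> \<open>Otherwise the truncated logarithm is \<open>n * ln r\<close> near 0 and the
    frequency is at least \<open>n\<close>, against its upper bound
    \<open>\<Lambda> + 1\<close>.\<close>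
  have "\<exists>r>0. r < \<delta> \<and> r ^ n < ?H r"
  proof (rule ccontr)
    assume "\<not> (\<exists>r>0. r < \<delta> \<and> r ^ n < ?H r)"
    then have le: "?H r \<le> r ^ n" if "0 < r" "r < \<delta>" for r using that by (meson not_le)
    obtain x where x: "0 < x" "x < \<delta>" "x \<notin> N" by (rule null_set_avoid[OF N \<delta>(1)])
    have d1: "((\<lambda>r. real n * ln r) has_real_derivative real n / x) (at x)"
      using x by (auto intro!: derivative_eq_intros)
    have eqL: "real n * ln r = ?L r" if "r \<in> {0<..<\<delta>}" for r
      using that le[of r] by (simp add: log_trunc_height_def n_def[symmetric] max_def ln_realpow)
    have "(?L has_real_derivative real n / x) (at x)"
      by (rule has_field_derivative_transform_within_open[OF d1 open_greaterThanLessThan[of 0 \<delta>] _ eqL]) (use x in simp)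
    then have "?F x = (x + C * x\<^sup>2) * (real n / x)" by (simp add: frequency_def DERIV_imp_deriv)
    also have "\<dots> = (1 + C * x) * real n" using x by (simp add: field_simps power2_eq_square)
    also have "\<dots> \<ge> real n" using x C by (simp add: algebra_simps)
    finally show False using up[of x] x n\<Lambda> by auto
  qed
  then obtain r\<^sub>2 where r2: "0 < r\<^sub>2" "r\<^sub>2 < \<delta>" "r\<^sub>2 ^ n < ?H r\<^sub>2" by blast
  \<comment> \<open>From a bad radius one passes to the last one, \<open>a\<close>, below
    \<open>r\<^sub>2\<close>. The quotient \<open>g\<close> of height and power rises between them
    from at most 1 to more than 1, so at some intermediate \<open>\<xi>\<close> the logarithmic
    derivative of the height exceeds that of the power, and the explicit frequency would be at least
    \<open>n\<close>.\<close>
  have big: "r ^ n < ?H r" if r: "0 < r" "r \<le> r\<^sub>2" for r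
  proof (rule ccontr)
    assume "\<not> r ^ n < ?H r"
    then have "r \<in> {s\<in>{r..r\<^sub>2}. ?H s - s ^ n \<le> 0}" (is "_ \<in> ?Z") using r by simp
    moreover have "compact ?Z"
    proof -
      have "continuous_on {r..r\<^sub>2} (\<lambda>s. ?H s - s ^ n)"
        using r r2 \<delta> by (intro continuous_intros continuous_at_imp_continuous_on ballI Hcont) auto
      then have "closed ?Z"
        by (rule continuous_on_closed_Collect_le[OF _ continuous_on_const]) simp
      moreover have "bounded ?Z"
        by (rule bounded_subset[of "cbox r r\<^sub>2"]) auto
      ultimately show ?thesis by (simp add: compact_eq_bounded_closed)
    qed
    ultimately obtain a where a: "a \<in> ?Z" "\<And>s. s \<in> ?Z \<Longrightarrow> s \<le> a"
      using compact_attains_sup[of ?Z] by blast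
    have ar: "0 < a" "a < r\<^sub>2" using a r r2 by (auto simp: less_le)
    have above: "s ^ n < ?H s" if "a < s" "s \<le> r\<^sub>2" for s
      using a(2)[of s] that a(1) by (cases "?H s \<le> s ^ n") auto
    define g where "g s = ?H s / s ^ n" for s
    have "g a \<le> 1" using a(1) ar by (simp add: g_def)
    moreover have "1 < g r\<^sub>2" using r2 by (simp add: g_def)
    moreover have Dg: "(g has_real_derivative (H' s - real n * ?H s / s) / s ^ n) (at s)" if "0 < s" "s < 1" for s
    proof -
      have n0: "s ^ n = s ^ (n - 1) * s" by (rule power_minus_mult[symmetric]) (simp add: n_def)
      show ?thesis unfolding g_def[abs_def]
      proof (rule DERIV_cong[OF DERIV_divide[OF DH[OF that] DERIV_pow]])
        define p where "p = s ^ (n - 1)"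
        have "0 < p" using that by (simp add: p_def)
        then show "(H' s * s ^ n - ?H s * (real n * s ^ (n - Suc 0))) / (s ^ n * s ^ n) = (H' s - real n * ?H s / s) / s ^ n"
          using that n0 by (simp add: p_def[symmetric] field_simps)
      qed (use that in simp)
    qed
    have "\<exists>\<xi>. a < \<xi> \<and> \<xi> < r\<^sub>2 \<and> g r\<^sub>2 - g a = (r\<^sub>2 - a) * ((H' \<xi> - real n * ?H \<xi> / \<xi>) / \<xi> ^ n)"
      using ar r2 \<delta> by (intro MVT2 Dg) auto
    then obtain \<xi> where \<xi>: "a < \<xi>" "\<xi> < r\<^sub>2" "g r\<^sub>2 - g a = (r\<^sub>2 - a) * ((H' \<xi> - real n * ?H \<xi> / \<xi>) / \<xi> ^ n)" by blast
    ultimately have "0 < (r\<^sub>2 - a) * ((H' \<xi> - real n * ?H \<xi> / \<xi>) / \<xi> ^ n)" by linarith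
    then have "0 < H' \<xi> - real n * ?H \<xi> / \<xi>" using ar \<xi> by (simp add: zero_less_mult_iff zero_less_divide_iff)
    then have n\<xi>: "real n < \<xi> * H' \<xi> / ?H \<xi>"
      using ar \<xi> above[of \<xi>] by (smt (verit, ccfv_SIG) less_divide_eq mult.commute times_divide_eq_right zero_less_power divide_less_eq)
    \<comment> \<open>The point \<open>\<xi>\<close> may lie in \<open>N\<close>, so the upper bound
      for the explicit frequency is carried over to it by continuity.\<close>
    moreover have "0 \<le> \<Lambda> + 1 - (1 + C * \<xi>) * (real ?d + 2 * flux_mean \<xi> / height_mean \<xi>)"
    proof (rule nonneg_off_null_set[where g="\<lambda>s. \<Lambda> + 1 - (1 + C * s) * (real ?d + 2 * flux_mean s / height_mean s)"
          and a=a and b=r\<^sub>2 and N=N])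
      have Hpos: "0 < ?H s" "0 < s" "s < 1" if "s \<in> {a<..<r\<^sub>2}" for s
        using above[of s] that ar r2 \<delta> by (auto intro: posH)
      then have hm: "height_mean s \<noteq> 0" if "s \<in> {a<..<r\<^sub>2}" for s using H[of s] that by force
      have sub: "{a<..<r\<^sub>2} \<subseteq> {0<..<r\<^sub>2}" using ar by auto
      show "continuous_on {a<..<r\<^sub>2} (\<lambda>s. \<Lambda> + 1 - (1 + C * s) * (real ?d + 2 * flux_mean s / height_mean s))"
        using hm r2 \<delta> by (intro continuous_intros continuous_on_subset[OF continuous_on_means(1) sub] continuous_on_subset[OF continuous_on_means(2) sub]) auto
      show "0 \<le> \<Lambda> + 1 - (1 + C * s) * (real ?d + 2 * flux_mean s / height_mean s)" if s: "s \<in> {a<..<r\<^sub>2} - N" for s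
      proof -
        have "?F s = (1 + C * s) * (real ?d + 2 * flux_mean s / height_mean s)"
          using Fbig[of s] Hrat[of s] Hpos[of s] above[of s] s by auto
        then show ?thesis using up[of s] s ar r2 by auto
      qed
    qed (use \<xi> N in auto)
    moreover have "(\<xi> + C * \<xi>\<^sup>2) * (H' \<xi> / ?H \<xi>) = (1 + C * \<xi>) * (\<xi> * H' \<xi> / ?H \<xi>)"
      by (simp add: algebra_simps power2_eq_square add_divide_distrib)
    moreover have "(\<xi> + C * \<xi>\<^sup>2) * (H' \<xi> / ?H \<xi>) = (1 + C * \<xi>) * (real ?d + 2 * flux_mean \<xi> / height_mean \<xi>)"
      using above[of \<xi>] \<xi> ar r2 \<delta> by (intro Hrat) (auto intro: posH)
    moreover have "real n * 1 \<le> (\<xi> * H' \<xi> / ?H \<xi>) * (1 + C * \<xi>)"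
      using n\<xi> C \<xi> ar by (intro mult_mono) auto
    moreover have "\<lbrakk>0 \<le> l - v; w = z * x; w = v; m * 1 \<le> x * z\<rbrakk> \<Longrightarrow> m \<le> l" for l m v w x z :: real
      by (simp add: mult.commute)
    ultimately have "real n \<le> \<Lambda> + 1" by metis
    then show False using n\<Lambda> by linarith
  qed
  have Hpos: "0 < ?H s" "0 < s" "s < 1" "s < \<delta>" if "s \<in> {0<..<r\<^sub>2}" for s
    using big[of s] that r2 \<delta> by (auto intro: posH)
  have hm: "0 < height_mean s" if "s \<in> {0<..<r\<^sub>2}" for s
  proof -
    have "0 < (c * s ^ ?d) * height_mean s" using H[of s] Hpos[OF that] by simp
    then show ?thesis by (rule zero_less_mult_pos) (use c that in simp)
  qed
  have ineq: "0 \<le> (1 + C * r) * (real ?d + 2 * flux_mean r / height_mean r) - \<Lambda>" if r: "r \<in> {0<..<r\<^sub>2}" for r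
  proof (rule nonneg_off_null_set[where g="\<lambda>s. (1 + C * s) * (real ?d + 2 * flux_mean s / height_mean s) - \<Lambda>"
        and a=0 and b=r\<^sub>2 and N=N])
    have "height_mean s \<noteq> 0" if "s \<in> {0<..<r\<^sub>2}" for s using hm[OF that] by simp
    then show "continuous_on {0<..<r\<^sub>2} (\<lambda>s. (1 + C * s) * (real ?d + 2 * flux_mean s / height_mean s) - \<Lambda>)"
      using r2 \<delta> by (intro continuous_intros continuous_on_means) auto
    show "0 \<le> (1 + C * s) * (real ?d + 2 * flux_mean s / height_mean s) - \<Lambda>" if s: "s \<in> {0<..<r\<^sub>2} - N" for s
    proof -
      have "?F s = (1 + C * s) * (real ?d + 2 * flux_mean s / height_mean s)"
        using Fbig[of s] Hrat[of s] Hpos[of s] big[of s] s by auto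
      then show ?thesis using low'[of s] s Hpos[of s] by auto
    qed
  qed (use r N in auto)
  \<comment> \<open>This comes from
    \<open>\<Lambda> / (1 + C * r) \<ge> \<Lambda> * (1 - C * r)\<close>: the loss is
    \<open>\<Lambda> * C * r\<close>, halved because the quotient of flux and height appears with
    the factor 2.\<close>
  define K where "K = (2 * real \<kappa> + real ?d) * C / 2"
  have "0 < height_mean r \<and> real \<kappa> * height_mean r - K * r * height_mean r \<le> flux_mean r" if r: "0 < r" "r < r\<^sub>2" for r
  proof -
    have h: "0 < height_mean r" using hm r by simp
    define x where "x = flux_mean r / height_mean r"
    have Cr: "0 < C * r" using C r by simp
    have "\<Lambda> \<le> (1 + C * r) * (real ?d + 2 * x)" using ineq[of r] r by (simp add: x_def)
    then have "\<Lambda> / (1 + C * r) \<le> real ?d + 2 * x" using Cr by (simp add: pos_divide_le_eq mult.commute)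
    moreover have "\<Lambda> * (1 - C * r) \<le> \<Lambda> / (1 + C * r)"
    proof -
      have "\<Lambda> * (1 - C * r) * (1 + C * r) = \<Lambda> * (1 - (C * r)\<^sup>2)" by (simp add: algebra_simps power2_eq_square)
      also have "\<dots> \<le> \<Lambda> * 1" by (intro mult_left_mono) (auto simp: \<Lambda>_def)
      finally show ?thesis using Cr by (simp add: pos_le_divide_eq)
    qed
    ultimately have "\<Lambda> * (1 - C * r) \<le> real ?d + 2 * x" by linarith
    moreover have "\<Lambda> * (1 - C * r) = real ?d + 2 * real \<kappa> - 2 * (K * r)"
      by (simp add: K_def \<Lambda>_def field_simps)
    ultimately have "real \<kappa> - K * r \<le> x" by linarith
    then have "(real \<kappa> - K * r) * height_mean r \<le> x * height_mean r" using h by (intro mult_right_mono) auto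
    then show ?thesis using h by (simp add: x_def algebra_simps)
  qed
  then show ?thesis
    using r2 \<delta> C by (intro exI[of _ K] exI[of _ r\<^sub>2]) (auto simp: K_def)
qed

text \<open>The factor \<open>exp (2 * K * r)\<close> offsets the loss \<open>K * r\<close>, so its
  product with the normalised height is nondecreasing and hence bounded near 0. Then the loss in the
  flux is at most \<open>K * C * r\<close> times \<open>r ^ (2 * \<kappa>)\<close>, which for small
  \<open>r\<close> is below any multiple \<open>e\<close> of that power.\<close>

lemma growth_from_frequency:
  assumes K: "0 \<le> K" and \<rho>: "0 < \<rho>" "\<rho> < 1" and \<kappa>: "1 \<le> \<kappa>"
    and flux: "\<And>r. 0 < r \<Longrightarrow> r < \<rho> \<Longrightarrow> 0 < height_mean r"
      "\<And>r. 0 < r \<Longrightarrow> r < \<rho> \<Longrightarrow> real \<kappa> * height_mean r - K * r * height_mean r \<le> flux_mean r"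
  shows "\<exists>C \<rho>. 0 < \<rho> \<and> (\<forall>r. 0 < r \<longrightarrow> r < \<rho> \<longrightarrow> height_mean r \<le> C * r ^ (2 * \<kappa>))"
    and "0 < e \<Longrightarrow> \<exists>\<rho>>0. \<forall>r. 0 < r \<longrightarrow> r < \<rho> \<longrightarrow>
      - e * r ^ (2 * \<kappa>) \<le> flux_mean r - real \<kappa> * height_mean r"
proof -
  define y where "y r = height_mean r / r ^ (2 * \<kappa>) * exp (2 * K * r)" for r
  have mono: "y a \<le> y b" if ab: "0 < a" "a \<le> b" "b < \<rho>" for a b
  proof (rule DERIV_nonneg_imp_nondecreasing[OF ab(2)])
    fix x assume "a \<le> x" "x \<le> b"
    then have x: "0 < x" "x < \<rho>" "x < 1" using ab \<rho> by auto
    define p where "p = x ^ (2 * \<kappa> - 1)"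
    have p: "0 < p" using x by (simp add: p_def)
    have px: "x ^ (2 * \<kappa>) = p * x" unfolding p_def by (rule power_minus_mult[symmetric]) (use \<kappa> in simp)
    have "((\<lambda>r. height_mean r / r ^ (2 * \<kappa>)) has_real_derivative 2 * (flux_mean x - real \<kappa> * height_mean x) / (p * x * x)) (at x)"
    proof (rule DERIV_cong[OF DERIV_divide[OF height_mean_derivative DERIV_pow]])
      show "(2 * flux_mean x / x * x ^ (2 * \<kappa>) - height_mean x * (real (2 * \<kappa>) * x ^ (2 * \<kappa> - Suc 0))) / (x ^ (2 * \<kappa>) * x ^ (2 * \<kappa>))
          = 2 * (flux_mean x - real \<kappa> * height_mean x) / (p * x * x)"
      proof -
        have "x ^ (2 * \<kappa> - Suc 0) = p" by (simp add: p_def)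
        then show ?thesis unfolding px using x p by (simp add: field_simps)
      qed
    qed (use x in auto)
    moreover have "((\<lambda>r. exp (2 * K * r)) has_real_derivative exp (2 * K * x) * (2 * K)) (at x)"
      by (auto intro!: derivative_eq_intros)
    ultimately have D: "(y has_real_derivative 2 * (flux_mean x - real \<kappa> * height_mean x) / (p * x * x) * exp (2 * K * x)
        + exp (2 * K * x) * (2 * K) * (height_mean x / x ^ (2 * \<kappa>))) (at x)"
      unfolding y_def[abs_def] by (rule DERIV_mult)
    have "- (K * x * height_mean x) \<le> flux_mean x - real \<kappa> * height_mean x" using flux(2)[of x] x by linarith
    then have "2 * - (K * x * height_mean x) / (p * x * x) \<le> 2 * (flux_mean x - real \<kappa> * height_mean x) / (p * x * x)"
      using x p by (intro divide_right_mono mult_left_mono) auto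
    also have "2 * - (K * x * height_mean x) / (p * x * x) = - (height_mean x / x ^ (2 * \<kappa>) * (2 * K))"
      using x p by (simp add: px)
    finally have "0 \<le> (2 * (flux_mean x - real \<kappa> * height_mean x) / (p * x * x) + height_mean x / x ^ (2 * \<kappa>) * (2 * K)) * exp (2 * K * x)"
      by (intro mult_nonneg_nonneg) auto
    then show "\<exists>z. (y has_real_derivative z) (at x) \<and> 0 \<le> z"
      using D by (intro exI conjI) (auto simp: algebra_simps)
  qed
  define C where "C = y (\<rho> / 2)"
  have C: "height_mean r \<le> C * r ^ (2 * \<kappa>)" if r: "0 < r" "r \<le> \<rho> / 2" for r
  proof -
    have "height_mean r / r ^ (2 * \<kappa>) * 1 \<le> height_mean r / r ^ (2 * \<kappa>) * exp (2 * K * r)"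
      using flux(1)[of r] r \<rho> K by (intro mult_left_mono) auto
    also have "\<dots> \<le> C" unfolding C_def y_def[symmetric] using r \<rho> by (intro mono) auto
    finally show ?thesis using r by (simp add: pos_divide_le_eq)
  qed
  then show "\<exists>C \<rho>. 0 < \<rho> \<and> (\<forall>r. 0 < r \<longrightarrow> r < \<rho> \<longrightarrow> height_mean r \<le> C * r ^ (2 * \<kappa>))"
    using \<rho> by (intro exI[of _ C] exI[of _ "\<rho> / 2"]) auto
  assume e: "0 < e"
  have C0: "0 \<le> C" unfolding C_def y_def using flux(1)[of "\<rho> / 2"] \<rho> by simp
  define s where "s = min (\<rho> / 2) (e / (K * C + 1))"
  have s: "0 < s" using \<rho> e K C0 by (simp add: s_def add_nonneg_pos)
  have "- e * r ^ (2 * \<kappa>) \<le> flux_mean r - real \<kappa> * height_mean r" if r: "0 < r" "r < s" for r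
  proof -
    have r': "r \<le> \<rho> / 2" "r < \<rho>" "r \<le> e / (K * C + 1)" using r \<rho> by (auto simp: s_def)
    have "K * r * height_mean r \<le> K * r * (C * r ^ (2 * \<kappa>))" using K r C[OF r(1) r'(1)] by (intro mult_left_mono) auto
    also have "\<dots> = (K * C * r) * r ^ (2 * \<kappa>)" by simp
    also have "\<dots> \<le> e * r ^ (2 * \<kappa>)"
    proof (rule mult_right_mono)
      have "K * C * r \<le> K * C * (e / (K * C + 1))" using K C0 r' by (intro mult_left_mono) auto
      also have "\<dots> \<le> e"
      proof -
        have "z * (e / (z + 1)) \<le> e" if "0 \<le> z" for z using that e by (simp add: field_simps)
        then show ?thesis using K C0 by simp
      qed
      finally show "K * C * r \<le> e" .
    qed (use r in simp)
    finally show ?thesis using flux(2)[OF r(1) r'(2)] by linarith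
  qed
  then show "\<exists>\<rho>>0. \<forall>r. 0 < r \<longrightarrow> r < \<rho> \<longrightarrow> - e * r ^ (2 * \<kappa>) \<le> flux_mean r - real \<kappa> * height_mean r"
    using s by blast
qed

end

section \<open>The Monneau functional\<close>

lemma upper_ball_approach:
  fixes x :: "'a::euclidean_space \<times> real"
  assumes x: "x \<in> upper_ball"
  shows "((\<lambda>t. x + (0, t)) \<longlongrightarrow> x) (at_right 0)"
    and "\<forall>\<^sub>F t in at_right 0. x + (0, t) \<in> half_ball 1"
proof -
  show lim: "((\<lambda>t. x + (0, t)) \<longlongrightarrow> x) (at_right 0)"
    by (auto intro!: tendsto_eq_intros simp: zero_prod_def[symmetric])
  have "x \<in> ball 0 1" using x by (simp add: mem_upper_ball)
  then have "\<forall>\<^sub>F t in at_right 0. x + (0, t) \<in> ball 0 1"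
    using topological_tendstoD[OF lim] by (metis open_ball)
  moreover have "\<forall>\<^sub>F t in at_right (0::real). 0 < t" by (rule eventually_at_right_less)
  ultimately show "\<forall>\<^sub>F t in at_right 0. x + (0, t) \<in> half_ball 1"
    by eventually_elim (use x in \<open>auto simp: half_ball_def mem_upper_ball\<close>)
qed

lemma norm_le_upper_ball:
  fixes g :: "'a::euclidean_space \<times> real \<Rightarrow> 'b::real_normed_vector"
  assumes g: "continuous_on upper_ball g" and le: "\<And>x. x \<in> half_ball 1 \<Longrightarrow> norm (g x) \<le> B"
    and x: "x \<in> upper_ball"
  shows "norm (g x) \<le> B"
proof -
  note ap = upper_ball_approach[OF x]
  have "\<forall>\<^sub>F t in at_right 0. x + (0, t) \<in> upper_ball"
    using ap(2) by eventually_elim (use half_ball_subset_upper_ball[of 1] in auto)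
  then have "((\<lambda>t. g (x + (0, t))) \<longlongrightarrow> g x) (at_right 0)"
    by (rule continuous_on_tendsto_compose[OF g ap(1) x])
  then have "((\<lambda>t. norm (g (x + (0, t)))) \<longlongrightarrow> norm (g x)) (at_right 0)" by (rule tendsto_norm)
  moreover have "\<forall>\<^sub>F t in at_right 0. norm (g (x + (0, t))) \<le> B"
    using ap(2) by eventually_elim (rule le)
  ultimately show ?thesis by (rule tendsto_upperbound) simp
qed

text \<open>\<open>Lim\<close> is determined only along a nontrivial filter, hence the check that
  \<open>x\<close> is approached from above. Near \<open>x\<close> the upper half space agrees with
  the half ball, where \<open>grad u\<close> is the continuous \<open>G\<close>.\<close>

lemma dnormal_eq:
  fixes u :: "'a::euclidean_space \<times> real \<Rightarrow> real"
  assumes G: "continuous_on upper_ball G" and eq: "\<And>x. x \<in> half_ball 1 \<Longrightarrow> G x = grad u x"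
    and x: "x \<in> thin_ball 1"
  shows "dnormal u x = G x \<bullet> (0, 1)"
proof -
  let ?S = "{y :: 'a \<times> real. 0 < snd y}"
  have xu: "x \<in> upper_ball" using x by (auto simp: mem_upper_ball thin_ball_def)
  have w: "at x within half_ball 1 = at x within ?S"
    by (rule at_within_nhd[where S="ball 0 1"]) (use x in \<open>auto simp: half_ball_def thin_ball_def\<close>)
  have "(G \<longlongrightarrow> G x) (at x within upper_ball)" using G xu by (simp add: continuous_on_def)
  then have "(G \<longlongrightarrow> G x) (at x within half_ball 1)"
    by (rule tendsto_within_subset) (rule half_ball_subset_upper_ball, simp)
  then have "((\<lambda>y. G y \<bullet> (0, 1)) \<longlongrightarrow> G x \<bullet> (0, 1)) (at x within half_ball 1)"
    by (intro tendsto_intros)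
  moreover have "\<forall>\<^sub>F y in at x within half_ball 1. G y \<bullet> (0, 1) = grad u y \<bullet> (0, 1)"
    by (auto simp: eventually_at_filter eq)
  ultimately have "((\<lambda>y. grad u y \<bullet> (0, 1)) \<longlongrightarrow> G x \<bullet> (0, 1)) (at x within ?S)"
    unfolding w[symmetric] by (rule Lim_transform_eventually)
  moreover have "at x within ?S \<noteq> bot"
  proof
    assume "at x within ?S = bot"
    moreover have "\<forall>\<^sub>F t in at_right 0. x + (0, t) \<in> ?S \<and> x + (0, t) \<noteq> x"
      using upper_ball_approach(2)[OF xu] by eventually_elim (use x in \<open>auto simp: half_ball_def thin_ball_def zero_prod_def\<close>)
    then have "filterlim (\<lambda>t. x + (0, t)) (at x within ?S) (at_right 0)"
      using upper_ball_approach(1)[OF xu] by (auto simp: filterlim_at)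
    ultimately have "filterlim (\<lambda>t. x + (0, t)) bot (at_right 0)" by simp
    then have "\<forall>\<^sub>F t in at_right (0::real). False" by (rule filterlim_iff[THEN iffD1, rule_format]) simp
    then show False by simp
  qed
  ultimately show ?thesis unfolding dnormal_def by (intro tendsto_Lim)
qed

text \<open>The Hoelder bounds hold on compact sets; a truncated ball of radius strictly between
  \<open>norm x\<close> and 1 is a relative neighbourhood of \<open>x\<close>, which gives
  continuity of \<open>G\<close>. The bounds by \<open>M\<close> pass from the open half ball to the
  thin ball by continuity.\<close>

lemma obstacle_class_thin_solution:
  fixes u :: "'a::euclidean_space \<times> real \<Rightarrow> real"
  assumes u: "u \<in> obstacle_class k M" and M: "0 < M"
  obtains U f where "thin_solution u U f M k"
proof -
  obtain \<alpha> where \<alpha>: "0 < \<alpha>" "C1_holder \<alpha> u" using u by (auto simp: obstacle_class_def)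
  obtain f where f: "f \<in> borel_measurable borel" "weak_laplacian (half_ball 1) u f"
    "AE x in lborel. x \<in> half_ball 1 \<longrightarrow> \<bar>f x\<bar> \<le> M * norm (fst x) ^ (k - 1)"
    using u by (auto simp: obstacle_class_def)
  have thin: "\<And>x. x \<in> thin_ball 1 \<Longrightarrow> 0 \<le> u x \<and> 0 \<le> - dnormal u x \<and> u x * dnormal u x = 0"
    and nu: "C1_norm u \<le> ennreal M"
    using u by (auto simp: obstacle_class_def)
  have uc: "continuous_on upper_ball u" and ud: "\<And>x. x \<in> half_ball 1 \<Longrightarrow> u differentiable (at x)"
    using \<alpha>(2) by (auto simp: C1_holder_def upper_ball_def)
  obtain G where G: "\<And>x. x \<in> half_ball 1 \<Longrightarrow> G x = grad u x"
    and hol: "\<And>K. compact K \<Longrightarrow> K \<subseteq> upper_ball \<Longrightarrow>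
      \<exists>c. \<forall>x\<in>K. \<forall>y\<in>K. norm (G x - G y) \<le> c * dist x y powr \<alpha>"
    using \<alpha>(2) unfolding C1_holder_def upper_ball_def by metis
  have Gc: "continuous_on upper_ball G"
    unfolding continuous_on_def
  proof
    fix x :: "'a \<times> real" assume x: "x \<in> upper_ball"
    define R where "R = (1 + norm x) / 2"
    have R: "norm x < R" "R < 1" using x by (auto simp: R_def mem_upper_ball)
    let ?K = "{y :: 'a \<times> real. norm y \<le> R \<and> 0 \<le> snd y}"
    have "?K \<subseteq> upper_ball" using R(2) by (auto simp: mem_upper_ball simp del: split_paired_All)
    from hol[OF compact_truncated_upper_ball this]
    obtain c where c: "\<And>y z. y \<in> ?K \<Longrightarrow> z \<in> ?K \<Longrightarrow> norm (G y - G z) \<le> c * dist y z powr \<alpha>"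
      by blast
    have "((\<lambda>y. G y - G x) \<longlongrightarrow> 0) (at x within upper_ball)"
    proof (rule Lim_null_comparison)
      have "\<forall>\<^sub>F y in at x within upper_ball. norm y < R"
        by (rule order_tendstoD(2)[OF tendsto_norm[OF tendsto_ident_at] R(1)])
      moreover have "\<forall>\<^sub>F y in at x within upper_ball. y \<in> upper_ball" by (simp add: eventually_at_filter)
      ultimately show "\<forall>\<^sub>F y in at x within upper_ball. norm (G y - G x) \<le> c * dist y x powr \<alpha>"
      proof eventually_elim
        case (elim y)
        show ?case by (rule c) (use elim x R in \<open>simp_all add: mem_upper_ball\<close>)
      qed
      have "((\<lambda>y. dist y x powr \<alpha>) \<longlongrightarrow> 0 powr \<alpha>) (at x within upper_ball)"
      proof (rule tendsto_powr')
        have "((\<lambda>y. dist y x) \<longlongrightarrow> dist x x) (at x within upper_ball)" by (intro tendsto_intros)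
        then show "((\<lambda>y. dist y x) \<longlongrightarrow> 0) (at x within upper_ball)" by simp
      qed (use \<alpha> in auto)
      from tendsto_mult_left[OF this, of c]
      show "((\<lambda>y. c * dist y x powr \<alpha>) \<longlongrightarrow> 0) (at x within upper_ball)" by simp
    qed
    then show "(G \<longlongrightarrow> G x) (at x within upper_ball)" by (simp add: LIM_zero_iff)
  qed
  have b: "\<bar>u x\<bar> \<le> M" "norm (G x) \<le> M" if x: "x \<in> half_ball 1" for x
  proof -
    have "ennreal \<bar>u x\<bar> \<le> (SUP x\<in>half_ball 1. ennreal \<bar>u x\<bar>)" by (rule SUP_upper[OF x])
    also have "\<dots> \<le> C1_norm u" by (simp add: C1_norm_def)
    also note nu
    finally show "\<bar>u x\<bar> \<le> M" using M by (simp add: ennreal_le_iff)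
    have "ennreal (norm (G x)) \<le> (SUP x\<in>half_ball 1. ennreal (norm (grad u x)))"
      unfolding G[OF x] by (rule SUP_upper[OF x])
    also have "\<dots> \<le> C1_norm u" by (simp add: C1_norm_def)
    also note nu
    finally show "norm (G x) \<le> M" using M by (simp add: ennreal_le_iff)
  qed
  note dn = dnormal_eq[OF Gc G]
  have "thin_solution u G f M k"
  proof
    show "C1_upper u G"
      unfolding C1_upper_def using uc Gc has_derivative_grad[OF ud] by (simp add: G)
    show "\<bar>u x\<bar> \<le> M" if "x \<in> upper_ball" for x
      using norm_le_upper_ball[OF uc, of M x] b that by simp
    show "norm (G x) \<le> M" if "x \<in> upper_ball" for x
      by (rule norm_le_upper_ball[OF Gc b(2) that])
    show "0 \<le> u x" "G x \<bullet> (0, 1) \<le> 0" "u x * (G x \<bullet> (0, 1)) = 0" if "x \<in> thin_ball 1" for x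
      using thin[OF that] dn[OF _ that] by simp_all
  qed (use f M in auto)
  then show ?thesis by (rule that)
qed

text \<open>Euler's identity, from differentiating \<open>p (c *\<^sub>R x)\<close> in
  \<open>c\<close> at 1.\<close>

lemma homogeneous_inner_gradient:
  fixes p :: "'b::euclidean_space \<Rightarrow> real"
  assumes hom: "\<And>c x. p (c *\<^sub>R x) = c ^ \<kappa> * p x" and P: "(p has_derivative (\<lambda>h. P \<bullet> h)) (at x)"
  shows "P \<bullet> x = real \<kappa> * p x"
proof -
  have "((\<lambda>c. p (c *\<^sub>R x)) has_derivative (\<lambda>c. P \<bullet> (c *\<^sub>R x))) (at 1)"
    by (rule has_derivative_compose[where f="\<lambda>c. c *\<^sub>R x" and g=p])
      (use P in \<open>simp_all add: bounded_linear_imp_has_derivative bounded_linear_scaleR_left\<close>)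
  moreover have "(\<lambda>c. P \<bullet> (c *\<^sub>R x)) = (*) (P \<bullet> x)" by (auto simp: fun_eq_iff)
  ultimately have "((\<lambda>c. p (c *\<^sub>R x)) has_real_derivative P \<bullet> x) (at 1)" by (simp only: has_field_derivative_def)
  moreover have "((\<lambda>c. c ^ \<kappa> * p x) has_real_derivative real \<kappa> * p x) (at 1)"
    by (auto intro!: derivative_eq_intros)
  ultimately show ?thesis unfolding hom by (rule DERIV_unique)
qed

lemma even_normal_derivative_0:
  fixes p :: "'a::euclidean_space \<times> real \<Rightarrow> real"
  assumes ev: "\<And>x' t. p (x', - t) = p (x', t)" and P: "(p has_derivative (\<lambda>h. P \<bullet> h)) (at (x', 0))"
  shows "P \<bullet> (0, 1) = 0"
proof -
  have "((\<lambda>t. p (x', t)) has_derivative (\<lambda>t. P \<bullet> (0, t))) (at 0)"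
    by (rule has_derivative_compose[OF has_derivative_Pair[OF has_derivative_const has_derivative_ident] P])
  moreover have "(\<lambda>t. P \<bullet> (0, t)) = (*) (P \<bullet> (0, 1))" by (auto simp: fun_eq_iff inner_prod_def)
  ultimately have d: "((\<lambda>t. p (x', t)) has_real_derivative P \<bullet> (0, 1)) (at 0)" by (simp only: has_field_derivative_def)
  then have "((\<lambda>t. p (x', t)) has_real_derivative P \<bullet> (0, 1)) (at (- 0))" by simp
  from DERIV_mirror[THEN iffD1, OF this]
  have "((\<lambda>t. p (x', - t)) has_real_derivative - (P \<bullet> (0, 1))) (at 0)" .
  then have "P \<bullet> (0, 1) = - (P \<bullet> (0, 1))" unfolding ev by (rule DERIV_unique[OF d])
  then show ?thesis by simp
qed

text \<open>Both integrals are the same multiple of a power of their radius. The radius 1/2 serves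
  as reference because the formula in polar coordinates is stated for radii below 1.\<close>

lemma abs_integral_homogeneous:
  fixes p :: "'a::euclidean_space \<times> real \<Rightarrow> real"
  assumes p: "continuous_on UNIV p" and hom: "\<And>c x. p (c *\<^sub>R x) = c ^ \<kappa> * p x" and r: "0 < r" "r < 1"
  shows "(LINT x:half_ball r|lborel. \<bar>p x\<bar>)
    = (2 * r) ^ (DIM('a) + \<kappa> + 1) * (LINT x:half_ball (1/2)|lborel. \<bar>p x\<bar>)"
proof -
  let ?n = "DIM('a) + \<kappa>"
  have eq: "(LINT x:half_ball r|lborel. \<bar>p x\<bar>) = hemi_int (\<lambda>x. \<bar>p x\<bar>) 1 * (r ^ Suc ?n / Suc ?n)"
    if r: "0 < r" "r < 1" for r
  proof -
    have h: "hemi_int (\<lambda>x. \<bar>p x\<bar>) \<rho> = \<rho> ^ \<kappa> * hemi_int (\<lambda>x. \<bar>p x\<bar>) 1" if "0 \<le> \<rho>" for \<rho>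
      unfolding hemi_int_def using that by (simp add: hom abs_mult)
    have "(LINT x:half_ball r|lborel. \<bar>p x\<bar>) = integral {0..r} (\<lambda>\<rho>. \<rho> ^ DIM('a) * hemi_int (\<lambda>x. \<bar>p x\<bar>) \<rho>)"
      by (rule polar_half_ball[OF continuous_on_rabs[OF continuous_on_subset[OF p subset_UNIV]] r])
    also have "\<dots> = integral {0..r} (\<lambda>\<rho>. hemi_int (\<lambda>x. \<bar>p x\<bar>) 1 * \<rho> ^ ?n)"
    proof (rule Henstock_Kurzweil_Integration.integral_cong)
      fix \<rho> assume "\<rho> \<in> {0..r}"
      then show "\<rho> ^ DIM('a) * hemi_int (\<lambda>x. \<bar>p x\<bar>) \<rho> = hemi_int (\<lambda>x. \<bar>p x\<bar>) 1 * \<rho> ^ ?n"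
        by (subst h) (simp_all add: power_add)
    qed
    also have "\<dots> = hemi_int (\<lambda>x. \<bar>p x\<bar>) 1 * (r ^ Suc ?n / Suc ?n)"
      using r by (subst integral_mult_right) (simp add: integral_power_0 del: power_Suc of_nat_Suc)
    finally show ?thesis .
  qed
  have half: "0 < (1/2 :: real)" "(1/2 :: real) < 1" by simp_all
  show ?thesis
    unfolding eq[OF r] eq[OF half] by (simp add: power_mult_distrib power_divide)
qed

text \<open>Young's inequality with the weight \<open>1 + L\<close>, which is positive also when
  \<open>p\<close> vanishes. It produces the factor \<open>1 + L2_norm_ball p\<close> in the form in
  which it appears in the theorem.\<close>

lemma abs_integral_le_L2_norm:
  fixes p :: "'a::euclidean_space \<times> real \<Rightarrow> real"
  assumes p: "continuous_on UNIV p"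
  shows "(LINT x:half_ball (1/2)|lborel. \<bar>p x\<bar>)
    \<le> ((LINT x:half_ball (1/2)|lborel :: ('a \<times> real) measure. 1) + 1) / 2 * (1 + L2_norm_ball p)"
proof -
  define L where "L = L2_norm_ball p"
  let ?H = "half_ball (1/2) :: ('a \<times> real) set"
  have pc: "continuous_on upper_ball p" by (rule continuous_on_subset[OF p]) simp
  have p2c: "continuous_on upper_ball (\<lambda>x. (p x)\<^sup>2)" by (intro continuous_intros pc)
  have I0: "0 \<le> (LINT x:ball 0 1|lborel. (p x)\<^sup>2)"
    unfolding set_lebesgue_integral_def by (intro Bochner_Integration.integral_nonneg) auto
  have L0: "0 \<le> L" using I0 by (simp add: L_def L2_norm_ball_def)
  have L2: "(LINT x:ball 0 1|lborel. (p x)\<^sup>2) = L\<^sup>2" using I0 by (simp add: L_def L2_norm_ball_def)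
  have "set_integrable lborel (cball 0 1) (\<lambda>x. (p x)\<^sup>2)"
    unfolding set_integrable_def by (intro borel_integrable_compact continuous_intros continuous_on_subset[OF p]) auto
  then have ib: "set_integrable lborel (ball 0 1) (\<lambda>x. (p x)\<^sup>2)"
    by (rule set_integrable_subset) auto
  have "(LINT x:?H|lborel. (p x)\<^sup>2) \<le> (LINT x:ball 0 1|lborel. (p x)\<^sup>2)"
    unfolding set_lebesgue_integral_def
  proof (rule integral_mono)
    show "integrable lborel (\<lambda>x. indicat_real ?H x *\<^sub>R (p x)\<^sup>2)"
      using set_integrable_half_ball[OF p2c, of "1/2"] by (simp add: set_integrable_def)
    show "integrable lborel (\<lambda>x. indicat_real (ball 0 1) x *\<^sub>R (p x)\<^sup>2)"
      using ib by (simp add: set_integrable_def)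
  qed (auto simp: half_ball_def split: split_indicator)
  then have p2: "(LINT x:?H|lborel. (p x)\<^sup>2) \<le> L\<^sup>2" by (simp add: L2)
  have young: "\<bar>b\<bar> \<le> ((1 + L) / 2) * 1 + (1 / (2 * (1 + L))) * b\<^sup>2" for b :: real
  proof -
    have "0 \<le> ((1 + L) - \<bar>b\<bar>)\<^sup>2 / (2 * (1 + L))" using L0 by simp
    also have "\<dots> = ((1 + L) / 2) * 1 + (1 / (2 * (1 + L))) * b\<^sup>2 - \<bar>b\<bar>"
    proof -
      have "((1 + L) - \<bar>b\<bar>)\<^sup>2 = (1 + L) * (1 + L) - \<bar>b\<bar> * (2 * (1 + L)) + b\<^sup>2"
        by (simp add: power2_eq_square algebra_simps)
      moreover have "1 + L \<noteq> 0" using L0 by linarith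
      ultimately have "((1 + L) - \<bar>b\<bar>)\<^sup>2 / (2 * (1 + L))
          = (1 + L) * (1 + L) / (2 * (1 + L)) - \<bar>b\<bar> * (2 * (1 + L)) / (2 * (1 + L)) + b\<^sup>2 / (2 * (1 + L))"
        by (simp only: add_divide_distrib diff_divide_distrib)
      also have "(1 + L) * (1 + L) / (2 * (1 + L)) = (1 + L) / 2"
        using \<open>1 + L \<noteq> 0\<close> by (simp add: divide_eq_eq)
      also have "\<bar>b\<bar> * (2 * (1 + L)) / (2 * (1 + L)) = \<bar>b\<bar>"
        by (rule nonzero_mult_div_cancel_right) (use \<open>1 + L \<noteq> 0\<close> in simp)
      finally show ?thesis by (simp only: mult_1 mult_1_right times_divide_eq_left)
    qed
    finally show ?thesis by simp
  qed
  have "(LINT x:?H|lborel. \<bar>p x\<bar>) \<le> (LINT x:?H|lborel. ((1 + L) / 2) * 1 + (1 / (2 * (1 + L))) * (p x)\<^sup>2)"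
  proof (rule set_integral_half_ball_le)
    fix x
    show "\<bar>p x\<bar> \<le> ((1 + L) / 2) * 1 + (1 / (2 * (1 + L))) * (p x)\<^sup>2"
      by (rule young)
    show "continuous_on upper_ball (\<lambda>x. ((1 + L) / 2) * 1 + (1 / (2 * (1 + L))) * (p x)\<^sup>2)"
      by (intro continuous_on_add continuous_on_mult continuous_on_const p2c)
  qed (simp_all add: continuous_on_rabs pc)
  also have "\<dots> = (LINT x:?H|lborel. ((1 + L) / 2) * 1) + (LINT x:?H|lborel. (1 / (2 * (1 + L))) * (p x)\<^sup>2)"
    by (intro set_integral_add(2) set_integrable_half_ball continuous_on_mult continuous_on_const p2c) auto
  also have "\<dots> = ((1 + L) / 2) * (LINT x:?H|lborel. 1) + (1 / (2 * (1 + L))) * (LINT x:?H|lborel. (p x)\<^sup>2)"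
    by (simp only: set_integral_mult_right)
  also have "\<dots> \<le> ((1 + L) / 2) * (LINT x:?H|lborel. 1) + (1 / (2 * (1 + L))) * (1 + L)\<^sup>2"
  proof -
    have "L\<^sup>2 \<le> (1 + L)\<^sup>2" using L0 by (intro power_mono) auto
    with p2 have "(LINT x:?H|lborel. (p x)\<^sup>2) \<le> (1 + L)\<^sup>2" by (rule order_trans)
    then show ?thesis using L0 by (intro add_left_mono mult_left_mono) auto
  qed
  also have "\<dots> = ((LINT x:?H|lborel. 1) + 1) / 2 * (1 + L)"
  proof -
    have "(1 / (2 * s)) * s\<^sup>2 = s / 2" for s :: real by (simp add: power2_eq_square)
    from this[of "1 + L"] have "(1 / (2 * (1 + L))) * (1 + L)\<^sup>2 = (1 + L) / 2" .
    then show ?thesis by (simp only:) (simp add: field_simps)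
  qed
  finally show ?thesis by (simp add: L_def)
qed

section \<open>Derivative of the Monneau functional\<close>

context thin_solution
begin

text \<open>Green's formula twice: \<open>p\<close> is tested against the equation for
  \<open>u\<close>, where \<open>p \<ge> 0\<close> meets a nonpositive normal derivative, and
  \<open>- u\<close> against the harmonic \<open>p\<close>, whose normal derivative vanishes. The
  products of gradients cancel.\<close>

lemma harmonic_flux_le:
  assumes p: "C1_upper p P" and harm: "weak_laplacian (half_ball 1) p (\<lambda>_. 0)"
    and normal: "\<And>x. x \<in> thin_ball 1 \<Longrightarrow> P x \<bullet> (0, 1) = 0"
    and nonneg: "\<And>x. x \<in> thin_ball 1 \<Longrightarrow> 0 \<le> p x" and r: "0 < r" "r < 1"
  shows "r ^ (DIM('a) - 1) * (hemi_int (\<lambda>x. p x * (U x \<bullet> x)) r - hemi_int (\<lambda>x. u x * (P x \<bullet> x)) r)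
    \<le> M * r ^ (k - 1) * (LINT x:half_ball r|lborel. \<bar>p x\<bar>)"
proof -
  note pc = C1_upperD(1)[OF p] and Pc = C1_upperD(2)[OF p]
  have "r ^ (DIM('a) - 1) * hemi_int (\<lambda>x. p x * (U x \<bullet> x)) r
      \<le> (LINT x:half_ball r|lborel. U x \<bullet> P x + weight x * \<bar>p x\<bar>)"
    by (rule solution_flux[OF _ p r], assumption) (intro mult_nonpos_nonneg thin_normal nonneg)
  also have "\<dots> \<le> (LINT x:half_ball r|lborel. U x \<bullet> P x) + M * r ^ (k - 1) * (LINT x:half_ball r|lborel. \<bar>p x\<bar>)"
    by (intro weighted_abs_le continuous_intros pc Pc Uc r)
  finally have 1: "r ^ (DIM('a) - 1) * hemi_int (\<lambda>x. p x * (U x \<bullet> x)) r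
      \<le> (LINT x:half_ball r|lborel. U x \<bullet> P x) + M * r ^ (k - 1) * (LINT x:half_ball r|lborel. \<bar>p x\<bar>)" .
  have "r ^ (DIM('a) - 1) * hemi_int (\<lambda>x. - u x * (P x \<bullet> x)) r
      \<le> (LINT x:half_ball r|lborel. P x \<bullet> (- U x) + 0 * \<bar>- u x\<bar>)"
    by (rule flux_le[OF p harm, where F=0]) (use r normal in \<open>auto intro: C1_upper_uminus C1\<close>)
  also have "\<dots> = (LINT x:half_ball r|lborel. - (U x \<bullet> P x))" by (simp add: inner_commute)
  also have "\<dots> = - (LINT x:half_ball r|lborel. U x \<bullet> P x)"
    by (simp add: set_lebesgue_integral_def)
  also have "hemi_int (\<lambda>x. - u x * (P x \<bullet> x)) r = - hemi_int (\<lambda>x. u x * (P x \<bullet> x)) r"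
    using hemi_int_cmult[of "-1" "\<lambda>x. u x * (P x \<bullet> x)" r] by simp
  finally show ?thesis using 1 by (simp add: algebra_simps)
qed

text \<open>By Euler's identity the terms with \<open>p\<^sup>2\<close> that stem from the integral
  and from the normalising power cancel. What remains is the bracket with \<open>u\<close> alone
  minus the mixed one.\<close>

lemma monneau_derivative:
  assumes p: "C1_upper p P" and euler: "\<And>x. P x \<bullet> x = real \<kappa> * p x"
    and c: "\<And>s. 0 < s \<Longrightarrow> s < 1 \<Longrightarrow> monneau \<kappa> u p s = c * hemi_int (\<lambda>x. (u x - p x)\<^sup>2) s / s ^ (2 * \<kappa>)"
    and r: "0 < r" "r < 1" and \<kappa>: "1 \<le> \<kappa>"
  shows "(monneau \<kappa> u p has_real_derivative
    2 * c * (flux_mean r - real \<kappa> * height_mean r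
      - (hemi_int (\<lambda>x. p x * (U x \<bullet> x)) r - real \<kappa> * hemi_int (\<lambda>x. u x * p x) r)) / r ^ (2 * \<kappa> + 1)) (at r)"
proof -
  note pc = C1_upperD(1)[OF p] and Pc = C1_upperD(2)[OF p]
  let ?F = "\<lambda>x. (u x - p x)\<^sup>2"
  let ?F' = "\<lambda>x. 2 * (u x * (U x \<bullet> x)) - 2 * (p x * (U x \<bullet> x)) - (2 * real \<kappa>) * (u x * p x) + (2 * real \<kappa>) * (p x)\<^sup>2"
  have cs: "continuous_on upper_ball (\<lambda>x. u x * (U x \<bullet> x))" "continuous_on upper_ball (\<lambda>x. p x * (U x \<bullet> x))"
    "continuous_on upper_ball (\<lambda>x. u x * p x)" "continuous_on upper_ball (\<lambda>x. (p x)\<^sup>2)"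
    "continuous_on upper_ball (\<lambda>x. (u x)\<^sup>2)"
    by (intro continuous_intros uc Uc pc)+
  have dF: "(hemi_int ?F has_real_derivative hemi_int ?F' r / r) (at r)"
  proof (rule has_real_derivative_hemi_int[OF r])
    fix t x assume "x \<in> (hemi :: ('a \<times> real) set)" and t: "0 < t" "t < (1::real)"
    from C1_upper_radial_derivative[OF C1_upper_diff[OF C1 p] this]
    have d: "((\<lambda>t. u (t *\<^sub>R x) - p (t *\<^sub>R x)) has_real_derivative
        ((U (t *\<^sub>R x) - P (t *\<^sub>R x)) \<bullet> (t *\<^sub>R x)) / t) (at t)" .
    define y where "y = t *\<^sub>R x"
    show "((\<lambda>t. (u (t *\<^sub>R x) - p (t *\<^sub>R x))\<^sup>2) has_real_derivative ?F' (t *\<^sub>R x) / t) (at t)"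
    proof (rule DERIV_cong[OF DERIV_power[OF d, of 2]])
      show "real 2 * (((U (t *\<^sub>R x) - P (t *\<^sub>R x)) \<bullet> (t *\<^sub>R x)) / t * (u (t *\<^sub>R x) - p (t *\<^sub>R x)) ^ (2 - Suc 0)) = ?F' (t *\<^sub>R x) / t"
        unfolding y_def[symmetric] inner_diff_left euler power2_eq_square by (simp add: algebra_simps diff_divide_distrib add_divide_distrib)
    qed
  qed (intro continuous_intros uc Uc pc)+
  have F': "hemi_int ?F' r = 2 * flux_mean r - 2 * hemi_int (\<lambda>x. p x * (U x \<bullet> x)) r
      - 2 * real \<kappa> * hemi_int (\<lambda>x. u x * p x) r + 2 * real \<kappa> * hemi_int (\<lambda>x. (p x)\<^sup>2) r"
    using r by (simp only: hemi_int_add hemi_int_diff hemi_int_cmult cs continuous_on_add continuous_on_diff continuous_on_mult continuous_on_const less_imp_le)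
      (simp add: flux_mean_def)
  have "?F = (\<lambda>x. (u x)\<^sup>2 - 2 * (u x * p x) + (p x)\<^sup>2)" by (auto simp: fun_eq_iff power2_diff)
  then have F: "hemi_int ?F r = height_mean r - 2 * hemi_int (\<lambda>x. u x * p x) r + hemi_int (\<lambda>x. (p x)\<^sup>2) r"
    using r by (simp only: hemi_int_add hemi_int_diff hemi_int_cmult cs continuous_on_add continuous_on_diff continuous_on_mult continuous_on_const less_imp_le)
      (simp add: height_mean_def)
  define q where "q = r ^ (2 * \<kappa> - 1)"
  have q: "0 < q" using r by (simp add: q_def)
  have qr: "r ^ (2 * \<kappa>) = q * r" unfolding q_def by (rule power_minus_mult[symmetric]) (use \<kappa> in simp)
  have alg: "(c * ((2 * a - 2 * x - 2 * real \<kappa> * w + 2 * real \<kappa> * z) / r) * (q * r)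
        - c * (h - 2 * w + z) * (real (2 * \<kappa>) * q)) / (q * r * (q * r))
      = 2 * c * (a - real \<kappa> * h - (x - real \<kappa> * w)) / (q * r * r)"
    if "r \<noteq> 0" "q \<noteq> 0" for a x w z h r q :: real
  proof -
    have "c * ((2 * a - 2 * x - 2 * real \<kappa> * w + 2 * real \<kappa> * z) / r) * (q * r)
        - c * (h - 2 * w + z) * (real (2 * \<kappa>) * q)
      = c * (2 * a - 2 * x - 2 * real \<kappa> * w + 2 * real \<kappa> * z) * q - c * (h - 2 * w + z) * (2 * real \<kappa> * q)"
      using that by simp
    also have "\<dots> = 2 * c * (a - real \<kappa> * h - (x - real \<kappa> * w)) * q" by (simp add: algebra_simps)
    finally show ?thesis using that by (simp only:) (simp add: ac_simps)
  qed
  have "((\<lambda>s. c * hemi_int ?F s / s ^ (2 * \<kappa>)) has_real_derivative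
      2 * c * (flux_mean r - real \<kappa> * height_mean r
      - (hemi_int (\<lambda>x. p x * (U x \<bullet> x)) r - real \<kappa> * hemi_int (\<lambda>x. u x * p x) r)) / r ^ (2 * \<kappa> + 1)) (at r)"
  proof (rule DERIV_cong[OF DERIV_divide[OF DERIV_cmult[OF dF] DERIV_pow]])
    have q': "r ^ (2 * \<kappa> - Suc 0) = q" by (simp add: q_def)
    have q'': "r ^ (2 * \<kappa> + 1) = q * r * r" by (simp add: qr)
    show "(c * (hemi_int ?F' r / r) * r ^ (2 * \<kappa>) - c * hemi_int ?F r * (real (2 * \<kappa>) * r ^ (2 * \<kappa> - Suc 0))) / (r ^ (2 * \<kappa>) * r ^ (2 * \<kappa>))
      = 2 * c * (flux_mean r - real \<kappa> * height_mean r
      - (hemi_int (\<lambda>x. p x * (U x \<bullet> x)) r - real \<kappa> * hemi_int (\<lambda>x. u x * p x) r)) / r ^ (2 * \<kappa> + 1)"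
      unfolding F F' q' q'' qr by (rule alg) (use r q in auto)
  qed (use r in simp)
  then show ?thesis
    by (rule has_field_derivative_transform_within_open[of _ _ _ "{0<..<1}"]) (use r c in auto)
qed

end

text \<open>The factor is common to both formulas: when it is positive for \<open>monneau\<close>,
  it is positive for \<open>height\<close> too, on which the use of the frequency relies.\<close>

lemma monneau_eq_hemi_int:
  obtains c where "0 \<le> c"
    and "\<And>(u :: 'a::euclidean_space \<times> real \<Rightarrow> real) r. continuous_on upper_ball u \<Longrightarrow> even_in u \<Longrightarrow> 0 < r \<Longrightarrow> r < 1 \<Longrightarrow>
      height u r = c * r ^ DIM('a) * hemi_int (\<lambda>x. (u x)\<^sup>2) r"
    and "\<And>(u :: 'a \<times> real \<Rightarrow> real) p \<kappa> r. continuous_on upper_ball u \<Longrightarrow> even_in u \<Longrightarrow>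
      continuous_on upper_ball p \<Longrightarrow> even_in p \<Longrightarrow> 0 < r \<Longrightarrow> r < 1 \<Longrightarrow>
      monneau \<kappa> u p r = c * hemi_int (\<lambda>x. (u x - p x)\<^sup>2) r / r ^ (2 * \<kappa>)"
proof -
  obtain c where c: "0 \<le> c" "\<And>F r. continuous_on upper_ball F \<Longrightarrow> even_in F \<Longrightarrow> (\<forall>x\<in>upper_ball. 0 \<le> F x) \<Longrightarrow> 0 < r \<Longrightarrow> r < 1 \<Longrightarrow>
    sphere_integral r F = c * r ^ DIM('a) * hemi_int (F :: 'a \<times> real \<Rightarrow> real) r"
    using sphere_integral_hemi_int[where 'a='a] by metis
  show ?thesis
  proof (rule that[OF c(1)])
    fix u :: "'a \<times> real \<Rightarrow> real" and r :: real
    assume u: "continuous_on upper_ball u" "even_in u" and r: "0 < r" "r < 1"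
    show "height u r = c * r ^ DIM('a) * hemi_int (\<lambda>x. (u x)\<^sup>2) r"
      unfolding height_def using u by (intro c(2) r continuous_intros) (auto simp: even_in_def)
  next
    fix u p :: "'a \<times> real \<Rightarrow> real" and \<kappa> and r :: real
    assume u: "continuous_on upper_ball u" "even_in u" and p: "continuous_on upper_ball p" "even_in p"
      and r: "0 < r" "r < 1"
    have "sphere_integral r (\<lambda>x. (u x - p x)\<^sup>2) = c * r ^ DIM('a) * hemi_int (\<lambda>x. (u x - p x)\<^sup>2) r"
      using u p by (intro c(2) r continuous_intros) (auto simp: even_in_def)
    then show "monneau \<kappa> u p r = c * hemi_int (\<lambda>x. (u x - p x)\<^sup>2) r / r ^ (2 * \<kappa>)"
      using r by (simp add: monneau_def power_add)
  qed
qed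

section \<open>Choice of the constants and conclusion\<close>

theorem theorem2p7p2:
  fixes M :: real and k m \<kappa> :: nat
  assumes "0 < M" and "1 \<le> k" and "1 \<le> m" and "\<kappa> = 2 * m" and "\<kappa> < k"
  shows "\<exists>r\<^sub>M>0. \<exists>C\<^sub>M\<ge>0.
    \<forall>u\<in>(obstacle_class k M :: ('a::euclidean_space \<times> real \<Rightarrow> real) set).
      singular_origin k \<kappa> u \<longrightarrow>
      (\<forall>p\<in>blowup_polys \<kappa>. \<forall>r. 0 < r \<and> r < r\<^sub>M \<longrightarrow>
        (\<exists>D. (monneau \<kappa> u p has_real_derivative D) (at r) \<and>
             D \<ge> - C\<^sub>M * (1 + L2_norm_ball p)))"
proof -
  let ?d = "DIM('a)"
  obtain c where c: "0 \<le> c"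
    and cu: "\<And>(u :: 'a \<times> real \<Rightarrow> real) r. continuous_on upper_ball u \<Longrightarrow> even_in u \<Longrightarrow> 0 < r \<Longrightarrow> r < 1 \<Longrightarrow>
      height u r = c * r ^ ?d * hemi_int (\<lambda>x. (u x)\<^sup>2) r"
    and cp: "\<And>(u :: 'a \<times> real \<Rightarrow> real) p \<kappa> r. continuous_on upper_ball u \<Longrightarrow> even_in u \<Longrightarrow>
      continuous_on upper_ball p \<Longrightarrow> even_in p \<Longrightarrow> 0 < r \<Longrightarrow> r < 1 \<Longrightarrow>
      monneau \<kappa> u p r = c * hemi_int (\<lambda>x. (u x - p x)\<^sup>2) r / r ^ (2 * \<kappa>)"
    by (rule monneau_eq_hemi_int) blast
  \<comment> \<open>The locale constant depends only on \<open>M\<close>, \<open>\<kappa>\<close>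
    and the type, so it can be fixed before \<open>u\<close> is given; \<open>max\<close> makes its
    sign immediate.\<close>
  define A where "A = max 0 (thin_solution.growth_const TYPE('a) M \<kappa>)"
  define V where "V = ((LINT x:half_ball (1/2)|lborel :: ('a \<times> real) measure. 1) + 1) / (2::real)"
  \<comment> \<open>\<open>M\<close> comes from the weight, the power of 2 from rescaling to radius
    1/2, and \<open>V\<close> from the estimate of the integral of \<open>|p|\<close> by the norm of
    \<open>p\<close>.\<close>
  define B where "B = M * 2 ^ (?d + \<kappa> + 1) * V"
  define Q where "Q = 2 * c * (A + B)"
  have A0: "0 \<le> A" by (simp add: A_def)
  have V0: "0 \<le> V"
  proof -
    have "0 \<le> (LINT x:half_ball (1/2)|lborel :: ('a \<times> real) measure. 1 :: real)"
      unfolding set_lebesgue_integral_def by (intro Bochner_Integration.integral_nonneg) auto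
    then show ?thesis by (simp add: V_def)
  qed
  have B0: "0 \<le> B" using V0 \<open>0 < M\<close> by (simp add: B_def)
  have Q0: "0 \<le> Q" using c A0 B0 by (simp add: Q_def)
  have \<kappa>: "2 \<le> \<kappa>" using assms by simp
  have main: "\<exists>D. (monneau \<kappa> u p has_real_derivative D) (at r) \<and> D \<ge> - Q * (1 + L2_norm_ball p)"
    if u: "u \<in> obstacle_class k M" and sing: "singular_origin k \<kappa> u" and p: "p \<in> blowup_polys \<kappa>"
      and r: "0 < r" "r < 1/2" for u p :: "'a \<times> real \<Rightarrow> real" and r
  proof -
    define L where "L = L2_norm_ball p"
    have L0: "0 \<le> L"
      unfolding L_def L2_norm_ball_def set_lebesgue_integral_def by (intro real_sqrt_ge_zero Bochner_Integration.integral_nonneg) auto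
    obtain U f where "thin_solution u U f M k" by (rule obstacle_class_thin_solution[OF u \<open>0 < M\<close>])
    then interpret thin_solution u U f M k .
    have poly: "real_polynomial_function p" and hom: "\<And>c x. p (c *\<^sub>R x) = c ^ \<kappa> * p x"
      and harm: "\<And>x. laplacian p x = 0" and nonneg: "\<And>x'. 0 \<le> p (x', 0)"
      and ev: "\<And>x' t. p (x', - t) = p (x', t)"
      using p by (auto simp: blowup_polys_def)
    obtain P where P: "\<And>x. (p has_derivative (\<lambda>h. P x \<bullet> h)) (at x)" "continuous_on UNIV P"
      "weak_laplacian (half_ball 1) p (\<lambda>_. 0)"
      by (rule weak_laplacian_harmonic_polynomial[OF poly harm half_ball_borel]) blast
    have CP: "C1_upper p P" using P by (intro C1_upperI)
    have pU: "continuous_on UNIV p"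
      using P(1) by (meson continuous_at_imp_continuous_on has_derivative_continuous)
    have euler: "P x \<bullet> x = real \<kappa> * p x" for x by (rule homogeneous_inner_gradient[OF hom P(1)])
    have r1: "r < 1" using r by simp
    have eu: "even_in u" using u by (auto simp: obstacle_class_def even_in_def)
    have ep: "even_in p" using ev by (auto simp: even_in_def)
    let ?X = "hemi_int (\<lambda>x. p x * (U x \<bullet> x)) r - real \<kappa> * hemi_int (\<lambda>x. u x * p x) r"
    let ?Y = "flux_mean r - real \<kappa> * height_mean r"
    have D: "(monneau \<kappa> u p has_real_derivative 2 * c * (?Y - ?X) / r ^ (2 * \<kappa> + 1)) (at r)"
      by (rule monneau_derivative[OF CP euler _ r(1) r1]) (use \<kappa> in \<open>auto intro: cp uc eu ep C1_upperD(1)[OF CP]\<close>)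
    have X: "?X \<le> B * (1 + L) * r ^ (2 * \<kappa> + 1)"
    proof -
      have "r ^ (?d - 1) * (hemi_int (\<lambda>x. p x * (U x \<bullet> x)) r - hemi_int (\<lambda>x. u x * (P x \<bullet> x)) r)
          \<le> M * r ^ (k - 1) * (LINT x:half_ball r|lborel. \<bar>p x\<bar>)"
      proof (rule harmonic_flux_le[OF CP P(3) _ _ r(1) r1])
        fix x :: "'a \<times> real" assume "x \<in> thin_ball 1"
        then obtain x' where x: "x = (x', 0)" by (cases x) (auto simp: thin_ball_def)
        show "0 \<le> p x" unfolding x by (rule nonneg)
        show "P x \<bullet> (0, 1) = 0"
          by (rule even_normal_derivative_0[OF ev, where x'=x']) (use P(1)[of x] in \<open>simp only: x\<close>)
      qed
      also have "hemi_int (\<lambda>x. u x * (P x \<bullet> x)) r = real \<kappa> * hemi_int (\<lambda>x. u x * p x) r"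
        unfolding euler hemi_int_cmult[symmetric] by (simp add: ac_simps)
      also have "(LINT x:half_ball r|lborel. \<bar>p x\<bar>) = (2 * r) ^ (?d + \<kappa> + 1) * (LINT x:half_ball (1/2)|lborel. \<bar>p x\<bar>)"
        by (rule abs_integral_homogeneous[OF pU hom r(1) r1])
      also have "M * r ^ (k - 1) * ((2 * r) ^ (?d + \<kappa> + 1) * (LINT x:half_ball (1/2)|lborel. \<bar>p x\<bar>))
          \<le> M * r ^ (k - 1) * ((2 * r) ^ (?d + \<kappa> + 1) * (V * (1 + L)))"
        unfolding V_def L_def using \<open>0 < M\<close> r by (intro mult_left_mono abs_integral_le_L2_norm pU) auto
      also have "\<dots> = B * (1 + L) * (r ^ (k - 1) * r ^ (?d + \<kappa> + 1))"
        by (simp add: B_def power_mult_distrib)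
      also have "r ^ (k - 1) * r ^ (?d + \<kappa> + 1) = r ^ (?d - 1) * r ^ (k + \<kappa> + 1)"
        using \<open>1 \<le> k\<close> DIM_positive[where 'a='a] by (simp only: power_add[symmetric]) (simp add: ac_simps)
      finally have "r ^ (?d - 1) * ?X \<le> r ^ (?d - 1) * (B * (1 + L) * r ^ (k + \<kappa> + 1))" by (simp add: ac_simps)
      then have "?X \<le> B * (1 + L) * r ^ (k + \<kappa> + 1)"
        by (rule mult_left_le_imp_le) (use r in simp)
      also have "\<dots> \<le> B * (1 + L) * r ^ (2 * \<kappa> + 1)"
        using B0 L0 r \<open>\<kappa> < k\<close> by (intro mult_left_mono power_decreasing) auto
      finally show ?thesis .
    qed
    \<comment> \<open>Positivity of \<open>c\<close> lets information on \<open>height\<close> be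
      read as information on \<open>height_mean\<close>.\<close>
    have Y: "- (A * r ^ (2 * \<kappa> + 1)) \<le> ?Y" if c: "0 < c"
    proof -
      have H: "height u r = c * r ^ ?d * height_mean r" if "0 < r" "r < 1" for r
        unfolding height_mean_def using that by (intro cu uc eu)
      have fr: "frequency_limit k u (real (?d + 2 * \<kappa>))" using sing by (simp add: singular_origin_def)
      obtain K \<rho> where K: "0 \<le> K" "0 < \<rho>" "\<rho> < 1"
        and fl: "\<And>r. 0 < r \<Longrightarrow> r < \<rho> \<Longrightarrow> 0 < height_mean r"
          "\<And>r. 0 < r \<Longrightarrow> r < \<rho> \<Longrightarrow> real \<kappa> * height_mean r - K * r * height_mean r \<le> flux_mean r"
        using frequency_lower_bound[OF c H fr \<open>\<kappa> < k\<close>] by blast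
      have \<kappa>1: "1 \<le> \<kappa>" using \<kappa> by simp
      note gf = growth_from_frequency[OF K \<kappa>1 fl]
      have "- (growth_const \<kappa> * r ^ (2 * \<kappa> + 2)) \<le> ?Y"
        by (rule flux_uniform_lower_bound[OF \<kappa> \<open>\<kappa> < k\<close> gf(2) gf(1) r])
      moreover have "growth_const \<kappa> * r ^ (2 * \<kappa> + 2) \<le> A * r ^ (2 * \<kappa> + 1)"
        using r by (intro mult_mono power_decreasing) (auto simp: A_def)
      ultimately show ?thesis by linarith
    qed
    have "- Q * (1 + L) \<le> 2 * c * (?Y - ?X) / r ^ (2 * \<kappa> + 1)"
    \<comment> \<open>For \<open>c = 0\<close> both the constant \<open>Q\<close> and the derivative
      vanish.\<close>
    proof (cases "c = 0")
      case False
      then have c: "0 < c" using c by simp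
      have rp: "0 < r ^ (2 * \<kappa> + 1)" using r by simp
      have "A * 1 \<le> A * (1 + L)" using A0 L0 by (intro mult_left_mono) auto
      then have "A * r ^ (2 * \<kappa> + 1) \<le> A * (1 + L) * r ^ (2 * \<kappa> + 1)"
        using rp by (intro mult_right_mono) auto
      then have "- ((A + B) * (1 + L) * r ^ (2 * \<kappa> + 1)) \<le> ?Y - ?X"
        using X Y[OF c] by (simp only: distrib_right)
      then have "2 * c * (- ((A + B) * (1 + L) * r ^ (2 * \<kappa> + 1))) \<le> 2 * c * (?Y - ?X)"
        using c by (intro mult_left_mono) auto
      moreover have "2 * c * (- ((A + B) * (1 + L) * r ^ (2 * \<kappa> + 1))) = - Q * (1 + L) * r ^ (2 * \<kappa> + 1)"
        by (simp add: Q_def)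
      ultimately have "- Q * (1 + L) * r ^ (2 * \<kappa> + 1) \<le> 2 * c * (?Y - ?X)" by (simp only:)
      then show ?thesis using rp by (simp only: pos_le_divide_eq)
    qed (simp add: Q_def)
    then show ?thesis using D by (intro exI conjI) (auto simp: L_def)
  qed
  show ?thesis
  proof (rule exI[of _ "1 / 2"], rule conjI[OF _ exI[of _ Q]], simp, intro conjI ballI impI allI)
    show "0 \<le> Q" by (rule Q0)
  qed (use main in blast)
qed

end
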